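(* Let $e$ and $n$ be positive integers. For any $u,v\in NCP(e,e,n+1)$ such that $u\preccurlyeq v$, we have $b_u\, b_{u\backslash v}=b_v$ in the braid group $B(e,e,n+1)$.
   Context: Partitions. $\mu_d\subset\mathbb{C}$ is the group of $d$-th roots of unity, $\zeta_d=\exp(2i\pi/d)$. For partitions $u,v$ of the same set, $u\preccurlyeq v$ means every part of $u$ is contained in a part of $v$. For finite $x\subset\mathbb{C}$, $NCP_x$ is the set of partitions of $x$ such that any two parts whose convex hulls intersect are equal (non-crossing partitions). The discrete partition (all parts singletons) is denoted $\mathrm{disc}$, the partition with one part is denoted $\mathrm{triv}$. $NCP(1,1,m):=NCP_{\mu_m}$. $NCP(e,1,n)$ is the set of elements of $NCP_{\mu_{en}}$ invariant under multiplication by $\mu_e$. For $u\in NCP_{\mu_{en}\cup\{0\}}$, $u^\flat$ is its restriction to $\mu_{en}$. $NCP(e,e,n+1):=\{u\in NCP_{\mu_{en}\cup\{0\}}\mid u^\flat\in NCP(e,1,n)\}$. An element of $NCP(e,1,n)$ is long if $0$ lies in the convex hull of one of its parts (the long part), short otherwise. An element $u\in NCP(e,e,n+1)$ is short symmetric if $u^\flat$ is short and $\{0\}$ is a part of $u$; long symmetric if $u^\flat$ is long (then $a\cup\{0\}$ is a part of $u$, called the long part, where $a$ is the long part of $u^\flat$); asymmetric if $u^\flat$ is short and $\{0\}$ is not a part of $u$. Symmetric means short or long symmetric. For $w\in NCP(e,1,n)$, $w_*\in NCP(e,e,n+1)$ is $w\cup\{\{0\}\}$ if $w$ is short, and is obtained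 by replacing the long part $a$ of $w$ by $a\cup\{0\}$ if $w$ is long. Complement in type $(1,1,m)$. For $u\in NCP(1,1,m)$ let $\sigma_u$ be the permutation of $\mu_m$ sending each point to its successor in the counterclockwise cyclic order of the part of $u$ containing it. For $u\preccurlyeq v$ in $NCP(1,1,m)$, $u\backslash v$ is the unique $w\in NCP(1,1,m)$ such that applying $\sigma_u$ and then $\sigma_w$ gives $\sigma_v$. If $u\preccurlyeq v$ lie in $NCP(e,1,n)$, then $u\backslash v$ computed in $NCP(1,1,en)$ lies in $NCP(e,1,n)$. Complement in $NCP(e,e,n+1)$. For $\zeta\in\mu_{en}$ let $a_\zeta=\{0,\zeta_{en}\zeta,\zeta_{en}^2\zeta,\dots,\zeta_{en}^n\zeta\}$, let $m_\zeta$ be the partition of $\mu_{en}\cup\{0\}$ with unique non-singleton part $\{0,\zeta\}$, and let $M_\zeta$ be the partition with parts $a_\zeta$ and $\zeta'a_\zeta\setminus\{0\}$ for $\zeta'\in\mu_e\setminus\{1\}$. The set $a_\zeta$ is viewed as a strictly convex $(n+1)$-gon, and the complement operation is defined on $NCP_{a_\zeta}$ via a standard (cyclic-order preserving) identification with $NCP(1,1,n+1)$. Let $\varphi_\zeta:[\mathrm{disc},M_\zeta]\to NCP_{a_\zeta}$ and $\psi_\zeta:[m_\zeta,\mathrm{triv}]\to NCP_{a_\zeta}$ (intervals in $NCP(e,e,n+1)$) be the poset isomorphisms induced by restriction of partitions to $a_\zeta$. For $u\preccurlyeq v$ in $NCP(e,e,n+1)$: (A) if $u,v$ are both symmetric,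 $u\backslash v:=(u^\flat\backslash v^\flat)_*$; (B) if $v$ is asymmetric, choose $\zeta\in\mu_{en}$ with $v\preccurlyeq M_\zeta$ and set $u\backslash v:=\varphi_\zeta^{-1}(\varphi_\zeta(u)\backslash\varphi_\zeta(v))$; (C) if $u$ is asymmetric, choose $\zeta\in\mu_{en}$ with $m_\zeta\preccurlyeq u$ and set $u\backslash v:=\varphi_\zeta^{-1}(\psi_\zeta(u)\backslash\psi_\zeta(v))$. The result does not depend on the choices, and (B) and (C) agree when both apply. Braid group. $G(e,e,n+1)\subset GL_{n+1}(\mathbb{C})$ is the group generated by the permutation matrices and the diagonal matrices with diagonal entries in $\mu_e$ and determinant $1$, acting on $V=\mathbb{C}^{n+1}$ with coordinates $X_0,\dots,X_n$. $V^{\mathrm{reg}}$ is the complement of the reflecting hyperplanes $X_i=\zeta X_j$ ($i\neq j$, $\zeta\in\mu_e$). Let $x_0=(0,\zeta_{en},\zeta_{en}^2,\dots,\zeta_{en}^n)\in V^{\mathrm{reg}}$ and $\overline{x_0}$ its image in the quotient. $B(e,e,n+1):=\pi_1(V^{\mathrm{reg}}/G(e,e,n+1),\overline{x_0})$, where the product $bb'$ is represented by the loop for $b$ followed by the loop for $b'$. Elements $b_u$. Let $u\in NCP(e,e,n+1)$. For $z\in\mu_{en}\cup\{0\}$ let $z'$ be the successor of $z$ in the counterclockwise order of the part of $u$ containing $z$; for the long part of a long symmetric $u$, use the counterclockwise order of its non-zero elements and set $0':=0$. Define $\gamma_z:[0,1]\to\mathbb{C}$ by: $\gamma_z(t)=(1-t)z+tz'$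 if the part of $u$ containing $z$ has three or more elements; $\gamma_z(t)=(1-t)z+tz'+it(1-t)(z-z')\varepsilon_n$ if this part has exactly two elements, where $\varepsilon_n>0$ is a fixed small enough real number depending only on $n$; $\gamma_z(t)=z$ if $z$ is isolated in $u$. If $u$ is asymmetric, let $z$ be the unique element of $\mu_{en}$ with $z'=0$, and let $j\in\{1,\dots,n\}$ and $\zeta\in\mu_e$ be such that $z=\zeta\zeta_{en}^j$; this $j$ is called special and $\gamma_{(j)}:=\zeta^{-1}\gamma_z$. For all non-special $j\in\{1,\dots,n\}$ (all $j$ if $u$ is symmetric), $\gamma_{(j)}:=\gamma_{\zeta_{en}^j}$; and $\gamma_{(0)}$ is the path $\gamma_z$ with $z=0$. Provided $\varepsilon_n$ is close enough to $0$, $\gamma_u:=(\gamma_{(0)},\gamma_{(1)},\dots,\gamma_{(n)}):[0,1]\to\mathbb{C}^{n+1}$ defines a path in $V^{\mathrm{reg}}$, whose homotopy class does not depend on $\varepsilon_n$; it starts at $x_0$ and ends in the $G(e,e,n+1)$-orbit of $x_0$. $b_u\in B(e,e,n+1)$ is the class of the loop it defines in the quotient.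
   Formalization: The case e=1, n≥2 is excluded: there u\v is undefined for u=m_ζ, v=triv, and the claim fails for n=3. For a long part {0,z,-z} the strands of z and -z are curved, since straight ones would leave V^reg; "small enough" ε may depend on e, n and u. *)

theory Defs
  imports "HOL-Analysis.Analysis" "HOL-Algebra.Bij" "HOL-Algebra.Generated_Groups"
begin

section \<open>Roots of unity and non-crossing partitions\<close>

definition mu :: "nat \<Rightarrow> complex set" where
  "mu d = {z. z ^ d = 1}"

definition zeta :: "nat \<Rightarrow> complex" where
  "zeta d = exp (2 * \<i> * of_real pi / of_nat d)"

definition NCP :: "complex set \<Rightarrow> complex set set set" where
  "NCP x = {u. partition_on x u \<and>
     (\<forall>p\<in>u. \<forall>q\<in>u. convex hull p \<inter> convex hull q \<noteq> {} \<longrightarrow> p = q)}"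

definition restr :: "'a set set \<Rightarrow> 'a set \<Rightarrow> 'a set set" where
  "restr u y = (\<inter>) y ` u - {{}}"

definition NCP_e1 :: "nat \<Rightarrow> nat \<Rightarrow> complex set set set" where
  "NCP_e1 e n = {u \<in> NCP (mu (e * n)). \<forall>\<zeta>\<in>mu e. (`) ((*) \<zeta>) ` u = u}"

abbreviation mu0 :: "nat \<Rightarrow> complex set" where
  "mu0 m \<equiv> mu m \<union> {0}"

definition flat :: "nat \<Rightarrow> nat \<Rightarrow> complex set set \<Rightarrow> complex set set" where
  "flat e n u = restr u (mu (e * n))"

text \<open>\<open>NCP_ee e n\<close> is \<open>NCP(e,e,n+1)\<close>.\<close>
definition NCP_ee :: "nat \<Rightarrow> nat \<Rightarrow> complex set set set" where
  "NCP_ee e n = {u \<in> NCP (mu0 (e * n)). flat e n u \<in> NCP_e1 e n}"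

definition long :: "complex set set \<Rightarrow> bool" where
  "long w \<longleftrightarrow> (\<exists>a\<in>w. 0 \<in> convex hull a)"

definition long_part :: "complex set set \<Rightarrow> complex set" where
  "long_part w = (THE a. a \<in> w \<and> 0 \<in> convex hull a)"

definition short_symmetric :: "nat \<Rightarrow> nat \<Rightarrow> complex set set \<Rightarrow> bool" where
  "short_symmetric e n u \<longleftrightarrow> \<not> long (flat e n u) \<and> {0} \<in> u"

definition long_symmetric :: "nat \<Rightarrow> nat \<Rightarrow> complex set set \<Rightarrow> bool" where
  "long_symmetric e n u \<longleftrightarrow> long (flat e n u)"

definition symmetric :: "nat \<Rightarrow> nat \<Rightarrow> complex set set \<Rightarrow> bool" where
  "symmetric e n u \<longleftrightarrow> short_symmetric e n u \<or> long_symmetric e n u"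

definition asymmetric :: "nat \<Rightarrow> nat \<Rightarrow> complex set set \<Rightarrow> bool" where
  "asymmetric e n u \<longleftrightarrow> \<not> long (flat e n u) \<and> {0} \<notin> u"

definition star :: "complex set set \<Rightarrow> complex set set" where
  "star w = (if long w then insert (insert 0 (long_part w)) (w - {long_part w})
             else insert {0} w)"

section \<open>Complements\<close>

definition part :: "'a set set \<Rightarrow> 'a \<Rightarrow> 'a set" where
  "part u z = (THE p. p \<in> u \<and> z \<in> p)"

text \<open>Counterclockwise successor of \<open>z\<close> among the vertices \<open>p\<close> of a convex polygon: the vertex
  \<open>w\<close> such that all remaining vertices lie strictly to the left of the directed line from \<open>z\<close> to
  \<open>w\<close>. (The cross product of \<open>a\<close> and \<open>b\<close> is \<open>Im (cnj a * b)\<close>.)\<close>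
definition ccw_succ :: "complex set \<Rightarrow> complex \<Rightarrow> complex" where
  "ccw_succ p z = (if p = {z} then z
     else (THE w. w \<in> p \<and> w \<noteq> z \<and> (\<forall>y\<in>p - {z, w}. Im (cnj (w - z) * (y - z)) > 0)))"

definition sigma :: "complex set set \<Rightarrow> complex \<Rightarrow> complex" where
  "sigma u z = ccw_succ (part u z) z"

definition compl_11 :: "nat \<Rightarrow> complex set set \<Rightarrow> complex set set \<Rightarrow> complex set set" where
  "compl_11 m u v = (THE w. w \<in> NCP (mu m) \<and> (\<forall>z\<in>mu m. sigma w (sigma u z) = sigma v z))"

definition polygon_vertex :: "nat \<Rightarrow> nat \<Rightarrow> complex \<Rightarrow> nat \<Rightarrow> complex" where
  "polygon_vertex e n \<zeta> k = (if k = 0 then 0 else zeta (e * n) ^ k * \<zeta>)"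

definition polygon :: "nat \<Rightarrow> nat \<Rightarrow> complex \<Rightarrow> complex set" where
  "polygon e n \<zeta> = polygon_vertex e n \<zeta> ` {..n}"

text \<open>The standard identification of \<open>mu (n+1)\<close> with the \<open>(n+1)\<close>-gon above; it preserves the
  cyclic order, the vertices being enumerated counterclockwise.\<close>
definition to_polygon :: "nat \<Rightarrow> nat \<Rightarrow> complex \<Rightarrow> complex \<Rightarrow> complex" where
  "to_polygon e n \<zeta> z = polygon_vertex e n \<zeta> (THE k. k \<le> n \<and> zeta (n + 1) ^ k = z)"

definition compl_polygon ::
    "nat \<Rightarrow> nat \<Rightarrow> complex \<Rightarrow> complex set set \<Rightarrow> complex set set \<Rightarrow> complex set set" where
  "compl_polygon e n \<zeta> u v =
     (let f = to_polygon e n \<zeta>; g = inv_into (mu (n + 1)) f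
      in (`) f ` compl_11 (n + 1) ((`) g ` u) ((`) g ` v))"

definition min_asym :: "nat \<Rightarrow> nat \<Rightarrow> complex \<Rightarrow> complex set set" where
  "min_asym e n \<zeta> = insert {0, \<zeta>} ((\<lambda>z. {z}) ` (mu (e * n) - {\<zeta>}))"

definition max_asym :: "nat \<Rightarrow> nat \<Rightarrow> complex \<Rightarrow> complex set set" where
  "max_asym e n \<zeta> = insert (polygon e n \<zeta>)
     ((\<lambda>\<zeta>'. (*) \<zeta>' ` polygon e n \<zeta> - {0}) ` (mu e - {1}))"

text \<open>The isomorphisms \<open>phi\<close> and \<open>psi\<close> are both given by \<open>restr _ (polygon e n \<zeta>)\<close>; only the
  inverse of \<open>phi\<close> needs its domain.\<close>
definition phi_inv :: "nat \<Rightarrow> nat \<Rightarrow> complex \<Rightarrow> complex set set \<Rightarrow> complex set set" where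
  "phi_inv e n \<zeta> w = (THE u. u \<in> NCP_ee e n \<and> refines (mu0 (e * n)) u (max_asym e n \<zeta>) \<and>
     restr u (polygon e n \<zeta>) = w)"

definition compl_via :: "nat \<Rightarrow> nat \<Rightarrow> complex \<Rightarrow> complex set set \<Rightarrow> complex set set \<Rightarrow> complex set set"
  where
  "compl_via e n \<zeta> u v =
     phi_inv e n \<zeta> (compl_polygon e n \<zeta> (restr u (polygon e n \<zeta>)) (restr v (polygon e n \<zeta>)))"

definition compl_ee :: "nat \<Rightarrow> nat \<Rightarrow> complex set set \<Rightarrow> complex set set \<Rightarrow> complex set set" where
  "compl_ee e n u v =
     (if symmetric e n u \<and> symmetric e n v then
        star (compl_11 (e * n) (flat e n u) (flat e n v))
      else if asymmetric e n v then
        compl_via e n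
          (SOME \<zeta>. \<zeta> \<in> mu (e * n) \<and> refines (mu0 (e * n)) v (max_asym e n \<zeta>)) u v
      else
        compl_via e n
          (SOME \<zeta>. \<zeta> \<in> mu (e * n) \<and> refines (mu0 (e * n)) (min_asym e n \<zeta>) u) u v)"

section \<open>Quotient spaces and fundamental groups\<close>

definition quotient_topology :: "'a topology \<Rightarrow> ('a \<Rightarrow> 'b) \<Rightarrow> 'b topology" where
  "quotient_topology X f =
     topology (\<lambda>U. U \<subseteq> f ` topspace X \<and> openin X {x \<in> topspace X. f x \<in> U})"

lemma openin_quotient_topology:
  "openin (quotient_topology X f) U \<longleftrightarrow>
     U \<subseteq> f ` topspace X \<and> openin X {x \<in> topspace X. f x \<in> U}"
proof -
  have "istopology (\<lambda>U. U \<subseteq> f ` topspace X \<and> openin X {x \<in> topspace X. f x \<in> U})"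
    unfolding istopology_def
  proof (intro conjI allI impI)
    fix S T
    assume S: "S \<subseteq> f ` topspace X \<and> openin X {x \<in> topspace X. f x \<in> S}"
      and T: "T \<subseteq> f ` topspace X \<and> openin X {x \<in> topspace X. f x \<in> T}"
    show "S \<inter> T \<subseteq> f ` topspace X" using S by blast
    have "{x \<in> topspace X. f x \<in> S \<inter> T} =
        {x \<in> topspace X. f x \<in> S} \<inter> {x \<in> topspace X. f x \<in> T}" by blast
    then show "openin X {x \<in> topspace X. f x \<in> S \<inter> T}" using S T by auto
  next
    fix K
    assume K: "\<forall>S\<in>K. S \<subseteq> f ` topspace X \<and> openin X {x \<in> topspace X. f x \<in> S}"
    show "\<Union>K \<subseteq> f ` topspace X" using K by blast
    have "{x \<in> topspace X. f x \<in> \<Union>K} = (\<Union>S\<in>K. {x \<in> topspace X. f x \<in> S})" by blast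
    then show "openin X {x \<in> topspace X. f x \<in> \<Union>K}" using K by auto
  qed
  then show ?thesis by (simp add: quotient_topology_def)
qed

lemma topspace_quotient_topology: "topspace (quotient_topology X f) = f ` topspace X"
proof (rule antisym)
  show "topspace (quotient_topology X f) \<subseteq> f ` topspace X"
    using openin_topspace[of "quotient_topology X f"] unfolding openin_quotient_topology by blast
  have "{x \<in> topspace X. f x \<in> f ` topspace X} = topspace X" by blast
  then show "f ` topspace X \<subseteq> topspace (quotient_topology X f)"
    by (intro openin_subset) (simp add: openin_quotient_topology)
qed

lemma quotient_map_quotient_topology: "quotient_map X (quotient_topology X f) f"
  by (auto simp: quotient_map_def topspace_quotient_topology openin_quotient_topology)

definition loops :: "'a topology \<Rightarrow> 'a \<Rightarrow> (real \<Rightarrow> 'a) set" where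
  "loops X a = {p. pathin X p \<and> p 0 = a \<and> p 1 = a}"

definition loop_class :: "'a topology \<Rightarrow> 'a \<Rightarrow> (real \<Rightarrow> 'a) \<Rightarrow> (real \<Rightarrow> 'a) set" where
  "loop_class X a p =
     {q \<in> loops X a. homotopic_with (\<lambda>r. r 0 = a \<and> r 1 = a) (top_of_set {0..1}) X p q}"

text \<open>The concatenation \<open>+++\<close> of the library is restricted to topological type classes, which
  excludes spaces of orbits.\<close>
definition concat_loops :: "(real \<Rightarrow> 'a) \<Rightarrow> (real \<Rightarrow> 'a) \<Rightarrow> real \<Rightarrow> 'a" where
  "concat_loops p q = (\<lambda>t. if t \<le> 1/2 then p (2 * t) else q (2 * t - 1))"

definition fundamental_group :: "'a topology \<Rightarrow> 'a \<Rightarrow> (real \<Rightarrow> 'a) set monoid" where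
  "fundamental_group X a =
     \<lparr>carrier = loop_class X a ` loops X a,
      mult = (\<lambda>P Q. \<Union>p\<in>P. \<Union>q\<in>Q. loop_class X a (concat_loops p q)),
      one = loop_class X a (\<lambda>t. a)\<rparr>"

section \<open>The braid group \<open>B(e,e,n+1)\<close>\<close>

text \<open>\<open>V_space n\<close> is the complex space of dimension \<open>n+1\<close>, with coordinates indexed by \<open>0, \<dots>, n\<close>
  (functions are \<open>undefined\<close> outside the index set).\<close>
definition V_top :: "nat \<Rightarrow> (nat \<Rightarrow> complex) topology" where
  "V_top n = product_topology (\<lambda>_. euclidean) {..n}"

abbreviation V_space :: "nat \<Rightarrow> (nat \<Rightarrow> complex) set" where
  "V_space n \<equiv> topspace (V_top n)"

definition perm_maps :: "nat \<Rightarrow> ((nat \<Rightarrow> complex) \<Rightarrow> nat \<Rightarrow> complex) set" where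
  "perm_maps n = {(\<lambda>X\<in>V_space n. \<lambda>i\<in>{..n}. X (s i)) | s. s permutes {..n}}"

definition diag_maps :: "nat \<Rightarrow> nat \<Rightarrow> ((nat \<Rightarrow> complex) \<Rightarrow> nat \<Rightarrow> complex) set" where
  "diag_maps e n =
     {(\<lambda>X\<in>V_space n. \<lambda>i\<in>{..n}. d i * X i) | d. (\<forall>i\<le>n. d i \<in> mu e) \<and> (\<Prod>i\<le>n. d i) = 1}"

text \<open>\<open>G(e,e,n+1)\<close>, with matrices replaced by the transformations of \<open>V_space n\<close> they induce.\<close>
definition G_ee :: "nat \<Rightarrow> nat \<Rightarrow> ((nat \<Rightarrow> complex) \<Rightarrow> nat \<Rightarrow> complex) set" where
  "G_ee e n = generate (BijGroup (V_space n)) (perm_maps n \<union> diag_maps e n)"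

definition Vreg :: "nat \<Rightarrow> nat \<Rightarrow> (nat \<Rightarrow> complex) set" where
  "Vreg e n = {X \<in> V_space n. \<forall>i\<le>n. \<forall>j\<le>n. i \<noteq> j \<longrightarrow> (\<forall>\<zeta>\<in>mu e. X i \<noteq> \<zeta> * X j)}"

definition orb :: "nat \<Rightarrow> nat \<Rightarrow> (nat \<Rightarrow> complex) \<Rightarrow> (nat \<Rightarrow> complex) set" where
  "orb e n X = (\<lambda>g. g X) ` G_ee e n"

definition orbit_space :: "nat \<Rightarrow> nat \<Rightarrow> (nat \<Rightarrow> complex) set topology" where
  "orbit_space e n = quotient_topology (subtopology (V_top n) (Vreg e n)) (orb e n)"

definition base_point :: "nat \<Rightarrow> nat \<Rightarrow> nat \<Rightarrow> complex" where
  "base_point e n = (\<lambda>i\<in>{..n}. if i = 0 then 0 else zeta (e * n) ^ i)"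

definition braid_group :: "nat \<Rightarrow> nat \<Rightarrow> (real \<Rightarrow> (nat \<Rightarrow> complex) set) set monoid" where
  "braid_group e n = fundamental_group (orbit_space e n) (orb e n (base_point e n))"

section \<open>The elements \<open>b\<^sub>u\<close>\<close>

text \<open>The vertices whose counterclockwise order is used for the strand starting at \<open>z\<close>: the part
  containing \<open>z\<close>, without \<open>0\<close> if this is the long part. The case distinction in \<open>strand\<close> is
  according to the number of these vertices; so if \<open>{0, z, -z}\<close> is the long part, then \<open>z\<close> and
  \<open>-z\<close> follow curved paths, which avoid the fixed strand at \<open>0\<close>.\<close>
definition vertices :: "nat \<Rightarrow> nat \<Rightarrow> complex set set \<Rightarrow> complex \<Rightarrow> complex set" where
  "vertices e n u z = (if long_symmetric e n u \<and> 0 \<in> part u z then part u z - {0} else part u z)"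

definition succ_in :: "nat \<Rightarrow> nat \<Rightarrow> complex set set \<Rightarrow> complex \<Rightarrow> complex" where
  "succ_in e n u z =
     (if long_symmetric e n u \<and> z = 0 then 0 else ccw_succ (vertices e n u z) z)"

definition strand :: "nat \<Rightarrow> nat \<Rightarrow> real \<Rightarrow> complex set set \<Rightarrow> complex \<Rightarrow> real \<Rightarrow> complex" where
  "strand e n \<epsilon> u z t =
     (let z' = succ_in e n u z; k = card (vertices e n u z) in
      if k \<ge> 3 then (1 - of_real t) * z + of_real t * z'
      else if k = 2 then
        (1 - of_real t) * z + of_real t * z'
          + \<i> * of_real t * (1 - of_real t) * (z - z') * of_real \<epsilon>
      else z)"

definition special :: "nat \<Rightarrow> nat \<Rightarrow> complex set set \<Rightarrow> nat \<Rightarrow> complex \<Rightarrow> bool" where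
  "special e n u j \<zeta> \<longleftrightarrow>
     asymmetric e n u \<and> \<zeta> \<in> mu e \<and> succ_in e n u (\<zeta> * zeta (e * n) ^ j) = 0"

definition gamma :: "nat \<Rightarrow> nat \<Rightarrow> real \<Rightarrow> complex set set \<Rightarrow> real \<Rightarrow> nat \<Rightarrow> complex" where
  "gamma e n \<epsilon> u t = (\<lambda>j\<in>{..n}.
     if j = 0 then strand e n \<epsilon> u 0 t
     else if \<exists>\<zeta>. special e n u j \<zeta> then
       (let \<zeta> = (THE \<zeta>. special e n u j \<zeta>)
        in inverse \<zeta> * strand e n \<epsilon> u (\<zeta> * zeta (e * n) ^ j) t)
     else strand e n \<epsilon> u (zeta (e * n) ^ j) t)"

text \<open>The class of the loop defined by \<open>gamma e n \<epsilon> u\<close> for all sufficiently small \<open>\<epsilon> > 0\<close>.\<close>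
definition braid :: "nat \<Rightarrow> nat \<Rightarrow> complex set set \<Rightarrow> (real \<Rightarrow> (nat \<Rightarrow> complex) set) set" where
  "braid e n u = (THE c. c \<in> carrier (braid_group e n) \<and>
     (\<forall>\<^sub>F \<epsilon> in at_right 0.
        loop_class (orbit_space e n) (orb e n (base_point e n)) (orb e n \<circ> gamma e n \<epsilon> u) = c))"

end

theory Submission
  imports Defs "HOL-Combinatorics.Orbits"
begin

text \<open>
  All braids are represented by paths whose coordinates move along edges of convex polygons. If the
  triangles formed by the edges for \<open>u\<close>, \<open>u\<backslash>v\<close> and \<open>v\<close> can be separated from
  each other, and from the \<open>\<mu>\<^sub>e\<close>-rotated copies of each other, by lines, then the straight-line
  homotopy from the concatenation of the first two paths to the third one stays in the complement
  of the reflecting hyperplanes, so that \<open>b\<^sub>u b\<^bsub>u\<backslash>v\<^esub> = b\<^sub>v\<close>.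

  For symmetric \<open>u\<close> and \<open>v\<close>, the separation holds because the relevant parts are non-crossing in
  the regular \<open>en\<close>-gon. For asymmetric \<open>v\<close>, one has \<open>v \<preceq> M\<^sub>\<zeta>\<close> for some \<open>\<zeta>\<close>, everything takes place in
  the polygon \<open>a\<^sub>\<zeta>\<close>, and the rotated copies of \<open>a\<^sub>\<zeta>\<close> are separated as they lie in disjoint
  sectors. There remains the case where \<open>u\<close> is asymmetric and \<open>v\<close> is long symmetric. Let
  \<open>m\<^sub>\<zeta> \<preceq> u\<close>, and let \<open>U\<close>, \<open>W\<close> be the partitions below \<open>M\<^sub>\<zeta>\<close> with the same restrictions to \<open>a\<^sub>\<zeta>\<close> as \<open>u\<close>,
  \<open>v\<close>. Then \<open>b\<^sub>U b\<^bsub>u\<backslash>v\<^esub> = b\<^sub>W\<close> and \<open>b\<^sub>m b\<^sub>U = b\<^sub>u\<close>, where \<open>m = m\<^sub>\<zeta>\<close>, are instances of the previous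
  case, while \<open>b\<^sub>m b\<^sub>W = b\<^sub>v\<close> is a direct separation argument using that the long part is invariant
  under \<open>\<mu>\<^sub>e\<close>; hence \<open>b\<^sub>u b\<^bsub>u\<backslash>v\<^esub> = b\<^sub>m b\<^sub>U b\<^bsub>u\<backslash>v\<^esub> = b\<^sub>m b\<^sub>W = b\<^sub>v\<close>.
\<close>

section \<open>Perturbed edges\<close>

text \<open>A separating line need not separate strictly: two strands may exchange the ends of one
  segment, and then only their curvature, which vanishes with \<epsilon>, keeps them apart. Hence
  \<open>separated\<close> asks for weak inequalities, with conditions on the curvatures along the
  boundary line, and all statements on paths hold eventually in \<open>at_right 0\<close>.

  The second path does not start where the first one ends. Its coordinates are permuted by some
  \<open>s\<close> and multiplied by elements \<open>d j\<close> of \<open>mu e\<close> with product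
  1. This is the action of an element of \<open>G_ee e n\<close>, so the loop in the quotient is
  unchanged.

  The last case does not fit into a single polygon: a long symmetric partition lies below no
  \<open>max_asym e n \<zeta>\<close>, and an asymmetric one is not determined by its flat part.
  Splitting off \<open>min_asym e n \<zeta>\<close> confines the difficulty to two coordinates: the
  one moved from 0 to \<zeta> and back, and the one equivalent to \<zeta>, which passes through
  0.\<close>

definition bulge :: "real \<Rightarrow> complex \<Rightarrow> complex \<Rightarrow> complex" where
  "bulge k z z' = of_real k * (\<i> * (z - z'))"

text \<open>One formula for all strands of \<open>gamma\<close>: straight for \<open>a = 0\<close>,
  curved for \<open>a = \<epsilon>\<close>. The bulge points to the right of the direction from
  \<open>z\<close> to \<open>z'\<close>, so two strands that exchange the ends of a segment pass on
  different sides of it.\<close>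

definition bpath :: "real \<Rightarrow> complex \<Rightarrow> complex \<Rightarrow> real \<Rightarrow> complex" where
  "bpath a z z' t = (1 - of_real t) * z + of_real t * z' + of_real (t * (1 - t)) * bulge a z z'"

lemma bpath_0 [simp]: "bpath a z z' 0 = z" and bpath_1 [simp]: "bpath a z z' 1 = z'"
  and bpath_const [simp]: "bpath a z z t = z"
  by (auto simp: bpath_def bulge_def algebra_simps)

lemma bpath_mult: "c * bpath a z z' t = bpath a (c * z) (c * z') t"
  by (simp add: bpath_def bulge_def algebra_simps)

lemma bulge_mult: "c * bulge a z z' = bulge a (c * z) (c * z')"
  by (simp add: bulge_def algebra_simps)

lemma bpath_diff:
  "bpath (\<epsilon> * k) x x' t - bpath (\<epsilon> * l) y y' t =
     of_real (1 - t) * (x - y) + of_real t * (x' - y')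
       + of_real (t * (1 - t) * \<epsilon>) * (bulge k x x' - bulge l y y')"
  by (simp add: bpath_def bulge_def algebra_simps)

lemma continuous_on_bpath [continuous_intros]:
  assumes "continuous_on A f" "continuous_on A a"
  shows "continuous_on A (\<lambda>x. bpath (a x) z z' (f x))"
  unfolding bpath_def bulge_def by (intro continuous_intros assms)

lemma eventually_small_mult: "a > 0 \<Longrightarrow> \<forall>\<^sub>F \<epsilon> in at_right 0. \<bar>\<epsilon> * q\<bar> < (a::real)"
proof -
  assume a: "a > 0"
  have "((\<lambda>\<epsilon>::real. \<bar>\<epsilon> * q\<bar>) \<longlongrightarrow> \<bar>0 * q\<bar>) (at_right 0)"
    by (intro tendsto_intros)
  then show ?thesis using a by (intro order_tendstoD(2)) auto
qed

text \<open>The perturbation shares the factor \<open>1 - t\<close> with the term of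
  \<open>a\<close>, so a small \<epsilon> works uniformly up to the endpoint \<open>t = 1\<close>.
  That endpoint is left out because \<open>c\<close> may vanish.\<close>

lemma edge_pos_left:
  fixes a c q :: real
  assumes "a > 0" "c \<ge> 0"
  shows "\<forall>\<^sub>F \<epsilon> in at_right 0. \<forall>t\<in>{0..<1}. 0 < (1 - t) * a + t * c + t * (1 - t) * \<epsilon> * q"
  using eventually_small_mult[OF assms(1), of q]
proof eventually_elim
  case (elim \<epsilon>)
  show ?case
  proof
    fix t :: real assume t: "t \<in> {0..<1}"
    have "t * \<bar>\<epsilon> * q\<bar> \<le> \<bar>\<epsilon> * q\<bar>" using t by (simp add: mult_left_le_one_le)
    moreover have "t * \<epsilon> * q \<ge> - (t * \<bar>\<epsilon> * q\<bar>)"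
      using t abs_ge_minus_self[of "t * \<epsilon> * q"] by (simp add: abs_mult mult.assoc)
    ultimately have "0 < a + t * \<epsilon> * q" using elim by linarith
    then have "0 < (1 - t) * (a + t * \<epsilon> * q) + t * c"
      using t assms by (intro add_pos_nonneg[OF mult_pos_pos mult_nonneg_nonneg]) auto
    then show "0 < (1 - t) * a + t * c + t * (1 - t) * \<epsilon> * q" by (simp add: algebra_simps)
  qed
qed

lemma edge_pos_right:
  fixes a c q :: real
  assumes "a \<ge> 0" "c > 0"
  shows "\<forall>\<^sub>F \<epsilon> in at_right 0. \<forall>t\<in>{0<..1}. 0 < (1 - t) * a + t * c + t * (1 - t) * \<epsilon> * q"
  using edge_pos_left[OF assms(2,1), of q]
proof eventually_elim
  case (elim \<epsilon>)
  show ?case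
  proof
    fix t :: real assume t: "t \<in> {0<..1}"
    then have "1 - t \<in> {0..<1}" by auto
    from elim[rule_format, OF this]
    show "0 < (1 - t) * a + t * c + t * (1 - t) * \<epsilon> * q" by (simp add: algebra_simps)
  qed
qed

text \<open>On an edge inside the boundary line (\<open>a = c = 0\<close>) only the curvature
  \<open>q\<close> remains, and its sign decides because \<epsilon> is positive.\<close>

lemma edge_pos:
  fixes a c q :: real
  assumes "a \<ge> 0" "c \<ge> 0" "a > 0 \<or> c > 0 \<or> q > 0"
  shows "\<forall>\<^sub>F \<epsilon> in at_right 0. \<forall>t\<in>{0<..<1}. 0 < (1 - t) * a + t * c + t * (1 - t) * \<epsilon> * q"
proof -
  consider "a > 0" | "c > 0" | "a = 0" "c = 0" "q > 0" using assms by force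
  then show ?thesis
  proof cases
    case 1
    from edge_pos_left[OF 1 assms(2), of q] show ?thesis by eventually_elim auto
  next
    case 2
    from edge_pos_right[OF assms(1) 2, of q] show ?thesis by eventually_elim auto
  next
    case 3
    have "\<forall>\<^sub>F \<epsilon> in at_right (0::real). \<epsilon> > 0" by (simp add: eventually_at_right_less)
    then show ?thesis by eventually_elim (use 3 in auto)
  qed
qed

lemma edge_nonneg:
  fixes a c q :: real
  assumes "a \<ge> 0" "c \<ge> 0" "a = 0 \<and> c = 0 \<longrightarrow> q \<ge> 0"
  shows "\<forall>\<^sub>F \<epsilon> in at_right 0. \<forall>t\<in>{0..1}. 0 \<le> (1 - t) * a + t * c + t * (1 - t) * \<epsilon> * q"
proof -
  consider "a > 0" | "c > 0" | "a = 0" "c = 0" "q \<ge> 0" using assms by force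
  then show ?thesis
  proof cases
    case 1
    from edge_pos_left[OF 1 assms(2), of q] show ?thesis
    proof eventually_elim
      case (elim \<epsilon>)
      show ?case
      proof
        fix t :: real assume t: "t \<in> {0..1}"
        show "0 \<le> (1 - t) * a + t * c + t * (1 - t) * \<epsilon> * q"
          using elim[rule_format, of t] t assms by (cases "t = 1") auto
      qed
    qed
  next
    case 2
    from edge_pos_right[OF assms(1) 2, of q] show ?thesis
    proof eventually_elim
      case (elim \<epsilon>)
      show ?case
      proof
        fix t :: real assume t: "t \<in> {0..1}"
        show "0 \<le> (1 - t) * a + t * c + t * (1 - t) * \<epsilon> * q"
          using elim[rule_format, of t] t assms by (cases "t = 0") auto
      qed
    qed
  next
    case 3
    have "\<forall>\<^sub>F \<epsilon> in at_right (0::real). \<epsilon> > 0" by (simp add: eventually_at_right_less)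
    then show ?thesis by eventually_elim (use 3 in auto)
  qed
qed

text \<open>A half-plane criterion for two strands not to meet during the straight-line homotopy from the
  concatenation of two edges to a third one: \<open>dx\<close>, \<open>dy\<close>, \<open>dz\<close> are the differences of the three
  vertices, and \<open>bu\<close>, \<open>bw\<close>, \<open>bv\<close> those of the curvatures of the three edges. The curvatures only
  matter, for small \<open>\<epsilon>\<close>, on edges contained in the boundary of the half-plane.\<close>
definition separated :: "complex \<Rightarrow> complex \<Rightarrow> complex \<Rightarrow> complex \<Rightarrow> complex \<Rightarrow> complex \<Rightarrow> bool" where
  "separated dx dy dz bu bw bv \<longleftrightarrow> (\<exists>c.
     Im (c * dx) \<ge> 0 \<and> Im (c * dy) \<ge> 0 \<and> Im (c * dz) \<ge> 0 \<and>
     (Im (c * dx) = 0 \<and> Im (c * dy) = 0 \<longrightarrow> Im (c * bu) \<ge> 0) \<and>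
     (Im (c * dy) = 0 \<and> Im (c * dz) = 0 \<longrightarrow> Im (c * bw) \<ge> 0) \<and>
     (Im (c * dx) = 0 \<and> Im (c * dz) = 0 \<longrightarrow> Im (c * bv) \<ge> 0 \<and> (Im (c * dy) = 0 \<longrightarrow> Im (c * bv) > 0)))"

lemma separatedI_strict:
  assumes "Im (c * dx) > 0" "Im (c * dy) > 0" "Im (c * dz) > 0"
  shows "separated dx dy dz bu bw bv"
  unfolding separated_def by (rule exI[of _ c]) (use assms in auto)

lemma separated_mult:
  assumes "separated dx dy dz bu bw bv" "a \<noteq> 0"
  shows "separated (a * dx) (a * dy) (a * dz) (a * bu) (a * bw) (a * bv)"
proof -
  obtain c where c: "Im (c * dx) \<ge> 0 \<and> Im (c * dy) \<ge> 0 \<and> Im (c * dz) \<ge> 0 \<and>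
     (Im (c * dx) = 0 \<and> Im (c * dy) = 0 \<longrightarrow> Im (c * bu) \<ge> 0) \<and>
     (Im (c * dy) = 0 \<and> Im (c * dz) = 0 \<longrightarrow> Im (c * bw) \<ge> 0) \<and>
     (Im (c * dx) = 0 \<and> Im (c * dz) = 0 \<longrightarrow> Im (c * bv) \<ge> 0 \<and> (Im (c * dy) = 0 \<longrightarrow> Im (c * bv) > 0))"
    using assms unfolding separated_def by blast
  have "(c / a) * (a * x) = c * x" for x using assms by simp
  then show ?thesis unfolding separated_def by (intro exI[of _ "c / a"]) (use c in simp)
qed

lemma separated_minus:
  "separated dx dy dz bu bw bv \<Longrightarrow> separated (- dx) (- dy) (- dz) (- bu) (- bw) (- bv)"
  using separated_mult[of dx dy dz bu bw bv "-1"] by simp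

text \<open>The linear form \<open>Im (c * _)\<close> turns the difference of the two strands into a
  convex combination of one function for the first edge and one for the third. For small \<epsilon>
  both are nonnegative, and one of them is positive away from the ends. This treats the first half
  of the concatenation.\<close>

lemma separated_half:
  assumes "separated dx dy dz bu bw bv"
  shows "\<forall>\<^sub>F \<epsilon> in at_right 0. \<forall>s\<in>{0<..<1}. \<forall>t\<in>{0<..1/2}.
    of_real (1 - s) * (of_real (1 - 2*t) * dx + of_real (2*t) * dy + of_real (2*t * (1 - 2*t) * \<epsilon>) * bu)
    + of_real s * (of_real (1 - t) * dx + of_real t * dz + of_real (t * (1 - t) * \<epsilon>) * bv) \<noteq> 0"
proof -
  obtain c where c: "Im (c * dx) \<ge> 0" "Im (c * dy) \<ge> 0" "Im (c * dz) \<ge> 0"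
     "Im (c * dx) = 0 \<and> Im (c * dy) = 0 \<longrightarrow> Im (c * bu) \<ge> 0"
     "Im (c * dx) = 0 \<and> Im (c * dz) = 0 \<longrightarrow> Im (c * bv) \<ge> 0"
     "Im (c * dx) = 0 \<and> Im (c * dz) = 0 \<longrightarrow> (Im (c * dy) = 0 \<longrightarrow> Im (c * bv) > 0)"
    using assms unfolding separated_def by blast
  define f where "f d = Im (c * d)" for d
  define T where "T a b q \<epsilon> t = (1 - t) * f a + t * f b + t * (1 - t) * \<epsilon> * f q" for a b q \<epsilon> t
  note c = c[folded f_def]
  have n1: "\<forall>\<^sub>F \<epsilon> in at_right 0. \<forall>t\<in>{0..1}. 0 \<le> T dx dy bu \<epsilon> t"
    unfolding T_def by (rule edge_nonneg) (use c in argo)+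
  have n2: "\<forall>\<^sub>F \<epsilon> in at_right 0. \<forall>t\<in>{0..1}. 0 \<le> T dx dz bv \<epsilon> t"
    unfolding T_def by (rule edge_nonneg) (use c in argo)+
  \<comment> \<open>If the third edge gives no positivity, then \<open>dx\<close> and
    \<open>dz\<close> lie on the boundary line and \<open>bv\<close> does not point inwards, so the
    last clause of \<open>separated\<close> forces \<open>dy\<close> off the line. The first edge is
    then positive also at its end, which corresponds to \<open>t = 1/2\<close>.\<close>
  have pos: "(\<forall>\<^sub>F \<epsilon> in at_right 0. \<forall>t\<in>{0<..<1}. 0 < T dx dz bv \<epsilon> t) \<or>
      (\<forall>\<^sub>F \<epsilon> in at_right 0. \<forall>t\<in>{0<..1}. 0 < T dx dy bu \<epsilon> t)"
  proof (cases "f dx > 0 \<or> f dz > 0 \<or> f bv > 0")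
    case True
    show ?thesis unfolding T_def
      by (rule disjI1, intro edge_pos) (use c True in argo)+
  next
    case False
    then have "f dy > 0" using c by argo
    show ?thesis unfolding T_def
      by (rule disjI2, intro edge_pos_right) (use c \<open>f dy > 0\<close> in argo)+
  qed
  have fT: "f (of_real (1 - s) * (of_real (1 - \<tau>) * dx + of_real \<tau> * dy + of_real (\<tau> * (1 - \<tau>) * \<epsilon>) * bu)
    + of_real s * (of_real (1 - t) * dx + of_real t * dz + of_real (t * (1 - t) * \<epsilon>) * bv))
    = (1 - s) * T dx dy bu \<epsilon> \<tau> + s * T dx dz bv \<epsilon> t" for s t \<tau> \<epsilon>
    unfolding f_def T_def by (simp add: algebra_simps)
  have "\<forall>\<^sub>F \<epsilon> in at_right 0. \<forall>s\<in>{0<..<1}. \<forall>t\<in>{0<..1/2}.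
     0 < (1 - s) * T dx dy bu \<epsilon> (2*t) + s * T dx dz bv \<epsilon> t"
    using pos
  proof (elim disjE)
    assume *: "\<forall>\<^sub>F \<epsilon> in at_right 0. \<forall>t\<in>{0<..<1}. 0 < T dx dz bv \<epsilon> t"
    show ?thesis using * n1
      by eventually_elim (intro ballI add_nonneg_pos mult_nonneg_nonneg mult_pos_pos, auto)
  next
    assume *: "\<forall>\<^sub>F \<epsilon> in at_right 0. \<forall>t\<in>{0<..1}. 0 < T dx dy bu \<epsilon> t"
    show ?thesis using * n2
      by eventually_elim (intro ballI add_pos_nonneg mult_nonneg_nonneg mult_pos_pos, auto)
  qed
  then show ?thesis
  proof eventually_elim
    case (elim \<epsilon>)
    show ?case
    proof (intro ballI notI)
      fix s t assume st: "s \<in> {0<..<1}" "t \<in> {0<..1/2::real}"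
        and eq: "of_real (1 - s) * (of_real (1 - 2*t) * dx + of_real (2*t) * dy + of_real (2*t * (1 - 2*t) * \<epsilon>) * bu)
    + of_real s * (of_real (1 - t) * dx + of_real t * dz + of_real (t * (1 - t) * \<epsilon>) * bv) = 0"
      have "(1 - s) * T dx dy bu \<epsilon> (2*t) + s * T dx dz bv \<epsilon> t = 0"
        using fT[of s "2*t" \<epsilon> t] unfolding eq by (simp add: f_def)
      then show False using elim st by (metis less_irrefl)
    qed
  qed
qed

lemma separated_reverse:
  "separated dx dy dz bu bw bv \<Longrightarrow> separated dz dy dx bw bu bv"
  unfolding separated_def by (elim ex_forward) auto

text \<open>The analogue of \<open>separated\<close> for a single path. Here the endpoints have to
  avoid the hyperplanes too, whence the conditions that \<open>dx\<close> and \<open>dy\<close> are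
  nonzero.\<close>

definition edge_sep :: "complex \<Rightarrow> complex \<Rightarrow> complex \<Rightarrow> bool" where
  "edge_sep dx dy b \<longleftrightarrow> dx \<noteq> 0 \<and> dy \<noteq> 0 \<and>
     (\<exists>c. Im (c * dx) \<ge> 0 \<and> Im (c * dy) \<ge> 0 \<and> (Im (c * dx) > 0 \<or> Im (c * dy) > 0 \<or> Im (c * b) > 0))"

lemma edge_sep_mult: "edge_sep dx dy b \<Longrightarrow> a \<noteq> 0 \<Longrightarrow> edge_sep (a * dx) (a * dy) (a * b)"
proof -
  assume *: "edge_sep dx dy b" and a: "a \<noteq> 0"
  have "(c / a) * (a * x) = c * x" for x c using a by simp
  with * a show ?thesis unfolding edge_sep_def by (smt (verit) mult_eq_0_iff)
qed

lemma edge_sep_avoids: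
  assumes "edge_sep dx dy b"
  shows "\<forall>\<^sub>F \<epsilon> in at_right 0. \<forall>t\<in>{0..1}.
    of_real (1 - t) * dx + of_real t * dy + of_real (t * (1 - t) * \<epsilon>) * b \<noteq> 0"
proof -
  obtain c where c: "Im (c * dx) \<ge> 0" "Im (c * dy) \<ge> 0"
      "Im (c * dx) > 0 \<or> Im (c * dy) > 0 \<or> Im (c * b) > 0" "dx \<noteq> 0" "dy \<noteq> 0"
    using assms unfolding edge_sep_def by blast
  from edge_pos[OF c(1-3)] show ?thesis
  proof eventually_elim
    case (elim \<epsilon>)
    show ?case
    proof (intro ballI notI)
      fix t :: real assume t: "t \<in> {0..1}"
        and eq: "of_real (1 - t) * dx + of_real t * dy + of_real (t * (1 - t) * \<epsilon>) * b = 0"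
      show False
      proof (cases "t = 0 \<or> t = 1")
        case True then show False using eq c by auto
      next
        case False
        then have "0 < (1 - t) * Im (c * dx) + t * Im (c * dy) + t * (1 - t) * \<epsilon> * Im (c * b)"
          using elim t by auto
        also have "\<dots> = Im (c * (of_real (1 - t) * dx + of_real t * dy + of_real (t * (1 - t) * \<epsilon>) * b))"
          by (simp add: algebra_simps)
        finally show False unfolding eq by simp
      qed
    qed
  qed
qed

text \<open>The straight-line homotopy, at parameter \<open>s\<close>, from the concatenation of the strands
  \<open>x \<rightarrow> y\<close> and \<open>y \<rightarrow> z\<close> to the strand \<open>x \<rightarrow> z\<close>.\<close>
definition tri_strand :: "real \<Rightarrow> complex \<times> complex \<times> complex \<Rightarrow> real \<times> real \<times> real \<Rightarrow> real \<Rightarrow> real \<Rightarrow> complex"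
  where
  "tri_strand \<epsilon> p k s t = (case p of (x, y, z) \<Rightarrow> case k of (ku, kw, kv) \<Rightarrow>
     of_real (1 - s) * (if t \<le> 1/2 then bpath (\<epsilon> * ku) x y (2 * t) else bpath (\<epsilon> * kw) y z (2 * t - 1))
     + of_real s * bpath (\<epsilon> * kv) x z t)"

text \<open>The second half of the concatenation is the first half of the time-reversed triangle:
  replacing \<open>t\<close> by \<open>1 - t\<close> exchanges \<open>x\<close> with
  \<open>z\<close> and the first edge with the second, and \<open>separated\<close> is symmetric
  under this exchange.\<close>

lemma separated_avoids:
  assumes "separated (x - x') (y - y') (z - z')
    (bulge ku x y - bulge ku' x' y') (bulge kw y z - bulge kw' y' z') (bulge kv x z - bulge kv' x' z')"
  shows "\<forall>\<^sub>F \<epsilon> in at_right 0. \<forall>s\<in>{0<..<1}. \<forall>t\<in>{0<..<1}.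
    tri_strand \<epsilon> (x, y, z) (ku, kw, kv) s t \<noteq> tri_strand \<epsilon> (x', y', z') (ku', kw', kv') s t"
  using separated_half[OF assms] separated_half[OF separated_reverse[OF assms]]
proof eventually_elim
  case (elim \<epsilon>)
  show ?case
  proof (intro ballI notI)
    fix s t assume st: "s \<in> {0<..<1::real}" "t \<in> {0<..<1::real}"
    let ?p = "tri_strand \<epsilon> (x, y, z) (ku, kw, kv) s t"
    let ?q = "tri_strand \<epsilon> (x', y', z') (ku', kw', kv') s t"
    assume "?p = ?q"
    then have eq: "?p - ?q = 0" by simp
    show False
    proof (cases "t \<le> 1/2")
      case True
      have d: "?p - ?q = of_real (1 - s) * (bpath (\<epsilon> * ku) x y (2*t) - bpath (\<epsilon> * ku') x' y' (2*t))
          + of_real s * (bpath (\<epsilon> * kv) x z t - bpath (\<epsilon> * kv') x' z' t)"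
        using True by (simp add: tri_strand_def algebra_simps)
      show False using eq elim(1) st True unfolding d bpath_diff by auto
    next
      case False
      have d: "?p - ?q = of_real (1 - s) * (bpath (\<epsilon> * kw) y z (2*t-1) - bpath (\<epsilon> * kw') y' z' (2*t-1))
          + of_real s * (bpath (\<epsilon> * kv) x z t - bpath (\<epsilon> * kv') x' z' t)"
        using False by (simp add: tri_strand_def algebra_simps)
      have m: "1 - t \<in> {0<..1/2}" using False st by auto
      have e2: "?p - ?q = of_real (1 - s) * (of_real (1 - 2*(1-t)) * (z - z') + of_real (2*(1-t)) * (y - y')
            + of_real (2*(1-t) * (1 - 2*(1-t)) * \<epsilon>) * (bulge kw y z - bulge kw' y' z'))
         + of_real s * (of_real (1 - (1-t)) * (z - z') + of_real (1-t) * (x - x')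
            + of_real ((1-t) * (1 - (1-t)) * \<epsilon>) * (bulge kv x z - bulge kv' x' z'))"
        unfolding d bpath_diff by (simp add: algebra_simps)
      show False using eq elim(2)[rule_format, OF st(1) m] unfolding e2 by blast
    qed
  qed
qed

section \<open>Loops\<close>

abbreviation loop_homotopic :: "'a topology \<Rightarrow> 'a \<Rightarrow> (real \<Rightarrow> 'a) \<Rightarrow> (real \<Rightarrow> 'a) \<Rightarrow> bool" where
  "loop_homotopic X a \<equiv> homotopic_with (\<lambda>r. r 0 = a \<and> r 1 = a) (top_of_set {0..1}) X"

lemma loop_homotopicI:
  fixes h :: "real \<times> real \<Rightarrow> 'a"
  assumes "continuous_map (top_of_set ({0..1} \<times> {0..1})) X h"
    and "\<And>t. t \<in> {0..1} \<Longrightarrow> h (0, t) = p t" "\<And>t. t \<in> {0..1} \<Longrightarrow> h (1, t) = q t"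
    and "\<And>s. s \<in> {0..1} \<Longrightarrow> h (s, 0) = a" "\<And>s. s \<in> {0..1} \<Longrightarrow> h (s, 1) = a"
  shows "loop_homotopic X a p q"
proof -
  have "loop_homotopic X a (\<lambda>t. h (0, t)) (\<lambda>t. h (1, t))"
    unfolding homotopic_with_def
    by (rule exI[of _ h]) (use assms in \<open>auto simp: prod_topology_subtopology_eu\<close>)
  then show ?thesis
    by (rule homotopic_with_eq) (use assms in auto)
qed

lemma loop_homotopicE:
  assumes "loop_homotopic X a p q"
  obtains h :: "real \<times> real \<Rightarrow> 'a" where "continuous_map (top_of_set ({0..1} \<times> {0..1})) X h"
    "\<And>t. h (0, t) = p t" "\<And>t. h (1, t) = q t"
    "\<And>s. s \<in> {0..1} \<Longrightarrow> h (s, 0) = a" "\<And>s. s \<in> {0..1} \<Longrightarrow> h (s, 1) = a"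
proof -
  obtain h :: "real \<times> real \<Rightarrow> 'a" where "continuous_map (prod_topology (top_of_set {0..1}) (top_of_set {0..1})) X h"
    "\<forall>t. h (0, t) = p t" "\<forall>t. h (1, t) = q t" "\<forall>s\<in>{0..1}. h (s, 0) = a \<and> h (s, 1) = a"
    using assms unfolding homotopic_with_def by auto
  then show thesis by (intro that[of h]) (auto simp: prod_topology_subtopology_eu)
qed

lemma loop_homotopic_cong:
  assumes "p \<in> loops X a" "\<And>t. t \<in> {0..1} \<Longrightarrow> p t = q t"
  shows "loop_homotopic X a p q"
proof -
  have "loop_homotopic X a p p" using assms(1) by (auto simp: homotopic_with_refl loops_def pathin_def)
  then show ?thesis by (rule homotopic_with_eq) (use assms in auto)
qed

lemma loop_class_eq:
  assumes "loop_homotopic X a p q"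
  shows "loop_class X a p = loop_class X a q"
  unfolding loop_class_def using assms
  by (metis (lifting) homotopic_with_sym homotopic_with_trans)

lemma loop_class_self: "p \<in> loops X a \<Longrightarrow> p \<in> loop_class X a p"
  by (auto simp: loop_class_def loops_def pathin_def)

lemma continuous_map_concat:
  assumes p: "continuous_map (top_of_set (A \<times> {0..1})) X p"
    and q: "continuous_map (top_of_set (A \<times> {0..1})) X q"
    and "\<And>s. s \<in> A \<Longrightarrow> p (s, 1) = q (s, 0)"
  shows "continuous_map (top_of_set (A \<times> {0..1})) X
    (\<lambda>x. if snd x \<le> (1/2::real) then p (fst x, 2 * snd x) else q (fst x, 2 * snd x - 1))"
proof (rule continuous_map_cases_le)
  show "continuous_map (subtopology (top_of_set (A \<times> {0..1})) {x \<in> topspace (top_of_set (A \<times> {0..1})). snd x \<le> 1/2}) X (\<lambda>x. p (fst x, 2 * snd x))"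
    by (rule continuous_map_compose[OF _ p, unfolded o_def])
      (auto simp: subtopology_subtopology continuous_map_iff_continuous intro!: continuous_intros)
  show "continuous_map (subtopology (top_of_set (A \<times> {0..1})) {x \<in> topspace (top_of_set (A \<times> {0..1})). 1/2 \<le> snd x}) X (\<lambda>x. q (fst x, 2 * snd x - 1))"
    by (rule continuous_map_compose[OF _ q, unfolded o_def])
      (auto simp: subtopology_subtopology continuous_map_iff_continuous intro!: continuous_intros)
  show "p (fst x, 2 * snd x) = q (fst x, 2 * snd x - 1)"
    if "x \<in> topspace (top_of_set (A \<times> {0..1}))" "snd x = 1/2" for x
  proof -
    have "2 * snd x = 1" "2 * snd x - 1 = 0" "fst x \<in> A" using that by auto
    then show ?thesis using assms(3) by simp
  qed
qed (auto intro!: continuous_intros simp: continuous_map_iff_continuous)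

lemma pathin_compose:
  assumes "pathin X p" "continuous_on A f" "f ` A \<subseteq> {0..1}"
  shows "continuous_map (top_of_set A) X (\<lambda>x. p (f x))"
  by (rule continuous_map_compose[OF _ assms(1)[unfolded pathin_def], unfolded o_def])
    (use assms in \<open>auto simp: continuous_map_iff_continuous\<close>)

lemma concat_loops:
  assumes "p \<in> loops X a" "q \<in> loops X a"
  shows "concat_loops p q \<in> loops X a"
proof -
  have "continuous_map (top_of_set ({0..1::real} \<times> {0..1})) X
    (\<lambda>x. if snd x \<le> (1/2::real) then p (snd (fst x, 2 * snd x)) else q (snd (fst x, 2 * snd x - 1)))"
    using assms
    by (intro continuous_map_concat[of _ _ "\<lambda>x. p (snd x)" "\<lambda>x. q (snd x)"] pathin_compose)
      (auto simp: loops_def intro!: continuous_intros)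
  then have "continuous_map (top_of_set {0..1}) X
     ((\<lambda>x. if snd x \<le> (1/2::real) then p (snd (fst x, 2 * snd x)) else q (snd (fst x, 2 * snd x - 1))) \<circ> (\<lambda>t. (0::real, t)))"
    by (intro continuous_map_compose[where X' = "top_of_set ({0..1} \<times> {0..1})"])
      (auto simp: continuous_map_iff_continuous intro!: continuous_intros)
  then show ?thesis using assms by (auto simp: loops_def pathin_def concat_loops_def o_def cong: if_cong)
qed

lemma concat_loops_homotopic:
  fixes X :: "'a topology"
  assumes "loop_homotopic X a p p'" "loop_homotopic X a q q'"
  shows "loop_homotopic X a (concat_loops p q) (concat_loops p' q')"
proof -
  obtain h :: "real \<times> real \<Rightarrow> 'a" where h: "continuous_map (top_of_set ({0..1} \<times> {0..1})) X h"
    "\<And>t. h (0, t) = p t" "\<And>t. h (1, t) = p' t"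
    "\<And>s. s \<in> {0..1} \<Longrightarrow> h (s, 0) = a" "\<And>s. s \<in> {0..1} \<Longrightarrow> h (s, 1) = a"
    using loop_homotopicE[OF assms(1)] by blast
  obtain k :: "real \<times> real \<Rightarrow> 'a" where k: "continuous_map (top_of_set ({0..1} \<times> {0..1})) X k"
    "\<And>t. k (0, t) = q t" "\<And>t. k (1, t) = q' t"
    "\<And>s. s \<in> {0..1} \<Longrightarrow> k (s, 0) = a" "\<And>s. s \<in> {0..1} \<Longrightarrow> k (s, 1) = a"
    using loop_homotopicE[OF assms(2)] by blast
  show ?thesis
    by (rule loop_homotopicI[OF continuous_map_concat[OF h(1) k(1)]])
      (auto simp: h k concat_loops_def)
qed

lemma loop_reparam:
  assumes p: "p \<in> loops X a" and f: "continuous_on {0..1} f" "f ` {0..1} \<subseteq> {0..1}" "f 0 = 0" "f 1 = 1"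
  shows "loop_homotopic X a (\<lambda>t. p (f t)) p"
proof (rule loop_homotopicI[where h = "\<lambda>x. p ((1 - fst x) * f (snd x) + fst x * snd x)"])
  show "continuous_map (top_of_set ({0..1} \<times> {0..1})) X (\<lambda>x. p ((1 - fst x) * f (snd x) + fst x * snd x))"
  proof (rule pathin_compose)
    show "pathin X p" using p by (simp add: loops_def)
    show "continuous_on ({0..1} \<times> {0..1}) (\<lambda>x. (1 - fst x) * f (snd x) + fst x * snd x)"
      by (intro continuous_intros continuous_on_compose2[OF f(1)]) auto
    show "(\<lambda>x. (1 - fst x) * f (snd x) + fst x * snd x) ` ({0..1} \<times> {0..1}) \<subseteq> {0..1}"
    proof (clarify)
      fix s t :: real assume st: "s \<in> {0..1}" "t \<in> {0..1}"
      have "f t \<in> {0..1}" using f(2) st by (metis image_subset_iff)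
      then show "(1 - fst (s, t)) * f (snd (s, t)) + fst (s, t) * snd (s, t) \<in> {0..1}"
        using convexD_alt[of "{0..1::real}" "f t" t s] st by (simp add: algebra_simps)
    qed
  qed
qed (use p f in \<open>auto simp: loops_def\<close>)

lemma concat_loops_assoc:
  assumes "p \<in> loops X a" "q \<in> loops X a" "r \<in> loops X a"
  shows "loop_homotopic X a (concat_loops (concat_loops p q) r) (concat_loops p (concat_loops q r))"
proof -
  \<comment> \<open>The change of parameter has slopes 2, 1 and 1/2 on the intervals [0,1/4],
    [1/4,1/2] and [1/2,1]. As it is concave, it is the minimum of the three linear
    functions.\<close>
  have eq: "concat_loops (concat_loops p q) r t = concat_loops p (concat_loops q r) (min (2 * t) (min (t + 1/4) ((t + 1) / 2)))"
    for t unfolding concat_loops_def by (auto simp: min_def intro!: arg_cong[of _ _ q] arg_cong[of _ _ r])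
  show ?thesis unfolding eq
    by (rule loop_reparam) (auto intro!: concat_loops assms continuous_intros simp: min_le_iff_disj)
qed

context
  fixes X :: "'a topology" and a :: 'a
begin

lemma fundamental_group_carrier:
  "p \<in> loops X a \<Longrightarrow> loop_class X a p \<in> carrier (fundamental_group X a)"
  by (simp add: fundamental_group_def)

text \<open>Concatenation respects homotopy, so all the classes in the union that defines the
  product coincide.\<close>

lemma fundamental_group_mult:
  assumes "p \<in> loops X a" "q \<in> loops X a"
  shows "loop_class X a p \<otimes>\<^bsub>fundamental_group X a\<^esub> loop_class X a q = loop_class X a (concat_loops p q)"
proof -
  have *: "loop_class X a (concat_loops p' q') = loop_class X a (concat_loops p q)"
    if "p' \<in> loop_class X a p" "q' \<in> loop_class X a q" for p' q'
    using that by (intro loop_class_eq[symmetric] concat_loops_homotopic) (auto simp: loop_class_def)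
  have "(\<Union>p'\<in>loop_class X a p. \<Union>q'\<in>loop_class X a q. loop_class X a (concat_loops p' q')) =
     (\<Union>p'\<in>loop_class X a p. \<Union>q'\<in>loop_class X a q. loop_class X a (concat_loops p q))"
    using * by (intro SUP_cong refl) auto
  also have "\<dots> = loop_class X a (concat_loops p q)"
    using loop_class_self assms by fastforce
  finally show ?thesis by (simp add: fundamental_group_def)
qed

text \<open>Used to regroup the product of three braids in the case of an asymmetric partition below
  a long symmetric one.\<close>

lemma fundamental_group_assoc:
  assumes "P \<in> carrier (fundamental_group X a)" "Q \<in> carrier (fundamental_group X a)"
    "R \<in> carrier (fundamental_group X a)"
  shows "P \<otimes>\<^bsub>fundamental_group X a\<^esub> Q \<otimes>\<^bsub>fundamental_group X a\<^esub> R =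
     P \<otimes>\<^bsub>fundamental_group X a\<^esub> (Q \<otimes>\<^bsub>fundamental_group X a\<^esub> R)"
proof -
  obtain p q r where "p \<in> loops X a" "q \<in> loops X a" "r \<in> loops X a"
    "P = loop_class X a p" "Q = loop_class X a q" "R = loop_class X a r"
    using assms by (auto simp: fundamental_group_def)
  then show ?thesis
    by (simp add: fundamental_group_mult concat_loops loop_class_eq[OF concat_loops_assoc])
qed

end

section \<open>Products of braids given by polygonal strands\<close>

lemma mu_1 [simp]: "1 \<in> mu e"
  and mu_mult: "a \<in> mu e \<Longrightarrow> b \<in> mu e \<Longrightarrow> a * b \<in> mu e"
  and mu_inverse: "a \<in> mu e \<Longrightarrow> inverse a \<in> mu e"
  and mu_divide: "a \<in> mu e \<Longrightarrow> b \<in> mu e \<Longrightarrow> a / b \<in> mu e"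
  by (auto simp: mu_def power_mult_distrib power_inverse power_divide)

lemma mu_nonzero: "e > 0 \<Longrightarrow> a \<in> mu e \<Longrightarrow> a \<noteq> 0"
  by (auto simp: mu_def power_0_left)

lemma V_space_eq: "V_space n = extensional {..n}"
  by (simp add: V_top_def PiE_def)

lemma orb_continuous:
  "continuous_map (subtopology (V_top n) (Vreg e n)) (orbit_space e n) (orb e n)"
  unfolding orbit_space_def by (rule quotient_imp_continuous_map[OF quotient_map_quotient_topology])

lemma restrict_in_Vreg:
  "restrict f {..n} \<in> Vreg e n \<longleftrightarrow> (\<forall>i\<le>n. \<forall>j\<le>n. i \<noteq> j \<longrightarrow> (\<forall>\<zeta>\<in>mu e. f i \<noteq> \<zeta> * f j))"
  by (auto simp: Vreg_def V_space_eq)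

lemma continuous_map_Vreg:
  assumes "\<And>j. j \<le> n \<Longrightarrow> continuous_on A (\<lambda>x. h x j)"
    and "\<And>x. x \<in> A \<Longrightarrow> (\<lambda>j\<in>{..n}. h x j) \<in> Vreg e n"
  shows "continuous_map (top_of_set A) (orbit_space e n) (\<lambda>x. orb e n (\<lambda>j\<in>{..n}. h x j))"
proof -
  have "continuous_map (top_of_set A) (subtopology (V_top n) (Vreg e n)) (\<lambda>x. \<lambda>j\<in>{..n}. h x j)"
    unfolding V_top_def continuous_map_in_subtopology continuous_map_componentwise
    using assms by auto
  from continuous_map_compose[OF this orb_continuous] show ?thesis by (simp add: o_def)
qed

section \<open>The action of \<open>G_ee e n\<close> and its orbits\<close>

lemma perm_map_Bij:
  assumes "s permutes {..n}"
  shows "(\<lambda>X\<in>V_space n. \<lambda>i\<in>{..n}. X (s i)) \<in> Bij (V_space n)"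
proof -
  have s: "s i \<le> n \<longleftrightarrow> i \<le> n" "inv_into UNIV s i \<le> n \<longleftrightarrow> i \<le> n" "s (inv_into UNIV s i) = i" "inv_into UNIV s (s i) = i" for i
    using permutes_in_image[OF assms] permutes_in_image[OF permutes_inv[OF assms]]
      permutes_inverses[OF assms] by auto
  have "bij_betw (\<lambda>X\<in>V_space n. \<lambda>i\<in>{..n}. X (s i)) (V_space n) (V_space n)"
    by (rule bij_betwI[where g = "\<lambda>X. \<lambda>i\<in>{..n}. X (inv_into UNIV s i)"])
      (auto simp: V_space_eq s extensional_def fun_eq_iff)
  then show ?thesis by (simp add: Bij_def)
qed

lemma diag_map_Bij:
  assumes "\<And>i. i \<le> n \<Longrightarrow> d i \<noteq> 0"
  shows "(\<lambda>X\<in>V_space n. \<lambda>i\<in>{..n}. d i * X i) \<in> Bij (V_space n)"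
proof -
  have "bij_betw (\<lambda>X\<in>V_space n. \<lambda>i\<in>{..n}. d i * X i) (V_space n) (V_space n)"
    by (rule bij_betwI[where g = "\<lambda>X. \<lambda>i\<in>{..n}. X i / d i"])
      (auto simp: V_space_eq assms extensional_def fun_eq_iff)
  then show ?thesis by (simp add: Bij_def)
qed

lemma generators_Bij: "e > 0 \<Longrightarrow> perm_maps n \<union> diag_maps e n \<subseteq> carrier (BijGroup (V_space n))"
proof -
  assume e: "e > 0"
  have "(\<lambda>X\<in>V_space n. \<lambda>i\<in>{..n}. d i * X i) \<in> Bij (V_space n)" if "\<forall>i\<le>n. d i \<in> mu e" for d
    by (rule diag_map_Bij) (use that mu_nonzero[OF e] in blast)
  then have "diag_maps e n \<subseteq> Bij (V_space n)" unfolding diag_maps_def by blast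
  moreover have "perm_maps n \<subseteq> Bij (V_space n)" unfolding perm_maps_def using perm_map_Bij by blast
  ultimately show ?thesis by (simp add: BijGroup_def)
qed

lemma orb_G:
  assumes "e > 0" "g \<in> G_ee e n" "X \<in> V_space n"
  shows "orb e n (g X) = orb e n X"
proof -
  interpret B: group "BijGroup (V_space n)" by (rule group_BijGroup)
  interpret G: subgroup "G_ee e n" "BijGroup (V_space n)"
    unfolding G_ee_def by (rule B.generate_is_subgroup[OF generators_Bij[OF assms(1)]])
  have mult: "(h \<otimes>\<^bsub>BijGroup (V_space n)\<^esub> k) Y = h (k Y)" if "h \<in> G_ee e n" "k \<in> G_ee e n" "Y \<in> V_space n" for h k Y
    using that G.subset by (auto simp: BijGroup_def compose_def subset_iff)
  have "h (g X) \<in> orb e n X" if "h \<in> G_ee e n" for h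
    using mult[OF that assms(2,3)] G.m_closed[OF that assms(2)] unfolding orb_def by (metis imageI)
  moreover have "h X \<in> orb e n (g X)" if "h \<in> G_ee e n" for h
  proof -
    let ?h = "h \<otimes>\<^bsub>BijGroup (V_space n)\<^esub> inv\<^bsub>BijGroup (V_space n)\<^esub> g"
    have "?h \<in> G_ee e n" using that assms(2) by simp
    moreover have "?h \<otimes>\<^bsub>BijGroup (V_space n)\<^esub> g = h"
      using that assms(2) G.mem_carrier by (simp add: B.m_assoc)
    ultimately show ?thesis using mult[OF _ assms(2,3), of ?h] unfolding orb_def by (metis imageI)
  qed
  ultimately show ?thesis by (auto simp: orb_def)
qed

text \<open>The map is a permutation matrix followed by a diagonal matrix of determinant 1. It
  serves to move the start of one path to the end of another within the same loop of the
  quotient.\<close>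

lemma orb_twist:
  assumes "e > 0" and s: "s permutes {..n}" and d: "\<And>i. i \<le> n \<Longrightarrow> d i \<in> mu e" "(\<Prod>i\<le>n. d i) = 1"
    and X: "X \<in> V_space n"
  shows "orb e n (\<lambda>i\<in>{..n}. d i * X (s i)) = orb e n X"
proof -
  let ?p = "\<lambda>X\<in>V_space n. \<lambda>i\<in>{..n}. X (s i)" and ?d = "\<lambda>X\<in>V_space n. \<lambda>i\<in>{..n}. d i * X i"
  have "?p \<in> G_ee e n" unfolding G_ee_def perm_maps_def using s by (intro generate.incl) blast
  moreover have "?d \<in> G_ee e n" unfolding G_ee_def diag_maps_def using d by (intro generate.incl) blast
  moreover have pV: "?p X \<in> V_space n" using X by (simp add: V_space_eq)
  ultimately have "orb e n (?d (?p X)) = orb e n X"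
    using orb_G[OF assms(1) _ pV, of ?d] orb_G[OF assms(1) _ X, of ?p] by argo
  moreover have "?d (?p X) = (\<lambda>i\<in>{..n}. d i * X (s i))" using X by (auto simp: V_space_eq)
  ultimately show ?thesis by argo
qed

lemma twist_Vreg:
  assumes "e > 0" "s permutes {..n}" "\<And>i. i \<le> n \<Longrightarrow> d i \<in> mu e" "X \<in> Vreg e n"
  shows "(\<lambda>i\<in>{..n}. d i * X (s i)) \<in> Vreg e n"
  unfolding restrict_in_Vreg
proof (intro allI impI ballI notI)
  fix i j \<zeta> assume ij: "i \<le> n" "j \<le> n" "i \<noteq> j" "\<zeta> \<in> mu e" "d i * X (s i) = \<zeta> * (d j * X (s j))"
  have *: "s i \<le> n" "s j \<le> n" "s i \<noteq> s j"
    using permutes_in_image[OF assms(2)] permutes_inj[OF assms(2)] ij by (auto simp: inj_eq)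
  have "X (s i) = (\<zeta> * d j / d i) * X (s j)"
    using ij mu_nonzero[OF assms(1) assms(3)] by (simp add: field_simps)
  moreover have "\<zeta> * d j / d i \<in> mu e" using ij assms by (intro mu_mult mu_divide) auto
  moreover have "\<forall>\<zeta>\<in>mu e. X (s i) \<noteq> \<zeta> * X (s j)" using assms(4) * by (auto simp: Vreg_def)
  ultimately show False by blast
qed

lemma base_point_0 [simp]: "base_point e n 0 = 0"
  by (simp add: base_point_def)

lemma base_point_V [simp]: "base_point e n \<in> V_space n"
  by (simp add: V_space_eq base_point_def)

text \<open>\<open>Y\<close> is the endpoint of \<open>gamma\<close>, and \<open>k\<close> tells which strands are curved.\<close>
definition has_strands :: "nat \<Rightarrow> nat \<Rightarrow> complex set set \<Rightarrow> (nat \<Rightarrow> complex) \<Rightarrow> (nat \<Rightarrow> real) \<Rightarrow> bool" where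
  "has_strands e n u Y k \<longleftrightarrow>
     (\<forall>\<epsilon> t. \<forall>j\<le>n. gamma e n \<epsilon> u t j = bpath (\<epsilon> * k j) (base_point e n j) (Y j) t)"

lemma gamma_eq:
  "has_strands e n u Y k \<Longrightarrow>
     gamma e n \<epsilon> u t = (\<lambda>j\<in>{..n}. bpath (\<epsilon> * k j) (base_point e n j) (Y j) t)"
  by (rule ext) (auto simp: has_strands_def gamma_def)

definition twisted_base :: "nat \<Rightarrow> nat \<Rightarrow> (nat \<Rightarrow> complex) \<Rightarrow> bool" where
  "twisted_base e n Y \<longleftrightarrow> (\<exists>s d. s permutes {..n} \<and> (\<forall>i\<le>n. d i \<in> mu e) \<and> (\<Prod>i\<le>n. d i) = 1 \<and>
     (\<forall>i\<le>n. Y i = d i * base_point e n (s i)))"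

lemma twisted_base_orb:
  assumes "e > 0" "twisted_base e n Y"
  shows "orb e n (restrict Y {..n}) = orb e n (base_point e n)"
proof -
  obtain s d where *: "s permutes {..n}" "\<forall>i\<le>n. d i \<in> mu e" "(\<Prod>i\<le>n. d i) = 1"
     "\<forall>i\<le>n. Y i = d i * base_point e n (s i)"
    using assms(2) unfolding twisted_base_def by blast
  have "restrict Y {..n} = (\<lambda>i\<in>{..n}. d i * base_point e n (s i))" using * by auto
  then show ?thesis using orb_twist[OF assms(1) *(1), of d "base_point e n"] * by simp
qed

section \<open>Loops defined by strands, and the independence of their classes from
  \<epsilon>\<close>

definition regular_at :: "nat \<Rightarrow> nat \<Rightarrow> complex set set \<Rightarrow> real \<Rightarrow> bool" where
  "regular_at e n u \<epsilon> \<longleftrightarrow> (\<forall>t\<in>{0..1}. gamma e n \<epsilon> u t \<in> Vreg e n)"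

abbreviation "braid_loops e n \<equiv> loops (orbit_space e n) (orb e n (base_point e n))"
abbreviation "braid_class e n \<equiv> loop_class (orbit_space e n) (orb e n (base_point e n))"

lemma gamma_ends:
  assumes "has_strands e n u Y k"
  shows "gamma e n \<epsilon> u 0 = base_point e n" "gamma e n \<epsilon> u 1 = restrict Y {..n}"
  unfolding gamma_eq[OF assms] by (auto simp: base_point_def)

lemma gamma_loop:
  assumes "e > 0" "has_strands e n u Y k" "twisted_base e n Y" "regular_at e n u \<epsilon>"
  shows "orb e n \<circ> gamma e n \<epsilon> u \<in> braid_loops e n"
proof -
  have "continuous_map (top_of_set {0..1}) (orbit_space e n)
    (\<lambda>t. orb e n (\<lambda>j\<in>{..n}. bpath (\<epsilon> * k j) (base_point e n j) (Y j) t))"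
    using assms(4) unfolding regular_at_def gamma_eq[OF assms(2)]
    by (intro continuous_map_Vreg continuous_intros) auto
  then have "pathin (orbit_space e n) (orb e n \<circ> gamma e n \<epsilon> u)"
    unfolding pathin_def gamma_eq[OF assms(2), abs_def] by (simp add: o_def)
  then show ?thesis using twisted_base_orb[OF assms(1,3)]
    by (simp add: loops_def gamma_ends[OF assms(2)])
qed

text \<open>Below the bound \<open>b\<close> all parameters are admissible and form an interval, so
  interpolating linearly between two of them is a homotopy of loops. The class is therefore constant
  near 0, and the description in \<open>braid\<close> determines it.\<close>

lemma braid_class_eventually:
  assumes "e > 0" and st: "has_strands e n u Y k" and tw: "twisted_base e n Y"
    and reg: "\<forall>\<^sub>F \<epsilon> in at_right 0. regular_at e n u \<epsilon>"
  shows "\<forall>\<^sub>F \<epsilon> in at_right 0. orb e n \<circ> gamma e n \<epsilon> u \<in> braid_loops e n \<and>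
    braid_class e n (orb e n \<circ> gamma e n \<epsilon> u) = braid e n u"
    and "braid e n u \<in> carrier (braid_group e n)"
proof -
  obtain b where b: "b > 0" "\<And>\<epsilon>. 0 < \<epsilon> \<Longrightarrow> \<epsilon> < b \<Longrightarrow> regular_at e n u \<epsilon>"
    using reg unfolding eventually_at_right_field by auto
  note loop = gamma_loop[OF assms(1) st tw]
  have same: "braid_class e n (orb e n \<circ> gamma e n \<epsilon> u) = braid_class e n (orb e n \<circ> gamma e n \<delta> u)"
    if "0 < \<epsilon>" "\<epsilon> < b" "0 < \<delta>" "\<delta> < b" for \<epsilon> \<delta>
  proof (rule loop_class_eq, rule loop_homotopicI)
    let ?m = "\<lambda>s. (1 - s) * \<epsilon> + s * \<delta>"
    have m: "0 < ?m s" "?m s < b" if "s \<in> {0..1}" for s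
      using convexD_alt[of "{0<..<b}" \<epsilon> \<delta> s] that \<open>0 < \<epsilon>\<close> \<open>\<epsilon> < b\<close> \<open>0 < \<delta>\<close> \<open>\<delta> < b\<close>
      by auto
    show "continuous_map (top_of_set ({0..1} \<times> {0..1})) (orbit_space e n)
      (\<lambda>x. orb e n (\<lambda>j\<in>{..n}. bpath (?m (fst x) * k j) (base_point e n j) (Y j) (snd x)))"
      using b(2)[OF m] unfolding regular_at_def gamma_eq[OF st]
      by (intro continuous_map_Vreg continuous_intros) auto
    show "orb e n (\<lambda>j\<in>{..n}. bpath (?m (fst (s, 0)) * k j) (base_point e n j) (Y j) (snd (s, 0)))
        = orb e n (base_point e n)" for s
      using gamma_ends(1)[OF st, of "?m s"] unfolding gamma_eq[OF st] by simp
    show "orb e n (\<lambda>j\<in>{..n}. bpath (?m (fst (s, 1)) * k j) (base_point e n j) (Y j) (snd (s, 1)))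
        = orb e n (base_point e n)" for s
      using gamma_ends(2)[OF st, of "?m s"] twisted_base_orb[OF assms(1) tw]
      unfolding gamma_eq[OF st] by simp
  qed (simp_all add: gamma_eq[OF st])
  define c where "c = braid_class e n (orb e n \<circ> gamma e n (b / 2) u)"
  have ev: "\<forall>\<^sub>F \<epsilon> in at_right 0. orb e n \<circ> gamma e n \<epsilon> u \<in> braid_loops e n \<and>
    braid_class e n (orb e n \<circ> gamma e n \<epsilon> u) = c"
    unfolding eventually_at_right_field c_def
  proof (intro exI[of _ b] conjI allI impI b(1))
    fix \<epsilon> assume "0 < \<epsilon>" "\<epsilon> < b"
    then show "orb e n \<circ> gamma e n \<epsilon> u \<in> braid_loops e n" using b loop by blast
    show "braid_class e n (orb e n \<circ> gamma e n \<epsilon> u) = braid_class e n (orb e n \<circ> gamma e n (b / 2) u)"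
      by (rule same) (use b \<open>0 < \<epsilon>\<close> \<open>\<epsilon> < b\<close> in auto)
  qed
  have c: "c \<in> carrier (braid_group e n)" unfolding c_def braid_group_def
    using b by (intro fundamental_group_carrier loop b) auto
  have "braid e n u = c" unfolding braid_def
  proof (rule the_equality)
    show "c \<in> carrier (braid_group e n) \<and>
      (\<forall>\<^sub>F \<epsilon> in at_right 0. braid_class e n (orb e n \<circ> gamma e n \<epsilon> u) = c)"
      using c ev by (simp add: eventually_conj_iff)
  next
    fix c' assume "c' \<in> carrier (braid_group e n) \<and>
      (\<forall>\<^sub>F \<epsilon> in at_right 0. braid_class e n (orb e n \<circ> gamma e n \<epsilon> u) = c')"
    then have "\<forall>\<^sub>F \<epsilon> in at_right 0. braid_class e n (orb e n \<circ> gamma e n \<epsilon> u) = c'" ..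
    \<comment> \<open>The filter \<open>at_right 0\<close> is not trivial, so a statement without
      \<epsilon> that holds eventually is true.\<close>
    with ev have "\<forall>\<^sub>F \<epsilon> in at_right (0::real). c' = c" by eventually_elim simp
    then show "c' = c" by simp
  qed
  then show "\<forall>\<^sub>F \<epsilon> in at_right 0. orb e n \<circ> gamma e n \<epsilon> u \<in> braid_loops e n \<and>
    braid_class e n (orb e n \<circ> gamma e n \<epsilon> u) = braid e n u"
    "braid e n u \<in> carrier (braid_group e n)" using ev c by blast+
qed

lemma finite_mu: "e > 0 \<Longrightarrow> finite (mu e)"
  unfolding mu_def by (rule finite_roots_unity) simp

text \<open>Only finitely many triples of two coordinates and an element of \<open>mu e\<close>
  occur, so the bounds on \<epsilon> from \<open>edge_sep_avoids\<close> have a common positive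
  lower bound.\<close>

lemma eventually_regular:
  assumes "e > 0" and st: "has_strands e n u Y k"
    and sep: "\<And>i j \<zeta>. i \<le> n \<Longrightarrow> j \<le> n \<Longrightarrow> i \<noteq> j \<Longrightarrow> \<zeta> \<in> mu e \<Longrightarrow>
      edge_sep (base_point e n i - \<zeta> * base_point e n j) (Y i - \<zeta> * Y j)
        (bulge (k i) (base_point e n i) (Y i) - \<zeta> * bulge (k j) (base_point e n j) (Y j))"
  shows "\<forall>\<^sub>F \<epsilon> in at_right 0. regular_at e n u \<epsilon>"
proof -
  let ?P = "\<lambda>i j \<zeta> \<epsilon>. \<forall>t\<in>{0..1}. bpath (\<epsilon> * k i) (base_point e n i) (Y i) t \<noteq>
         \<zeta> * bpath (\<epsilon> * k j) (base_point e n j) (Y j) t"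
  have "\<forall>\<^sub>F \<epsilon> in at_right 0. ?P i j \<zeta> \<epsilon>"
    if "i \<le> n" "j \<le> n" "i \<noteq> j" "\<zeta> \<in> mu e" for i j \<zeta>
    using edge_sep_avoids[OF sep[OF that]]
  proof eventually_elim
    case (elim \<epsilon>)
    show ?case
    proof (intro ballI notI)
      fix t :: real assume t: "t \<in> {0..1}"
      assume "bpath (\<epsilon> * k i) (base_point e n i) (Y i) t = \<zeta> * bpath (\<epsilon> * k j) (base_point e n j) (Y j) t"
      then have "bpath (\<epsilon> * k i) (base_point e n i) (Y i) t
          - bpath (\<epsilon> * k j) (\<zeta> * base_point e n j) (\<zeta> * Y j) t = 0"
        by (simp add: bpath_mult)
      then show False using elim t unfolding bpath_diff by (auto simp: bulge_mult)
    qed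
  qed
  then have "\<forall>\<^sub>F \<epsilon> in at_right 0. \<forall>x\<in>{..n} \<times> {..n} \<times> mu e. fst x \<noteq> fst (snd x) \<longrightarrow>
      ?P (fst x) (fst (snd x)) (snd (snd x)) \<epsilon>"
    using finite_mu[OF assms(1)] by (intro eventually_ball_finite) (auto split: prod.splits)
  then show ?thesis
    unfolding regular_at_def gamma_eq[OF st] restrict_in_Vreg
    by eventually_elim force
qed

lemma tri_strand_mult:
  "c * tri_strand \<epsilon> (x, y, z) k s t = tri_strand \<epsilon> (c * x, c * y, c * z) k s t"
proof -
  obtain ku kw kv where k: "k = (ku, kw, kv)" by (cases k) auto
  show ?thesis unfolding k tri_strand_def by (simp add: bpath_mult[symmetric] distrib_left mult.left_commute)
qed

lemma continuous_on_tri_strand: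
  "continuous_on ({0..1} \<times> {0..1}) (\<lambda>x. tri_strand \<epsilon> p k (fst x) (snd x))"
proof -
  obtain a b c ku kw kv where pk: "p = (a, b, c)" "k = (ku, kw, kv)" by (cases p; cases k) auto
  \<comment> \<open>Clamping the two parameters removes the case distinction: in each half of the
    interval one of the two strands rests at the common vertex \<open>b\<close>, which is then
    subtracted.\<close>
  have "tri_strand \<epsilon> p k (fst x) (snd x) = of_real (1 - fst x) *
     (bpath (\<epsilon> * ku) a b (min (2 * snd x) 1) + bpath (\<epsilon> * kw) b c (max (2 * snd x - 1) 0) - b)
     + of_real (fst x) * bpath (\<epsilon> * kv) a c (snd x)" for x
    by (auto simp: tri_strand_def pk min_def max_def)
  then show ?thesis by (simp add: continuous_intros)
qed

text \<open>The path of \<open>w\<close> starts at the base point, so it is twisted by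
  \<open>s\<close> and \<open>d\<close> to start at \<open>Y\<close>; it then ends at
  \<open>Z\<close>, the end of the path of \<open>v\<close>. Each coordinate thus runs around a
  triangle, contracted by the straight-line homotopy. The assumption \<open>sep\<close> covers the
  interior of the square of parameters, and \<open>reg\<close> its sides.\<close>

lemma braid_mult:
  assumes e: "e > 0"
    and stu: "has_strands e n u Y ku" and stw: "has_strands e n w Y' kw" and stv: "has_strands e n v Z kv"
    and s: "s permutes {..n}" and d: "\<And>i. i \<le> n \<Longrightarrow> d i \<in> mu e" "(\<Prod>i\<le>n. d i) = 1"
    and Y: "\<And>j. j \<le> n \<Longrightarrow> Y j = d j * base_point e n (s j)"
    and Z: "\<And>j. j \<le> n \<Longrightarrow> Z j = d j * Y' (s j)"
    and tw: "twisted_base e n Y" "twisted_base e n Y'" "twisted_base e n Z"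
    and reg: "\<forall>\<^sub>F \<epsilon> in at_right 0. regular_at e n u \<epsilon>" "\<forall>\<^sub>F \<epsilon> in at_right 0. regular_at e n w \<epsilon>"
      "\<forall>\<^sub>F \<epsilon> in at_right 0. regular_at e n v \<epsilon>"
    and sep: "\<And>i j \<zeta>. i \<le> n \<Longrightarrow> j \<le> n \<Longrightarrow> i \<noteq> j \<Longrightarrow> \<zeta> \<in> mu e \<Longrightarrow>
      separated (base_point e n i - \<zeta> * base_point e n j) (Y i - \<zeta> * Y j) (Z i - \<zeta> * Z j)
        (bulge (ku i) (base_point e n i) (Y i) - \<zeta> * bulge (ku j) (base_point e n j) (Y j))
        (bulge (kw (s i)) (Y i) (Z i) - \<zeta> * bulge (kw (s j)) (Y j) (Z j))
        (bulge (kv i) (base_point e n i) (Z i) - \<zeta> * bulge (kv j) (base_point e n j) (Z j))"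
  shows "braid e n u \<otimes>\<^bsub>braid_group e n\<^esub> braid e n w = braid e n v"
proof -
  let ?h = "\<lambda>\<epsilon> j. tri_strand \<epsilon> (base_point e n j, Y j, Z j) (ku j, kw (s j), kv j)"
  let ?P = "\<lambda>i j \<zeta> \<epsilon>. \<forall>\<sigma>\<in>{0<..<1}. \<forall>t\<in>{0<..<1}. ?h \<epsilon> i \<sigma> t \<noteq> \<zeta> * ?h \<epsilon> j \<sigma> t"
  have "\<forall>\<^sub>F \<epsilon> in at_right 0. ?P i j \<zeta> \<epsilon>"
    if "i \<le> n" "j \<le> n" "i \<noteq> j" "\<zeta> \<in> mu e" for i j \<zeta>
    unfolding tri_strand_mult
    by (rule separated_avoids) (use sep[OF that] in \<open>simp add: bulge_mult\<close>)
  then have "\<forall>\<^sub>F \<epsilon> in at_right 0. \<forall>x\<in>{..n} \<times> {..n} \<times> mu e. fst x \<noteq> fst (snd x) \<longrightarrow>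
      ?P (fst x) (fst (snd x)) (snd (snd x)) \<epsilon>"
    using finite_mu[OF e] by (intro eventually_ball_finite) (auto split: prod.splits)
  then have interior: "\<forall>\<^sub>F \<epsilon> in at_right 0. \<forall>\<sigma>\<in>{0<..<1}. \<forall>t\<in>{0<..<1}.
      (\<lambda>j\<in>{..n}. ?h \<epsilon> j \<sigma> t) \<in> Vreg e n"
    unfolding restrict_in_Vreg by eventually_elim force
  note bu = braid_class_eventually(1)[OF e stu tw(1) reg(1)]
    and bw = braid_class_eventually(1)[OF e stw tw(2) reg(2)]
    and bv = braid_class_eventually(1)[OF e stv tw(3) reg(3)]
  from interior bu bw bv reg
  have "\<forall>\<^sub>F \<epsilon> in at_right (0::real). ?thesis"
  proof eventually_elim
    case (elim \<epsilon>)
    let ?u = "orb e n \<circ> gamma e n \<epsilon> u" and ?w = "orb e n \<circ> gamma e n \<epsilon> w" and ?v = "orb e n \<circ> gamma e n \<epsilon> v"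
    \<comment> \<open>At homotopy parameter 0 the homotopy is the path of \<open>u\<close> followed
      by the twisted path of \<open>w\<close>, which have the same orbits as the concatenated
      loops.\<close>
    have h0: "(\<lambda>j\<in>{..n}. ?h \<epsilon> j 0 t) = (if t \<le> 1/2 then gamma e n \<epsilon> u (2*t)
        else (\<lambda>i\<in>{..n}. d i * gamma e n \<epsilon> w (2*t-1) (s i)))" for t
      using permutes_in_image[OF s]
      by (auto simp: tri_strand_def gamma_eq[OF stu] gamma_eq[OF stw] bpath_mult Y Z fun_eq_iff)
    have h1: "(\<lambda>j\<in>{..n}. ?h \<epsilon> j 1 t) = gamma e n \<epsilon> v t" for t
      by (auto simp: tri_strand_def gamma_eq[OF stv])
    have ht0: "(\<lambda>j\<in>{..n}. ?h \<epsilon> j \<sigma> 0) = base_point e n" for \<sigma>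
      by (auto simp: tri_strand_def algebra_simps base_point_def)
    have ht1: "(\<lambda>j\<in>{..n}. ?h \<epsilon> j \<sigma> 1) = restrict Z {..n}" for \<sigma>
      by (auto simp: tri_strand_def algebra_simps)
    \<comment> \<open>On the sides of the square the homotopy is one of the three paths or rests at
      an endpoint, so regularity of the paths applies where \<open>separated_avoids\<close> gives
      nothing.\<close>
    have hV: "(\<lambda>j\<in>{..n}. ?h \<epsilon> j \<sigma> t) \<in> Vreg e n" if "\<sigma> \<in> {0..1}" "t \<in> {0..1}" for \<sigma> t
    proof -
      consider "\<sigma> = 0" | "\<sigma> = 1" | "t = 0" | "t = 1" | "\<sigma> \<in> {0<..<1}" "t \<in> {0<..<1}"
        using \<open>\<sigma> \<in> {0..1}\<close> \<open>t \<in> {0..1}\<close> by force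
      then show ?thesis
      proof cases
        case 1
        show ?thesis
        proof (cases "t \<le> 1/2")
          case True
          then show ?thesis using elim that unfolding 1 h0 by (simp add: regular_at_def)
        next
          case False
          then have "gamma e n \<epsilon> w (2*t-1) \<in> Vreg e n" using elim that by (simp add: regular_at_def)
          from twist_Vreg[OF e s d(1) this] show ?thesis using False unfolding 1 h0 by simp
        qed
      next
        case 2
        then show ?thesis using elim that unfolding 2 h1 by (simp add: regular_at_def)
      next
        case 3
        have "gamma e n \<epsilon> u 0 \<in> Vreg e n" using elim by (simp add: regular_at_def)
        then show ?thesis unfolding 3 ht0 gamma_ends(1)[OF stu] .
      next
        case 4
        have "gamma e n \<epsilon> v 1 \<in> Vreg e n" using elim by (simp add: regular_at_def)
        then show ?thesis unfolding 4 ht1 gamma_ends(2)[OF stv] .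
      next
        case 5 then show ?thesis using elim by auto
      qed
    qed
    have "loop_homotopic (orbit_space e n) (orb e n (base_point e n)) (concat_loops ?u ?w) ?v"
    proof (rule loop_homotopicI)
      show "continuous_map (top_of_set ({0..1} \<times> {0..1})) (orbit_space e n)
        (\<lambda>x. orb e n (\<lambda>j\<in>{..n}. ?h \<epsilon> j (fst x) (snd x)))"
        by (intro continuous_map_Vreg continuous_on_tri_strand) (use hV in auto)
      have "gamma e n \<epsilon> w t \<in> V_space n" for t by (simp add: V_space_eq gamma_def)
      then show "orb e n (\<lambda>j\<in>{..n}. ?h \<epsilon> j (fst (0, t)) (snd (0, t))) = concat_loops ?u ?w t" for t
        unfolding fst_conv snd_conv h0 concat_loops_def using orb_twist[OF e s d] by auto
      show "orb e n (\<lambda>j\<in>{..n}. ?h \<epsilon> j (fst (1, t)) (snd (1, t))) = ?v t" for t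
        unfolding fst_conv snd_conv h1 by simp
      show "orb e n (\<lambda>j\<in>{..n}. ?h \<epsilon> j (fst (\<sigma>, 0)) (snd (\<sigma>, 0))) = orb e n (base_point e n)" for \<sigma>
        unfolding fst_conv snd_conv ht0 ..
      show "orb e n (\<lambda>j\<in>{..n}. ?h \<epsilon> j (fst (\<sigma>, 1)) (snd (\<sigma>, 1))) = orb e n (base_point e n)" for \<sigma>
        unfolding fst_conv snd_conv ht1 by (rule twisted_base_orb[OF e tw(3)])
    qed
    from loop_class_eq[OF this] show ?case
      using elim unfolding braid_group_def by (metis fundamental_group_mult)
  qed
  then show ?thesis by simp
qed

section \<open>Convex polygons\<close>

text \<open>Twice the signed area of the triangle \<open>a b p\<close>, positive if \<open>p\<close>
  lies to the left of the directed line from \<open>a\<close> to \<open>b\<close>.\<close>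

definition orient :: "complex \<Rightarrow> complex \<Rightarrow> complex \<Rightarrow> real" where
  "orient a b p = Im (cnj (b - a) * (p - a))"

abbreviation ccw :: "complex \<Rightarrow> complex \<Rightarrow> complex \<Rightarrow> bool" where
  "ccw a b p \<equiv> orient a b p > 0"

lemma orient_rotate: "orient b c a = orient a b c"
  and orient_swap: "orient a c b = - orient a b c"
  and orient_swap': "orient b a c = - orient a b c"
  by (auto simp: orient_def algebra_simps)

lemma orient_self [simp]: "orient a b a = 0" "orient a b b = 0" "orient a a b = 0"
  by (simp_all add: orient_def algebra_simps)

text \<open>Explains the usual choice \<open>c = cnj (b - a)\<close> in \<open>separated\<close>: up
  to a factor the linear form measures the distance from the line through \<open>a\<close> and
  \<open>b\<close>, so that differences of strands are compared by the sides of an edge.\<close>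

lemma orient_diff: "Im (cnj (b - a) * (p - q)) = orient a b p - orient a b q"
  by (simp add: orient_def algebra_simps)

lemma Im_bulge: "Im (cnj (b - a) * bulge k a b) = - (k * (cmod (b - a))\<^sup>2)"
  and Im_bulge': "Im (cnj (b - a) * bulge k b a) = k * (cmod (b - a))\<^sup>2"
  unfolding cmod_power2 by (simp_all add: bulge_def power2_eq_square algebra_simps)

lemma bulge_self [simp]: "bulge k a a = 0"
  by (simp add: bulge_def)

text \<open>Cyclic order of indices. Rewriting \<open>ccw\<close> to it turns every question on
  relative positions of vertices into linear integer arithmetic.\<close>

definition cyc :: "int \<Rightarrow> int \<Rightarrow> int \<Rightarrow> bool" where
  "cyc i j k \<longleftrightarrow> i < j \<and> j < k \<or> j < k \<and> k < i \<or> k < i \<and> i < j"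

text \<open>Combinatorial substitute for disjoint convex hulls: no chord from \<open>a\<close> to
  \<open>c\<close> in \<open>p\<close> crosses a chord from \<open>b\<close> to \<open>d\<close> in
  \<open>q\<close>, the four vertices being in the cyclic order \<open>a\<close>, \<open>b\<close>,
  \<open>c\<close>, \<open>d\<close>.\<close>

definition noncrossing :: "complex set \<Rightarrow> complex set \<Rightarrow> bool" where
  "noncrossing p q \<longleftrightarrow> (\<forall>a\<in>p. \<forall>c\<in>p. \<forall>b\<in>q. \<forall>d\<in>q. \<not> (ccw a b c \<and> ccw c d a))"

lemma part_eq: "partition_on A u \<Longrightarrow> p \<in> u \<Longrightarrow> z \<in> p \<Longrightarrow> part u z = p"
  unfolding part_def by (rule the_equality) (auto simp: partition_on_def disjoint_def)

lemma
  assumes "partition_on A u" "z \<in> A"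
  shows part_in: "part u z \<in> u" and part_self: "z \<in> part u z"
proof -
  obtain p where "p \<in> u" "z \<in> p" using assms by (auto simp: partition_on_def)
  then show "part u z \<in> u" "z \<in> part u z" using part_eq[OF assms(1)] by auto
qed

lemma part_subset: "partition_on A u \<Longrightarrow> z \<in> A \<Longrightarrow> part u z \<subseteq> A"
  using part_in[of A u z] unfolding partition_on_def by blast

lemma part_cong: "partition_on A u \<Longrightarrow> z \<in> A \<Longrightarrow> y \<in> part u z \<Longrightarrow> part u y = part u z"
  using part_eq[of A u "part u z" y] part_in[of A u z] by simp

lemma refines_part: "refines A u v \<Longrightarrow> z \<in> A \<Longrightarrow> part u z \<subseteq> part v z"
proof -
  assume *: "refines A u v" "z \<in> A"
  then have u: "partition_on A u" and v: "partition_on A v" by (auto simp: refines_def)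
  obtain q where q: "q \<in> v" "part u z \<subseteq> q" using * part_in[OF u] unfolding refines_def by blast
  then have "part v z = q" using part_eq[OF v] part_self[OF u *(2)] by blast
  then show ?thesis using q by simp
qed

lemma separated_hulls:
  assumes "\<forall>x\<in>p. \<forall>y\<in>q. Im (c * (x - y)) > (0::real)"
  shows "convex hull p \<inter> convex hull q = {}"
proof (rule ccontr)
  assume "convex hull p \<inter> convex hull q \<noteq> {}"
  then obtain z where z: "z \<in> convex hull p" "z \<in> convex hull q" by blast
  have "Im (c * x) = Complex (Im c) (Re c) \<bullet> x" for x by (simp add: inner_complex_def)
  then have "{x. Im (c * (x - y)) > 0} = {x. Complex (Im c) (Re c) \<bullet> x > Im (c * y)}"
    "{y. Im (c * (x - y)) > 0} = {y. Complex (Im c) (Re c) \<bullet> y < Im (c * x)}" for x y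
    by (auto simp: right_diff_distrib simp del: times_complex.sel)
  then have conv: "convex {x. Im (c * (x - y)) > 0}" "convex {y. Im (c * (x - y)) > 0}" for x y
    by (simp_all only: convex_halfspace_gt convex_halfspace_lt)
  have 1: "Im (c * (x - z)) > 0" if "x \<in> p" for x
  proof -
    have "convex hull q \<subseteq> {y. Im (c * (x - y)) > 0}"
      using assms that by (intro hull_minimal conv) auto
    then show ?thesis using z by auto
  qed
  have "convex hull p \<subseteq> {x. Im (c * (x - z)) > 0}"
    using 1 by (intro hull_minimal conv) auto
  then show False using z by auto
qed

text \<open>Strict convexity is encoded by letting the orientation of vertices be the cyclic order
  of their indices. The instances are the regular polygons, the polygons
  \<open>polygon e n \<zeta>\<close>, and the regular polygon numbered from an arbitrary
  vertex.\<close>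

locale convex_polygon =
  fixes vertex :: "nat \<Rightarrow> complex" and N :: nat
  assumes inj_vertex: "inj_on vertex {..<N}"
    and ccw_vertex: "i < N \<Longrightarrow> j < N \<Longrightarrow> k < N \<Longrightarrow>
      ccw (vertex i) (vertex j) (vertex k) \<longleftrightarrow> cyc (int i) (int j) (int k)"
begin

definition S :: "complex set" where "S = vertex ` {..<N}"

definition idx :: "complex \<Rightarrow> int" where "idx a = int (inv_into {..<N} vertex a)"

lemma finite_S [simp]: "finite S"
  by (simp add: S_def)

lemma idx_range: "a \<in> S \<Longrightarrow> 0 \<le> idx a \<and> idx a < int N"
  using inv_into_into[of a vertex "{..<N}"] by (auto simp: S_def idx_def)

lemma vertex_idx: "a \<in> S \<Longrightarrow> vertex (nat (idx a)) = a"
  by (auto simp: S_def idx_def f_inv_into_f)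

lemma idx_vertex: "i < N \<Longrightarrow> idx (vertex i) = int i"
  by (simp add: idx_def inv_into_f_f[OF inj_vertex])

lemma vertex_in_S: "i < N \<Longrightarrow> vertex i \<in> S"
  by (simp add: S_def)

lemma ccw_iff: "a \<in> S \<Longrightarrow> b \<in> S \<Longrightarrow> c \<in> S \<Longrightarrow> ccw a b c \<longleftrightarrow> cyc (idx a) (idx b) (idx c)"
  using ccw_vertex[of "nat (idx a)" "nat (idx b)" "nat (idx c)"] idx_range[of a] idx_range[of b] idx_range[of c]
  by (simp add: vertex_idx nat_less_iff)

lemma eq_iff: "a \<in> S \<Longrightarrow> b \<in> S \<Longrightarrow> a = b \<longleftrightarrow> idx a = idx b"
  by (metis vertex_idx)

lemmas to_idx = ccw_iff eq_iff cyc_def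

lemma orient_nonneg_iff:
  assumes "a \<in> S" "b \<in> S" "c \<in> S"
  shows "orient a b c = 0 \<longleftrightarrow> a = b \<or> b = c \<or> a = c" "orient a b c < 0 \<longleftrightarrow> ccw a c b"
proof -
  show *: "orient a b c < 0 \<longleftrightarrow> ccw a c b" using orient_swap[of a c b] by simp
  have "orient a b c = 0 \<longleftrightarrow> \<not> ccw a b c \<and> \<not> ccw a c b" using * by linarith
  also have "\<dots> \<longleftrightarrow> a = b \<or> b = c \<or> a = c"
    using assms by (simp only: to_idx) (smt (verit))
  finally show "orient a b c = 0 \<longleftrightarrow> a = b \<or> b = c \<or> a = c" .
qed

lemma ccw_succ_ex:
  assumes "p \<subseteq> S" "z \<in> p" "p \<noteq> {z}"
  shows "\<exists>w. w \<in> p \<and> w \<noteq> z \<and> (\<forall>y\<in>p - {z, w}. ccw z w y)"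
proof -
  \<comment> \<open>Indices are unrolled to start just after \<open>z\<close>, so the least value is
    the next vertex of \<open>p\<close>.\<close>
  define f where "f w = (if idx z < idx w then idx w else idx w + int N)" for w
  have "finite (p - {z})" "p - {z} \<noteq> {}" using assms finite_subset[OF assms(1)] by auto
  from arg_min_if_finite[OF this, of f] obtain w where
    w: "w \<in> p - {z}" "\<And>y. y \<in> p - {z} \<Longrightarrow> \<not> f y < f w" by blast
  have "ccw z w y" if y: "y \<in> p - {z, w}" for y
  proof -
    have m: "z \<in> S" "w \<in> S" "y \<in> S" "y \<noteq> w" "y \<noteq> z" "w \<noteq> z" using assms w y by auto
    have "f w \<le> f y" using w(2)[of y] y by auto
    then show ?thesis using m idx_range[OF m(1)] idx_range[OF m(2)] idx_range[OF m(3)]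
      unfolding f_def by (simp only: to_idx) (smt (verit))
  qed
  then show ?thesis using w by blast
qed

lemma ccw_succI:
  assumes "p \<subseteq> S" "z \<in> p" "w \<in> p" "w \<noteq> z" "\<And>y. y \<in> p \<Longrightarrow> y \<noteq> z \<Longrightarrow> y \<noteq> w \<Longrightarrow> ccw z w y"
  shows "ccw_succ p z = w"
proof -
  have "p \<noteq> {z}" using assms by auto
  have "(THE w. w \<in> p \<and> w \<noteq> z \<and> (\<forall>y\<in>p - {z, w}. Im (cnj (w - z) * (y - z)) > 0)) = w"
  proof (rule the_equality)
    fix w' assume w': "w' \<in> p \<and> w' \<noteq> z \<and> (\<forall>y\<in>p - {z, w'}. Im (cnj (w' - z) * (y - z)) > 0)"
    show "w' = w"
    proof (rule ccontr)
      assume "w' \<noteq> w"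
      then have "ccw z w' w" "ccw z w w'" using w' assms by (auto simp: orient_def)
      then show False by (simp add: orient_swap[of z w w'])
    qed
  qed (use assms in \<open>auto simp: orient_def\<close>)
  then show ?thesis using \<open>p \<noteq> {z}\<close> by (simp add: ccw_succ_def)
qed

lemma ccw_succ_single [simp]: "ccw_succ {z} z = z"
  by (simp add: ccw_succ_def)

lemma ccw_succ:
  assumes "p \<subseteq> S" "z \<in> p"
  shows "ccw_succ p z \<in> p" "p \<noteq> {z} \<Longrightarrow> ccw_succ p z \<noteq> z"
    "y \<in> p \<Longrightarrow> y \<noteq> z \<Longrightarrow> y \<noteq> ccw_succ p z \<Longrightarrow> ccw z (ccw_succ p z) y"
proof -
  have "ccw_succ p z \<in> p \<and> (p \<noteq> {z} \<longrightarrow> ccw_succ p z \<noteq> z) \<and>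
    (\<forall>y\<in>p. y \<noteq> z \<longrightarrow> y \<noteq> ccw_succ p z \<longrightarrow> ccw z (ccw_succ p z) y)"
  proof (cases "p = {z}")
    case False
    then obtain w where w: "w \<in> p" "w \<noteq> z" "\<forall>y\<in>p - {z, w}. ccw z w y"
      using ccw_succ_ex[OF assms] by blast
    then have "ccw_succ p z = w" by (intro ccw_succI assms) auto
    then show ?thesis using w by auto
  qed auto
  then show "ccw_succ p z \<in> p" "p \<noteq> {z} \<Longrightarrow> ccw_succ p z \<noteq> z"
    "y \<in> p \<Longrightarrow> y \<noteq> z \<Longrightarrow> y \<noteq> ccw_succ p z \<Longrightarrow> ccw z (ccw_succ p z) y" by auto
qed

lemma ccw_succ_inj:
  assumes "p \<subseteq> S" "y \<in> p" "z \<in> p" "ccw_succ p y = ccw_succ p z"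
  shows "y = z"
proof (rule ccontr)
  assume ne: "y \<noteq> z"
  let ?w = "ccw_succ p z"
  have "p \<noteq> {z}" "p \<noteq> {y}" using ne assms by auto
  then have "?w \<noteq> z" "?w \<noteq> y" using ccw_succ(2)[of p y] ccw_succ(2)[of p z] assms by auto
  then have "ccw z ?w y" "ccw y ?w z"
    using ccw_succ(3)[OF assms(1,3,2)] ccw_succ(3)[OF assms(1,2,3)] assms(4) ne by auto
  then show False using orient_swap[of y ?w z] orient_rotate[of z ?w y] orient_rotate[of ?w y z] by simp
qed

text \<open>Take for \<open>a\<close> the last vertex of \<open>p\<close> before \<open>b\<close>:
  its successor in \<open>p\<close> comes after \<open>b\<close>. The function in the proof unrolls
  the indices so that they end just before \<open>b\<close>.\<close>

lemma gap:
  assumes "p \<subseteq> S" "a0 \<in> p" "p \<noteq> {a0}" "b \<in> S" "b \<notin> p"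
  obtains a where "a \<in> p" "ccw a b (ccw_succ p a)"
proof -
  define f where "f a = (if idx a < idx b then idx a + int N else idx a)" for a
  have "finite p" "p \<noteq> {}" using assms finite_subset[OF assms(1)] by auto
  from arg_min_if_finite[OF this, of "\<lambda>a. - f a"] obtain a where
    a: "a \<in> p" "\<And>y. y \<in> p \<Longrightarrow> \<not> - f y < - f a" by blast
  let ?c = "ccw_succ p a"
  have "p \<noteq> {a}" using assms by blast
  note s = ccw_succ[OF assms(1) a(1)]
  have "f ?c \<le> f a" using a(2)[OF s(1)] by simp
  moreover have m: "a \<in> S" "?c \<in> S" "b \<in> S" "a \<noteq> b" "?c \<noteq> b" "?c \<noteq> a" using assms a s \<open>p \<noteq> {a}\<close> by auto
  ultimately have "ccw a b ?c"
    using idx_range[OF m(1)] idx_range[OF m(2)] idx_range[OF m(3)]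
    unfolding f_def by (simp only: to_idx) (smt (verit))
  then show thesis using that a by blast
qed

text \<open>A missing vertex \<open>b\<close> would lie in a gap of \<open>q\<close>, after some
  \<open>a\<close> and before the successor of \<open>a\<close> in \<open>q\<close>. But the
  successor of \<open>a\<close> in \<open>p\<close> belongs to \<open>q\<close> and comes before
  \<open>b\<close>. Thus the successor map permutes a part transitively.\<close>

lemma ccw_succ_closed:
  assumes "p \<subseteq> S" "q \<subseteq> p" "q \<noteq> {}" "\<And>z. z \<in> q \<Longrightarrow> ccw_succ p z \<in> q"
  shows "q = p"
proof (rule ccontr)
  assume "q \<noteq> p"
  then obtain b where b: "b \<in> p" "b \<notin> q" using assms by blast
  obtain a0 where a0: "a0 \<in> q" using assms by blast
  show False
  proof (cases "q = {a0}")
    case True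
    then have "ccw_succ p a0 = a0" using assms(4) a0 by auto
    then have "p = {a0}" using ccw_succ(2)[OF assms(1), of a0] a0 assms by auto
    then show False using b a0 by auto
  next
    case False
    obtain a where a: "a \<in> q" "ccw a b (ccw_succ q a)"
      using gap[of q a0 b] False assms a0 b by blast
    have ap: "a \<in> p" "a \<noteq> b" "p \<noteq> {a}" using a b assms by auto
    have qS: "q \<subseteq> S" "q \<noteq> {a}" using assms a a0 False by auto
    let ?s = "ccw_succ p a" and ?t = "ccw_succ q a"
    have s: "?s \<in> q" "?s \<noteq> a" using assms(4)[OF a(1)] ccw_succ(2)[OF assms(1) ap(1) ap(3)] by auto
    have t: "?t \<in> q" "?t \<noteq> a" using ccw_succ[OF qS(1) a(1)] qS by auto
    have 1: "ccw a ?s b" using ccw_succ(3)[OF assms(1) ap(1) b(1)] ap s b by auto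
    have 2: "?s = ?t \<or> ccw a ?t ?s" using ccw_succ(3)[OF qS(1) a(1) s(1) s(2)] by auto
    have "a \<in> S" "b \<in> S" "?s \<in> S" "?t \<in> S" using ap b s t assms qS by auto
    with a(2) 1 2 show False by (simp only: to_idx) (smt (verit))
  qed
qed

text \<open>The diagonals of a convex quadrilateral meet. The weights of the common point are the
  areas of the triangles cut off by the diagonals, by the linear relation between four points of the
  plane.\<close>

lemma crossing_hulls:
  assumes "a \<in> S" "b \<in> S" "c \<in> S" "d \<in> S" "ccw a b c" "ccw c d a"
  shows "convex hull {a, c} \<inter> convex hull {b, d} \<noteq> {}"
proof -
  have o: "ccw b c d" "ccw a b d" "ccw a c d"
    using assms by (simp_all only: to_idx) (smt (verit))+
  define T where "T = orient b c d + orient a b d"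
  have T: "T = orient a c d + orient a b c" by (simp add: T_def orient_def algebra_simps)
  have Tpos: "T > 0" using o by (simp add: T_def)
  have eq: "of_real (orient b c d) * a + of_real (orient a b d) * c =
      of_real (orient a c d) * b + of_real (orient a b c) * d"
    by (simp add: orient_def complex_eq_iff algebra_simps)
  let ?x = "(of_real (orient b c d) * a + of_real (orient a b d) * c) / of_real T"
  have "?x \<in> convex hull {a, c}"
    unfolding convex_hull_2 using o Tpos
    by (intro CollectI exI[of _ "orient b c d / T"] exI[of _ "orient a b d / T"])
      (auto simp: scaleR_conv_of_real T_def add_divide_distrib[symmetric])
  moreover have "?x \<in> convex hull {b, d}"
    unfolding convex_hull_2 eq using o Tpos assms(5)
    by (intro CollectI exI[of _ "orient a c d / T"] exI[of _ "orient a b c / T"])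
      (auto simp: scaleR_conv_of_real T add_divide_distrib[symmetric])
  ultimately show ?thesis by blast
qed

lemma noncrossing_gap:
  assumes "p \<subseteq> S" "q \<subseteq> S" "p \<inter> q = {}" "noncrossing p q" "a0 \<in> p" "p \<noteq> {a0}" "b0 \<in> q"
  obtains a where "a \<in> p" "\<And>b. b \<in> q \<Longrightarrow> ccw a b (ccw_succ p a)"
proof -
  obtain a where a: "a \<in> p" "ccw a b0 (ccw_succ p a)"
    using gap[OF assms(1,5,6), of b0] assms by blast
  have "ccw a b (ccw_succ p a)" if b: "b \<in> q" for b
  proof -
    let ?c = "ccw_succ p a"
    have m: "a \<in> S" "b \<in> S" "?c \<in> S" "b \<noteq> a" "b \<noteq> ?c" "?c \<in> p" "a \<noteq> ?c"
      using a b assms ccw_succ(1)[OF assms(1) a(1)] by auto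
    have "\<not> ccw ?c b a" using assms(4) a m assms(7) b unfolding noncrossing_def by blast
    with m show ?thesis by (simp only: to_idx) (smt (verit))
  qed
  then show thesis using that a by blast
qed

lemma noncrossing_sym:
  assumes "p \<subseteq> S" "q \<subseteq> S" "noncrossing p q"
  shows "noncrossing q p"
  unfolding noncrossing_def
proof (intro ballI notI)
  fix a c b d assume h: "a \<in> q" "c \<in> q" "b \<in> p" "d \<in> p" "ccw a b c \<and> ccw c d a"
  then have m: "a \<in> S" "b \<in> S" "c \<in> S" "d \<in> S" using assms by auto
  with h(5) have "ccw b c d \<and> ccw d a b" by (simp only: to_idx) (smt (verit))
  then show False using assms(3) h unfolding noncrossing_def by blast
qed

text \<open>All of \<open>q\<close> lies in one gap of \<open>p\<close>, and the edge of
  \<open>p\<close> that closes this gap is the separating line. If \<open>p\<close> is a single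
  point, the roles are exchanged.\<close>

lemma noncrossing_separated:
  assumes "p \<subseteq> S" "q \<subseteq> S" "p \<inter> q = {}" "noncrossing p q"
  shows "\<exists>c. \<forall>x\<in>p. \<forall>y\<in>q. Im (c * (x - y)) > 0"
proof -
  have *: "\<exists>c. \<forall>x\<in>p. \<forall>y\<in>q. Im (c * (x - y)) > 0"
    if h: "p \<subseteq> S" "q \<subseteq> S" "p \<inter> q = {}" "noncrossing p q" "a0 \<in> p" "p \<noteq> {a0}" "b0 \<in> q" for p q a0 b0
  proof -
    obtain a where a: "a \<in> p" "\<And>b. b \<in> q \<Longrightarrow> ccw a b (ccw_succ p a)"
      by (rule noncrossing_gap[OF h]) blast
    let ?c = "ccw_succ p a"
    have "orient a ?c x \<ge> 0" if "x \<in> p" for x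
      using ccw_succ(3)[OF \<open>p \<subseteq> S\<close> a(1) that] by (cases "x = a \<or> x = ?c") auto
    moreover have "orient a ?c y < 0" if "y \<in> q" for y
      using a(2)[OF that] orient_swap[of a ?c y] by simp
    ultimately show ?thesis
      by (intro exI[of _ "cnj (?c - a)"]) (use orient_diff in fastforce)
  qed
  consider "p = {} \<or> q = {}" | a0 b0 where "a0 \<in> p" "p \<noteq> {a0}" "b0 \<in> q"
    | a0 b0 where "a0 \<in> q" "q \<noteq> {a0}" "b0 \<in> p" | a b where "p = {a}" "q = {b}" by blast
  then show ?thesis
  proof cases
    case 1 then show ?thesis by auto
  next
    case 2 show ?thesis by (rule *[OF assms 2])
  next
    case 3
    obtain c where "\<forall>x\<in>q. \<forall>y\<in>p. Im (c * (x - y)) > 0"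
      using *[OF assms(2,1) _ noncrossing_sym[OF assms(1,2,4)] 3] assms(3) by blast
    then show ?thesis by (intro exI[of _ "-c"]) (fastforce simp: algebra_simps)
  next
    case 4
    \<comment> \<open>For two points the witness makes the product equal to \<i> times their squared
      distance.\<close>
    then have "Im (\<i> * cnj (a - b) * (a - b)) > 0"
      using assms(3) by (auto simp: complex_eq_iff sum_power2_gt_zero_iff simp flip: power2_eq_square)
    then show ?thesis using 4 by (intro exI[of _ "\<i> * cnj (a - b)"]) simp
  qed
qed

lemma NCP_iff:
  "u \<in> NCP S \<longleftrightarrow> partition_on S u \<and> (\<forall>p\<in>u. \<forall>q\<in>u. p \<noteq> q \<longrightarrow> noncrossing p q)"
proof (intro iffI conjI ballI impI)
  assume u: "u \<in> NCP S"
  then show part: "partition_on S u" by (simp add: NCP_def)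
  fix p q assume pq: "p \<in> u" "q \<in> u" "p \<noteq> q"
  then have pqS: "p \<subseteq> S" "q \<subseteq> S" using part by (auto simp: partition_on_def)
  show "noncrossing p q" unfolding noncrossing_def
  proof (intro ballI notI)
    fix a c b d assume abcd: "a \<in> p" "c \<in> p" "b \<in> q" "d \<in> q" "ccw a b c \<and> ccw c d a"
    then have "convex hull {a, c} \<inter> convex hull {b, d} \<noteq> {}"
      using pqS by (intro crossing_hulls) auto
    moreover have "convex hull {a, c} \<subseteq> convex hull p" "convex hull {b, d} \<subseteq> convex hull q"
      using abcd by (auto intro!: hull_mono)
    ultimately have "convex hull p \<inter> convex hull q \<noteq> {}" by blast
    then show False using u pq by (auto simp: NCP_def)
  qed
next
  assume *: "partition_on S u \<and> (\<forall>p\<in>u. \<forall>q\<in>u. p \<noteq> q \<longrightarrow> noncrossing p q)"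
  have "p = q" if "p \<in> u" "q \<in> u" "convex hull p \<inter> convex hull q \<noteq> {}" for p q
  proof (rule ccontr)
    assume "p \<noteq> q"
    then have "p \<inter> q = {}" "p \<subseteq> S" "q \<subseteq> S" "noncrossing p q"
      using * that by (auto simp: partition_on_def disjoint_def)
    from noncrossing_separated[OF this(2,3,1,4)] obtain c where "\<forall>x\<in>p. \<forall>y\<in>q. Im (c * (x - y)) > 0"
      by blast
    then show False using separated_hulls[of p q c] that by simp
  qed
  then show "u \<in> NCP S" using * by (simp add: NCP_def)
qed

end

section \<open>Complements in a convex polygon\<close>

context convex_polygon
begin

lemma NCP_D:
  assumes "u \<in> NCP S"
  shows "partition_on S u" "p \<in> u \<Longrightarrow> q \<in> u \<Longrightarrow> p \<noteq> q \<Longrightarrow> noncrossing p q"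
  using assms by (auto simp: NCP_iff)

lemma NCP_crossing:
  assumes "u \<in> NCP S" "a \<in> S" "b \<in> S" "c \<in> part u a" "d \<in> part u b" "b \<notin> part u a"
    "ccw a b c" "ccw c d a"
  shows False
proof -
  note P = NCP_D(1)[OF assms(1)]
  have "part u a \<noteq> part u b" using part_self[OF P assms(3)] assms(6) by auto
  then have "noncrossing (part u a) (part u b)"
    using NCP_D(2)[OF assms(1)] part_in[OF P] assms by blast
  then show False using assms part_self[OF P] unfolding noncrossing_def by blast
qed

context
  fixes u assumes u: "u \<in> NCP S"
begin

lemmas P = NCP_D(1)[OF u]

lemma sigma_part: "z \<in> S \<Longrightarrow> sigma u z \<in> part u z"
  unfolding sigma_def using ccw_succ(1) part_subset[OF P] part_self[OF P] by blast

lemma sigma_S: "z \<in> S \<Longrightarrow> sigma u z \<in> S"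
  using sigma_part part_subset[OF P] by blast

lemma part_sigma: "z \<in> S \<Longrightarrow> part u (sigma u z) = part u z"
  by (rule part_cong[OF P _ sigma_part])

lemma sigma_fixed: "z \<in> S \<Longrightarrow> sigma u z = z \<longleftrightarrow> part u z = {z}"
  unfolding sigma_def using ccw_succ(2)[of "part u z" z] part_subset[OF P] part_self[OF P]
  by (metis ccw_succ_single)

lemma sigma_next:
  assumes "z \<in> S" "y \<in> part u z" "y \<noteq> z"
  shows "y = sigma u z \<or> ccw z (sigma u z) y"
  unfolding sigma_def using ccw_succ(3)[of "part u z" z y] part_subset[OF P] part_self[OF P] assms by blast

lemma sigma_moves: "z \<in> S \<Longrightarrow> y \<in> part u z \<Longrightarrow> y \<noteq> z \<Longrightarrow> sigma u z \<noteq> z"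
  by (metis sigma_fixed singletonD)

lemma sigma_inj: "y \<in> S \<Longrightarrow> z \<in> S \<Longrightarrow> sigma u y = sigma u z \<Longrightarrow> y = z"
proof -
  assume h: "y \<in> S" "z \<in> S" "sigma u y = sigma u z"
  then have eq: "part u y = part u z" using part_sigma by metis
  show "y = z"
    using ccw_succ_inj[of "part u z" y z] part_subset[OF P h(2)] part_self[OF P] h eq
    unfolding sigma_def by metis
qed

lemma sigma_bij: "bij_betw (sigma u) S S"
proof -
  have i: "inj_on (sigma u) S" using sigma_inj by (auto simp: inj_on_def)
  moreover have "sigma u ` S \<subseteq> S" using sigma_S by auto
  ultimately show ?thesis using endo_inj_surj[OF finite_S _ i] by (simp add: bij_betw_def)
qed

text \<open>A part that has a vertex in the gap after \<open>i\<close> cannot leave the gap without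
  meeting the part of \<open>i\<close> or crossing the chord that closes the gap.\<close>

lemma sigma_gap:
  assumes "i \<in> S" "j \<in> S" "ccw i j (sigma u i)" "k \<in> part u j"
  shows "ccw i k (sigma u i)"
proof -
  have m: "k \<in> S" "sigma u i \<in> S" using assms part_subset[OF P] sigma_S by auto
  have "j \<notin> part u i"
  proof
    assume "j \<in> part u i"
    moreover have "j \<noteq> i" "j \<noteq> sigma u i" using assms(3) by auto
    ultimately have "ccw i (sigma u i) j" using sigma_next assms by blast
    then show False using assms(3) orient_swap[of i j "sigma u i"] by simp
  qed
  moreover have "k \<notin> part u i" using calculation part_cong[OF P] assms part_self[OF P] by metis
  ultimately have "k \<noteq> i" "k \<noteq> sigma u i" "\<not> ccw (sigma u i) k i"
    using NCP_crossing[OF u assms(1,2) sigma_part[OF assms(1)] assms(4) _ assms(3)] part_self[OF P]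
      sigma_part assms by auto
  then show ?thesis using assms m by (simp only: to_idx) (smt (verit))
qed

lemma sigma_closed_part:
  assumes "C \<subseteq> S" "\<And>z. z \<in> C \<Longrightarrow> sigma u z \<in> C" "z \<in> C"
  shows "part u z \<subseteq> C"
proof -
  have z: "z \<in> S" using assms by auto
  have "part u z \<inter> C = part u z"
  proof (rule ccw_succ_closed[OF part_subset[OF P z]])
    show "part u z \<inter> C \<noteq> {}" using assms part_self[OF P z] by auto
    fix y assume y: "y \<in> part u z \<inter> C"
    then have "part u y = part u z" "y \<in> S" using part_cong[OF P z] part_subset[OF P z] by auto
    then show "ccw_succ (part u z) y \<in> part u z \<inter> C"
      using sigma_part[of y] assms(2)[of y] y unfolding sigma_def by auto
  qed auto
  then show ?thesis by blast
qed

end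

lemma sigma_unique:
  assumes u: "u \<in> NCP S" and v: "v \<in> NCP S" and eq: "\<And>z. z \<in> S \<Longrightarrow> sigma u z = sigma v z"
  shows "u = v"
proof -
  have sub: "part u z \<subseteq> part v z"
    if "u \<in> NCP S" "v \<in> NCP S" "\<And>z. z \<in> S \<Longrightarrow> sigma u z = sigma v z" "z \<in> S" for u v z
  proof (rule sigma_closed_part[OF that(1)])
    note V = NCP_D(1)[OF that(2)]
    show "part v z \<subseteq> S" "z \<in> part v z" using part_subset[OF V] part_self[OF V] that by auto
    fix y assume y: "y \<in> part v z"
    then have "y \<in> S" using part_subset[OF V] that by auto
    then show "sigma u y \<in> part v z"
      using that(3)[of y] sigma_part[OF that(2), of y] part_cong[OF V that(4) y] by simp
  qed
  have eqp: "part u z = part v z" if "z \<in> S" for z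
    using sub[OF u v eq that] sub[OF v u eq[symmetric] that] by auto
  have "p \<in> v" if "p \<in> u" "u \<in> NCP S" "v \<in> NCP S" "\<And>z. z \<in> S \<Longrightarrow> part u z = part v z" for p u v
  proof -
    note U = NCP_D(1)[OF that(2)] and V = NCP_D(1)[OF that(3)]
    have "p \<noteq> {}" using partition_onD3[OF U] that(1) by blast
    then obtain z where "z \<in> p" by blast
    moreover then have "z \<in> S" using U that(1) by (auto simp: partition_on_def)
    ultimately show ?thesis using part_eq[OF U that(1)] that(4) part_in[OF V] by metis
  qed
  from this[OF _ u v eqp] this[OF _ v u eqp[symmetric]] show ?thesis by blast
qed

section \<open>Non-crossing partitions from permutations, and the existence of complements\<close>

lemma NCP_of_permutation:
  assumes \<pi>: "\<And>a. a \<in> S \<Longrightarrow> \<pi> a \<in> S" "inj_on \<pi> S"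
    and K: "\<And>a b. a \<in> S \<Longrightarrow> b \<in> S \<Longrightarrow> ccw a b (\<pi> a) \<Longrightarrow> ccw a (\<pi> b) (\<pi> a)"
  shows "\<exists>w\<in>NCP S. \<forall>z\<in>S. sigma w z = \<pi> z"
proof -
  define f where "f a = (if a \<in> S then \<pi> a else a)" for a
  have "\<pi> ` S = S" using endo_inj_surj[OF finite_S _ \<pi>(2)] \<pi>(1) by auto
  then have "bij_betw f S S"
    using \<pi>(2) by (auto simp: bij_betw_def f_def inj_on_def image_def)
  then have fp: "f permutes S" by (rule bij_imp_permutes) (simp add: f_def)
  then have perm: "permutation f" using finite_S permutation_permutes by blast
  have self: "a \<in> orbit f a" for a by (rule permutation_self_in_orbit[OF perm])
  have orbS: "orbit f a \<subseteq> S" if "a \<in> S" for a by (rule permutes_orbit_subset[OF fp that])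
  have eqo: "orbit f b = orbit f a" if "b \<in> orbit f a" for a b
    using cyclic_on_orbit[OF fp finite_S, of a] that
    by (metis orbit_cyclic_eq3)
  define w where "w = orbit f ` S"
  have part: "partition_on S w" unfolding partition_on_def
  proof (intro conjI)
    show "\<Union> w = S" using orbS self by (auto simp: w_def)
    show "disjoint w" unfolding disjoint_def w_def using eqo by blast
    show "{} \<notin> w" using self by (auto simp: w_def)
  qed
  have pw: "part w a = orbit f a" if "a \<in> S" for a
    by (rule part_eq[OF part _ self]) (use that in \<open>auto simp: w_def\<close>)
  have arc: "c \<in> S \<and> ccw a c (\<pi> a)" if "a \<in> S" "b \<in> S" "ccw a b (\<pi> a)" "c \<in> orbit f b" for a b c
    using that(4)
  proof (induction rule: orbit.induct)
    case base
    then show ?case using that K[of a b] \<pi> by (simp add: f_def)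
  next
    case (step c)
    then show ?case using that K[of a c] \<pi> by (simp add: f_def)
  qed
  \<comment> \<open>A gap is invariant under \<pi> by \<open>K\<close>. If it contained a point of
    the orbit of \<open>a\<close>, it would contain \<open>a\<close> itself, which is an end of it.
    So \<pi> is the successor map of its own orbits.\<close>
  have notarc: "\<not> ccw a c (\<pi> a)" if "a \<in> S" "c \<in> orbit f a" for a c
  proof
    assume "ccw a c (\<pi> a)"
    moreover have "a \<in> orbit f c" using eqo[OF that(2)] self by simp
    ultimately have "ccw a a (\<pi> a)" using arc[of a c a] that orbS by blast
    then show False by simp
  qed
  have fin: "f a \<in> orbit f a" for a by (rule orbit.base)
  have succ: "ccw_succ (orbit f a) a = \<pi> a" if a: "a \<in> S" for a
  proof (cases "\<pi> a = a")
    case True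
    then have "orbit f a = {a}" using a by (simp add: orbit_eq_singleton_iff f_def)
    then show ?thesis using True by simp
  next
    case False
    show ?thesis
    proof (rule ccw_succI[OF orbS[OF a] self])
      show "\<pi> a \<in> orbit f a" using fin[of a] a by (simp add: f_def)
      show "\<pi> a \<noteq> a" by (rule False)
      fix y assume y: "y \<in> orbit f a" "y \<noteq> a" "y \<noteq> \<pi> a"
      then have "y \<in> S" "\<pi> a \<in> S" using orbS a \<pi> by auto
      with notarc[OF a y(1)] y a False show "ccw a (\<pi> a) y" by (simp only: to_idx) (smt (verit))
    qed
  qed
  have "noncrossing p q" if pq: "p \<in> w" "q \<in> w" "p \<noteq> q" for p q
    unfolding noncrossing_def
  proof (intro ballI notI)
    fix a c b d assume h: "a \<in> p" "c \<in> p" "b \<in> q" "d \<in> q" "ccw a b c \<and> ccw c d a"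
    have pS: "p \<subseteq> S" "q \<subseteq> S" using pq orbS by (auto simp: w_def)
    then have abcd: "a \<in> S" "b \<in> S" "c \<in> S" "d \<in> S" using h by auto
    have porb: "p = orbit f x" if "x \<in> p" for x using pq(1) eqo that by (auto simp: w_def)
    have qorb: "q = orbit f b" using pq(2) eqo h by (auto simp: w_def)
    have "p \<inter> q = {}" using part pq by (auto simp: partition_on_def disjoint_def)
    then have "b \<notin> p" using h by auto
    moreover have "p \<noteq> {a}" using h by auto
    ultimately obtain x where x: "x \<in> p" "ccw x b (ccw_succ p x)"
      using gap[OF pS(1) h(1)] abcd by blast
    then have xS: "x \<in> S" using pS by auto
    have xb: "ccw x b (\<pi> x)" using x succ[OF xS] porb[OF x(1)] by simp
    have "d \<in> orbit f b" using h qorb by simp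
    then have "ccw x d (\<pi> x)" using arc[OF xS abcd(2) xb] by blast
    moreover have "\<not> ccw x a (\<pi> x)" "\<not> ccw x c (\<pi> x)" using notarc[OF xS] porb[OF x(1)] h by auto
    ultimately show False using xb h(5) xS abcd \<pi>(1)[OF xS] by (simp only: to_idx) (smt (verit))
  qed
  then have "w \<in> NCP S" unfolding NCP_iff using part by blast
  moreover have "sigma w z = \<pi> z" if "z \<in> S" for z
    using succ[OF that] pw[OF that] by (simp add: sigma_def)
  ultimately show ?thesis by blast
qed

context
  fixes u v assumes u: "u \<in> NCP S" and v: "v \<in> NCP S" and uv: "refines S u v"
begin

lemma next_between:
  assumes "i \<in> S" "sigma u i \<noteq> i"
  shows "sigma v i \<noteq> i" "sigma u i = sigma v i \<or> ccw i (sigma v i) (sigma u i)"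
proof -
  have "sigma u i \<in> part v i" using sigma_part[OF u assms(1)] refines_part[OF uv assms(1)] by auto
  then show "sigma v i \<noteq> i" "sigma u i = sigma v i \<or> ccw i (sigma v i) (sigma u i)"
    using sigma_next[OF v assms(1)] sigma_moves[OF v assms(1)] assms by auto
qed

text \<open>This is assumption \<open>K\<close> of \<open>NCP_of_permutation\<close> for the
  quotient of the two successor maps, which sends \<open>sigma u i\<close> to
  \<open>sigma v i\<close>. As \<open>sigma v i\<close> comes no later after \<open>i\<close> than
  \<open>sigma u i\<close>, the arc from \<open>sigma u i\<close> to \<open>sigma v i\<close> passes
  through \<open>i\<close>; the cases locate \<open>sigma u j\<close> before, at or after
  \<open>i\<close> on it.\<close>

lemma complement_arc:
  assumes i: "i \<in> S" and j: "j \<in> S" and h: "ccw (sigma u i) (sigma u j) (sigma v i)"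
  shows "ccw (sigma u i) (sigma v j) (sigma v i)"
proof -
  note U = NCP_D(1)[OF u] and V = NCP_D(1)[OF v]
  let ?ui = "sigma u i" and ?uj = "sigma u j" and ?vi = "sigma v i" and ?vj = "sigma v j"
  have m: "?ui \<in> S" "?uj \<in> S" "?vi \<in> S" "?vj \<in> S" using sigma_S[OF u] sigma_S[OF v] i j by auto
  have vj: "?vj \<in> part v ?uj"
  proof -
    have "?uj \<in> part v j" using sigma_part[OF u j] refines_part[OF uv j] by auto
    then show ?thesis using sigma_part[OF v j] part_cong[OF V j] by auto
  qed
  have gapi: "ccw i ?vj ?vi" if "ccw i ?uj ?vi" by (rule sigma_gap[OF v i m(2) that vj])
  show ?thesis
  proof (cases "?ui = i")
    case True then show ?thesis using h gapi by simp
  next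
    case False
    have "?ui \<noteq> ?vi" using h by auto
    then have ivu: "ccw i ?vi ?ui" using next_between(2)[OF i False] by auto
    consider "ccw i ?uj ?vi" | "?uj = i" | "ccw ?ui ?uj i" "?uj \<noteq> i"
      using h ivu m i j False by (simp only: to_idx) (smt (verit))
    then show ?thesis
    proof cases
      case 1
      from gapi[OF this] ivu m i show ?thesis by (simp only: to_idx) (smt (verit))
    next
      case 2
      then have "j \<noteq> i" using False by auto
      then have ne: "?uj \<noteq> j" using 2 by auto
      have "j \<in> part u i" using 2 part_sigma[OF u j] part_self[OF U j] by auto
      then have "j = ?ui \<or> ccw i ?ui j" using sigma_next[OF u i] \<open>j \<noteq> i\<close> by auto
      moreover have "i = ?vj \<or> ccw j ?vj i" using next_between(2)[OF j ne] 2 by auto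
      ultimately show ?thesis using ivu m i j \<open>j \<noteq> i\<close> by (simp only: to_idx) (smt (verit))
    next
      case 3
      show ?thesis
      proof (cases "j \<in> part u i")
        case True
        have "j \<noteq> i" using 3 by auto
        then have jn: "j = ?ui \<or> ccw i ?ui j" using sigma_next[OF u i] True by auto
        have ipj: "i \<in> part u j" using part_cong[OF U i True] part_self[OF U i] by simp
        then have ne: "?uj \<noteq> j" using sigma_moves[OF u j] \<open>j \<noteq> i\<close> by auto
        have "ccw j ?uj i" using sigma_next[OF u j ipj] \<open>j \<noteq> i\<close> 3 by auto
        moreover have "?uj = ?vj \<or> ccw j ?vj ?uj" using next_between(2)[OF j ne] by auto
        ultimately show ?thesis using jn ivu m i j 3 by (simp only: to_idx) (smt (verit))
      next
        case False
        have "j \<noteq> i" "j \<noteq> ?ui" using False sigma_part[OF u i] part_self[OF U i] by auto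
        moreover have "\<not> ccw i j ?ui"
          using NCP_crossing[OF u i j sigma_part[OF u i] sigma_part[OF u j] False] 3 by auto
        ultimately have jarc: "ccw ?ui j i" using i j m \<open>?ui \<noteq> i\<close> by (simp only: to_idx) (smt (verit))
        show ?thesis
        proof (cases "j \<in> part v i")
          case True
          have "i \<in> part v j" using part_cong[OF V i True] part_self[OF V i] by simp
          then have "i = ?vj \<or> ccw j ?vj i" using sigma_next[OF v j] \<open>j \<noteq> i\<close> by auto
          then show ?thesis using jarc ivu m i j by (simp only: to_idx) (smt (verit))
        next
          case False
          have "?vj \<notin> part v i" using False part_sigma[OF v j] part_cong[OF V i, of ?vj] part_self[OF V j] by auto
          moreover have pui: "?ui \<in> part v i" using sigma_part[OF u i] refines_part[OF uv i] by auto
          ultimately have "?vj \<noteq> i" "?vj \<noteq> ?ui" using part_self[OF V i] by auto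
          moreover have "\<not> ccw i ?vj ?ui"
          proof
            assume "ccw i ?vj ?ui"
            moreover have "j \<in> part v ?vj" using part_sigma[OF v j] part_self[OF V j] by simp
            ultimately show False
              using NCP_crossing[OF v i m(4) pui _ \<open>?vj \<notin> part v i\<close> _ jarc] by auto
          qed
          ultimately show ?thesis using jarc ivu m i j \<open>?ui \<noteq> i\<close> by (simp only: to_idx) (smt (verit))
        qed
      qed
    qed
  qed
qed

lemma complement_ex1:
  "\<exists>!w. w \<in> NCP S \<and> (\<forall>z\<in>S. sigma w (sigma u z) = sigma v z)"
proof -
  define \<pi> where "\<pi> y = sigma v (inv_into S (sigma u) y)" for y
  have im: "sigma u ` S = S" "inj_on (sigma u) S" using sigma_bij[OF u] by (auto simp: bij_betw_def)
  have \<pi>: "\<pi> (sigma u z) = sigma v z" if "z \<in> S" for z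
    using that im by (simp add: \<pi>_def)
  have "\<exists>w\<in>NCP S. \<forall>z\<in>S. sigma w z = \<pi> z"
  proof (rule NCP_of_permutation)
    show "\<pi> a \<in> S" if "a \<in> S" for a
      using that im(1) \<pi> sigma_S[OF v] by (metis imageE)
    show "inj_on \<pi> S"
    proof (rule inj_onI)
      fix a b assume ab: "a \<in> S" "b \<in> S" "\<pi> a = \<pi> b"
      then obtain i j where "i \<in> S" "j \<in> S" "a = sigma u i" "b = sigma u j" using im(1) by (metis imageE)
      then show "a = b" using ab \<pi> sigma_inj[OF v] by metis
    qed
    fix a b assume ab: "a \<in> S" "b \<in> S" "ccw a b (\<pi> a)"
    then obtain i j where "i \<in> S" "j \<in> S" "a = sigma u i" "b = sigma u j" using im(1) by (metis imageE)
    then show "ccw a (\<pi> b) (\<pi> a)" using ab \<pi> complement_arc by metis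
  qed
  then obtain w where w: "w \<in> NCP S" "\<forall>z\<in>S. sigma w z = \<pi> z" by blast
  show ?thesis
  proof (rule ex1I[of _ w])
    show "w \<in> NCP S \<and> (\<forall>z\<in>S. sigma w (sigma u z) = sigma v z)"
      using w \<pi> sigma_S[OF u] by simp
    fix w' assume w': "w' \<in> NCP S \<and> (\<forall>z\<in>S. sigma w' (sigma u z) = sigma v z)"
    have "sigma w' z = sigma w z" if "z \<in> S" for z
      using that w' w \<pi> im(1) by (metis imageE)
    then show "w' = w" using sigma_unique w' w(1) by blast
  qed
qed

end

end

section \<open>Separation of strands in a convex polygon\<close>

lemma orient_diff_minus: "Im (- cnj (b - a) * (p - q)) = orient a b q - orient a b p"
  by (simp add: orient_def algebra_simps)

context convex_polygon
begin

lemma parts_separated: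
  assumes "u \<in> NCP S" "i \<in> S" "j \<in> S" "part u i \<noteq> part u j"
  obtains c where "\<And>x y. x \<in> part u i \<Longrightarrow> y \<in> part u j \<Longrightarrow> Im (c * (x - y)) > 0"
proof -
  note P = NCP_D(1)[OF assms(1)]
  have "part u i \<inter> part u j = {}"
    using part_in[OF P] assms P by (auto simp: partition_on_def disjoint_def)
  then have "\<exists>c. \<forall>x\<in>part u i. \<forall>y\<in>part u j. Im (c * (x - y)) > 0"
    using assms NCP_D(2)[OF assms(1)] part_in[OF P] part_subset[OF P]
    by (intro noncrossing_separated) blast+
  then show thesis using that by blast
qed

lemma two_cycle_part:
  assumes "u \<in> NCP S" "i \<in> S" "j \<in> S" "i \<noteq> j" "sigma u i = j" "sigma u j = i"
  shows "part u i = {i, j}"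
proof
  show "part u i \<subseteq> {i, j}" by (rule sigma_closed_part[OF assms(1)]) (use assms in auto)
  show "{i, j} \<subseteq> part u i"
    using sigma_part[OF assms(1,2)] part_self[OF NCP_D(1)[OF assms(1)] assms(2)] assms by auto
qed

text \<open>Within one part, the edge from \<open>i\<close> to its successor has the whole part on
  its left, so its line separates the two strands weakly. It fails to do so strictly only if
  \<open>i\<close> and \<open>j\<close> form a part of two elements, and then the curvatures point
  to different sides. Other parts are separated strictly.\<close>

lemma sigma_edge_sep:
  assumes u: "u \<in> NCP S" and i: "i \<in> S" and j: "j \<in> S" and ij: "i \<noteq> j"
    and k: "ki \<ge> 0" "kj \<ge> 0" "card (part u i) = 2 \<Longrightarrow> ki > 0"
  shows "edge_sep (i - j) (sigma u i - sigma u j) (bulge ki i (sigma u i) - bulge kj j (sigma u j))"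
proof -
  note P = NCP_D(1)[OF u]
  let ?ui = "sigma u i" and ?uj = "sigma u j"
  have ne: "?ui \<noteq> ?uj" using sigma_inj[OF u i j] ij by auto
  show ?thesis
  proof (cases "part u i = part u j")
    case False
    obtain c where "\<And>x y. x \<in> part u i \<Longrightarrow> y \<in> part u j \<Longrightarrow> Im (c * (x - y)) > 0"
      using parts_separated[OF u i j False] by blast
    then have "Im (c * (i - j)) > 0" "Im (c * (?ui - ?uj)) > 0"
      using part_self[OF P] sigma_part[OF u] i j by auto
    then show ?thesis using ij ne unfolding edge_sep_def by (auto intro!: exI[of _ c])
  next
    case True
    let ?g = "orient i ?ui"
    have m: "?ui \<in> S" "?uj \<in> S" using sigma_S[OF u] i j by auto
    have ji: "j \<in> part u i" "?uj \<in> part u i" using part_self[OF P j] sigma_part[OF u j] True by auto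
    have uii: "?ui \<noteq> i" using sigma_moves[OF u i ji(1)] ij by auto
    have nonneg: "?g y \<ge> 0" "?g y = 0 \<longleftrightarrow> y = i \<or> y = ?ui" if "y \<in> part u i" for y
      using sigma_next[OF u i that] that orient_nonneg_iff(1)[OF i m(1), of y] uii part_subset[OF P i]
      by (cases "y = i"; force)+
    note c = orient_diff_minus[of ?ui i i j] orient_diff_minus[of ?ui i ?ui ?uj]
    show ?thesis unfolding edge_sep_def
    proof (intro conjI exI[of _ "- cnj (?ui - i)"])
      show "0 \<le> Im (- cnj (?ui - i) * (i - j))" "0 \<le> Im (- cnj (?ui - i) * (?ui - ?uj))"
        unfolding c using nonneg ji by auto
      show "0 < Im (- cnj (?ui - i) * (i - j)) \<or> 0 < Im (- cnj (?ui - i) * (?ui - ?uj)) \<or>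
        0 < Im (- cnj (?ui - i) * (bulge ki i ?ui - bulge kj j ?uj))"
      proof (cases "?g j = 0 \<and> ?g ?uj = 0")
        case True
        then have eq: "?ui = j" "?uj = i" using nonneg(2) ji ij ne by auto
        then have "card (part u i) = 2" using two_cycle_part[OF u i j ij] ij by simp
        then have "ki > 0" using k by simp
        have "Im (- cnj (?ui - i) * (bulge ki i ?ui - bulge kj j ?uj))
          = - Im (cnj (j - i) * bulge ki i j) + Im (cnj (j - i) * bulge kj j i)"
          unfolding eq by (simp add: algebra_simps)
        also have "\<dots> = (ki + kj) * (cmod (j - i))\<^sup>2" unfolding Im_bulge Im_bulge' by (simp add: algebra_simps)
        also have "\<dots> > 0" using \<open>ki > 0\<close> k ij by (intro mult_pos_pos) auto
        finally show ?thesis by blast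
      next
        case False
        then have "?g j > 0 \<or> ?g ?uj > 0" using nonneg(1)[OF ji(1)] nonneg(1)[OF ji(2)] by linarith
        then show ?thesis unfolding c by auto
      qed
    qed (use ij ne in auto)
  qed
qed

context
  fixes u v w
  assumes u: "u \<in> NCP S" and v: "v \<in> NCP S" and uv: "refines S u v"
begin

context
  fixes ku ku' kw kw' kv kv' :: real and a b :: complex
  assumes a: "a \<in> S" and b: "b \<in> S" and ab: "a \<noteq> b"
    and k: "ku \<ge> 0" "ku' \<ge> 0" "kw \<ge> 0" "kw' \<ge> 0" "kv \<ge> 0" "kv' \<ge> 0"
    and kv: "card (part v a) = 2 \<longrightarrow> kv > 0 \<and> kv' > 0"
    and same: "part v a = part v b"
begin

abbreviation (input) "ua \<equiv> sigma u a"
abbreviation (input) "ub \<equiv> sigma u b"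
abbreviation (input) "va \<equiv> sigma v a"
abbreviation (input) "vb \<equiv> sigma v b"

abbreviation (input) "tri_separated \<equiv> separated (a - b) (ua - ub) (va - vb)
    (bulge ku a ua - bulge ku' b ub) (bulge kw ua va - bulge kw' ub vb) (bulge kv a va - bulge kv' b vb)"

text \<open>All positions that the following case lemmas use, in the form required by the arithmetic
  of cyclic orders: successors for \<open>v\<close> come first among the vertices of the common part
  of \<open>v\<close>.\<close>

lemma tri_mem:
  "ua \<in> S" "ub \<in> S" "va \<in> S" "vb \<in> S" "va \<noteq> vb" "ua \<noteq> ub"
  "ua = a \<or> (ua = va \<or> ccw a va ua)" "ub = b \<or> (ub = vb \<or> ccw b vb ub)"
  "b = va \<or> ccw a va b" "a = vb \<or> ccw b vb a" "va \<noteq> a" "vb \<noteq> b"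
  "ua = va \<or> ccw a va ua \<or> ua = a" "ub = va \<or> ub = a \<or> ccw a va ub"
  "ua = vb \<or> ua = b \<or> ccw b vb ua" "vb = a \<or> ccw a va vb" "va = b \<or> ccw b vb va"
proof -
  note V = NCP_D(1)[OF v]
  show m: "ua \<in> S" "ub \<in> S" "va \<in> S" "vb \<in> S" using sigma_S[OF u] sigma_S[OF v] a b by auto
  show ne: "va \<noteq> vb" "ua \<noteq> ub" using sigma_inj[OF u a b] sigma_inj[OF v a b] ab by auto
  show "ua = a \<or> (ua = va \<or> ccw a va ua)" "ub = b \<or> (ub = vb \<or> ccw b vb ub)"
    "ua = va \<or> ccw a va ua \<or> ua = a"
    using next_between(2)[OF u v uv a] next_between(2)[OF u v uv b] by auto
  have in': "b \<in> part v a" "a \<in> part v b" using part_self[OF V] a b same by auto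
  then show x: "va \<noteq> a" "vb \<noteq> b" "b = va \<or> ccw a va b" "a = vb \<or> ccw b vb a"
    using sigma_moves[OF v] sigma_next[OF v] a b ab by auto
  have "ua \<in> part v a" "ub \<in> part v a" "ua \<in> part v b" "ub \<in> part v b"
    using sigma_part[OF u] refines_part[OF uv] a b same by auto
  then show "ub = va \<or> ub = a \<or> ccw a va ub" "ua = vb \<or> ua = b \<or> ccw b vb ua"
    using sigma_next[OF v] a b by auto
  have "va \<in> part v b" "vb \<in> part v a" using sigma_part[OF v] a b same by auto
  then show "vb = a \<or> ccw a va vb" "va = b \<or> ccw b vb va"
    using sigma_next[OF v a, of vb] sigma_next[OF v b, of va] ne by auto
qed

lemma v_two_cycle: "va = b \<Longrightarrow> vb = a \<Longrightarrow> kv > 0 \<and> kv' > 0"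
  using two_cycle_part[OF v a b ab] ab kv by auto

lemma orient_sgn:
  assumes "x \<in> S" "y \<in> S" "z \<in> S" "x \<noteq> y"
  shows "orient x y z \<ge> 0 \<longleftrightarrow> z = x \<or> z = y \<or> ccw x y z" "orient x y z = 0 \<longleftrightarrow> z = x \<or> z = y"
  using orient_nonneg_iff(1)[OF assms(1-3)] assms(4) by auto

text \<open>The line through \<open>a\<close> and \<open>ua\<close> works: the part of
  \<open>u\<close> lies to its left, \<open>va\<close> comes no later than \<open>ua\<close> and so
  lies to its right or on it, and \<open>vb\<close> is again to its left. Curvatures count only when
  \<open>a\<close> and \<open>b\<close> are exchanged.\<close>

lemma separated_same_part:
  assumes eq: "part u a = part u b"
  shows tri_separated
proof -
  note U = NCP_D(1)[OF u] and t = tri_mem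
  have in': "b \<in> part u a" "ub \<in> part u a" using part_self[OF U b] sigma_part[OF u b] eq by auto
  then have ua: "ua \<noteq> a" "b = ua \<or> ccw a ua b" "ub = a \<or> ub = ua \<or> ccw a ua ub"
    using sigma_moves[OF u a] sigma_next[OF u a] ab by auto
  let ?g = "orient a ua"
  note c = orient_diff_minus[of ua a a b] orient_diff_minus[of ua a ua ub] orient_diff_minus[of ua a va vb]
  have gb: "?g b \<ge> 0" "?g b = 0 \<longleftrightarrow> b = ua" using orient_sgn[OF a t(1) b] ua ab by auto
  have gub: "?g ub \<ge> 0" "?g ub = 0 \<longleftrightarrow> ub = a" using orient_sgn[OF a t(1,2)] ua t(6) by auto
  have "\<not> ccw a ua va" using t ua(1) a by (simp only: to_idx) (smt (verit))
  then have gva: "?g va \<le> 0" "?g va = 0 \<longleftrightarrow> va = ua" using orient_sgn[OF a t(1,3)] ua t(11) by auto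
  have "vb = a \<or> ccw a ua vb" using t(1-10) ua a b ab by (simp only: to_idx) (smt (verit))
  moreover have "vb \<noteq> ua" using t(1-12) ua a b ab by (simp only: to_idx) (smt (verit))
  ultimately have gvb: "?g vb \<ge> 0" "?g vb = 0 \<longleftrightarrow> vb = a" using orient_sgn[OF a t(1,4)] ua by auto
  show ?thesis unfolding separated_def
  proof (intro exI[of _ "- cnj (ua - a)"] conjI impI; (unfold c)?)
    show "0 \<le> ?g b - ?g a" "0 \<le> ?g ub - ?g ua" "0 \<le> ?g vb - ?g va" using gb gub gvb gva by auto
    have bulge: "Im (- cnj (ua - a) * (bulge k a ua - bulge k' ua a)) = (k + k') * (cmod (ua - a))\<^sup>2" for k k'
    proof -
      have "Im (- cnj (ua - a) * (bulge k a ua - bulge k' ua a))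
         = - Im (cnj (ua - a) * bulge k a ua) + Im (cnj (ua - a) * bulge k' ua a)"
        by (simp add: algebra_simps)
      then show ?thesis unfolding Im_bulge Im_bulge' by (simp add: algebra_simps)
    qed
    {
      assume "?g b - ?g a = 0 \<and> ?g ub - ?g ua = 0"
      then have e: "b = ua" "ub = a" using gb gub by auto
      show "0 \<le> Im (- cnj (ua - a) * (bulge ku a ua - bulge ku' b ub))"
        unfolding e(2) unfolding e(1) bulge using k by simp
    next
      assume "?g ub - ?g ua = 0 \<and> ?g vb - ?g va = 0"
      then have e: "ub = a" "va = ua" "vb = a" using gub gva gvb by auto
      show "0 \<le> Im (- cnj (ua - a) * (bulge kw ua va - bulge kw' ub vb))"
        unfolding e by simp
    next
      assume "?g b - ?g a = 0 \<and> ?g vb - ?g va = 0"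
      then have e: "b = ua" "va = ua" "vb = a" using gb gva gvb by auto
      have "kv > 0 \<and> kv' > 0" using v_two_cycle e by auto
      then have "0 < Im (- cnj (ua - a) * (bulge kv a va - bulge kv' b vb))"
        unfolding e(2,3) unfolding e(1) bulge using ua by simp
      then show "0 \<le> Im (- cnj (ua - a) * (bulge kv a va - bulge kv' b vb))"
        "0 < Im (- cnj (ua - a) * (bulge kv a va - bulge kv' b vb))" by auto
    }
  qed
qed

text \<open>Here \<open>b\<close> lies beyond the edge from \<open>a\<close> to \<open>ua\<close>,
  and by non-crossing so does \<open>ub\<close>. The line of this edge separates, strictly for
  \<open>b\<close> and \<open>ub\<close>.\<close>

lemma separated_outside:
  assumes ua: "ua \<noteq> a" and arc: "ccw ua b a" and ne: "part u a \<noteq> part u b"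
  shows tri_separated
proof -
  note U = NCP_D(1)[OF u] and t = tri_mem
  let ?g = "orient a ua"
  note c = orient_diff_minus[of ua a a b] orient_diff_minus[of ua a ua ub] orient_diff_minus[of ua a va vb]
  have "b \<notin> part u a" using part_cong[OF U a] ne by metis
  then have ub_notin: "ub \<notin> part u a" using part_cong[OF U a] part_sigma[OF u b] ne by metis
  have gb: "?g b > 0" using arc orient_rotate[of a ua b] orient_rotate[of ua b a] by simp
  have "\<not> ccw a ub ua"
  proof
    assume "ccw a ub ua"
    moreover have "b \<in> part u ub" using part_sigma[OF u b] part_self[OF U b] by simp
    ultimately show False
      using NCP_crossing[OF u a t(2) sigma_part[OF u a] _ ub_notin] arc by blast
  qed
  moreover have "ub \<noteq> a" "ub \<noteq> ua" using ub_notin part_self[OF U a] sigma_part[OF u a] by auto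
  ultimately have gub: "?g ub > 0" using t(1,2) a ua by (simp only: to_idx) (smt (verit))
  have "\<not> ccw a ua va" using t ua a by (simp only: to_idx) (smt (verit))
  then have gva: "?g va \<le> 0" by simp
  have "vb = a \<or> ccw a ua vb" using t ua a b ab arc by (simp only: to_idx) (smt (verit))
  then have gvb: "?g vb \<ge> 0" by auto
  show ?thesis unfolding separated_def
    by (intro exI[of _ "- cnj (ua - a)"]; (unfold c)?) (use gb gub gva gvb in \<open>auto simp del: times_complex.sel\<close>)
qed

text \<open>The triangles degenerate to the edges for \<open>v\<close>, so the edge from
  \<open>a\<close> to \<open>va\<close> works as for a single path.\<close>

lemma separated_both_fixed:
  assumes eq: "ua = a" "ub = b"
  shows tri_separated
proof -
  note t = tri_mem
  let ?g = "orient a va"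
  note c = orient_diff_minus[of va a a b] orient_diff_minus[of va a ua ub] orient_diff_minus[of va a va vb]
  have gb: "?g b \<ge> 0" "?g b = 0 \<longleftrightarrow> b = va" using orient_sgn[OF a t(3) b] t(9,11) ab by auto
  have gvb: "?g vb \<ge> 0" "?g vb = 0 \<longleftrightarrow> vb = a" using orient_sgn[OF a t(3,4)] t(16,5,11) by auto
  have bulge: "Im (- cnj (va - a) * (bulge k a va - bulge k' va a)) = (k + k') * (cmod (va - a))\<^sup>2" for k k'
  proof -
    have "Im (- cnj (va - a) * (bulge k a va - bulge k' va a))
       = - Im (cnj (va - a) * bulge k a va) + Im (cnj (va - a) * bulge k' va a)"
      by (simp add: algebra_simps)
    then show ?thesis unfolding Im_bulge Im_bulge' by (simp add: algebra_simps)
  qed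
  show ?thesis unfolding separated_def eq
  proof (intro exI[of _ "- cnj (va - a)"] conjI impI; (unfold c[unfolded eq])?)
    show "0 \<le> ?g b - ?g a" "0 \<le> ?g b - ?g a" "0 \<le> ?g vb - ?g va" using gb gvb by auto
    show "0 \<le> Im (- cnj (va - a) * (bulge ku a a - bulge ku' b b))" by simp
    assume "?g b - ?g a = 0 \<and> ?g vb - ?g va = 0"
    then have e: "b = va" "vb = a" using gb gvb by auto
    show "0 \<le> Im (- cnj (va - a) * (bulge kw a va - bulge kw' b vb))"
      unfolding e(2) unfolding e(1) bulge using k by simp
    have "kv > 0 \<and> kv' > 0" using v_two_cycle e by auto
    then have "0 < Im (- cnj (va - a) * (bulge kv a va - bulge kv' b vb))"
      unfolding e(2) unfolding e(1) bulge using t by simp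
    then show "0 \<le> Im (- cnj (va - a) * (bulge kv a va - bulge kv' b vb))"
        "0 < Im (- cnj (va - a) * (bulge kv a va - bulge kv' b vb))" by auto
  qed
qed

text \<open>Now \<open>a\<close> lies in the gap of \<open>u\<close> after \<open>b\<close>, where
  no edge of \<open>u\<close> or \<open>v\<close> is suitable in general. The edge of the complement
  from \<open>ub\<close> to \<open>vb\<close> has \<open>b\<close> strictly on its right and
  \<open>a\<close>, \<open>ua\<close>, \<open>va\<close> on its left or on it.\<close>

lemma separated_inside:
  assumes ub: "ub \<noteq> b" and arc: "ccw b a ub" and ua: "ua = a \<or> ccw a b ua" and ne: "part u a \<noteq> part u b"
  shows tri_separated
proof -
  note U = NCP_D(1)[OF u] and t = tri_mem
  let ?g = "orient ub vb"
  note c = orient_diff[of vb ub a b] orient_diff[of vb ub ua ub] orient_diff[of vb ub va vb]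
  have "b \<notin> part u a" using part_cong[OF U a] ne by metis
  then have ub_notin: "ub \<notin> part u a" using part_cong[OF U a] part_sigma[OF u b] ne by metis
  have uv': "ub \<noteq> vb" using t(2,4,8,10) ub arc a b by (simp only: to_idx) (smt (verit))
  have "ccw ub b vb" using t(1-10) ub arc uv' a b by (simp only: to_idx) (smt (verit))
  then have gb: "?g b < 0" using orient_swap[of ub vb b] by simp
  have "a = vb \<or> ccw ub vb a" using t(1-10) ub arc uv' a b by (simp only: to_idx) (smt (verit))
  then have ga: "?g a \<ge> 0" by auto
  have "va = ub \<or> ccw a va ub"
  proof -
    have "ub = va \<or> ub = a \<or> ccw a va ub" by (rule t(14))
    moreover have "ub \<noteq> a" using ub_notin part_self[OF U a] by auto
    ultimately show ?thesis by auto
  qed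
  then have "va = ub \<or> ccw ub vb va"
    using t(1-12) ub arc uv' a b by (simp only: to_idx) (smt (verit))
  then have gva: "?g va \<ge> 0" "?g va = 0 \<longleftrightarrow> va = ub" using t(5) by (auto simp: orient_sgn[OF t(2,4,3) uv'])
  have gua: "?g ua \<ge> 0 \<and> (?g ua = 0 \<longrightarrow> ua = vb)"
  proof (cases "ua = a")
    case True
    have "ua \<noteq> ub" by (rule t(6))
    then show ?thesis using ga orient_sgn(2)[OF t(2,4,1) uv'] True by auto
  next
    case False
    then have abu: "ccw a b ua" using ua by auto
    have "\<not> ccw ua ub a"
    proof
      assume *: "ccw ua ub a"
      have "b \<in> part u ub" using part_sigma[OF u b] part_self[OF U b] by simp
      then show False
        using NCP_crossing[OF u a b sigma_part[OF u a] sigma_part[OF u b] \<open>b \<notin> part u a\<close> abu *] by blast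
    qed
    moreover have "ub \<noteq> a" "ub \<noteq> ua" using ub_notin part_self[OF U a] sigma_part[OF u a] by auto
    ultimately have "ccw a ub ua" using t(1,2) a False by (simp only: to_idx) (smt (verit))
    moreover have "ua \<noteq> b" using abu by auto
    then have "ua = vb \<or> ccw b vb ua" using t(15) by auto
    ultimately have "ua = vb \<or> ccw ub vb ua"
      using t(1-12) ub arc abu uv' a b by (simp only: to_idx) (smt (verit))
    then show ?thesis using orient_sgn[OF t(2,4,1) uv'] t(6) by auto
  qed
  show ?thesis unfolding separated_def
  proof (intro exI[of _ "cnj (vb - ub)"] conjI impI; (unfold c)?)
    show "0 \<le> ?g a - ?g b" "0 \<le> ?g ua - ?g ub" "0 \<le> ?g va - ?g vb" using ga gb gua gva by auto
    assume "?g ua - ?g ub = 0 \<and> ?g va - ?g vb = 0"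
    then have e: "ua = vb" "va = ub" using gua gva by auto
    have "Im (cnj (vb - ub) * (bulge kw vb ub - bulge kw' ub vb)) = (kw + kw') * (cmod (vb - ub))\<^sup>2"
    proof -
      have "Im (cnj (vb - ub) * (bulge kw vb ub - bulge kw' ub vb))
         = Im (cnj (vb - ub) * bulge kw vb ub) - Im (cnj (vb - ub) * bulge kw' ub vb)"
        by (simp add: algebra_simps)
      then show ?thesis unfolding Im_bulge Im_bulge' by (simp add: algebra_simps)
    qed
    then show "0 \<le> Im (cnj (vb - ub) * (bulge kw ua va - bulge kw' ub vb))"
      unfolding e using k by simp
  qed (use ga gb in auto)
qed

end

text \<open>Curvatures are arbitrary nonnegative numbers, positive only where a part of
  \<open>v\<close> has two elements, because strands below an asymmetric partition may be curved
  along edges of larger parts; see \<open>poly_curv\<close>.\<close>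

lemma sigma_separated:
  assumes a: "a \<in> S" and b: "b \<in> S" and ab: "a \<noteq> b"
    and k: "ku \<ge> 0" "ku' \<ge> 0" "kw \<ge> 0" "kw' \<ge> 0" "kv \<ge> 0" "kv' \<ge> 0"
    and kv: "card (part v a) = 2 \<Longrightarrow> kv > 0" "card (part v b) = 2 \<Longrightarrow> kv' > 0"
  shows "separated (a - b) (sigma u a - sigma u b) (sigma v a - sigma v b)
    (bulge ku a (sigma u a) - bulge ku' b (sigma u b))
    (bulge kw (sigma u a) (sigma v a) - bulge kw' (sigma u b) (sigma v b))
    (bulge kv a (sigma v a) - bulge kv' b (sigma v b))"
proof -
  note U = NCP_D(1)[OF u] and V = NCP_D(1)[OF v]
  show ?thesis
  proof (cases "part v a = part v b")
    case False
    obtain c where "\<And>x y. x \<in> part v a \<Longrightarrow> y \<in> part v b \<Longrightarrow> Im (c * (x - y)) > 0"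
      using parts_separated[OF v a b False] by blast
    moreover have "sigma u a \<in> part v a" "sigma u b \<in> part v b"
      using sigma_part[OF u] refines_part[OF uv] a b by auto
    ultimately show ?thesis
      using part_self[OF V] sigma_part[OF v] a b by (intro separatedI_strict[of c]) auto
  next
    case same: True
    have kva: "card (part v a) = 2 \<longrightarrow> kv > 0 \<and> kv' > 0"
      and kvb: "card (part v b) = 2 \<longrightarrow> kv' > 0 \<and> kv > 0" using kv same by auto
    note X = a b ab k kva same
    note Y = b a ab[symmetric] k(2,1,4,3,6,5) kvb same[symmetric]
    have flip: "separated (b - a) (sigma u b - sigma u a) (sigma v b - sigma v a)
      (bulge ku' b (sigma u b) - bulge ku a (sigma u a))
      (bulge kw' (sigma u b) (sigma v b) - bulge kw (sigma u a) (sigma v a))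
      (bulge kv' b (sigma v b) - bulge kv a (sigma v a)) \<Longrightarrow> ?thesis"
      by (drule separated_minus) simp
    show ?thesis
    proof (cases "part u a = part u b")
      case True show ?thesis by (rule separated_same_part[OF X True])
    next
      case ne: False
      have nb: "b \<notin> part u a" using part_cong[OF U a] ne by metis
      have nb': "a \<notin> part u b" using part_cong[OF U b] ne by metis
      from nb nb' have ne': "b \<noteq> sigma u a" "a \<noteq> sigma u b" using sigma_part[OF u] a b by auto
      have m: "sigma u a \<in> S" "sigma u b \<in> S" using sigma_S[OF u] a b by auto
      \<comment> \<open>Either one point lies beyond the edge that leaves the other, or
        \<open>u\<close> fixes both, or one lies in the gap after the other.\<close>
      consider "sigma u a \<noteq> a" "ccw (sigma u a) b a" | "sigma u b \<noteq> b" "ccw (sigma u b) a b"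
        | "sigma u a = a" "sigma u b = b"
        | "sigma u b \<noteq> b" "ccw b a (sigma u b)" "sigma u a = a \<or> ccw a b (sigma u a)"
        | "sigma u a \<noteq> a" "ccw a b (sigma u a)" "sigma u b = b \<or> ccw b a (sigma u b)"
        using ne' m a b ab by (simp only: to_idx) (smt (verit))
      then show ?thesis
      proof cases
        case 1 show ?thesis by (rule separated_outside[OF X 1 ne])
      next
        case 2 show ?thesis by (rule flip, rule separated_outside[OF Y 2 ne[symmetric]])
      next
        case 3 show ?thesis by (rule separated_both_fixed[OF X 3])
      next
        case 4 show ?thesis by (rule separated_inside[OF X 4 ne])
      next
        case 5 show ?thesis by (rule flip, rule separated_inside[OF Y 5 ne[symmetric]])
      qed
    qed
  qed
qed

end

end

section \<open>Roots of unity\<close>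

lemma convex_polygonI:
  assumes inj: "inj_on v {..<N}"
    and ccw: "\<And>i j k. i < j \<Longrightarrow> j < k \<Longrightarrow> k < N \<Longrightarrow> ccw (v i) (v j) (v k)"
  shows "convex_polygon v N"
proof
  fix i j k assume N: "i < N" "j < N" "k < N"
  have rot: "ccw (v b) (v c) (v a) \<longleftrightarrow> ccw (v a) (v b) (v c)" for a b c by (simp add: orient_rotate)
  have neg: "\<not> ccw (v a) (v c) (v b)" if "ccw (v a) (v b) (v c)" for a b c
    using that orient_swap[of "v a" "v c" "v b"] by simp
  consider "i = j \<or> j = k \<or> i = k" | "i < j" "j < k" | "j < k" "k < i" | "k < i" "i < j"
    | "i < k" "k < j" | "k < j" "j < i" | "j < i" "i < k" by linarith
  then show "ccw (v i) (v j) (v k) \<longleftrightarrow> cyc (int i) (int j) (int k)"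
  proof cases
    case 1 then show ?thesis by (auto simp: cyc_def)
  next
    case 2 then show ?thesis using ccw[of i j k] N by (simp add: cyc_def)
  next
    case 3 then show ?thesis using ccw[of j k i] N rot by (simp add: cyc_def)
  next
    case 4 then show ?thesis using ccw[of k i j] N rot by (simp add: cyc_def)
  next
    case 5 then show ?thesis using neg[OF ccw[of i k j]] N by (auto simp: cyc_def)
  next
    case 6 then show ?thesis using neg[OF ccw[of k j i]] N rot by (auto simp: cyc_def)
  next
    case 7 then show ?thesis using neg[OF ccw[of j i k]] N rot by (auto simp: cyc_def)
  qed
qed (rule inj)

text \<open>The product formula for the area of a triangle inscribed in the unit circle. For
  vertices in increasing order the half differences of angles lie between 0 and \<open>pi\<close>,
  so convexity is read off from the signs of sines.\<close>

lemma orient_cis: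
  "orient (cis \<alpha>) (cis \<beta>) (cis \<gamma>) = 4 * sin ((\<beta> - \<alpha>) / 2) * sin ((\<gamma> - \<beta>) / 2) * sin ((\<gamma> - \<alpha>) / 2)"
proof -
  define x y where "x = (\<gamma> - \<beta>) / 2" and "y = (\<beta> - \<alpha>) / 2"
  have "orient (cis \<alpha>) (cis \<beta>) (cis \<gamma>) = sin (\<gamma> - \<beta>) + sin (\<beta> - \<alpha>) - sin (\<gamma> - \<alpha>)"
    by (simp add: orient_def sin_diff algebra_simps)
  also have "\<dots> = sin (2 * x) + sin (2 * y) - sin (2 * x + 2 * y)"
  proof -
    have "\<gamma> - \<beta> = 2 * x" "\<beta> - \<alpha> = 2 * y" "\<gamma> - \<alpha> = 2 * x + 2 * y" by (simp_all add: x_def y_def field_simps)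
    then show ?thesis by (simp only:)
  qed
  also have "\<dots> = 4 * sin y * sin x * sin (x + y)"
    unfolding sin_add sin_double cos_double using sin_cos_squared_add[of x] sin_cos_squared_add[of y]
    by algebra
  also have "x + y = (\<gamma> - \<alpha>) / 2" by (simp add: x_def y_def field_simps)
  finally show ?thesis by (simp add: x_def y_def)
qed

lemma orient_mult: "orient (c * a) (c * b) (c * d) = (cmod c)\<^sup>2 * orient a b d"
  unfolding cmod_power2 by (simp add: orient_def power2_eq_square algebra_simps)

lemma zeta_power: "zeta d ^ k = cis (2 * pi * real k / real d)"
proof -
  have "zeta d = cis (2 * pi / real d)" by (simp add: zeta_def cis_conv_exp mult_ac)
  then show ?thesis by (simp add: Complex.DeMoivre mult_ac)
qed

lemma mu_eq_powers: "m > 0 \<Longrightarrow> mu m = (\<lambda>k. zeta m ^ k) ` {..<m}"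
  and inj_on_zeta: "m > 0 \<Longrightarrow> inj_on (\<lambda>k. zeta m ^ k) {..<m}"
  using Complex.bij_betw_roots_unity[of m] by (simp_all add: bij_betw_def mu_def zeta_power)

lemma zeta_in_mu: "m > 0 \<Longrightarrow> zeta m ^ k \<in> mu m"
proof -
  have "m > 0 \<Longrightarrow> zeta m ^ m = 1" by (simp add: zeta_power)
  then show "m > 0 \<Longrightarrow> zeta m ^ k \<in> mu m"
    by (simp add: mu_def power_mult[symmetric] mult.commute[of k]) (simp add: power_mult)
qed

lemma norm_mu: "m > 0 \<Longrightarrow> z \<in> mu m \<Longrightarrow> cmod z = 1"
  by (auto simp: mu_eq_powers zeta_power)

lemma convex_polygon_mu:
  assumes "m > 0"
  shows "convex_polygon (\<lambda>k. zeta m ^ k) m"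
proof (rule convex_polygonI[OF inj_on_zeta[OF assms]])
  fix i j k :: nat assume h: "i < j" "j < k" "k < m"
  have s: "sin ((2 * pi * real b / real m - 2 * pi * real a / real m) / 2) > 0" if "a < b" "b < m" for a b
  proof (rule sin_gt_zero)
    have e: "(2 * pi * real b / real m - 2 * pi * real a / real m) / 2 = pi * ((real b - real a) / real m)"
      by (simp add: diff_divide_distrib right_diff_distrib)
    have "(real b - real a) / real m < 1" using that assms by (simp add: field_simps)
    then show "(2 * pi * real b / real m - 2 * pi * real a / real m) / 2 < pi"
      unfolding e using mult_strict_left_mono[of "(real b - real a) / real m" 1 pi] by simp
    show "0 < (2 * pi * real b / real m - 2 * pi * real a / real m) / 2"
      unfolding e using that assms by simp
  qed
  show "ccw (zeta m ^ i) (zeta m ^ j) (zeta m ^ k)"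
    unfolding zeta_power orient_cis using s[of i j] s[of j k] s[of i k] h by simp
qed

lemma S_mu: "m > 0 \<Longrightarrow> convex_polygon.S (\<lambda>k. zeta m ^ k) m = mu m"
  by (simp add: convex_polygon.S_def[OF convex_polygon_mu] mu_eq_powers)

lemma compl_11:
  assumes "m > 0" "u \<in> NCP (mu m)" "v \<in> NCP (mu m)" "refines (mu m) u v"
  shows "compl_11 m u v \<in> NCP (mu m)"
    and "z \<in> mu m \<Longrightarrow> sigma (compl_11 m u v) (sigma u z) = sigma v z"
    and "w \<in> NCP (mu m) \<Longrightarrow> (\<And>z. z \<in> mu m \<Longrightarrow> sigma w (sigma u z) = sigma v z) \<Longrightarrow> compl_11 m u v = w"
proof -
  interpret convex_polygon "\<lambda>k. zeta m ^ k" m by (rule convex_polygon_mu[OF assms(1)])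
  note ex1 = complement_ex1[unfolded S_mu[OF assms(1)], OF assms(2-4)]
  from theI'[OF ex1] show "compl_11 m u v \<in> NCP (mu m)"
    "z \<in> mu m \<Longrightarrow> sigma (compl_11 m u v) (sigma u z) = sigma v z"
    unfolding compl_11_def by blast+
  show "w \<in> NCP (mu m) \<Longrightarrow> (\<And>z. z \<in> mu m \<Longrightarrow> sigma w (sigma u z) = sigma v z) \<Longrightarrow> compl_11 m u v = w"
    unfolding compl_11_def by (rule the1_equality[OF ex1]) auto
qed

lemma image_partition:
  assumes "partition_on A u" "inj_on f A"
  shows "partition_on (f ` A) ((`) f ` u)"
  unfolding partition_on_def disjoint_def
proof (intro conjI ballI impI)
  show "\<Union> ((`) f ` u) = f ` A" using assms(1) by (auto simp: partition_on_def)
  show "{} \<notin> (`) f ` u" using assms(1) by (auto simp: partition_on_def)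
  fix p q assume "p \<in> (`) f ` u" "q \<in> (`) f ` u" "p \<noteq> q"
  then obtain p' q' where *: "p = f ` p'" "q = f ` q'" "p' \<in> u" "q' \<in> u" "p' \<noteq> q'" by auto
  then have "p' \<inter> q' = {}" "p' \<subseteq> A" "q' \<subseteq> A"
    using assms(1) by (auto simp: partition_on_def disjoint_def)
  then show "p \<inter> q = {}" using inj_on_image_Int[OF assms(2), of p' q'] * by simp
qed

text \<open>A map that preserves indices preserves orientations, hence everything defined from them:
  non-crossing partitions, successors and refinement. It carries complements from the regular
  polygon with \<open>n + 1\<close> vertices to \<open>polygon e n \<zeta>\<close>.\<close>

locale polygon_map = P: convex_polygon v N + Q: convex_polygon v' N for v v' :: "nat \<Rightarrow> complex" and N +
  fixes f :: "complex \<Rightarrow> complex"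
  assumes f: "k < N \<Longrightarrow> f (v k) = v' k"
begin

lemma f_eq: "z \<in> P.S \<Longrightarrow> f z = v' (nat (P.idx z))"
  using f[of "nat (P.idx z)"] P.idx_range[of z] P.vertex_idx[of z] by (auto simp: nat_less_iff)

lemma f_idx: "z \<in> P.S \<Longrightarrow> Q.idx (f z) = P.idx z" and f_S: "z \<in> P.S \<Longrightarrow> f z \<in> Q.S"
  using f_eq[of z] P.idx_range[of z] Q.idx_vertex[of "nat (P.idx z)"] Q.vertex_in_S[of "nat (P.idx z)"]
  by (auto simp: nat_less_iff)

lemma f_inj: "inj_on f P.S"
  by (rule inj_onI) (metis f_idx P.vertex_idx)

lemma f_image: "f ` P.S = Q.S"
  using f f_S by (auto simp: P.S_def Q.S_def image_image)

lemma f_ccw: "a \<in> P.S \<Longrightarrow> b \<in> P.S \<Longrightarrow> c \<in> P.S \<Longrightarrow> ccw (f a) (f b) (f c) \<longleftrightarrow> ccw a b c"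
  by (simp add: P.ccw_iff Q.ccw_iff f_S f_idx)

lemma image_NCP:
  assumes "u \<in> NCP P.S"
  shows "(`) f ` u \<in> NCP Q.S"
proof -
  have U: "partition_on P.S u" "\<forall>p\<in>u. \<forall>q\<in>u. p \<noteq> q \<longrightarrow> noncrossing p q" using assms by (auto simp: P.NCP_iff)
  have sub: "p \<subseteq> P.S" if "p \<in> u" for p using U that by (auto simp: partition_on_def)
  have "noncrossing (f ` p) (f ` q)" if "p \<in> u" "q \<in> u" "p \<noteq> q" for p q
    using U(2) that sub[OF that(1)] sub[OF that(2)] unfolding noncrossing_def
    by (auto simp: f_ccw subset_iff)
  then show ?thesis unfolding Q.NCP_iff
    using image_partition[OF U(1) f_inj] f_image by auto
qed

lemma image_part:
  assumes "u \<in> NCP P.S" "z \<in> P.S"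
  shows "part ((`) f ` u) (f z) = f ` part u z"
  by (rule part_eq[OF Q.NCP_D(1)[OF image_NCP[OF assms(1)]]])
    (use part_in[OF P.NCP_D(1)[OF assms(1)] assms(2)] part_self[OF P.NCP_D(1)[OF assms(1)] assms(2)] in auto)

lemma image_sigma:
  assumes "u \<in> NCP P.S" "z \<in> P.S"
  shows "sigma ((`) f ` u) (f z) = f (sigma u z)"
proof -
  note U = P.NCP_D(1)[OF assms(1)]
  have sub: "part u z \<subseteq> P.S" and zp: "z \<in> part u z" using part_subset[OF U] part_self[OF U] assms by auto
  show ?thesis unfolding sigma_def image_part[OF assms]
  proof (cases "part u z = {z}")
    case True then show "ccw_succ (f ` part u z) (f z) = f (ccw_succ (part u z) z)" by simp
  next
    case False
    note s = P.ccw_succ(1)[OF sub zp] P.ccw_succ(2)[OF sub zp False]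
    show "ccw_succ (f ` part u z) (f z) = f (ccw_succ (part u z) z)"
    proof (rule Q.ccw_succI)
      show "f ` part u z \<subseteq> Q.S" using sub f_S by auto
      show "f (ccw_succ (part u z) z) \<noteq> f z" using s sub assms inj_onD[OF f_inj] by blast
      fix y assume "y \<in> f ` part u z" "y \<noteq> f z" "y \<noteq> f (ccw_succ (part u z) z)"
      then obtain y' where y': "y = f y'" "y' \<in> part u z" "y' \<noteq> z" "y' \<noteq> ccw_succ (part u z) z" by auto
      then show "ccw (f z) (f (ccw_succ (part u z) z)) y"
        using P.ccw_succ(3)[OF sub zp y'(2-4)] f_ccw s sub assms by auto
    qed (use zp s in auto)
  qed
qed

lemma image_refines: "refines P.S u w \<Longrightarrow> refines Q.S ((`) f ` u) ((`) f ` w)"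
  using image_partition[OF _ f_inj] f_image unfolding refines_def by (auto; meson image_mono)

end

lemma restr_NCP:
  assumes "u \<in> NCP A" "B \<subseteq> A"
  shows "restr u B \<in> NCP B"
proof -
  have part: "partition_on A u" using assms by (simp add: NCP_def)
  have "partition_on B (restr u B)"
    unfolding partition_on_def restr_def disjoint_def
  proof (intro conjI ballI impI)
    show "\<Union> ((\<inter>) B ` u - {{}}) = B" using assms(2) part unfolding partition_on_def by blast
    fix a b assume "a \<in> (\<inter>) B ` u - {{}}" "b \<in> (\<inter>) B ` u - {{}}" "a \<noteq> b"
    then show "a \<inter> b = {}" using part by (auto simp: partition_on_def disjoint_def)
  qed auto
  moreover have "p = q" if pq: "p \<in> restr u B" "q \<in> restr u B" "convex hull p \<inter> convex hull q \<noteq> {}" for p q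
  proof -
    obtain p' q' where *: "p' \<in> u" "q' \<in> u" "p = B \<inter> p'" "q = B \<inter> q'" using pq by (auto simp: restr_def)
    then have "convex hull p \<subseteq> convex hull p'" "convex hull q \<subseteq> convex hull q'" by (auto intro!: hull_mono)
    then have "p' = q'" using pq(3) * assms(1) unfolding NCP_def by blast
    then show ?thesis using * by simp
  qed
  ultimately show ?thesis by (simp add: NCP_def)
qed

lemma part_restr:
  assumes "partition_on A u" "B \<subseteq> A" "partition_on B (restr u B)" "z \<in> B"
  shows "part (restr u B) z = part u z \<inter> B"
proof (rule part_eq[OF assms(3)])
  have z: "z \<in> part u z" "part u z \<in> u" using part_self[OF assms(1)] part_in[OF assms(1)] assms by auto
  then show "z \<in> part u z \<inter> B" using assms by auto
  show "part u z \<inter> B \<in> restr u B" using z assms unfolding restr_def by blast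
qed

lemma restr_refines:
  assumes "refines A u v" "B \<subseteq> A" "partition_on B (restr u B)" "partition_on B (restr v B)"
  shows "refines B (restr u B) (restr v B)"
  unfolding refines_def
proof (intro conjI ballI assms)
  fix p assume "p \<in> restr u B"
  then obtain p' where p': "p' \<in> u" "p = B \<inter> p'" "p \<noteq> {}" by (auto simp: restr_def)
  then obtain q where "q \<in> v" "p' \<subseteq> q" using assms(1) by (auto simp: refines_def)
  then show "\<exists>q\<in>restr v B. p \<subseteq> q" using p' unfolding restr_def by (intro bexI[of _ "B \<inter> q"]) auto
qed

text \<open>The condition \<open>e1\<close> makes 0 a vertex of a strictly convex polygon: for
  \<open>e = 1\<close> and \<open>n \<ge> 2\<close> the other vertices would be all of
  \<open>mu n\<close>, with 0 in their convex hull. For \<open>e \<ge> 2\<close> they span an angle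
  less than \<open>pi\<close>.\<close>

locale ee =
  fixes e n :: nat
  assumes e_pos: "e > 0" and n_pos: "n > 0" and e1: "e = 1 \<longrightarrow> n = 1"
begin

abbreviation "M \<equiv> e * n"
abbreviation "\<omega> \<equiv> zeta M"
abbreviation "Q \<zeta> \<equiv> polygon e n \<zeta>"

lemma M_pos: "M > 0" using e_pos n_pos by simp

lemma mu_cis: "z \<in> mu M \<Longrightarrow> \<exists>t. z = cis t"
  using mu_eq_powers[OF M_pos] zeta_power by fastforce

lemma polygon_vertex_cis: "k > 0 \<Longrightarrow> polygon_vertex e n (cis t) k = cis (2 * pi * real k / real M + t)"
  by (simp add: polygon_vertex_def zeta_power cis_mult)

lemma angle_bounds:
  assumes "i < j" "j \<le> n" "i > 0"
  shows "0 < 2 * pi * real j / real M - 2 * pi * real i / real M" (is ?A)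
    and "2 * pi * real j / real M - 2 * pi * real i / real M < pi" (is ?B)
proof -
  have eq: "2 * pi * real j / real M - 2 * pi * real i / real M = pi * (2 * (real j - real i) / real M)"
    by (simp add: diff_divide_distrib algebra_simps)
  have "e \<noteq> 1" using assms e1 by auto
  then have "2 \<le> e" using e_pos by linarith
  have "2 * (real j - real i) < 2 * real n" using assms by simp
  also have "\<dots> \<le> real e * real n" using \<open>2 \<le> e\<close> by (intro mult_right_mono) auto
  finally have "2 * (real j - real i) / real M < 1" using M_pos by simp
  then show ?B unfolding eq using mult_strict_left_mono[of "2 * (real j - real i) / real M" 1 pi] by simp
  show ?A unfolding eq using assms M_pos by simp
qed

lemma polygon_in_mu: "\<zeta> \<in> mu M \<Longrightarrow> k > 0 \<Longrightarrow> polygon_vertex e n \<zeta> k \<in> mu M"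
  by (simp add: polygon_vertex_def mu_mult zeta_in_mu[OF M_pos])

lemma convex_polygon_Q:
  assumes "\<zeta> \<in> mu M"
  shows "convex_polygon (polygon_vertex e n \<zeta>) (n + 1)"
proof (rule convex_polygonI)
  obtain t where t: "\<zeta> = cis t" using mu_cis[OF assms] by blast
  have "\<omega> ^ i \<noteq> \<omega> ^ j" if "i < j" "j < n + 1" "i > 0" for i j
  proof -
    have "j - i < M" "j - i > 0"
    proof -
      have "n \<le> M" using e_pos by simp
      then show "j - i < M" using that by linarith
    qed (use that in auto)
    then have "\<omega> ^ (j - i) \<noteq> \<omega> ^ 0" using inj_on_eq_iff[OF inj_on_zeta[OF M_pos], of "j - i" 0] e_pos n_pos by auto
    moreover have "\<omega> ^ j = \<omega> ^ i * \<omega> ^ (j - i)" using that by (simp flip: power_add)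
    moreover have "\<omega> ^ i \<noteq> 0" by (simp add: zeta_power)
    ultimately show ?thesis by auto
  qed
  moreover have "\<zeta> \<noteq> 0" using t by simp
  moreover have "\<omega> \<noteq> 0" using zeta_power[of M 1] by simp
  ultimately show "inj_on (polygon_vertex e n \<zeta>) {..<n + 1}"
    by (intro linorder_inj_onI) (auto simp: polygon_vertex_def)
  fix i j k :: nat assume h: "i < j" "j < k" "k < n + 1"
  show "ccw (polygon_vertex e n \<zeta> i) (polygon_vertex e n \<zeta> j) (polygon_vertex e n \<zeta> k)"
  proof (cases "i = 0")
    case True
    have "orient 0 (cis \<alpha>) (cis \<beta>) = sin (\<beta> - \<alpha>)" for \<alpha> \<beta>
      by (simp add: orient_def sin_diff algebra_simps)
    then show ?thesis using True h angle_bounds[of j k] sin_gt_zero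
      unfolding t by (simp add: polygon_vertex_cis) (simp add: polygon_vertex_def)
  next
    case False
    have s: "sin ((2 * pi * real b / real M + t - (2 * pi * real a / real M + t)) / 2) > 0"
      if "a < b" "b \<le> n" "a > 0" for a b
      using angle_bounds[OF that] by (intro sin_gt_zero) auto
    show ?thesis using h False s[of i j] s[of j k] s[of i k]
      unfolding t by (simp add: polygon_vertex_cis orient_cis)
  qed
qed

lemma S_Q: "\<zeta> \<in> mu M \<Longrightarrow> convex_polygon.S (polygon_vertex e n \<zeta>) (n + 1) = Q \<zeta>"
  unfolding polygon_def using convex_polygon.S_def[OF convex_polygon_Q]
  by (simp only: Suc_eq_plus1[symmetric] lessThan_Suc_atMost)

lemma Q_subset: "\<zeta> \<in> mu M \<Longrightarrow> Q \<zeta> \<subseteq> mu0 M"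
  using polygon_in_mu by (auto simp: polygon_def) (metis polygon_vertex_def neq0_conv)

lemma compl_polygon:
  assumes \<zeta>: "\<zeta> \<in> mu M" and u: "u \<in> NCP (Q \<zeta>)" and v: "v \<in> NCP (Q \<zeta>)" and uv: "refines (Q \<zeta>) u v"
  shows "compl_polygon e n \<zeta> u v \<in> NCP (Q \<zeta>)"
    and "z \<in> Q \<zeta> \<Longrightarrow> sigma (compl_polygon e n \<zeta> u v) (sigma u z) = sigma v z"
proof -
  let ?f = "to_polygon e n \<zeta>"
  let ?g = "inv_into (mu (n + 1)) ?f"
  have n1: "n + 1 > 0" by simp
  interpret R: convex_polygon "\<lambda>k. zeta (n + 1) ^ k" "n + 1" by (rule convex_polygon_mu[OF n1])
  interpret A: convex_polygon "polygon_vertex e n \<zeta>" "n + 1" by (rule convex_polygon_Q[OF \<zeta>])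
  have S: "R.S = mu (n + 1)" "A.S = Q \<zeta>" using S_mu[OF n1] S_Q[OF \<zeta>] by auto
  have fv: "?f (zeta (n + 1) ^ k) = polygon_vertex e n \<zeta> k" if "k < n + 1" for k
  proof -
    have "(THE j. j \<le> n \<and> zeta (n + 1) ^ j = zeta (n + 1) ^ k) = k"
      using that inj_onD[OF inj_on_zeta[OF n1]] by (intro the_equality) auto
    then show ?thesis by (simp add: to_polygon_def)
  qed
  interpret F: polygon_map "\<lambda>k. zeta (n + 1) ^ k" "polygon_vertex e n \<zeta>" "n + 1" ?f
    by unfold_locales (rule fv)
  have gv: "?g (polygon_vertex e n \<zeta> k) = zeta (n + 1) ^ k" if "k < n + 1" for k
    using inv_into_f_f[OF F.f_inj[unfolded S] zeta_in_mu[OF n1]] fv[OF that] by metis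
  interpret G: polygon_map "polygon_vertex e n \<zeta>" "\<lambda>k. zeta (n + 1) ^ k" "n + 1" ?g
    by unfold_locales (rule gv)
  have u': "(`) ?g ` u \<in> NCP (mu (n + 1))" and v': "(`) ?g ` v \<in> NCP (mu (n + 1))"
    using G.image_NCP u v unfolding S by auto
  have uv': "refines (mu (n + 1)) ((`) ?g ` u) ((`) ?g ` v)" using G.image_refines uv unfolding S by auto
  let ?w = "compl_11 (n + 1) ((`) ?g ` u) ((`) ?g ` v)"
  note w = compl_11[OF n1 u' v' uv']
  show "compl_polygon e n \<zeta> u v \<in> NCP (Q \<zeta>)"
    unfolding compl_polygon_def Let_def using F.image_NCP[of ?w] w(1) unfolding S by blast
  assume z: "z \<in> Q \<zeta>"
  have fg: "?f (?g y) = y" if "y \<in> Q \<zeta>" for y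
    using that F.f_image unfolding S by (metis f_inv_into_f)
  have gz: "?g z \<in> mu (n + 1)" using G.f_S z unfolding S by auto
  have sz: "sigma u z \<in> Q \<zeta>" "sigma v z \<in> Q \<zeta>" using A.sigma_S u v z unfolding S by auto
  have "sigma ((`) ?f ` ?w) (sigma u z) = sigma ((`) ?f ` ?w) (?f (?g (sigma u z)))" using fg sz by simp
  also have "\<dots> = ?f (sigma ?w (?g (sigma u z)))"
    using F.image_sigma[of ?w "?g (sigma u z)"] w(1) G.f_S[of "sigma u z"] sz unfolding S by simp
  also have "?g (sigma u z) = sigma ((`) ?g ` u) (?g z)"
    using G.image_sigma[of u z] u z unfolding S by simp
  also have "sigma ?w \<dots> = sigma ((`) ?g ` v) (?g z)" by (rule w(2)[OF gz])
  also have "\<dots> = ?g (sigma v z)" using G.image_sigma[of v z] v z unfolding S by simp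
  also have "?f \<dots> = sigma v z" by (rule fg[OF sz(2)])
  finally show "sigma (compl_polygon e n \<zeta> u v) (sigma u z) = sigma v z"
    by (simp add: compl_polygon_def Let_def)
qed

lemma mu_e_power: "\<xi> \<in> mu e \<Longrightarrow> \<exists>l<e. \<xi> = \<omega> ^ (n * l)"
proof -
  assume "\<xi> \<in> mu e"
  then obtain l where "l < e" "\<xi> = zeta e ^ l" using mu_eq_powers[OF e_pos] by auto
  then show ?thesis using n_pos by (intro exI[of _ l]) (simp add: zeta_power field_simps)
qed

text \<open>The polygon and its rotated copy lie in disjoint sectors with apex 0, so a line through
  0 between the sectors separates them. It meets both only in 0, whence the exception.\<close>

lemma cone_separated:
  assumes \<zeta>: "\<zeta> \<in> mu M" and \<xi>: "\<xi> \<in> mu e" "\<xi> \<noteq> 1"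
  shows "\<exists>c. \<forall>x\<in>Q \<zeta>. \<forall>y\<in>Q \<zeta>. (x, y) \<noteq> (0, 0) \<longrightarrow> Im (c * (x - \<xi> * y)) > 0"
proof -
  obtain t where t: "\<zeta> = cis t" using mu_cis[OF \<zeta>] by blast
  obtain l where l: "l < e" "\<xi> = \<omega> ^ (n * l)" using mu_e_power[OF \<xi>(1)] by blast
  then have "l > 0" using \<xi> by (cases l) auto
  have l': "\<xi> = cis (2 * pi * real n * real l / real M)" by (simp add: l zeta_power mult.assoc)
  \<comment> \<open>The mean of the middle directions of the two sectors: the vertices have angles
    \<open>2 * pi * k / M + t\<close> with \<open>k\<close> from 1 to \<open>n\<close>, and the copy
    is turned by \<open>n * l\<close> steps.\<close>
  define \<theta> where "\<theta> = 2 * pi / real M * ((real n + 1) / 2 + real n * real l / 2) + t"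
  define c where "c = - cis (- \<theta>)"
  have bound: "pi / real M * x < pi" if "x < real n * real e" for x
  proof -
    have "x / real M < 1" using that M_pos by (simp add: mult.commute)
    then show ?thesis using mult_strict_left_mono[of "x / real M" 1 pi] by simp
  qed
  have x: "Im (c * polygon_vertex e n \<zeta> k) > 0" if k: "k > 0" "k \<le> n" for k
  proof -
    have "Im (c * polygon_vertex e n \<zeta> k) = sin (\<theta> - (2 * pi * real k / real M + t))"
      unfolding c_def t polygon_vertex_cis[OF k(1)] by (simp add: sin_diff algebra_simps)
    also have "\<theta> - (2 * pi * real k / real M + t) = pi / real M * (real n + 1 + real n * real l - 2 * real k)"
      using M_pos by (simp add: \<theta>_def field_simps)
    also have "sin \<dots> > 0"
    proof (rule sin_gt_zero)
      have "real n * 1 \<le> real n * real l" using \<open>l > 0\<close> by (intro mult_left_mono) auto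
      then have "real n + 1 + real n * real l - 2 * real k > 0" using k by linarith
      then show "0 < pi / real M * (real n + 1 + real n * real l - 2 * real k)"
        using M_pos by (intro mult_pos_pos divide_pos_pos) auto
      have "real n * (real l + 1) \<le> real n * real e" using l by (intro mult_left_mono) auto
      then show "pi / real M * (real n + 1 + real n * real l - 2 * real k) < pi"
        using k by (intro bound) (simp add: algebra_simps)
    qed
    finally show ?thesis .
  qed
  have y: "Im (c * (\<xi> * polygon_vertex e n \<zeta> k)) < 0" if k: "k > 0" "k \<le> n" for k
  proof -
    have "\<xi> * polygon_vertex e n \<zeta> k = cis (2 * pi * real n * real l / real M + (2 * pi * real k / real M + t))"
      unfolding l' t polygon_vertex_cis[OF k(1)] by (rule cis_mult)
    then have "Im (c * (\<xi> * polygon_vertex e n \<zeta> k)) =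
        - sin (2 * pi * real n * real l / real M + (2 * pi * real k / real M + t) - \<theta>)"
      unfolding c_def by (simp add: sin_diff algebra_simps)
    also have "2 * pi * real n * real l / real M + (2 * pi * real k / real M + t) - \<theta>
       = pi / real M * (real n * real l - real n - 1 + 2 * real k)"
      using M_pos by (simp add: \<theta>_def field_simps)
    also have "- sin \<dots> < 0"
    proof -
      have "real n * 1 \<le> real n * real l" using \<open>l > 0\<close> by (intro mult_left_mono) auto
      then have "real n * real l - real n - 1 + 2 * real k > 0" using k by linarith
      then have "0 < pi / real M * (real n * real l - real n - 1 + 2 * real k)"
        using M_pos by (intro mult_pos_pos divide_pos_pos) auto
      moreover have "real n * (real l + 1) \<le> real n * real e" using l by (intro mult_left_mono) auto
      then have "pi / real M * (real n * real l - real n - 1 + 2 * real k) < pi"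
        using k by (intro bound) (simp add: algebra_simps)
      ultimately show ?thesis using sin_gt_zero by simp
    qed
    finally show ?thesis .
  qed
  have "Im (c * (x - \<xi> * y)) > 0" if h: "x \<in> Q \<zeta>" "y \<in> Q \<zeta>" "(x, y) \<noteq> (0, 0)" for x y
  proof -
    obtain i j where ij: "i \<le> n" "j \<le> n" "x = polygon_vertex e n \<zeta> i" "y = polygon_vertex e n \<zeta> j"
      using h(1,2) unfolding polygon_def by auto
    have z: "polygon_vertex e n \<zeta> 0 = 0" by (simp add: polygon_vertex_def)
    have "i > 0 \<or> j > 0" using h(3) ij z by (cases "i = 0"; cases "j = 0") auto
    moreover have "Im (c * x) \<ge> 0" "i > 0 \<Longrightarrow> Im (c * x) > 0" using x[of i] ij z by (cases "i > 0"; simp)+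
    moreover have "Im (c * (\<xi> * y)) \<le> 0" "j > 0 \<Longrightarrow> Im (c * (\<xi> * y)) < 0" using y[of j] ij z by (cases "j > 0"; simp)+
    ultimately have "Im (c * x) - Im (c * (\<xi> * y)) > 0" by linarith
    then show ?thesis by (simp add: algebra_simps)
  qed
  then show ?thesis by blast
qed

end

section \<open>Symmetric partitions\<close>

context ee
begin

sublocale R: convex_polygon "\<lambda>k. \<omega> ^ k" M
  by (rule convex_polygon_mu[OF M_pos])

lemma R_S [simp]: "R.S = mu M"
  by (rule S_mu[OF M_pos])

lemma mu_e_M: "\<xi> \<in> mu e \<Longrightarrow> \<xi> \<in> mu M"
  by (simp add: mu_def power_mult)

lemma mu_M_nonzero: "z \<in> mu M \<Longrightarrow> z \<noteq> 0"
  by (rule mu_nonzero[OF M_pos])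

lemma zero_notin_mu [simp]: "0 \<notin> mu M"
  using mu_M_nonzero by blast

lemma finite_mu0: "finite (mu0 M)"
  using finite_mu[OF M_pos] by simp

lemma base_point_pos: "0 < j \<Longrightarrow> j \<le> n \<Longrightarrow> base_point e n j = \<omega> ^ j"
  by (simp add: base_point_def)

lemma omega_in_mu: "\<omega> ^ j \<in> mu M"
  by (rule zeta_in_mu[OF M_pos])

lemma omega_M: "\<omega> ^ M = 1"
  using omega_in_mu[of 1] by (simp add: mu_def)

lemma omega_nonzero: "\<omega> ^ j \<noteq> 0"
  using mu_M_nonzero[OF omega_in_mu] .

lemma omega_equiv_unique:
  assumes "\<omega> ^ i = \<xi> * \<omega> ^ j" "\<xi> \<in> mu e" "0 < i" "i \<le> n" "0 < j" "j \<le> n"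
  shows "i = j"
proof -
  have "(\<omega> ^ i) ^ e = (\<omega> ^ j) ^ e" using assms(1,2) by (simp add: mu_def power_mult_distrib)
  then have "\<omega> ^ (i * e) = \<omega> ^ (j * e)" by (simp add: power_mult)
  \<comment> \<open>The exponents run from 1 to \<open>n\<close>; lowering each by one keeps its
    multiple by \<open>e\<close> below \<open>M\<close>, where the powers of \<omega> are
    distinct.\<close>
  moreover have "i * e = (i - 1) * e + e" "j * e = (j - 1) * e + e"
    using assms by (cases i; cases j; simp)+
  ultimately have "\<omega> ^ ((i - 1) * e) * \<omega> ^ e = \<omega> ^ ((j - 1) * e) * \<omega> ^ e" by (metis power_add)
  then have eq: "\<omega> ^ ((i - 1) * e) = \<omega> ^ ((j - 1) * e)" using omega_nonzero[of e] by (metis mult_right_cancel)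
  have lt: "(k - 1) * e < M" if "0 < k" "k \<le> n" for k
  proof -
    have "(k - 1) * e < n * e" using that e_pos by (intro mult_strict_right_mono) auto
    then show ?thesis by (simp add: mult.commute)
  qed
  have "(i - 1) * e \<in> {..<M}" "(j - 1) * e \<in> {..<M}" using lt assms by (simp_all only: lessThan_iff)
  then have "(i - 1) * e = (j - 1) * e" by (rule inj_onD[OF inj_on_zeta[OF M_pos] eq])
  then show ?thesis using e_pos assms by auto
qed

lemma mu_representative:
  assumes "z \<in> mu M"
  shows "\<exists>r c. 0 < r \<and> r \<le> n \<and> c \<in> mu e \<and> z = c * \<omega> ^ r"
proof -
  obtain k where k: "z = \<omega> ^ k" using assms mu_eq_powers[OF M_pos] by auto
  \<comment> \<open>Coordinates are numbered from 1 to \<open>n\<close>, so the remainder 0 is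
    replaced by \<open>n\<close>.\<close>
  define r where "r = (if k mod n = 0 then n else k mod n)"
  have r: "0 < r" "r \<le> n" using n_pos by (auto simp: r_def intro: less_imp_le)
  have "\<omega> ^ (k * e) = \<omega> ^ (M * (k div n) + (k mod n) * e)"
    by (metis add_mult_distrib mult.assoc mult.commute div_mult_mod_eq)
  then have "\<omega> ^ (k * e) = \<omega> ^ ((k mod n) * e)" by (simp add: power_add power_mult omega_M[unfolded power_mult])
  also have "\<dots> = \<omega> ^ (r * e)" using omega_M by (simp add: r_def mult.commute)
  finally have "\<omega> ^ k / \<omega> ^ r \<in> mu e" using omega_nonzero[of r] by (simp add: mu_def power_divide flip: power_mult)
  then show ?thesis using r k omega_nonzero[of r] by (intro exI[of _ r] exI[of _ "\<omega> ^ k / \<omega> ^ r"]) simp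
qed

text \<open>The set \<open>mu0 M\<close> has \<open>n + 1\<close> orbits under \<open>mu e\<close>,
  represented by the base coordinates, and pairwise inequivalent values \<open>Y j\<close> meet each
  of them once.\<close>

lemma twisted_baseI:
  assumes Y: "\<And>j. j \<le> n \<Longrightarrow> Y j \<in> mu0 M"
    and inj: "\<And>i j \<xi>. i \<le> n \<Longrightarrow> j \<le> n \<Longrightarrow> i \<noteq> j \<Longrightarrow> \<xi> \<in> mu e \<Longrightarrow> Y i \<noteq> \<xi> * Y j"
  shows "twisted_base e n Y"
proof -
  have "\<exists>r c. r \<le> n \<and> c \<in> mu e \<and> Y j = c * base_point e n r" if "j \<le> n" for j
  proof (cases "Y j = 0")
    case True
    then show ?thesis by (intro exI[of _ 0] exI[of _ 1]) simp
  next
    case False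
    then show ?thesis using mu_representative[of "Y j"] Y[OF that] base_point_pos by auto
  qed
  then obtain r c where rc: "\<And>j. j \<le> n \<Longrightarrow> r j \<le> n \<and> c j \<in> mu e \<and> Y j = c j * base_point e n (r j)"
    by metis
  have inj_r: "inj_on r {..n}"
  proof (rule inj_onI, rule ccontr)
    fix i j assume h: "i \<in> {..n}" "j \<in> {..n}" "r i = r j" "i \<noteq> j"
    then have "c j \<noteq> 0" using rc mu_nonzero[OF e_pos] by auto
    then have "Y i = (c i / c j) * Y j" using rc[of i] rc[of j] h by simp
    then show False using inj[of i j "c i / c j"] h rc mu_divide by auto
  qed
  then have "r ` {..n} = {..n}" using rc by (intro endo_inj_surj) auto
  then obtain j0 where j0: "j0 \<le> n" "r j0 = 0" by (metis atMost_iff imageE le0)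
  define s where "s j = (if j \<le> n then r j else j)" for j
  define p where "p = (\<Prod>i\<in>{..n} - {j0}. c i)"
  have p: "p \<in> mu e" using rc unfolding p_def mu_def by (simp add: prod_power_distrib)
  \<comment> \<open>The coordinate with value 0 can be multiplied by anything; it absorbs the
    determinant.\<close>
  define d where "d j = (if j = j0 then inverse p else c j)" for j
  have "s permutes {..n}"
  proof (rule bij_imp_permutes)
    show "bij_betw s {..n} {..n}"
      using inj_r \<open>r ` {..n} = {..n}\<close> unfolding bij_betw_def s_def inj_on_def by auto
  qed (simp add: s_def)
  moreover have "\<forall>i\<le>n. d i \<in> mu e" using rc mu_inverse[OF p] by (simp add: d_def)
  moreover have "(\<Prod>i\<le>n. d i) = 1"
  proof -
    have "(\<Prod>i\<le>n. d i) = d j0 * (\<Prod>i\<in>{..n} - {j0}. d i)" using j0 by (intro prod.remove) auto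
    also have "(\<Prod>i\<in>{..n} - {j0}. d i) = p" unfolding p_def by (intro prod.cong) (auto simp: d_def)
    finally show ?thesis using mu_nonzero[OF e_pos p] by (simp add: d_def)
  qed
  moreover have "\<forall>i\<le>n. Y i = d i * base_point e n (s i)"
    using rc j0 by (auto simp: s_def d_def)
  ultimately show ?thesis unfolding twisted_base_def by blast
qed

section \<open>Rotations, invariant partitions and long parts\<close>

lemma rotate_hull: "convex hull ((*) c ` p) = (*) c ` (convex hull p)" for c :: complex
  by (rule convex_hull_linear_image[symmetric]) (simp add: linear_iff algebra_simps)

lemma rotate_mu: "c \<in> mu M \<Longrightarrow> (*) c ` mu M = mu M"
proof
  assume c: "c \<in> mu M"
  show "(*) c ` mu M \<subseteq> mu M" using mu_mult[OF c] by auto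
  show "mu M \<subseteq> (*) c ` mu M"
  proof
    fix z assume "z \<in> mu M"
    then have "z / c \<in> mu M" "z = c * (z / c)" using c mu_divide mu_M_nonzero by auto
    then show "z \<in> (*) c ` mu M" by blast
  qed
qed

lemma
  assumes c: "c \<in> mu M" and w: "w \<in> NCP (mu M)"
  shows rotate_NCP: "(`) ((*) c) ` w \<in> NCP (mu M)"
    and rotate_part: "z \<in> mu M \<Longrightarrow> part ((`) ((*) c) ` w) (c * z) = (*) c ` part w z"
    and rotate_sigma: "z \<in> mu M \<Longrightarrow> sigma ((`) ((*) c) ` w) (c * z) = c * sigma w z"
proof -
  have c0: "c \<noteq> 0" by (rule mu_M_nonzero[OF c])
  then have inj: "inj_on ((*) c) A" for A by (simp add: inj_on_def)
  have P: "partition_on (mu M) w" using w by (simp add: NCP_def)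
  have P': "partition_on (mu M) ((`) ((*) c) ` w)"
    using image_partition[OF P inj] rotate_mu[OF c] by simp
  show N: "(`) ((*) c) ` w \<in> NCP (mu M)" unfolding NCP_def
  proof (intro CollectI conjI P' ballI impI)
    fix p q assume "p \<in> (`) ((*) c) ` w" "q \<in> (`) ((*) c) ` w" "convex hull p \<inter> convex hull q \<noteq> {}"
    then obtain p' q' where *: "p' \<in> w" "q' \<in> w" "p = (*) c ` p'" "q = (*) c ` q'"
      "convex hull ((*) c ` p') \<inter> convex hull ((*) c ` q') \<noteq> {}" by blast
    then have "convex hull p' \<inter> convex hull q' \<noteq> {}" unfolding rotate_hull using c0 by auto
    then have "p' = q'" using * w by (simp add: NCP_def)
    then show "p = q" using * by simp
  qed
  assume z: "z \<in> mu M"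
  show pt: "part ((`) ((*) c) ` w) (c * z) = (*) c ` part w z"
    by (rule part_eq[OF P']) (use part_in[OF P z] part_self[OF P z] in auto)
  have sub: "part w z \<subseteq> mu M" and zp: "z \<in> part w z" using part_subset[OF P z] part_self[OF P z] by auto
  show "sigma ((`) ((*) c) ` w) (c * z) = c * sigma w z"
  proof (cases "part w z = {z}")
    case True then show ?thesis unfolding sigma_def pt by simp
  next
    case False
    note s = R.ccw_succ(1,2)[unfolded R_S, OF sub zp]
    show ?thesis unfolding sigma_def pt
    proof (rule R.ccw_succI)
      show "(*) c ` part w z \<subseteq> R.S" using sub mu_mult[OF c] by auto
      show "c * ccw_succ (part w z) z \<noteq> c * z" using s(2)[OF False] c0 by simp
      fix y assume "y \<in> (*) c ` part w z" "y \<noteq> c * z" "y \<noteq> c * ccw_succ (part w z) z"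
      then obtain y' where y': "y = c * y'" "y' \<in> part w z" "y' \<noteq> z" "y' \<noteq> ccw_succ (part w z) z" by auto
      then show "ccw (c * z) (c * ccw_succ (part w z) z) y"
        using R.ccw_succ(3)[unfolded R_S, OF sub zp y'(2-4)] norm_mu[OF M_pos c] by (simp add: orient_mult)
    qed (use zp s in auto)
  qed
qed

lemma NCP_e1_D:
  assumes "w \<in> NCP_e1 e n"
  shows "w \<in> NCP (mu M)" "partition_on (mu M) w" "\<xi> \<in> mu e \<Longrightarrow> (`) ((*) \<xi>) ` w = w"
    and "\<xi> \<in> mu e \<Longrightarrow> z \<in> mu M \<Longrightarrow> part w (\<xi> * z) = (*) \<xi> ` part w z"
    and "\<xi> \<in> mu e \<Longrightarrow> z \<in> mu M \<Longrightarrow> sigma w (\<xi> * z) = \<xi> * sigma w z"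
proof -
  show 1: "w \<in> NCP (mu M)" and 3: "\<xi> \<in> mu e \<Longrightarrow> (`) ((*) \<xi>) ` w = w"
    using assms by (auto simp: NCP_e1_def)
  then show "partition_on (mu M) w" by (simp add: NCP_def)
  assume \<xi>: "\<xi> \<in> mu e" and z: "z \<in> mu M"
  show "part w (\<xi> * z) = (*) \<xi> ` part w z" "sigma w (\<xi> * z) = \<xi> * sigma w z"
    using rotate_part[OF mu_e_M[OF \<xi>] 1 z] rotate_sigma[OF mu_e_M[OF \<xi>] 1 z] 3[OF \<xi>] by simp_all
qed

lemma long_part_invariant:
  assumes "w \<in> NCP_e1 e n" "a \<in> w" "0 \<in> convex hull a" "\<xi> \<in> mu e"
  shows "(*) \<xi> ` a = a"
proof -
  have "(*) \<xi> ` a \<in> w" using NCP_e1_D(3)[OF assms(1,4)] assms(2) by blast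
  moreover have "0 \<in> convex hull ((*) \<xi> ` a)" unfolding rotate_hull using assms(3) by force
  ultimately show ?thesis using assms NCP_e1_D(1)[OF assms(1)] unfolding NCP_def by blast
qed

lemma long_part:
  assumes "w \<in> NCP_e1 e n" "long w"
  shows "long_part w \<in> w" "0 \<in> convex hull (long_part w)"
    and "a \<in> w \<Longrightarrow> 0 \<in> convex hull a \<Longrightarrow> a = long_part w"
proof -
  have "\<exists>!a. a \<in> w \<and> 0 \<in> convex hull a"
    using assms NCP_e1_D(1)[OF assms(1)] unfolding long_def NCP_def by blast
  from theI'[OF this] this show "long_part w \<in> w" "0 \<in> convex hull (long_part w)"
    "a \<in> w \<Longrightarrow> 0 \<in> convex hull a \<Longrightarrow> a = long_part w"
    unfolding long_part_def by blast+
qed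

lemma star:
  assumes w: "w \<in> NCP_e1 e n"
  shows "star w \<in> NCP_ee e n" "flat e n (star w) = w" "symmetric e n (star w)"
proof -
  note P = NCP_e1_D(2)[OF w]
  have sub: "p \<subseteq> mu M" "p \<noteq> {}" if "p \<in> w" for p using P that by (auto simp: partition_on_def)
  have ne: "{} \<notin> w" using P by (simp add: partition_on_def)
  have d: "p \<inter> q = {}" if "p \<in> w" "q \<in> w" "p \<noteq> q" for p q
    using P that by (auto simp: partition_on_def disjoint_def)
  have sub0: "0 \<notin> p" if "p \<in> w" for p using sub(1)[OF that] by auto
  have ncp: "p = q" if "p \<in> w" "q \<in> w" "convex hull p \<inter> convex hull q \<noteq> {}" for p q
    using NCP_e1_D(1)[OF w] that unfolding NCP_def by blast
  have "star w \<in> NCP (mu0 M) \<and> flat e n (star w) = w \<and> ({0} \<in> star w \<or> long w)"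
  proof (cases "long w")
    case True
    define a where "a = long_part w"
    have a: "a \<in> w" "0 \<in> convex hull a" using long_part(1,2)[OF w True] unfolding a_def by auto
    have st: "star w = insert (insert 0 a) (w - {a})" using True by (simp add: star_def a_def)
    have hull: "convex hull (insert 0 a) = convex hull a" by (rule hull_redundant[OF a(2)])
    have "partition_on (mu0 M) (star w)" unfolding partition_on_def disjoint_def st
    proof (intro conjI ballI impI)
      show "\<Union> (insert (insert 0 a) (w - {a})) = mu0 M" using P a by (auto simp: partition_on_def)
      show "{} \<notin> insert (insert 0 a) (w - {a})" using sub by auto
      fix p q assume "p \<in> insert (insert 0 a) (w - {a})" "q \<in> insert (insert 0 a) (w - {a})" "p \<noteq> q"
      then consider "p = insert 0 a" "q \<in> w" "q \<noteq> a" | "q = insert 0 a" "p \<in> w" "p \<noteq> a"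
        | "p \<in> w" "q \<in> w" "p \<noteq> q" by auto
      then show "p \<inter> q = {}"
        by cases (use d[OF a(1), of q] d[OF a(1), of p] d[of p q] sub0[of p] sub0[of q] in auto)
    qed
    moreover have "p = q" if h: "p \<in> star w" "q \<in> star w" "convex hull p \<inter> convex hull q \<noteq> {}" for p q
    proof -
      consider "p = insert 0 a" "q = insert 0 a" | "p = insert 0 a" "q \<in> w" "q \<noteq> a"
        | "q = insert 0 a" "p \<in> w" "p \<noteq> a" | "p \<in> w" "q \<in> w"
        using h(1,2) unfolding st by auto
      then show ?thesis
      proof cases
        case 2 then show ?thesis using ncp[OF a(1), of q] h(3) hull by simp
      next
        case 3 then show ?thesis using ncp[OF _ a(1), of p] h(3) hull by simp
      next
        case 4 then show ?thesis using ncp h(3) by simp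
      qed simp
    qed
    moreover have "flat e n (star w) = w"
    proof -
      have "mu M \<inter> insert 0 a = a" "\<And>p. p \<in> w \<Longrightarrow> mu M \<inter> p = p" using sub a by auto
      then have "(\<inter>) (mu M) ` star w = w" unfolding st using a by auto
      then show ?thesis using ne by (auto simp: flat_def restr_def)
    qed
    ultimately show ?thesis using True by (simp add: NCP_def)
  next
    case False
    have st: "star w = insert {0} w" using False by (simp add: star_def)
    have "partition_on (mu0 M) (star w)" unfolding partition_on_def disjoint_def st
    proof (intro conjI ballI impI)
      show "\<Union> (insert {0} w) = mu0 M" using P by (auto simp: partition_on_def)
      show "{} \<notin> insert {0} w" using sub by auto
      fix p q assume "p \<in> insert {0} w" "q \<in> insert {0} w" "p \<noteq> q"
      then show "p \<inter> q = {}" using d[of p q] sub0 by blast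
    qed
    moreover have "p = q" if "p \<in> star w" "q \<in> star w" "convex hull p \<inter> convex hull q \<noteq> {}" for p q
      using that ncp False unfolding st long_def by auto
    moreover have "flat e n (star w) = w"
    proof -
      have "mu M \<inter> {0} = {}" "\<And>p. p \<in> w \<Longrightarrow> mu M \<inter> p = p" using sub by auto
      then have "(\<inter>) (mu M) ` star w = insert {} w" unfolding st by auto
      then show ?thesis using ne by (auto simp: flat_def restr_def)
    qed
    ultimately show ?thesis by (auto simp: NCP_def st)
  qed
  then show "star w \<in> NCP_ee e n" "flat e n (star w) = w" "symmetric e n (star w)"
    using w by (auto simp: NCP_ee_def symmetric_def short_symmetric_def long_symmetric_def)
qed

lemma NCP_ee_D:
  assumes "u \<in> NCP_ee e n"
  shows "partition_on (mu0 M) u" "flat e n u \<in> NCP_e1 e n" "u \<in> NCP (mu0 M)"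
    and "z \<in> mu M \<Longrightarrow> part (flat e n u) z = part u z - {0}"
proof -
  show P: "partition_on (mu0 M) u" and F: "flat e n u \<in> NCP_e1 e n" "u \<in> NCP (mu0 M)"
    using assms by (auto simp: NCP_ee_def NCP_def)
  assume z: "z \<in> mu M"
  have "part (flat e n u) z = part u z \<inter> mu M"
    using part_restr[OF P _ _ z] NCP_e1_D(2)[OF F(1)] unfolding flat_def by auto
  moreover have "part u z \<subseteq> mu0 M" using part_subset[OF P] z by auto
  ultimately show "part (flat e n u) z = part u z - {0}" by auto
qed

lemma asymmetric_iff: "asymmetric e n u \<longleftrightarrow> \<not> symmetric e n u"
  by (auto simp: asymmetric_def symmetric_def short_symmetric_def long_symmetric_def)

text \<open>In the long case 0 is removed from its part, and in the short case it is alone. The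
  strands at nonzero points of a symmetric partition therefore see only the flat partition of the
  regular polygon.\<close>

lemma symmetric_vertices:
  assumes u: "u \<in> NCP_ee e n" and sym: "symmetric e n u" and z: "z \<in> mu M"
  shows "vertices e n u z = part (flat e n u) z"
proof -
  note P = NCP_ee_D(1)[OF u]
  show ?thesis
  proof (cases "long_symmetric e n u \<and> 0 \<in> part u z")
    case True then show ?thesis using NCP_ee_D(4)[OF u z] by (simp add: vertices_def)
  next
    case False
    have "0 \<notin> part u z"
    proof
      assume 0: "0 \<in> part u z"
      then have "{0} \<in> u" using False sym by (auto simp: symmetric_def short_symmetric_def)
      then have "part u 0 = {0}" by (intro part_eq[OF P]) auto
      moreover have "part u 0 = part u z" by (rule part_cong[OF P _ 0]) (use z in simp)
      ultimately have "part u z = {0}" by simp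
      then show False using part_self[OF P, of z] z mu_M_nonzero by auto
    qed
    then show ?thesis using False NCP_ee_D(4)[OF u z] by (auto simp: vertices_def)
  qed
qed

lemma strand_bpath:
  assumes "card (vertices e n u z) \<le> 1 \<Longrightarrow> succ_in e n u z = z"
  shows "strand e n \<epsilon> u z t =
    bpath (\<epsilon> * of_bool (card (vertices e n u z) = 2)) z (succ_in e n u z) t"
proof -
  consider "card (vertices e n u z) \<le> 1" | "card (vertices e n u z) = 2" | "card (vertices e n u z) \<ge> 3"
    by linarith
  then show ?thesis
  proof cases
    case 1 then show ?thesis using assms by (simp add: strand_def)
  next
    case 2 then show ?thesis by (simp add: strand_def Let_def bpath_def bulge_def mult_ac)
  next
    case 3 then show ?thesis by (simp add: strand_def bpath_def bulge_def)
  qed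
qed

definition sym_end :: "complex set set \<Rightarrow> nat \<Rightarrow> complex" where
  "sym_end u j = (if j = 0 then 0 else sigma (flat e n u) (\<omega> ^ j))"

definition sym_curv :: "complex set set \<Rightarrow> nat \<Rightarrow> real" where
  "sym_curv u j = (if j = 0 then 0 else of_bool (card (part (flat e n u) (\<omega> ^ j)) = 2))"

lemma symmetric_strands:
  assumes u: "u \<in> NCP_ee e n" and sym: "symmetric e n u"
  shows "has_strands e n u (sym_end u) (sym_curv u)"
  unfolding has_strands_def
proof (intro allI impI)
  fix \<epsilon> t :: real and j assume j: "j \<le> n"
  note P = NCP_ee_D(1)[OF u] and F = NCP_e1_D(1,2)[OF NCP_ee_D(2)[OF u]]
  have special: "\<not> special e n u j \<xi>" for j \<xi> using sym by (simp add: special_def asymmetric_iff)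
  show "gamma e n \<epsilon> u t j = bpath (\<epsilon> * sym_curv u j) (base_point e n j) (sym_end u j) t"
  proof (cases "j = 0")
    case True
    have "strand e n \<epsilon> u 0 t = 0"
    proof (cases "long_symmetric e n u")
      case True
      then have "succ_in e n u 0 = 0" by (simp add: succ_in_def)
      then show ?thesis using strand_bpath[of u 0] by simp
    next
      case False
      then have "{0} \<in> u" using sym by (auto simp: symmetric_def short_symmetric_def)
      then have "part u 0 = {0}" using part_eq[OF P, of "{0}"] by simp
      then have "vertices e n u 0 = {0}" using False by (simp add: vertices_def)
      then show ?thesis by (simp add: strand_def)
    qed
    then show ?thesis using True by (simp add: gamma_def sym_end_def sym_curv_def)
  next
    case False
    let ?z = "\<omega> ^ j"
    have z: "?z \<in> mu M" "?z \<noteq> 0" using omega_in_mu omega_nonzero by auto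
    note v = symmetric_vertices[OF u sym z(1)]
    have s: "succ_in e n u ?z = sigma (flat e n u) ?z" unfolding succ_in_def v sigma_def by (rule if_not_P) (use z(2) in blast)
    have zp: "?z \<in> part (flat e n u) ?z" by (rule part_self[OF F(2) z(1)])
    have "finite (part (flat e n u) ?z)"
      using part_subset[OF F(2) z(1)] finite_mu[OF M_pos] finite_subset by blast
    then have "card (part (flat e n u) ?z) \<le> 1 \<Longrightarrow> part (flat e n u) ?z = {?z}"
      using zp by (auto simp: card_le_Suc0_iff_eq)
    then have one: "card (vertices e n u ?z) \<le> 1 \<Longrightarrow> succ_in e n u ?z = ?z"
      unfolding s v using R.sigma_fixed[of "flat e n u" ?z] F z by simp
    have no: "(\<exists>\<xi>. special e n u j \<xi>) = False" using special by blast
    have "gamma e n \<epsilon> u t j = strand e n \<epsilon> u ?z t" using False j by (simp add: gamma_def no)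
    then show ?thesis using strand_bpath[OF one, of \<epsilon> t] False j
      by (simp add: s v sym_end_def sym_curv_def base_point_def)
  qed
qed

text \<open>Comparing a strand with its own rotation by \<xi> gives the difference
  \<open>1 - \<xi>\<close> times the strand, so separation from the rotated copy is separation from
  0. For \<open>e = 1\<close> there is only the point 1.\<close>

lemma edge_avoids_zero:
  assumes w: "w \<in> NCP_e1 e n" and z: "z \<in> mu M" and k: "k \<ge> 0" "card (part w z) = 2 \<Longrightarrow> k > 0"
  shows "edge_sep z (sigma w z) (bulge k z (sigma w z))"
proof (cases "e = 1")
  case True
  then have "M = 1" using e1 by simp
  then have "mu M = {1}" by (auto simp: mu_def)
  then have "z = 1" "sigma w z = 1" using z R.sigma_S[of w z] NCP_e1_D(1)[OF w] by auto
  then show ?thesis unfolding edge_sep_def by (auto intro!: exI[of _ \<i>])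
next
  case False
  define \<xi> where "\<xi> = zeta e ^ 1"
  have \<xi>: "\<xi> \<in> mu e" "\<xi> \<noteq> 1"
    using zeta_in_mu[OF e_pos, of 1] inj_onD[OF inj_on_zeta[OF e_pos], of 1 0] False e_pos
    by (auto simp: \<xi>_def)
  have z': "\<xi> * z \<in> mu M" "z \<noteq> \<xi> * z" using mu_mult[OF mu_e_M[OF \<xi>(1)] z] \<xi> mu_M_nonzero[OF z] by auto
  have "edge_sep (z - \<xi> * z) (sigma w z - sigma w (\<xi> * z))
     (bulge k z (sigma w z) - bulge k (\<xi> * z) (sigma w (\<xi> * z)))"
    by (rule R.sigma_edge_sep) (use w z z' k NCP_e1_D in auto)
  then have "edge_sep ((1 - \<xi>) * z) ((1 - \<xi>) * sigma w z) ((1 - \<xi>) * bulge k z (sigma w z))"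
    unfolding NCP_e1_D(5)[OF w \<xi>(1) z] by (simp add: algebra_simps flip: bulge_mult)
  moreover have "inverse (1 - \<xi>) * ((1 - \<xi>) * x) = x" for x using \<xi> by (simp flip: mult.assoc)
  ultimately show ?thesis using edge_sep_mult[of _ _ _ "inverse (1 - \<xi>)"] \<xi> by (metis inverse_nonzero_iff_nonzero right_minus_eq)
qed

lemma tri_avoids_zero:
  assumes u: "u \<in> NCP_e1 e n" and v: "v \<in> NCP_e1 e n" and uv: "refines (mu M) u v"
    and z: "z \<in> mu M" and k: "ku \<ge> 0" "kw \<ge> 0" "kv \<ge> 0" "card (part v z) = 2 \<Longrightarrow> kv > 0"
  shows "separated z (sigma u z) (sigma v z) (bulge ku z (sigma u z))
    (bulge kw (sigma u z) (sigma v z)) (bulge kv z (sigma v z))"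
proof (cases "e = 1")
  case True
  then have "M = 1" using e1 by simp
  then have "mu M = {1}" by (auto simp: mu_def)
  then have "z = 1" "sigma u z = 1" "sigma v z = 1"
    using z R.sigma_S[of u z] R.sigma_S[of v z] NCP_e1_D(1)[OF u] NCP_e1_D(1)[OF v] by auto
  then show ?thesis by (intro separatedI_strict[of \<i>]) auto
next
  case False
  define \<xi> where "\<xi> = zeta e ^ 1"
  have \<xi>: "\<xi> \<in> mu e" "\<xi> \<noteq> 1"
    using zeta_in_mu[OF e_pos, of 1] inj_onD[OF inj_on_zeta[OF e_pos], of 1 0] False e_pos
    by (auto simp: \<xi>_def)
  have z': "\<xi> * z \<in> mu M" "z \<noteq> \<xi> * z" using mu_mult[OF mu_e_M[OF \<xi>(1)] z] \<xi> mu_M_nonzero[OF z] by auto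
  have cv: "card (part v (\<xi> * z)) = card (part v z)"
    unfolding NCP_e1_D(4)[OF v \<xi>(1) z] using mu_nonzero[OF e_pos \<xi>(1)] by (intro card_image) (simp add: inj_on_def)
  have "separated (z - \<xi> * z) (sigma u z - sigma u (\<xi> * z)) (sigma v z - sigma v (\<xi> * z))
     (bulge ku z (sigma u z) - bulge ku (\<xi> * z) (sigma u (\<xi> * z)))
     (bulge kw (sigma u z) (sigma v z) - bulge kw (sigma u (\<xi> * z)) (sigma v (\<xi> * z)))
     (bulge kv z (sigma v z) - bulge kv (\<xi> * z) (sigma v (\<xi> * z)))"
    by (rule R.sigma_separated) (use u v uv z z' k cv NCP_e1_D in auto)
  then have "separated ((1 - \<xi>) * z) ((1 - \<xi>) * sigma u z) ((1 - \<xi>) * sigma v z)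
     ((1 - \<xi>) * bulge ku z (sigma u z)) ((1 - \<xi>) * bulge kw (sigma u z) (sigma v z))
     ((1 - \<xi>) * bulge kv z (sigma v z))"
    unfolding NCP_e1_D(5)[OF u \<xi>(1) z] NCP_e1_D(5)[OF v \<xi>(1) z] by (simp add: algebra_simps flip: bulge_mult)
  moreover have "inverse (1 - \<xi>) * ((1 - \<xi>) * x) = x" for x using \<xi> by (simp flip: mult.assoc)
  ultimately show ?thesis using separated_mult[of _ _ _ _ _ _ "inverse (1 - \<xi>)"] \<xi> by (metis inverse_nonzero_iff_nonzero right_minus_eq)
qed

end

section \<open>Products of symmetric braids\<close>

context ee
begin

lemma part_rotate_card:
  assumes "w \<in> NCP_e1 e n" "z \<in> mu M" "\<xi> \<in> mu e"
  shows "card (part w (\<xi> * z)) = card (part w z)"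
  unfolding NCP_e1_D(4)[OF assms(1,3,2)] using mu_nonzero[OF e_pos assms(3)]
  by (intro card_image) (simp add: inj_on_def)

lemma omega_distinct:
  assumes "i \<le> n" "j \<le> n" "i \<noteq> j" "0 < i" "0 < j" "\<xi> \<in> mu e"
  shows "\<omega> ^ i \<noteq> \<xi> * \<omega> ^ j"
  using omega_equiv_unique[of i \<xi> j] assms by auto

text \<open>Multiplying a strand by \<xi> gives the strand at the rotated point, since successors
  commute with rotations. All hyperplane conditions thus become statements about two points of the
  regular polygon, or about one point and 0.\<close>

lemma
  assumes u: "u \<in> NCP_ee e n" and sym: "symmetric e n u"
  shows symmetric_regular: "\<forall>\<^sub>F \<epsilon> in at_right 0. regular_at e n u \<epsilon>"
    and symmetric_twisted: "twisted_base e n (sym_end u)"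
proof -
  note F = NCP_ee_D(2)[OF u] and N = NCP_e1_D(1)[OF NCP_ee_D(2)[OF u]]
  have \<omega>: "\<xi> * \<omega> ^ j \<in> mu M" if "\<xi> \<in> mu e" for \<xi> j using mu_mult[OF mu_e_M[OF that] omega_in_mu] .
  have avoid: "edge_sep (\<omega> ^ j) (sym_end u j) (bulge (sym_curv u j) (\<omega> ^ j) (sym_end u j))" if "0 < j" for j
    using edge_avoids_zero[OF F omega_in_mu[of j], of "sym_curv u j"] that
    by (simp add: sym_end_def sym_curv_def)
  show "\<forall>\<^sub>F \<epsilon> in at_right 0. regular_at e n u \<epsilon>"
  proof (rule eventually_regular[OF e_pos symmetric_strands[OF u sym]])
    fix i j \<xi> assume h: "i \<le> n" "j \<le> n" "i \<noteq> j" "\<xi> \<in> mu e"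
    consider "i = 0" "0 < j" | "j = 0" "0 < i" | "0 < i" "0 < j" using h(3) by auto
    then show "edge_sep (base_point e n i - \<xi> * base_point e n j) (sym_end u i - \<xi> * sym_end u j)
      (bulge (sym_curv u i) (base_point e n i) (sym_end u i)
       - \<xi> * bulge (sym_curv u j) (base_point e n j) (sym_end u j))"
    proof cases
      case 1
      have "- \<xi> \<noteq> 0" using mu_nonzero[OF e_pos h(4)] by simp
      from edge_sep_mult[OF avoid[OF 1(2)] this] show ?thesis
        using 1 h by (simp add: sym_end_def base_point_pos)
    next
      case 2
      from avoid[OF 2(2)] show ?thesis using 2 h by (simp add: sym_end_def base_point_pos)
    next
      case 3
      have "edge_sep (\<omega> ^ i - \<xi> * \<omega> ^ j) (sigma (flat e n u) (\<omega> ^ i) - sigma (flat e n u) (\<xi> * \<omega> ^ j))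
        (bulge (sym_curv u i) (\<omega> ^ i) (sigma (flat e n u) (\<omega> ^ i))
         - bulge (sym_curv u j) (\<xi> * \<omega> ^ j) (sigma (flat e n u) (\<xi> * \<omega> ^ j)))"
        by (rule R.sigma_edge_sep)
          (use N omega_in_mu \<omega> h 3 omega_distinct in \<open>auto simp: sym_curv_def\<close>)
      then show ?thesis using 3 h
        by (simp add: base_point_pos sym_end_def bulge_mult NCP_e1_D(5)[OF F h(4) omega_in_mu])
    qed
  qed
  show "twisted_base e n (sym_end u)"
  proof (rule twisted_baseI)
    show "sym_end u j \<in> mu0 M" for j
      using R.sigma_S[of "flat e n u"] N omega_in_mu by (auto simp: sym_end_def)
    fix i j \<xi> assume h: "i \<le> n" "j \<le> n" "i \<noteq> j" "\<xi> \<in> mu e"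
    have s: "sigma (flat e n u) (\<omega> ^ k) \<noteq> 0" for k
      using R.sigma_S[of "flat e n u" "\<omega> ^ k"] N omega_in_mu mu_M_nonzero by auto
    consider "i = 0" "0 < j" | "j = 0" "0 < i" | "0 < i" "0 < j" using h(3) by auto
    then show "sym_end u i \<noteq> \<xi> * sym_end u j"
    proof cases
      case 3
      show ?thesis
      proof
        assume "sym_end u i = \<xi> * sym_end u j"
        then have "sigma (flat e n u) (\<omega> ^ i) = sigma (flat e n u) (\<xi> * \<omega> ^ j)"
          using 3 by (simp add: sym_end_def NCP_e1_D(5)[OF F h(4) omega_in_mu])
        then have "\<omega> ^ i = \<xi> * \<omega> ^ j" using R.sigma_inj[of "flat e n u"] N omega_in_mu \<omega>[OF h(4)] by simp
        then show False using omega_distinct[OF h(1-3) 3 h(4)] by simp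
      qed
    qed (use s mu_nonzero[OF e_pos h(4)] in \<open>auto simp: sym_end_def\<close>)
  qed
qed

lemma flat_refines:
  assumes "u \<in> NCP_ee e n" "v \<in> NCP_ee e n" "refines (mu0 M) u v"
  shows "refines (mu M) (flat e n u) (flat e n v)"
  using restr_refines[OF assms(3), of "mu M"] NCP_e1_D(2)[OF NCP_ee_D(2)[OF assms(1)]]
    NCP_e1_D(2)[OF NCP_ee_D(2)[OF assms(2)]] unfolding flat_def by auto

text \<open>The rotated complement solves the defining equation again, because the successors of
  \<open>u\<close> and \<open>v\<close> commute with rotations; uniqueness does the rest.\<close>

lemma compl_11_NCP_e1:
  assumes u: "u \<in> NCP_e1 e n" and v: "v \<in> NCP_e1 e n" and uv: "refines (mu M) u v"
  shows "compl_11 M u v \<in> NCP_e1 e n"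
proof -
  note C = compl_11[OF M_pos NCP_e1_D(1)[OF u] NCP_e1_D(1)[OF v] uv]
  let ?w = "compl_11 M u v"
  have "(`) ((*) \<xi>) ` ?w = ?w" if \<xi>: "\<xi> \<in> mu e" for \<xi>
  proof (rule C(3)[symmetric])
    note rot = rotate_NCP[OF mu_e_M[OF \<xi>] C(1)] rotate_sigma[OF mu_e_M[OF \<xi>] C(1)]
    show "(`) ((*) \<xi>) ` ?w \<in> NCP (mu M)" by (rule rot(1))
    fix z assume z: "z \<in> mu M"
    define y where "y = z / \<xi>"
    have y: "y \<in> mu M" "z = \<xi> * y"
      using mu_divide[OF z mu_e_M[OF \<xi>]] mu_nonzero[OF e_pos \<xi>] by (auto simp: y_def)
    have "sigma ((`) ((*) \<xi>) ` ?w) (sigma u z) = sigma ((`) ((*) \<xi>) ` ?w) (\<xi> * sigma u y)"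
      unfolding y(2) NCP_e1_D(5)[OF u \<xi> y(1)] ..
    also have "\<dots> = \<xi> * sigma ?w (sigma u y)"
      using rot(2) R.sigma_S[of u y] NCP_e1_D(1)[OF u] y(1) by simp
    also have "\<dots> = \<xi> * sigma v y" using C(2)[OF y(1)] by simp
    also have "\<dots> = sigma v z" unfolding y(2) NCP_e1_D(5)[OF v \<xi> y(1)] ..
    finally show "sigma ((`) ((*) \<xi>) ` ?w) (sigma u z) = sigma v z" .
  qed
  then show ?thesis using C(1) by (auto simp: NCP_e1_def)
qed

text \<open>The twist comes from writing the successor of \<open>\<omega> ^ j\<close> for
  \<open>u\<close> as \<open>c j * \<omega> ^ r j\<close>. Rotations being harmless, separation
  reduces to \<open>R.sigma_separated\<close>, and to \<open>tri_avoids_zero\<close> for the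
  coordinate that stays at 0.\<close>

lemma braid_mult_symmetric:
  assumes u: "u \<in> NCP_ee e n" and v: "v \<in> NCP_ee e n" and w: "w \<in> NCP_ee e n"
    and sym: "symmetric e n u" "symmetric e n v" "symmetric e n w"
    and uv: "refines (mu M) (flat e n u) (flat e n v)"
    and uwv: "\<And>z. z \<in> mu M \<Longrightarrow> sigma (flat e n w) (sigma (flat e n u) z) = sigma (flat e n v) z"
  shows "braid e n u \<otimes>\<^bsub>braid_group e n\<^esub> braid e n w = braid e n v"
proof -
  note FU = NCP_ee_D(2)[OF u] and FV = NCP_ee_D(2)[OF v] and FW = NCP_ee_D(2)[OF w]
  note NU = NCP_e1_D(1)[OF FU] and NV = NCP_e1_D(1)[OF FV] and NW = NCP_e1_D(1)[OF FW]
  let ?u = "sigma (flat e n u)" and ?v = "sigma (flat e n v)" and ?w = "sigma (flat e n w)"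
  have uS: "?u z \<in> mu M" if "z \<in> mu M" for z using R.sigma_S[of "flat e n u" z] NU that by simp
  have "\<exists>r c. 0 < r \<and> r \<le> n \<and> c \<in> mu e \<and> ?u (\<omega> ^ j) = c * \<omega> ^ r" for j
    using mu_representative[OF uS[OF omega_in_mu]] by blast
  then obtain r c where rc: "\<And>j. 0 < r j \<and> r j \<le> n \<and> c j \<in> mu e \<and> ?u (\<omega> ^ j) = c j * \<omega> ^ r j"
    by metis
  have rr: "0 < r j" "r j \<le> n" and cc: "c j \<in> mu e" for j using rc by blast+
  define s where "s j = (if 0 < j \<and> j \<le> n then r j else j)" for j
  define p where "p = (\<Prod>i\<in>{1..n}. c i)"
  \<comment> \<open>The resting coordinate 0 absorbs the determinant.\<close>
  define d where "d j = (if j = 0 then inverse p else c j)" for j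
  have p: "p \<in> mu e" using cc unfolding p_def mu_def by (simp add: prod_power_distrib)
  have inj: "i = j" if "0 < i" "i \<le> n" "0 < j" "j \<le> n" "r i = r j" for i j
  proof -
    have c: "c j \<noteq> 0" "c i / c j \<in> mu e" using cc mu_nonzero[OF e_pos] mu_divide by auto
    have "?u (\<omega> ^ i) = (c i / c j) * ?u (\<omega> ^ j)" using rc[of i] rc[of j] c that(5) by simp
    also have "\<dots> = ?u ((c i / c j) * \<omega> ^ j)" using NCP_e1_D(5)[OF FU c(2) omega_in_mu] by simp
    finally have "\<omega> ^ i = (c i / c j) * \<omega> ^ j"
      using R.sigma_inj[of "flat e n u"] NU omega_in_mu mu_mult[OF mu_e_M[OF c(2)] omega_in_mu] by simp
    then show ?thesis using omega_equiv_unique c that by blast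
  qed
  have perm: "s permutes {..n}"
  proof (rule bij_imp_permutes)
    have "inj_on s {..n}"
    proof (rule inj_onI)
      fix i j assume "i \<in> {..n}" "j \<in> {..n}" "s i = s j"
      then show "i = j" using rr[of i] rr[of j] inj[of i j] by (auto simp: s_def split: if_splits)
    qed
    moreover then have "s ` {..n} = {..n}" using rr by (intro endo_inj_surj) (auto simp: s_def)
    ultimately show "bij_betw s {..n} {..n}" by (simp add: bij_betw_def)
  qed (simp add: s_def)
  have "(\<Prod>i\<le>n. d i) = d 0 * (\<Prod>i\<in>{..n} - {0}. d i)" by (intro prod.remove) auto
  also have "(\<Prod>i\<in>{..n} - {0}. d i) = p" unfolding p_def by (intro prod.cong) (auto simp: d_def)
  finally have prod: "(\<Prod>i\<le>n. d i) = 1" using mu_nonzero[OF e_pos p] by (simp add: d_def)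
  have d: "d i \<in> mu e" for i using cc mu_inverse[OF p] by (simp add: d_def)
  have Y: "sym_end u j = d j * base_point e n (s j)" if "j \<le> n" for j
    using that rc[of j] by (auto simp: sym_end_def d_def s_def base_point_pos)
  have us: "?u (\<omega> ^ j) = c j * \<omega> ^ r j" for j using rc by blast
  have Z: "sym_end v j = d j * sym_end w (s j)" if "j \<le> n" for j
  proof (cases "j = 0")
    case False
    have "?v (\<omega> ^ j) = ?w (c j * \<omega> ^ r j)" using uwv[OF omega_in_mu, of j] us by simp
    then show ?thesis using False that rc[of j] NCP_e1_D(5)[OF FW _ omega_in_mu, of "c j" "r j"]
      by (simp add: sym_end_def d_def s_def)
  qed (simp add: sym_end_def s_def)
  show ?thesis
  proof (rule braid_mult[OF e_pos symmetric_strands[OF u sym(1)] symmetric_strands[OF w sym(3)]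
        symmetric_strands[OF v sym(2)] perm d prod Y Z symmetric_twisted[OF u sym(1)]
        symmetric_twisted[OF w sym(3)] symmetric_twisted[OF v sym(2)]
        symmetric_regular[OF u sym(1)] symmetric_regular[OF w sym(3)] symmetric_regular[OF v sym(2)]])
    fix i j \<xi> assume h: "i \<le> n" "j \<le> n" "i \<noteq> j" "\<xi> \<in> mu e"
    have k: "sym_curv x j \<ge> 0" for x j by (simp add: sym_curv_def)
    have kv: "card (part (flat e n v) (\<omega> ^ j)) = 2 \<Longrightarrow> sym_curv v j > 0" if "0 < j" for j
      using that by (simp add: sym_curv_def)
    have avoid: "separated (\<omega> ^ j) (sym_end u j) (sym_end v j)
        (bulge (sym_curv u j) (\<omega> ^ j) (sym_end u j)) (bulge (sym_curv w (s j)) (sym_end u j) (sym_end v j))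
        (bulge (sym_curv v j) (\<omega> ^ j) (sym_end v j))" if "0 < j" for j
      using tri_avoids_zero[OF FU FV uv omega_in_mu k k k kv[OF that]] that by (simp add: sym_end_def)
    consider "i = 0" "0 < j" | "j = 0" "0 < i" | "0 < i" "0 < j" using h(3) by auto
    then show "separated (base_point e n i - \<xi> * base_point e n j) (sym_end u i - \<xi> * sym_end u j)
        (sym_end v i - \<xi> * sym_end v j)
        (bulge (sym_curv u i) (base_point e n i) (sym_end u i)
          - \<xi> * bulge (sym_curv u j) (base_point e n j) (sym_end u j))
        (bulge (sym_curv w (s i)) (sym_end u i) (sym_end v i)
          - \<xi> * bulge (sym_curv w (s j)) (sym_end u j) (sym_end v j))
        (bulge (sym_curv v i) (base_point e n i) (sym_end v i)
          - \<xi> * bulge (sym_curv v j) (base_point e n j) (sym_end v j))"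
    proof cases
      case 1
      have "- \<xi> \<noteq> 0" using mu_nonzero[OF e_pos h(4)] by simp
      from separated_mult[OF avoid[OF 1(2)] this] show ?thesis
        using 1 h by (simp add: sym_end_def base_point_pos)
    next
      case 2
      from avoid[OF 2(2)] show ?thesis using 2 h by (simp add: sym_end_def base_point_pos)
    next
      case 3
      have "separated (\<omega> ^ i - \<xi> * \<omega> ^ j) (?u (\<omega> ^ i) - ?u (\<xi> * \<omega> ^ j)) (?v (\<omega> ^ i) - ?v (\<xi> * \<omega> ^ j))
        (bulge (sym_curv u i) (\<omega> ^ i) (?u (\<omega> ^ i)) - bulge (sym_curv u j) (\<xi> * \<omega> ^ j) (?u (\<xi> * \<omega> ^ j)))
        (bulge (sym_curv w (s i)) (?u (\<omega> ^ i)) (?v (\<omega> ^ i)) - bulge (sym_curv w (s j)) (?u (\<xi> * \<omega> ^ j)) (?v (\<xi> * \<omega> ^ j)))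
        (bulge (sym_curv v i) (\<omega> ^ i) (?v (\<omega> ^ i)) - bulge (sym_curv v j) (\<xi> * \<omega> ^ j) (?v (\<xi> * \<omega> ^ j)))"
      proof (rule R.sigma_separated)
        show "\<xi> * \<omega> ^ j \<in> R.S" using mu_mult[OF mu_e_M[OF h(4)] omega_in_mu] by simp
        show "\<omega> ^ i \<noteq> \<xi> * \<omega> ^ j" by (rule omega_distinct[OF h(1-3) 3 h(4)])
        show "card (part (flat e n v) (\<xi> * \<omega> ^ j)) = 2 \<Longrightarrow> 0 < sym_curv v j"
          using kv[OF 3(2)] part_rotate_card[OF FV omega_in_mu h(4)] by simp
      qed (use NU NV uv omega_in_mu k kv[OF 3(1)] in auto)
      then show ?thesis using 3 h
        by (simp add: base_point_pos sym_end_def bulge_mult NCP_e1_D(5)[OF FU h(4) omega_in_mu]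
            NCP_e1_D(5)[OF FV h(4) omega_in_mu])
    qed
  qed
qed

end

section \<open>Products below a maximal asymmetric partition\<close>

lemma edge_sep_strict:
  "Im (c * dx) > 0 \<Longrightarrow> Im (c * dy) > 0 \<Longrightarrow> edge_sep dx dy b"
  unfolding edge_sep_def by (auto intro!: exI[of _ c] simp del: times_complex.sel)

context ee
begin

lemma Q_0 [simp]: "0 \<in> Q \<zeta>"
  unfolding polygon_def by (rule image_eqI[of _ _ 0]) (auto simp: polygon_vertex_def)

lemma Q_elem: "y \<in> Q \<zeta> \<Longrightarrow> y \<noteq> 0 \<Longrightarrow> \<exists>k. 0 < k \<and> k \<le> n \<and> y = \<omega> ^ k * \<zeta>"
  unfolding polygon_def polygon_vertex_def by (auto split: if_splits)

lemma Q_inequivalent: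
  assumes "\<zeta> \<in> mu M" "x \<in> Q \<zeta>" "y \<in> Q \<zeta>" "\<xi> \<in> mu e" "x = \<xi> * y"
  shows "x = y"
proof (cases "x = 0 \<or> y = 0")
  case True then show ?thesis using assms mu_nonzero[OF e_pos] by auto
next
  case False
  then obtain k l where kl: "0 < k" "k \<le> n" "x = \<omega> ^ k * \<zeta>" "0 < l" "l \<le> n" "y = \<omega> ^ l * \<zeta>"
    using Q_elem assms by metis
  then have "\<omega> ^ k = \<xi> * \<omega> ^ l" using assms(5) mu_M_nonzero[OF assms(1)] by simp
  then show ?thesis using omega_equiv_unique assms kl by metis
qed

lemma Q_nonzero_mu: "\<zeta> \<in> mu M \<Longrightarrow> y \<in> Q \<zeta> \<Longrightarrow> y \<noteq> 0 \<Longrightarrow> y \<in> mu M"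
  using Q_subset by auto

text \<open>\<open>rep \<zeta> j\<close> is the vertex of \<open>Q \<zeta>\<close> in the \<open>mu e\<close>-orbit of the \<open>j\<close>-th base coordinate.\<close>
definition rep :: "complex \<Rightarrow> nat \<Rightarrow> complex" where
  "rep \<zeta> j = (if j = 0 then 0 else THE y. y \<in> Q \<zeta> \<and> y \<noteq> 0 \<and> (\<exists>c\<in>mu e. \<omega> ^ j = c * y))"

definition coef :: "complex \<Rightarrow> nat \<Rightarrow> complex" where
  "coef \<zeta> j = (if j = 0 then 1 else \<omega> ^ j / rep \<zeta> j)"

lemma rep_0 [simp]: "rep \<zeta> 0 = 0" and coef_0 [simp]: "coef \<zeta> 0 = 1"
  by (auto simp: rep_def coef_def)

context
  fixes \<zeta> assumes \<zeta>: "\<zeta> \<in> mu M"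
begin

lemma rep_unique: "y \<in> Q \<zeta> \<Longrightarrow> \<xi> \<in> mu e \<Longrightarrow> y = \<xi> * \<omega> ^ j \<Longrightarrow> 0 < j \<Longrightarrow> rep \<zeta> j = y"
proof -
  assume h: "y \<in> Q \<zeta>" "\<xi> \<in> mu e" "y = \<xi> * \<omega> ^ j" "0 < j"
  have \<xi>: "\<xi> \<noteq> 0" by (rule mu_nonzero[OF e_pos h(2)])
  have "(THE y. y \<in> Q \<zeta> \<and> y \<noteq> 0 \<and> (\<exists>c\<in>mu e. \<omega> ^ j = c * y)) = y"
  proof (rule the_equality)
    show "y \<in> Q \<zeta> \<and> y \<noteq> 0 \<and> (\<exists>c\<in>mu e. \<omega> ^ j = c * y)"
      using h \<xi> omega_nonzero mu_inverse[OF h(2)] by (auto intro!: bexI[of _ "inverse \<xi>"])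
    fix y' assume y': "y' \<in> Q \<zeta> \<and> y' \<noteq> 0 \<and> (\<exists>c\<in>mu e. \<omega> ^ j = c * y')"
    then obtain c where c: "c \<in> mu e" "\<omega> ^ j = c * y'" by blast
    then have eq: "y = (\<xi> * c) * y'" by (metis h(3) c(2) mult.assoc)
    have "y' \<in> Q \<zeta>" using y' by simp
    from Q_inequivalent[OF \<zeta> h(1) this mu_mult[OF h(2) c(1)] eq] show "y' = y" by simp
  qed
  then show ?thesis using h(4) by (simp add: rep_def)
qed

lemma rep_coef:
  assumes "0 < j"
  shows "rep \<zeta> j \<in> Q \<zeta>" "rep \<zeta> j \<noteq> 0" "coef \<zeta> j \<in> mu e" "\<omega> ^ j = coef \<zeta> j * rep \<zeta> j"
proof -
  have "\<omega> ^ j / \<zeta> \<in> mu M" using mu_divide[OF omega_in_mu \<zeta>] .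
  then obtain k c where k: "0 < k" "k \<le> n" "c \<in> mu e" "\<omega> ^ j / \<zeta> = c * \<omega> ^ k"
    using mu_representative by blast
  have c0: "c \<noteq> 0" by (rule mu_nonzero[OF e_pos k(3)])
  define y where "y = \<omega> ^ k * \<zeta>"
  have y: "y \<in> Q \<zeta>" using k unfolding polygon_def y_def
    by (intro image_eqI[of _ _ k]) (auto simp: polygon_vertex_def)
  have eq: "\<omega> ^ j = c * y" using k(4) mu_M_nonzero[OF \<zeta>] by (simp add: y_def field_simps)
  then have "y = inverse c * \<omega> ^ j" using c0 by simp
  then have r: "rep \<zeta> j = y" by (rule rep_unique[OF y mu_inverse[OF k(3)] _ assms])
  have y0: "y \<noteq> 0" using eq omega_nonzero[of j] by auto
  then have co: "coef \<zeta> j = c" using assms eq r by (simp add: coef_def)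
  show "rep \<zeta> j \<in> Q \<zeta>" "rep \<zeta> j \<noteq> 0" "coef \<zeta> j \<in> mu e" "\<omega> ^ j = coef \<zeta> j * rep \<zeta> j"
    unfolding r co using y y0 k eq by auto
qed

lemma rep_Q: "rep \<zeta> j \<in> Q \<zeta>" and coef_mu: "coef \<zeta> j \<in> mu e"
  using rep_coef[of j] by (cases "j = 0"; simp)+

lemma coef_nonzero: "coef \<zeta> j \<noteq> 0"
  by (rule mu_nonzero[OF e_pos coef_mu])

lemma base_rep: "j \<le> n \<Longrightarrow> base_point e n j = coef \<zeta> j * rep \<zeta> j"
  using rep_coef(4)[of j] by (cases "j = 0") (auto simp: base_point_pos)

lemma rep_bij: "bij_betw (rep \<zeta>) {..n} (Q \<zeta>)"
proof -
  have inj: "inj_on (rep \<zeta>) {..n}"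
  proof (rule inj_onI)
    fix i j assume h: "i \<in> {..n}" "j \<in> {..n}" "rep \<zeta> i = rep \<zeta> j"
    consider "i = 0" | "j = 0" | "0 < i" "0 < j" by auto
    then show "i = j"
    proof cases
      case 1 then show ?thesis using h rep_coef(2)[of j] by (cases "j = 0") auto
    next
      case 2 then show ?thesis using h rep_coef(2)[of i] by (cases "i = 0") auto
    next
      case 3
      have "\<omega> ^ i = (coef \<zeta> i / coef \<zeta> j) * \<omega> ^ j"
        using rep_coef(4)[OF 3(1)] rep_coef(4)[OF 3(2)] h(3) coef_nonzero[of j] by simp
      then show ?thesis using omega_equiv_unique mu_divide[OF coef_mu coef_mu] 3 h(1,2) by blast
    qed
  qed
  have fin: "finite (Q \<zeta>)" and "card (Q \<zeta>) \<le> n + 1"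
    using card_image_le[of "{..n}" "polygon_vertex e n \<zeta>"] by (auto simp: polygon_def)
  moreover have "card (rep \<zeta> ` {..n}) = n + 1" using card_image[OF inj] by simp
  moreover have "rep \<zeta> ` {..n} \<subseteq> Q \<zeta>" using rep_Q by auto
  ultimately have "rep \<zeta> ` {..n} = Q \<zeta>" by (intro card_seteq) auto
  then show ?thesis using inj by (simp add: bij_betw_def)
qed

lemma rep_inj: "i \<le> n \<Longrightarrow> j \<le> n \<Longrightarrow> i \<noteq> j \<Longrightarrow> rep \<zeta> i \<noteq> rep \<zeta> j"
  using rep_bij by (auto simp: bij_betw_def inj_on_def)

interpretation A: convex_polygon "polygon_vertex e n \<zeta>" "n + 1"
  by (rule convex_polygon_Q[OF \<zeta>])

lemma A_S: "A.S = Q \<zeta>"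
  by (rule S_Q[OF \<zeta>])

context
  fixes u assumes u: "u \<in> NCP_ee e n" and uM: "refines (mu0 M) u (max_asym e n \<zeta>)"
begin

lemma part_in_Q: "z \<in> Q \<zeta> \<Longrightarrow> part u z \<subseteq> Q \<zeta>"
proof -
  assume z: "z \<in> Q \<zeta>"
  have "partition_on (mu0 M) (max_asym e n \<zeta>)" using uM by (simp add: refines_def)
  then have "part (max_asym e n \<zeta>) z = Q \<zeta>" using z by (intro part_eq) (auto simp: max_asym_def)
  then show ?thesis using refines_part[OF uM, of z] z Q_subset[OF \<zeta>] by auto
qed

text \<open>A long part would lie in the part of 0, hence in \<open>Q \<zeta>\<close>, and be
  invariant under \<open>mu e\<close>. But distinct points of \<open>Q \<zeta>\<close> are never
  equivalent.\<close>

lemma below_max_not_long: "\<not> long (flat e n u)"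
proof
  assume l: "long (flat e n u)"
  note P = NCP_ee_D(1)[OF u] and F = NCP_ee_D(2)[OF u]
  obtain a where a: "a \<in> flat e n u" "0 \<in> convex hull a" using l by (auto simp: long_def)
  then obtain p where p: "p \<in> u" "a = mu M \<inter> p" "a \<noteq> {}" by (auto simp: flat_def restr_def)
  have "0 \<in> convex hull p" using a(2) p(2) hull_mono[of a p convex] by auto
  moreover have "0 \<in> convex hull (part u 0)" using part_self[OF P, of 0] by (auto intro: hull_inc)
  ultimately have "p = part u 0"
    using NCP_ee_D(3)[OF u] p(1) part_in[OF P, of 0] unfolding NCP_def by blast
  then have aQ: "a \<subseteq> Q \<zeta>" using part_in_Q[of 0] p(2) by auto
  obtain z where z: "z \<in> a" "z \<in> mu M" using p by auto
  show False
  proof (cases "e = 1")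
    case True
    then have "M = 1" using e1 by simp
    then have "mu M = {1}" by (auto simp: mu_def)
    then have "a = {1}" using z p(2) by auto
    then show False using a(2) by simp
  next
    case False
    define \<xi> where "\<xi> = zeta e ^ 1"
    have \<xi>: "\<xi> \<in> mu e" "\<xi> \<noteq> 1"
      using zeta_in_mu[OF e_pos, of 1] inj_onD[OF inj_on_zeta[OF e_pos], of 1 0] False e_pos
      by (auto simp: \<xi>_def)
    have "\<xi> * z \<in> a" using long_part_invariant[OF F a \<xi>(1)] z by blast
    then have "\<xi> * z = z" using Q_inequivalent[OF \<zeta> _ _ \<xi>(1)] aQ z by blast
    then show False using \<xi>(2) mu_M_nonzero[OF z(2)] by simp
  qed
qed

lemma below_max_vertices: "vertices e n u z = part u z" "succ_in e n u z = sigma u z"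
  using below_max_not_long by (auto simp: vertices_def succ_in_def long_symmetric_def sigma_def)

lemma restr_Q_NCP: "restr u (Q \<zeta>) \<in> NCP (Q \<zeta>)"
  by (rule restr_NCP[OF NCP_ee_D(3)[OF u] Q_subset[OF \<zeta>]])

lemma restr_Q_part: "z \<in> Q \<zeta> \<Longrightarrow> part (restr u (Q \<zeta>)) z = part u z"
  using part_restr[OF NCP_ee_D(1)[OF u] Q_subset[OF \<zeta>], of z] restr_Q_NCP part_in_Q[of z]
  by (auto simp: NCP_def)

lemma restr_Q_sigma: "z \<in> Q \<zeta> \<Longrightarrow> sigma (restr u (Q \<zeta>)) z = sigma u z"
  by (simp add: sigma_def restr_Q_part)

lemma below_max_sigma:
  assumes "z \<in> Q \<zeta>"
  shows "sigma u z \<in> Q \<zeta>" "sigma u z \<in> part u z" "sigma u z = z \<longleftrightarrow> part u z = {z}"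
  using A.sigma_S[unfolded A_S, OF restr_Q_NCP assms] A.sigma_part[unfolded A_S, OF restr_Q_NCP assms]
    A.sigma_fixed[unfolded A_S, OF restr_Q_NCP assms]
  by (auto simp: restr_Q_sigma[OF assms] restr_Q_part[OF assms])

lemma below_max_sigma_inj: "y \<in> Q \<zeta> \<Longrightarrow> z \<in> Q \<zeta> \<Longrightarrow> sigma u y = sigma u z \<Longrightarrow> y = z"
  using A.sigma_inj[unfolded A_S, OF restr_Q_NCP] restr_Q_sigma by metis

definition poly_end :: "nat \<Rightarrow> complex" where
  "poly_end j = coef \<zeta> j * sigma u (rep \<zeta> j)"

text \<open>For non-special \<open>j\<close>, \<open>gamma\<close> follows the strand starting at \<open>\<omega> ^ j\<close>, whose part is in general
  only a rotated copy of the part of \<open>rep \<zeta> j\<close> without \<open>0\<close>.\<close>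
definition poly_curv :: "nat \<Rightarrow> real" where
  "poly_curv j = of_bool (card (part u
     (if j = 0 \<or> (\<exists>\<xi>. special e n u j \<xi>) then rep \<zeta> j else \<omega> ^ j)) = 2)"

lemma part_nonzero_flat: "z \<in> mu M \<Longrightarrow> 0 \<notin> part u z \<Longrightarrow> part u z = part (flat e n u) z"
  using NCP_ee_D(4)[OF u, of z] by auto

lemma zero_part_Q:
  assumes "z \<in> mu0 M" "0 \<in> part u z"
  shows "z \<in> Q \<zeta>"
proof -
  note P = NCP_ee_D(1)[OF u]
  have "part u 0 = part u z" by (rule part_cong[OF P assms])
  then show ?thesis using part_self[OF P assms(1)] part_in_Q[of 0] by auto
qed

text \<open>The part of 0 lies in \<open>Q \<zeta>\<close>, so a strand that ends at 0 starts there.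
  Hence the rotation that \<open>gamma\<close> applies to a special coordinate is exactly the one
  that brings \<open>\<omega> ^ j\<close> to its representative.\<close>

lemma special_iff:
  assumes j: "0 < j"
  shows "special e n u j \<xi> \<longleftrightarrow> sigma u (rep \<zeta> j) = 0 \<and> \<xi> = inverse (coef \<zeta> j)"
proof
  note P = NCP_ee_D(1)[OF u] and r = rep_coef[OF j]
  assume "special e n u j \<xi>"
  then have s: "\<xi> \<in> mu e" "sigma u (\<xi> * \<omega> ^ j) = 0" by (auto simp: special_def below_max_vertices)
  have m: "\<xi> * \<omega> ^ j \<in> mu M" using mu_mult[OF mu_e_M[OF s(1)] omega_in_mu] .
  have q: "\<xi> * \<omega> ^ j \<in> Q \<zeta>"
  proof (rule ccontr)
    assume nq: "\<xi> * \<omega> ^ j \<notin> Q \<zeta>"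
    then have "0 \<notin> part u (\<xi> * \<omega> ^ j)" using zero_part_Q m by auto
    then have "sigma (flat e n u) (\<xi> * \<omega> ^ j) = 0"
      using s(2) part_nonzero_flat[OF m] by (simp add: sigma_def)
    then show False
      using R.sigma_S[of "flat e n u" "\<xi> * \<omega> ^ j"] m NCP_e1_D(1)[OF NCP_ee_D(2)[OF u]] by simp
  qed
  then have eq: "rep \<zeta> j = \<xi> * \<omega> ^ j" using rep_unique s j by blast
  then have "\<xi> * coef \<zeta> j = 1" using r by (metis mult.assoc mult_cancel_right1)
  then show "sigma u (rep \<zeta> j) = 0 \<and> \<xi> = inverse (coef \<zeta> j)"
    using eq s by (metis inverse_unique mult.commute)
next
  note P = NCP_ee_D(1)[OF u] and r = rep_coef[OF j]
  assume s: "sigma u (rep \<zeta> j) = 0 \<and> \<xi> = inverse (coef \<zeta> j)"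
  have "{0} \<notin> u"
  proof
    assume "{0} \<in> u"
    then have "part u 0 = {0}" by (intro part_eq[OF P]) auto
    moreover have "0 \<in> part u (rep \<zeta> j)" using below_max_sigma(2)[OF r(1)] s by simp
    then have "part u 0 = part u (rep \<zeta> j)" using part_cong[OF P] r(1) Q_subset[OF \<zeta>] by blast
    ultimately show False using part_self[OF P, of "rep \<zeta> j"] r Q_subset[OF \<zeta>] by auto
  qed
  moreover have "inverse (coef \<zeta> j) * \<omega> ^ j = rep \<zeta> j" using r coef_nonzero by simp
  ultimately show "special e n u j \<xi>"
    using s below_max_not_long mu_inverse[OF r(3)] by (simp add: special_def asymmetric_def below_max_vertices)
qed

lemma strand_rep:
  assumes z: "z \<in> mu0 M"
    and s: "part u z = {z} \<Longrightarrow> sigma u z = z"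
  shows "strand e n \<epsilon> u z t = bpath (\<epsilon> * of_bool (card (part u z) = 2)) z (sigma u z) t"
proof -
  note P = NCP_ee_D(1)[OF u]
  have "finite (part u z)" using part_subset[OF P z] finite_mu0 finite_subset by blast
  then have "card (part u z) \<le> 1 \<Longrightarrow> part u z = {z}"
    using part_self[OF P z] by (auto simp: card_le_Suc0_iff_eq)
  then show ?thesis using strand_bpath[of u z \<epsilon> t] s by (simp add: below_max_vertices)
qed

text \<open>A non-special strand runs in a rotated copy of the part of \<open>rep \<zeta> j\<close>
  without 0. Removing 0 does not change a nonzero successor, but it shrinks a part of three elements
  to two, so the strand may be curved where the polygon has a straight edge. Hence the curvature is
  controlled in one direction only.\<close>

lemma poly_strands: "has_strands e n u poly_end poly_curv"
  and poly_curv: "j \<le> n \<Longrightarrow> card (part u (rep \<zeta> j)) = 2 \<Longrightarrow> poly_curv j > 0"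
proof -
  note P = NCP_ee_D(1)[OF u] and F = NCP_ee_D(2)[OF u]
  have single: "part u z = {z} \<Longrightarrow> sigma u z = z" for z by (simp add: sigma_def)
  have main: "sigma u (\<omega> ^ j) = coef \<zeta> j * sigma u (rep \<zeta> j) \<and>
     (card (part u (rep \<zeta> j)) = 2 \<longrightarrow> card (part u (\<omega> ^ j)) = 2)"
    if j: "0 < j" and ns: "sigma u (rep \<zeta> j) \<noteq> 0" for j
  proof -
    let ?y = "rep \<zeta> j" and ?c = "coef \<zeta> j"
    note r = rep_coef[OF j]
    have y: "?y \<in> mu M" by (rule Q_nonzero_mu[OF \<zeta> r(1,2)])
    have yp: "?y \<in> part u ?y" using part_self[OF P] y by auto
    show ?thesis
    proof (cases "\<omega> ^ j \<in> Q \<zeta>")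
      case True
      then have "?y = \<omega> ^ j" using rep_unique[OF True mu_1] j by simp
      then have "?c = 1" using omega_nonzero[of j] j by (simp add: coef_def)
      then show ?thesis using \<open>?y = \<omega> ^ j\<close> by simp
    next
      case False
      then have nz: "0 \<notin> part u (\<omega> ^ j)" using zero_part_Q omega_in_mu by blast
      have pj: "part u (\<omega> ^ j) = part (flat e n u) (\<omega> ^ j)" by (rule part_nonzero_flat[OF omega_in_mu nz])
      have sj: "sigma u (\<omega> ^ j) = ?c * sigma (flat e n u) ?y"
        using NCP_e1_D(5)[OF F r(3) y] r(4) pj by (simp add: sigma_def)
      show ?thesis
      proof (cases "0 \<in> part u ?y")
        case nz': False
        note py = part_nonzero_flat[OF y nz']
        have "card (part u (\<omega> ^ j)) = card (part u ?y)"
          using part_rotate_card[OF F y r(3)] pj py r(4) by simp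
        moreover have "sigma (flat e n u) ?y = sigma u ?y" using py by (simp add: sigma_def)
        ultimately show ?thesis using sj by simp
      next
        case True
        have fp: "part (flat e n u) ?y = part u ?y - {0}" by (rule NCP_ee_D(4)[OF u y])
        have sub: "part u ?y \<subseteq> A.S" using part_in_Q[OF r(1)] A_S by simp
        have ne: "part u ?y \<noteq> {?y}" using True r(2) by auto
        note s = A.ccw_succ[OF sub yp]
        have "sigma (flat e n u) ?y = sigma u ?y"
          unfolding sigma_def fp
        proof (rule A.ccw_succI)
          show "part u ?y - {0} \<subseteq> A.S" using sub by auto
          show "ccw_succ (part u ?y) ?y \<in> part u ?y - {0}" using s(1) ns by (simp add: sigma_def)
          show "ccw_succ (part u ?y) ?y \<noteq> ?y" by (rule s(2)[OF ne])
        qed (use yp r(2) s(3) in auto)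
        moreover have "card (part u ?y) \<noteq> 2"
        proof
          assume "card (part u ?y) = 2"
          moreover have "{0, ?y} \<subseteq> part u ?y" "card {0, ?y} = 2" using True yp r(2) by auto
          moreover have "finite (part u ?y)" using sub A.finite_S finite_subset by blast
          ultimately have "part u ?y = {0, ?y}" by (metis card_subset_eq)
          then show False using below_max_sigma(2,3)[OF r(1)] ns ne by auto
        qed
        ultimately show ?thesis using sj by simp
      qed
    qed
  qed
  show "has_strands e n u poly_end poly_curv"
    unfolding has_strands_def
  proof (intro allI impI)
    fix \<epsilon> t :: real and j assume j: "j \<le> n"
    show "gamma e n \<epsilon> u t j = bpath (\<epsilon> * poly_curv j) (base_point e n j) (poly_end j) t"
    proof (cases "j = 0")
      case True
      then show ?thesis using strand_rep[OF _ single, of 0 \<epsilon> t]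
        by (simp add: gamma_def poly_end_def poly_curv_def)
    next
      case False
      then have j0: "0 < j" by simp
      note r = rep_coef[OF j0]
      show ?thesis
      proof (cases "sigma u (rep \<zeta> j) = 0")
        case True
        have sp: "special e n u j = (\<lambda>\<xi>. \<xi> = inverse (coef \<zeta> j))"
          using special_iff[OF j0] True by (intro ext) simp
        have y: "inverse (coef \<zeta> j) * \<omega> ^ j = rep \<zeta> j" using r coef_nonzero by simp
        have "gamma e n \<epsilon> u t j = coef \<zeta> j * strand e n \<epsilon> u (rep \<zeta> j) t"
          using j False by (simp add: gamma_def sp y)
        also have "\<dots> = bpath (\<epsilon> * poly_curv j) (coef \<zeta> j * rep \<zeta> j) (poly_end j) t"
          using strand_rep[OF _ single, of "rep \<zeta> j" \<epsilon> t] r(1) Q_subset[OF \<zeta>] j0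
          by (auto simp: bpath_mult poly_end_def poly_curv_def sp)
        finally show ?thesis using base_rep[OF j] by simp
      next
        case False
        have sp: "special e n u j \<xi> \<longleftrightarrow> False" for \<xi> using special_iff[OF j0] False by simp
        then have sp': "(\<exists>\<xi>. special e n u j \<xi>) = False" by blast
        have "gamma e n \<epsilon> u t j = strand e n \<epsilon> u (\<omega> ^ j) t"
          using j j0 by (simp add: gamma_def sp')
        also have "\<dots> = bpath (\<epsilon> * poly_curv j) (\<omega> ^ j) (poly_end j) t"
          using strand_rep[OF _ single, of "\<omega> ^ j" \<epsilon> t] omega_in_mu main[OF j0 False] j0
          by (simp add: poly_end_def poly_curv_def sp')
        finally show ?thesis using base_point_pos[OF j0 j] by simp
      qed
    qed
  qed
  show "j \<le> n \<Longrightarrow> card (part u (rep \<zeta> j)) = 2 \<Longrightarrow> poly_curv j > 0"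
  proof (cases "0 < j \<and> sigma u (rep \<zeta> j) \<noteq> 0")
    case True
    then have "(\<exists>\<xi>. special e n u j \<xi>) = False" using special_iff by blast
    then show "card (part u (rep \<zeta> j)) = 2 \<Longrightarrow> poly_curv j > 0"
      using main True by (simp add: poly_curv_def)
  next
    case False
    then have "j = 0 \<or> (\<exists>\<xi>. special e n u j \<xi>)"
      using special_iff[of j "inverse (coef \<zeta> j)"] by (cases "j = 0") auto
    then show "card (part u (rep \<zeta> j)) = 2 \<Longrightarrow> poly_curv j > 0"
      unfolding poly_curv_def by simp
  qed
qed

lemma poly_curv_nonneg: "poly_curv j \<ge> 0"
  by (simp add: poly_curv_def)

lemma poly_twisted: "twisted_base e n poly_end"
proof (rule twisted_baseI)
  show "poly_end j \<in> mu0 M" for j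
  proof (cases "sigma u (rep \<zeta> j) = 0")
    case False
    then have "sigma u (rep \<zeta> j) \<in> mu M" using Q_nonzero_mu[OF \<zeta>] below_max_sigma(1)[OF rep_Q] by blast
    then show ?thesis using mu_mult[OF mu_e_M[OF coef_mu]] by (simp add: poly_end_def)
  qed (simp add: poly_end_def)
  fix i j \<xi> assume h: "i \<le> n" "j \<le> n" "i \<noteq> j" "\<xi> \<in> mu e"
  show "poly_end i \<noteq> \<xi> * poly_end j"
  proof
    assume "poly_end i = \<xi> * poly_end j"
    then have "sigma u (rep \<zeta> i) = (\<xi> * coef \<zeta> j / coef \<zeta> i) * sigma u (rep \<zeta> j)"
      using coef_nonzero[of i] by (simp add: poly_end_def field_simps)
    moreover have "\<xi> * coef \<zeta> j / coef \<zeta> i \<in> mu e" using h coef_mu mu_mult mu_divide by auto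
    ultimately have "sigma u (rep \<zeta> i) = sigma u (rep \<zeta> j)"
      using Q_inequivalent[OF \<zeta>] below_max_sigma(1)[OF rep_Q] by blast
    then show False using below_max_sigma_inj rep_Q rep_inj h by blast
  qed
qed

text \<open>After division by the coefficient of \<open>i\<close>, both strands run in
  \<open>Q \<zeta>\<close> up to a rotation \<eta>. For \<open>\<eta> = 1\<close> this is a question
  within the polygon; otherwise the sectors are disjoint.\<close>

lemma poly_regular: "\<forall>\<^sub>F \<epsilon> in at_right 0. regular_at e n u \<epsilon>"
proof (rule eventually_regular[OF e_pos poly_strands])
  fix i j \<xi> assume h: "i \<le> n" "j \<le> n" "i \<noteq> j" "\<xi> \<in> mu e"
  let ?x = "rep \<zeta> i" and ?y = "rep \<zeta> j"
  define \<eta> where "\<eta> = \<xi> * coef \<zeta> j / coef \<zeta> i"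
  have \<eta>: "\<eta> \<in> mu e" "coef \<zeta> i * \<eta> = \<xi> * coef \<zeta> j"
    using h coef_mu mu_mult mu_divide coef_nonzero[of i] by (auto simp: \<eta>_def)
  have "edge_sep (?x - \<eta> * ?y) (sigma u ?x - \<eta> * sigma u ?y)
     (bulge (poly_curv i) ?x (sigma u ?x) - \<eta> * bulge (poly_curv j) ?y (sigma u ?y))"
  proof (cases "\<eta> = 1")
    case True
    have "edge_sep (?x - ?y) (sigma (restr u (Q \<zeta>)) ?x - sigma (restr u (Q \<zeta>)) ?y)
     (bulge (poly_curv i) ?x (sigma (restr u (Q \<zeta>)) ?x) - bulge (poly_curv j) ?y (sigma (restr u (Q \<zeta>)) ?y))"
      using rep_Q rep_inj[OF h(1-3)] poly_curv_nonneg poly_curv[OF h(1)] restr_Q_NCP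
      by (intro A.sigma_edge_sep[unfolded A_S]) (auto simp: restr_Q_part)
    then show ?thesis using True by (simp add: restr_Q_sigma rep_Q)
  next
    case False
    obtain c where c: "\<And>x y. x \<in> Q \<zeta> \<Longrightarrow> y \<in> Q \<zeta> \<Longrightarrow> x \<noteq> y \<Longrightarrow> Im (c * (x - \<eta> * y)) > 0"
      using cone_separated[OF \<zeta> \<eta>(1) False] by (metis prod.inject)
    have "sigma u ?x \<noteq> sigma u ?y" using below_max_sigma_inj[OF rep_Q rep_Q] rep_inj[OF h(1-3)] by blast
    then show ?thesis
      by (intro edge_sep_strict[of c] c rep_Q below_max_sigma(1) rep_inj[OF h(1-3)])
  qed
  from edge_sep_mult[OF this coef_nonzero[of i]]
  show "edge_sep (base_point e n i - \<xi> * base_point e n j) (poly_end i - \<xi> * poly_end j)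
      (bulge (poly_curv i) (base_point e n i) (poly_end i) - \<xi> * bulge (poly_curv j) (base_point e n j) (poly_end j))"
    using \<eta>(2) unfolding base_rep[OF h(1)] base_rep[OF h(2)] poly_end_def bulge_mult[symmetric]
    by (simp add: right_diff_distrib flip: mult.assoc)
qed

end

text \<open>Through \<open>rep \<zeta>\<close> the coordinates correspond to the vertices of
  \<open>Q \<zeta>\<close>, and \<open>s\<close> is the successor map of \<open>u\<close> in these
  terms.\<close>

lemma braid_mult_polygon:
  assumes u: "u \<in> NCP_ee e n" "refines (mu0 M) u (max_asym e n \<zeta>)"
    and v: "v \<in> NCP_ee e n" "refines (mu0 M) v (max_asym e n \<zeta>)"
    and w: "w \<in> NCP_ee e n" "refines (mu0 M) w (max_asym e n \<zeta>)"
    and uv: "refines (mu0 M) u v"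
    and uwv: "\<And>z. z \<in> Q \<zeta> \<Longrightarrow> sigma w (sigma u z) = sigma v z"
  shows "braid e n u \<otimes>\<^bsub>braid_group e n\<^esub> braid e n w = braid e n v"
proof -
  note NU = restr_Q_NCP[OF u] and NV = restr_Q_NCP[OF v]
  have uvQ: "refines (Q \<zeta>) (restr u (Q \<zeta>)) (restr v (Q \<zeta>))"
    using restr_refines[OF uv Q_subset[OF \<zeta>]] NU NV by (simp add: NCP_def)
  have rep_img: "rep \<zeta> ` {..n} = Q \<zeta>" using rep_bij by (simp add: bij_betw_def)
  have uQ: "sigma u (rep \<zeta> j) \<in> Q \<zeta>" for j by (rule below_max_sigma(1)[OF u rep_Q])
  define s where "s j = (if j \<le> n then inv_into {..n} (rep \<zeta>) (sigma u (rep \<zeta> j)) else j)" for j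
  have s: "s j \<le> n" "rep \<zeta> (s j) = sigma u (rep \<zeta> j)" if "j \<le> n" for j
    using that uQ[of j] inv_into_into[of "sigma u (rep \<zeta> j)" "rep \<zeta>" "{..n}"]
      f_inv_into_f[of "sigma u (rep \<zeta> j)" "rep \<zeta>" "{..n}"] unfolding rep_img s_def by auto
  have perm: "s permutes {..n}"
  proof (rule bij_imp_permutes)
    have inj: "inj_on s {..n}"
    proof (rule inj_onI)
      fix i j assume h: "i \<in> {..n}" "j \<in> {..n}" "s i = s j"
      then have "sigma u (rep \<zeta> i) = sigma u (rep \<zeta> j)" using s by (metis atMost_iff)
      then have "rep \<zeta> i = rep \<zeta> j" using below_max_sigma_inj[OF u rep_Q rep_Q] by blast
      then show "i = j" using rep_inj h by (metis atMost_iff)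
    qed
    moreover have "s ` {..n} = {..n}" using s(1) by (intro endo_inj_surj inj) auto
    ultimately show "bij_betw s {..n} {..n}" by (simp add: bij_betw_def)
  qed (simp add: s_def)
  define d where "d j = coef \<zeta> j / coef \<zeta> (s j)" for j
  have d: "d j \<in> mu e" for j unfolding d_def by (rule mu_divide[OF coef_mu coef_mu])
  \<comment> \<open>The determinant is 1 without any correction, as \<open>s\<close> only permutes
    the factors of the denominator.\<close>
  have "(\<Prod>j\<le>n. coef \<zeta> (s j)) = (\<Prod>j\<le>n. coef \<zeta> j)"
    using prod.permute[OF perm, of "coef \<zeta>"] by (simp add: o_def)
  then have prod: "(\<Prod>i\<le>n. d i) = 1"
    using coef_nonzero by (simp add: d_def prod_dividef)
  have dc: "d j * coef \<zeta> (s j) = coef \<zeta> j" for j using coef_nonzero by (simp add: d_def)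
  have Y: "poly_end u j = d j * base_point e n (s j)" if "j \<le> n" for j
    unfolding base_rep[OF s(1)[OF that]] poly_end_def[OF u] mult.assoc[symmetric] dc s(2)[OF that] ..
  have Z: "poly_end v j = d j * poly_end w (s j)" if "j \<le> n" for j
    unfolding poly_end_def[OF v] poly_end_def[OF w] mult.assoc[symmetric] dc s(2)[OF that]
    using uwv[OF rep_Q] by simp
  show ?thesis
  proof (rule braid_mult[OF e_pos poly_strands[OF u] poly_strands[OF w] poly_strands[OF v] perm d prod Y Z
        poly_twisted[OF u] poly_twisted[OF w] poly_twisted[OF v]
        poly_regular[OF u] poly_regular[OF w] poly_regular[OF v]])
    fix i j \<xi> assume h: "i \<le> n" "j \<le> n" "i \<noteq> j" "\<xi> \<in> mu e"
    let ?x = "rep \<zeta> i" and ?y = "rep \<zeta> j"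
    define \<eta> where "\<eta> = \<xi> * coef \<zeta> j / coef \<zeta> i"
    have \<eta>: "\<eta> \<in> mu e" "coef \<zeta> i * \<eta> = \<xi> * coef \<zeta> j"
      using h coef_mu mu_mult mu_divide coef_nonzero[of i] by (auto simp: \<eta>_def)
    have "separated (?x - \<eta> * ?y) (sigma u ?x - \<eta> * sigma u ?y) (sigma v ?x - \<eta> * sigma v ?y)
       (bulge (poly_curv u i) ?x (sigma u ?x) - \<eta> * bulge (poly_curv u j) ?y (sigma u ?y))
       (bulge (poly_curv w (s i)) (sigma u ?x) (sigma v ?x)
          - \<eta> * bulge (poly_curv w (s j)) (sigma u ?y) (sigma v ?y))
       (bulge (poly_curv v i) ?x (sigma v ?x) - \<eta> * bulge (poly_curv v j) ?y (sigma v ?y))"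
    proof (cases "\<eta> = 1")
      case True
      let ?u = "restr u (Q \<zeta>)" and ?v = "restr v (Q \<zeta>)"
      have "separated (?x - ?y) (sigma ?u ?x - sigma ?u ?y) (sigma ?v ?x - sigma ?v ?y)
         (bulge (poly_curv u i) ?x (sigma ?u ?x) - bulge (poly_curv u j) ?y (sigma ?u ?y))
         (bulge (poly_curv w (s i)) (sigma ?u ?x) (sigma ?v ?x)
            - bulge (poly_curv w (s j)) (sigma ?u ?y) (sigma ?v ?y))
         (bulge (poly_curv v i) ?x (sigma ?v ?x) - bulge (poly_curv v j) ?y (sigma ?v ?y))"
        using rep_Q rep_inj[OF h(1-3)] poly_curv_nonneg[OF u] poly_curv_nonneg[OF v] poly_curv_nonneg[OF w]
          poly_curv[OF v h(1)] poly_curv[OF v h(2)] NU NV uvQ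
        by (intro A.sigma_separated[unfolded A_S]) (auto simp: restr_Q_part[OF v])
      then show ?thesis using True by (simp add: restr_Q_sigma[OF u] restr_Q_sigma[OF v] rep_Q)
    next
      case False
      obtain c where c: "\<And>x y. x \<in> Q \<zeta> \<Longrightarrow> y \<in> Q \<zeta> \<Longrightarrow> x \<noteq> y \<Longrightarrow> Im (c * (x - \<eta> * y)) > 0"
        using cone_separated[OF \<zeta> \<eta>(1) False] by (metis prod.inject)
      have "sigma u ?x \<noteq> sigma u ?y" "sigma v ?x \<noteq> sigma v ?y"
        using below_max_sigma_inj[OF u rep_Q rep_Q] below_max_sigma_inj[OF v rep_Q rep_Q]
          rep_inj[OF h(1-3)] by blast+
      then show ?thesis
        by (intro separatedI_strict[of c] c rep_Q below_max_sigma(1)[OF u] below_max_sigma(1)[OF v]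
            rep_inj[OF h(1-3)])
    qed
    from separated_mult[OF this coef_nonzero[of i]]
    show "separated (base_point e n i - \<xi> * base_point e n j) (poly_end u i - \<xi> * poly_end u j)
        (poly_end v i - \<xi> * poly_end v j)
        (bulge (poly_curv u i) (base_point e n i) (poly_end u i)
          - \<xi> * bulge (poly_curv u j) (base_point e n j) (poly_end u j))
        (bulge (poly_curv w (s i)) (poly_end u i) (poly_end v i)
          - \<xi> * bulge (poly_curv w (s j)) (poly_end u j) (poly_end v j))
        (bulge (poly_curv v i) (base_point e n i) (poly_end v i)
          - \<xi> * bulge (poly_curv v j) (base_point e n j) (poly_end v j))"
      using \<eta>(2) unfolding base_rep[OF h(1)] base_rep[OF h(2)] poly_end_def[OF u] poly_end_def[OF v] bulge_mult[symmetric]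
      by (simp add: right_diff_distrib flip: mult.assoc)
  qed
qed

end

end

section \<open>Restriction to a polygon\<close>

lemma partition_eqI:
  assumes u: "partition_on A u" and v: "partition_on A v" and eq: "\<And>z. z \<in> A \<Longrightarrow> part u z = part v z"
  shows "u = v"
proof -
  have "u = part u ` A" if u: "partition_on A u" for u :: "'a set set"
  proof
    show "part u ` A \<subseteq> u" using part_in[OF u] by auto
    show "u \<subseteq> part u ` A"
    proof
      fix p assume p: "p \<in> u"
      then have "p \<noteq> {}" using partition_onD3[OF u] by blast
      then obtain z where "z \<in> p" by blast
      moreover then have "z \<in> A" using partition_onD1[OF u] p by blast
      ultimately show "p \<in> part u ` A" using part_eq[OF u p] by blast
    qed
  qed
  from this[OF u] this[OF v] eq show ?thesis by (metis image_cong)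
qed

lemma partition_meet:
  "partition_on A u \<Longrightarrow> p \<in> u \<Longrightarrow> q \<in> u \<Longrightarrow> z \<in> p \<Longrightarrow> z \<in> q \<Longrightarrow> p = q"
  using part_eq by metis

lemma NCP_meet:
  "u \<in> NCP A \<Longrightarrow> p \<in> u \<Longrightarrow> q \<in> u \<Longrightarrow> x \<in> convex hull p \<Longrightarrow> x \<in> convex hull q \<Longrightarrow> p = q"
  by (auto simp: NCP_def)

lemma NCP_I:
  assumes "\<Union>u = A" "{} \<notin> u" "\<And>p q. p \<in> u \<Longrightarrow> q \<in> u \<Longrightarrow> convex hull p \<inter> convex hull q \<noteq> {} \<Longrightarrow> p = q"
  shows "u \<in> NCP A"
proof -
  have "p \<inter> q = {}" if "p \<in> u" "q \<in> u" "p \<noteq> q" for p q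
    using assms(3)[OF that(1,2)] that(3) hull_inc[of _ p convex] hull_inc[of _ q convex] by blast
  then show ?thesis using assms by (auto simp: NCP_def partition_on_def disjoint_def)
qed

text \<open>The line through \<open>a\<close> and \<open>b\<close> passes between 0 and
  \<open>z\<close>, so it meets the radius to \<open>z\<close> at a point of the disc, and the disc
  cuts the line in the chord.\<close>

lemma chord_meets_radius:
  assumes n1: "cmod a = 1" "cmod b = 1" "cmod z = 1"
    and o: "orient a b z \<noteq> 0" "orient a b 0 * orient a b z \<le> 0"
  shows "closed_segment a b \<inter> closed_segment 0 z \<noteq> {}"
proof -
  define \<tau> where "\<tau> = orient a b 0 / (orient a b 0 - orient a b z)"
  have sgn: "orient a b z > 0 \<and> orient a b 0 \<le> 0 \<or> orient a b z < 0 \<and> orient a b 0 \<ge> 0"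
    using o by (auto simp: mult_le_0_iff)
  then have dne: "orient a b 0 - orient a b z \<noteq> 0" by auto
  have \<tau>: "0 \<le> \<tau>" "\<tau> \<le> 1"
    using sgn unfolding \<tau>_def by (auto simp: divide_le_eq_1 zero_le_divide_iff)
  define x where "x = of_real \<tau> * z"
  have x: "x \<in> closed_segment 0 z" unfolding closed_segment_def x_def using \<tau> by (auto simp: scaleR_conv_of_real)
  have xn: "(cmod x)\<^sup>2 \<le> 1" using \<tau> n1 by (simp add: x_def norm_mult power_le_one)
  have "orient a b x = (1 - \<tau>) * orient a b 0 + \<tau> * orient a b z"
    by (simp add: x_def orient_def algebra_simps)
  also have "\<dots> = orient a b 0 - \<tau> * (orient a b 0 - orient a b z)" by (simp add: algebra_simps)
  also have "\<dots> = 0" using dne by (simp add: \<tau>_def)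
  finally have ox: "Im (cnj (b - a) * (x - a)) = 0" by (simp add: orient_def)
  have ab: "a \<noteq> b" using o by auto
  define l where "l = Re (cnj (b - a) * (x - a)) / (cmod (b - a))\<^sup>2"
  have nz: "(cmod (b - a))\<^sup>2 > 0" using ab by simp
  have "cnj (b - a) * (x - a) = of_real (l * (cmod (b - a))\<^sup>2)"
    using ox nz by (simp add: complex_eq_iff l_def)
  also have "\<dots> = cnj (b - a) * (of_real l * (b - a))"
    using complex_norm_square[of "b - a"] by (simp add: mult_ac)
  finally have xl: "x = a + of_real l * (b - a)" using ab by (simp add: mult_left_cancel) (simp add: algebra_simps)
  have nab: "(Re a)\<^sup>2 + (Im a)\<^sup>2 = 1" "(Re b)\<^sup>2 + (Im b)\<^sup>2 = 1" using n1 cmod_power2[of a] cmod_power2[of b] by auto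
  \<comment> \<open>The power of the point \<open>x\<close> with respect to the circle; its sign
    confines \<open>l\<close> to the unit interval.\<close>
  have "(cmod x)\<^sup>2 = 1 - l * (1 - l) * (cmod (b - a))\<^sup>2"
    unfolding cmod_power2 xl using nab by simp algebra
  then have "l * (1 - l) * (cmod (b - a))\<^sup>2 \<ge> 0" using xn by simp
  then have "l * (1 - l) \<ge> 0" using nz by (simp add: zero_le_mult_iff)
  then have "0 \<le> l" "l \<le> 1" by (auto simp: zero_le_mult_iff)
  then have "x \<in> closed_segment a b" unfolding closed_segment_def xl
    by (intro CollectI exI[of _ l]) (simp add: scaleR_conv_of_real algebra_simps)
  then show ?thesis using x by blast
qed

context ee
begin

lemma mu_Q_rep:
  assumes "\<zeta> \<in> mu M" "z \<in> mu M"
  obtains c y where "c \<in> mu e" "y \<in> Q \<zeta>" "y \<noteq> 0" "z = c * y"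
proof -
  obtain r c where r: "0 < r" "c \<in> mu e" "z = c * \<omega> ^ r" using mu_representative[OF assms(2)] by blast
  note rc = rep_coef[OF assms(1) r(1)]
  show thesis by (rule that[OF mu_mult[OF r(2) rc(3)] rc(1,2)]) (use r rc in \<open>simp add: mult.assoc\<close>)
qed

text \<open>The inverse of the restriction to \<open>Q \<zeta>\<close> on the partitions below \<open>max_asym e n \<zeta>\<close>.\<close>
definition spread :: "complex set set \<Rightarrow> complex set set" where
  "spread w = w \<union> {(*) c ` (p - {0}) | c p. c \<in> mu e \<and> c \<noteq> 1 \<and> p \<in> w \<and> p \<noteq> {0}}"

context
  fixes \<zeta> assumes \<zeta>: "\<zeta> \<in> mu M"
begin

context
  fixes w assumes w: "w \<in> NCP (Q \<zeta>)"
begin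

lemma w_part: "partition_on (Q \<zeta>) w" "p \<in> w \<Longrightarrow> p \<subseteq> Q \<zeta>" "p \<in> w \<Longrightarrow> p \<noteq> {}"
  using w partition_onD1[of "Q \<zeta>" w] partition_onD3[of "Q \<zeta>" w] by (auto simp: NCP_def)

lemma w_hull: "p \<in> w \<Longrightarrow> q \<in> w \<Longrightarrow> convex hull p \<inter> convex hull q \<noteq> {} \<Longrightarrow> p = q"
  using w by (auto simp: NCP_def)

lemma cone_hulls:
  assumes "c \<in> mu e" "c \<noteq> 1" "p \<in> w" "q \<in> w"
  shows "convex hull p \<inter> convex hull ((*) c ` (q - {0})) = {}"
proof -
  obtain k where k: "\<And>x y. x \<in> Q \<zeta> \<Longrightarrow> y \<in> Q \<zeta> \<Longrightarrow> (x, y) \<noteq> (0, 0) \<Longrightarrow> Im (k * (x - c * y)) > 0"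
    using cone_separated[OF \<zeta> assms(1,2)] by blast
  show ?thesis
  proof (rule separated_hulls[of _ _ k], intro ballI)
    fix x y assume "x \<in> p" "y \<in> (*) c ` (q - {0})"
    then show "Im (k * (x - y)) > 0" using k w_part(2) assms by blast
  qed
qed

lemma flat_hulls:
  assumes c: "c \<in> mu e" "d \<in> mu e" and p: "p \<in> w" "q \<in> w"
    and h: "convex hull ((*) c ` (p - {0})) \<inter> convex hull ((*) d ` (q - {0})) \<noteq> {}"
  shows "c = d \<and> p = q"
proof -
  have c0: "c \<noteq> 0" by (rule mu_nonzero[OF e_pos c(1)])
  have e: "(*) d ` (q - {0}) = (*) c ` (*) (d / c) ` (q - {0})" using c0 by (simp add: image_image)
  have "(*) c ` (convex hull (p - {0})) \<inter> (*) c ` (convex hull ((*) (d / c) ` (q - {0}))) \<noteq> {}"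
    using h unfolding e rotate_hull[of c] .
  then have h': "convex hull (p - {0}) \<inter> convex hull ((*) (d / c) ` (q - {0})) \<noteq> {}" using c0 by auto
  have sub: "convex hull (x - {0}) \<subseteq> convex hull x" for x :: "complex set" by (intro hull_mono) auto
  have dc: "d / c = 1"
    using cone_hulls[OF mu_divide[OF c(2,1)] _ p] h' sub[of p] by blast
  then have "convex hull p \<inter> convex hull q \<noteq> {}" using h' sub[of p] sub[of q] by auto
  then show ?thesis using w_hull[OF p] dc c0 by simp
qed

lemma spread_NCP: "spread w \<in> NCP (mu0 M)"
proof (rule NCP_I)
  show "\<Union> (spread w) = mu0 M"
  proof
    show "\<Union> (spread w) \<subseteq> mu0 M"
    proof
      fix z assume "z \<in> \<Union> (spread w)"
      then obtain p where p: "p \<in> spread w" "z \<in> p" by blast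
      show "z \<in> mu0 M"
      proof (cases "p \<in> w")
        case True then show ?thesis using w_part(2) Q_subset[OF \<zeta>] p by blast
      next
        case False
        then obtain c q where "c \<in> mu e" "q \<in> w" "z \<in> (*) c ` (q - {0})" using p by (auto simp: spread_def)
        then show ?thesis using mu_mult[OF mu_e_M] w_part(2) Q_nonzero_mu[OF \<zeta>] by blast
      qed
    qed
    show "mu0 M \<subseteq> \<Union> (spread w)"
    proof
      fix z assume z: "z \<in> mu0 M"
      show "z \<in> \<Union> (spread w)"
      proof (cases "z \<in> Q \<zeta>")
        case True then show ?thesis using partition_onD1[OF w_part(1)] by (auto simp: spread_def)
      next
        case False
        then have "z \<in> mu M" using z Q_0 by auto
        then obtain c y where cy: "c \<in> mu e" "y \<in> Q \<zeta>" "y \<noteq> 0" "z = c * y" using mu_Q_rep[OF \<zeta>] by metis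
        then obtain p where p: "p \<in> w" "y \<in> p" using partition_onD1[OF w_part(1)] by blast
        have "c \<noteq> 1" "p \<noteq> {0}" using False cy p by auto
        then have "(*) c ` (p - {0}) \<in> spread w" using cy p unfolding spread_def by blast
        moreover have "z \<in> (*) c ` (p - {0})" using cy p by blast
        ultimately show ?thesis by blast
      qed
    qed
  qed
  show "{} \<notin> spread w"
  proof
    assume "{} \<in> spread w"
    then obtain p where "p \<in> w" "p \<noteq> {0}" "p - {0} = {}" using w_part(3) by (auto simp: spread_def)
    then show False using w_part(3)[of p] by auto
  qed
  fix p q assume h: "p \<in> spread w" "q \<in> spread w" "convex hull p \<inter> convex hull q \<noteq> {}"
  have mixed: False if h: "p \<in> w" "q \<in> spread w" "q \<notin> w" "convex hull p \<inter> convex hull q \<noteq> {}" for p q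
  proof -
    obtain c r where "q = (*) c ` (r - {0})" "c \<in> mu e" "c \<noteq> 1" "r \<in> w" using h(2,3) by (auto simp: spread_def)
    then show False using cone_hulls h(1,4) by blast
  qed
  consider "p \<in> w" "q \<in> w" | "p \<in> w" "q \<notin> w" | "p \<notin> w" "q \<in> w" | "p \<notin> w" "q \<notin> w" by blast
  then show "p = q"
  proof cases
    case 1 then show ?thesis using w_hull h(3) by blast
  next
    case 2 then show ?thesis using mixed h by blast
  next
    case 3 then show ?thesis using mixed[of q p] h by (simp add: Int_commute)
  next
    case 4
    obtain c p' where p: "p = (*) c ` (p' - {0})" "c \<in> mu e" "p' \<in> w" using 4(1) h(1) by (auto simp: spread_def)
    obtain d q' where q: "q = (*) d ` (q' - {0})" "d \<in> mu e" "q' \<in> w" using 4(2) h(2) by (auto simp: spread_def)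
    show ?thesis using flat_hulls[OF p(2) q(2) p(3) q(3)] h(3) p q by blast
  qed
qed

lemma flat_spread: "flat e n (spread w) = {(*) c ` (p - {0}) | c p. c \<in> mu e \<and> p \<in> w \<and> p \<noteq> {0}}" (is "_ = ?F")
proof
  have int1: "mu M \<inter> p = (*) 1 ` (p - {0})" if "p \<in> w" for p
    using w_part(2)[OF that] Q_subset[OF \<zeta>] by auto
  have int2: "mu M \<inter> (*) c ` (p - {0}) = (*) c ` (p - {0})" if "p \<in> w" "c \<in> mu e" for c p
    using mu_mult[OF mu_e_M[OF that(2)]] w_part(2)[OF that(1)] Q_nonzero_mu[OF \<zeta>] by blast
  have ne: "(*) c ` (p - {0}) \<noteq> {}" if "p \<in> w" "p \<noteq> {0}" for c p using w_part(3)[OF that(1)] that(2) by auto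
  show "flat e n (spread w) \<subseteq> ?F"
  proof
    fix x assume "x \<in> flat e n (spread w)"
    then obtain p where p: "p \<in> spread w" "x = mu M \<inter> p" "x \<noteq> {}" by (auto simp: flat_def restr_def)
    show "x \<in> ?F"
    proof (cases "p \<in> w")
      case True
      then have "x = (*) 1 ` (p - {0})" "p \<noteq> {0}" using int1 p by auto
      then show ?thesis using True mu_1 by blast
    next
      case False
      then obtain c q where q: "p = (*) c ` (q - {0})" "c \<in> mu e" "q \<in> w" "q \<noteq> {0}" using p by (auto simp: spread_def)
      then have "x = (*) c ` (q - {0})" using int2 p(2) by simp
      then show ?thesis using q by blast
    qed
  qed
  show "?F \<subseteq> flat e n (spread w)"
  proof
    fix x assume "x \<in> ?F"
    then obtain c p where cp: "x = (*) c ` (p - {0})" "c \<in> mu e" "p \<in> w" "p \<noteq> {0}" by blast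
    have xn: "x \<noteq> {}" using ne cp by blast
    show "x \<in> flat e n (spread w)"
    proof (cases "c = 1")
      case True
      then have "x = mu M \<inter> p" using int1 cp by simp
      then show ?thesis using xn cp(3) unfolding flat_def restr_def spread_def by blast
    next
      case False
      then have "x \<in> spread w" using cp unfolding spread_def by blast
      moreover have "x = mu M \<inter> x" using int2 cp by simp
      ultimately show ?thesis using xn unfolding flat_def restr_def by blast
    qed
  qed
qed

lemma spread_NCP_ee: "spread w \<in> NCP_ee e n"
proof -
  let ?F = "{(*) c ` (p - {0}) | c p. c \<in> mu e \<and> p \<in> w \<and> p \<noteq> {0}}"
  have "flat e n (spread w) \<in> NCP (mu M)"
    unfolding flat_def by (rule restr_NCP[OF spread_NCP]) auto
  moreover have "(`) ((*) \<xi>) ` flat e n (spread w) = flat e n (spread w)" if \<xi>: "\<xi> \<in> mu e" for \<xi>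
  proof -
    have sub: "(`) ((*) \<xi>) ` ?F \<subseteq> ?F" if "\<xi> \<in> mu e" for \<xi>
    proof
      fix x assume "x \<in> (`) ((*) \<xi>) ` ?F"
      then obtain c p where "x = (*) \<xi> ` (*) c ` (p - {0})" "c \<in> mu e" "p \<in> w" "p \<noteq> {0}" by blast
      moreover then have "x = (*) (\<xi> * c) ` (p - {0})" by (simp add: image_image mult.assoc)
      ultimately show "x \<in> ?F" using mu_mult[OF that] by blast
    qed
    have "x \<in> (`) ((*) \<xi>) ` ?F" if x: "x \<in> ?F" for x
    proof -
      have "(*) (inverse \<xi>) ` x \<in> ?F" using sub[OF mu_inverse[OF \<xi>]] x by blast
      moreover have "x = (*) \<xi> ` (*) (inverse \<xi>) ` x"
        using mu_nonzero[OF e_pos \<xi>] by (simp add: image_image flip: mult.assoc)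
      ultimately show ?thesis by blast
    qed
    then show ?thesis unfolding flat_spread using sub[OF \<xi>] by blast
  qed
  ultimately show ?thesis using spread_NCP by (auto simp: NCP_ee_def NCP_e1_def)
qed

lemma restr_spread: "restr (spread w) (Q \<zeta>) = w"
proof -
  have 1: "Q \<zeta> \<inter> p = p" if "p \<in> w" for p using w_part(2)[OF that] by auto
  have 2: "Q \<zeta> \<inter> (*) c ` (p - {0}) = {}" if "p \<in> w" "c \<in> mu e" "c \<noteq> 1" for c p
  proof (rule ccontr)
    assume "Q \<zeta> \<inter> (*) c ` (p - {0}) \<noteq> {}"
    then obtain y where y: "y \<in> p" "y \<noteq> 0" "c * y \<in> Q \<zeta>" by blast
    then have "c * y = y" using Q_inequivalent[OF \<zeta> y(3) _ that(2)] w_part(2)[OF that(1)] by blast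
    then show False using y that by simp
  qed
  have ne: "{} \<notin> w" using w_part(3) by blast
  show ?thesis
  proof
    show "restr (spread w) (Q \<zeta>) \<subseteq> w"
    proof
      fix x assume "x \<in> restr (spread w) (Q \<zeta>)"
      then obtain p where p: "p \<in> spread w" "x = Q \<zeta> \<inter> p" "x \<noteq> {}" by (auto simp: restr_def)
      show "x \<in> w"
      proof (cases "p \<in> w")
        case True then show ?thesis using 1 p by simp
      next
        case False
        then obtain c q where "p = (*) c ` (q - {0})" "c \<in> mu e" "c \<noteq> 1" "q \<in> w" using p by (auto simp: spread_def)
        then show ?thesis using 2 p by simp
      qed
    qed
    show "w \<subseteq> restr (spread w) (Q \<zeta>)"
    proof
      fix p assume p: "p \<in> w"
      then have "p = Q \<zeta> \<inter> p" "p \<noteq> {}" using 1 ne by auto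
      then show "p \<in> restr (spread w) (Q \<zeta>)" using p unfolding restr_def spread_def by blast
    qed
  qed
qed

end

lemma Q_nontrivial: "Q \<zeta> \<noteq> {0}"
  using rep_coef(1,2)[OF \<zeta>, of 1] by auto

lemma triv_NCP: "{Q \<zeta>} \<in> NCP (Q \<zeta>)"
  by (rule NCP_I) (use Q_0[of \<zeta>] in \<open>auto simp del: Q_0\<close>)

lemma max_asym_eq: "max_asym e n \<zeta> = spread {Q \<zeta>}"
proof -
  have "(*) c ` Q \<zeta> - {0} = (*) c ` (Q \<zeta> - {0})" if "c \<in> mu e" for c
    using mu_nonzero[OF e_pos that] by auto
  then have "(\<lambda>c. (*) c ` Q \<zeta> - {0}) ` (mu e - {1}) = (\<lambda>c. (*) c ` (Q \<zeta> - {0})) ` (mu e - {1})"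
    by (intro image_cong) auto
  then show ?thesis using Q_nontrivial unfolding max_asym_def spread_def by auto
qed

lemma max_asym_partition: "partition_on (mu0 M) (max_asym e n \<zeta>)"
  using spread_NCP[OF triv_NCP] unfolding max_asym_eq by (simp add: NCP_def)

lemma spread_mono:
  assumes w: "w \<in> NCP (Q \<zeta>)" "w' \<in> NCP (Q \<zeta>)" "refines (Q \<zeta>) w w'"
  shows "refines (mu0 M) (spread w) (spread w')"
  unfolding refines_def
proof (intro conjI ballI)
  show "partition_on (mu0 M) (spread w)" "partition_on (mu0 M) (spread w')"
    using spread_NCP w by (simp_all add: NCP_def)
  fix p assume p: "p \<in> spread w"
  show "\<exists>q\<in>spread w'. p \<subseteq> q"
  proof (cases "p \<in> w")
    case True
    then show ?thesis using w(3) unfolding refines_def spread_def by blast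
  next
    case False
    then obtain c q where q: "p = (*) c ` (q - {0})" "c \<in> mu e" "c \<noteq> 1" "q \<in> w" "q \<noteq> {0}" using p by (auto simp: spread_def)
    then obtain q' where q': "q' \<in> w'" "q \<subseteq> q'" using w(3) unfolding refines_def by blast
    have "q' \<noteq> {0}" using q q' w_part(3)[OF w(1) q(4)] by auto
    then have "(*) c ` (q' - {0}) \<in> spread w'" using q q' unfolding spread_def by blast
    moreover have "p \<subseteq> (*) c ` (q' - {0})" using q q' by blast
    ultimately show ?thesis by blast
  qed
qed

lemma spread_refines:
  assumes w: "w \<in> NCP (Q \<zeta>)"
  shows "refines (mu0 M) (spread w) (max_asym e n \<zeta>)"
proof -
  have "refines (Q \<zeta>) w {Q \<zeta>}"
    using w_part(1,2)[OF w] w_part(1)[OF triv_NCP] by (simp add: refines_def)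
  from spread_mono[OF w triv_NCP this] show ?thesis by (simp add: max_asym_eq)
qed

text \<open>No part that meets the complement of \<open>Q \<zeta>\<close> contains 0, so there
  \<open>u\<close> agrees with its invariant flat partition. This makes the restriction to
  \<open>Q \<zeta>\<close> injective.\<close>

lemma below_max_part:
  assumes u: "u \<in> NCP_ee e n" "refines (mu0 M) u (max_asym e n \<zeta>)"
    and "c \<in> mu e" "y \<in> Q \<zeta>" "y \<noteq> 0" "c * y \<notin> Q \<zeta>"
  shows "part u (c * y) = (*) c ` (part (restr u (Q \<zeta>)) y - {0})"
proof -
  have y: "y \<in> mu M" by (rule Q_nonzero_mu[OF \<zeta> assms(4,5)])
  have cy: "c * y \<in> mu M" by (rule mu_mult[OF mu_e_M[OF assms(3)] y])
  have "0 \<notin> part u (c * y)" using zero_part_Q[OF \<zeta> u _ ] cy assms(6) by blast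
  then have "part u (c * y) = part (flat e n u) (c * y)" by (rule part_nonzero_flat[OF \<zeta> u cy])
  also have "\<dots> = (*) c ` part (flat e n u) y" by (rule NCP_e1_D(4)[OF NCP_ee_D(2)[OF u(1)] assms(3) y])
  also have "part (flat e n u) y = part (restr u (Q \<zeta>)) y - {0}"
    using NCP_ee_D(4)[OF u(1) y] restr_Q_part[OF \<zeta> u assms(4)] by simp
  finally show ?thesis .
qed

lemma restr_inj:
  assumes u: "u \<in> NCP_ee e n" "refines (mu0 M) u (max_asym e n \<zeta>)"
    and v: "v \<in> NCP_ee e n" "refines (mu0 M) v (max_asym e n \<zeta>)"
    and eq: "restr u (Q \<zeta>) = restr v (Q \<zeta>)"
  shows "u = v"
proof (rule partition_eqI[OF NCP_ee_D(1)[OF u(1)] NCP_ee_D(1)[OF v(1)]])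
  fix z assume z: "z \<in> mu0 M"
  show "part u z = part v z"
  proof (cases "z \<in> Q \<zeta>")
    case True then show ?thesis using restr_Q_part[OF \<zeta> u True] restr_Q_part[OF \<zeta> v True] eq by simp
  next
    case False
    then have "z \<in> mu M" using z Q_0 by auto
    then obtain c y where cy: "c \<in> mu e" "y \<in> Q \<zeta>" "y \<noteq> 0" "z = c * y" using mu_Q_rep[OF \<zeta>] by metis
    have nq: "c * y \<notin> Q \<zeta>" using False cy(4) by simp
    show ?thesis unfolding cy(4)
      using below_max_part[OF u cy(1-3) nq] below_max_part[OF v cy(1-3) nq] eq by simp
  qed
qed

lemma phi_inv_eq: "w \<in> NCP (Q \<zeta>) \<Longrightarrow> phi_inv e n \<zeta> w = spread w"
  unfolding phi_inv_def
  by (rule the_equality) (use spread_NCP_ee spread_refines restr_spread restr_inj in auto)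

lemma phi_inv:
  assumes w: "w \<in> NCP (Q \<zeta>)"
  shows "phi_inv e n \<zeta> w \<in> NCP_ee e n" "refines (mu0 M) (phi_inv e n \<zeta> w) (max_asym e n \<zeta>)"
    "restr (phi_inv e n \<zeta> w) (Q \<zeta>) = w"
  unfolding phi_inv_eq[OF w] by (rule spread_NCP_ee[OF w] spread_refines[OF w] restr_spread[OF w])+

end

section \<open>Every asymmetric partition lies below some
  \<open>max_asym e n \<zeta>\<close>\<close>

lemma flat_part_in:
  assumes "v \<in> NCP_ee e n" "r \<in> flat e n v" "r \<noteq> part v 0 - {0}"
  shows "r \<in> v"
proof -
  note P = NCP_ee_D(1)[OF assms(1)]
  obtain s where s: "s \<in> v" "r = mu M \<inter> s" using assms(2) by (auto simp: flat_def restr_def)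
  have sub: "s \<subseteq> mu0 M" using partition_onD1[OF P] s by blast
  have "0 \<notin> s"
  proof
    assume "0 \<in> s"
    then have "part v 0 = s" by (rule part_eq[OF P s(1)])
    then show False using assms(3) s sub by auto
  qed
  then have "r = s" using s sub by auto
  then show ?thesis using s by simp
qed

lemma least_direction:
  assumes "finite p" "p \<noteq> {}" "0 \<notin> convex hull p" "p \<subseteq> mu M"
  obtains z where "z \<in> p" "\<And>x. x \<in> p \<Longrightarrow> x \<noteq> z \<Longrightarrow> Im (cnj z * x) > 0"
proof -
  have "closed (convex hull p)" using assms(1) finite_imp_compact_convex_hull compact_imp_closed by blast
  then obtain a b where ab: "a \<bullet> 0 < b" "\<forall>x\<in>convex hull p. a \<bullet> x > b"
    using separating_hyperplane_closed_point[of "convex hull p" 0] assms(3) by auto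
  \<comment> \<open>The tangent of the angle from \<open>x\<close> to the direction
    \<open>a\<close>, which is monotone on the open half-plane containing \<open>p\<close>. Its
    maximum is attained at the first point of \<open>p\<close> in counterclockwise order.\<close>
  define f where "f x = (Re x * Im a - Im x * Re a) / (a \<bullet> x)" for x
  obtain z where z: "z \<in> p" "\<And>x. x \<in> p \<Longrightarrow> \<not> - f x < - f z"
    using arg_min_if_finite[OF assms(1,2), of "\<lambda>x. - f x"] by blast
  have pos: "a \<bullet> x > 0" if "x \<in> p" for x using ab hull_inc[OF that, of convex] by force
  show thesis
  proof (rule that[OF z(1)])
    fix x assume x: "x \<in> p" "x \<noteq> z"
    have a: "(cmod a)\<^sup>2 > 0" using pos[OF z(1)] by auto
    have key: "(cmod a)\<^sup>2 * Im (cnj z * x) = (a \<bullet> x) * (a \<bullet> z) * (f z - f x)"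
    proof -
      let ?g = "\<lambda>x. Re x * Im a - Im x * Re a"
      have "(a \<bullet> x) * (a \<bullet> z) * (f z - f x) = (a \<bullet> x) * ?g z - (a \<bullet> z) * ?g x"
        using pos[OF x(1)] pos[OF z(1)] by (simp add: f_def field_simps)
      also have "\<dots> = (cmod a)\<^sup>2 * Im (cnj z * x)"
        unfolding cmod_power2 by (simp add: inner_complex_def power2_eq_square algebra_simps)
      finally show ?thesis by simp
    qed
    have "f z - f x \<ge> 0" using z(2)[OF x(1)] by simp
    then have "(cmod a)\<^sup>2 * Im (cnj z * x) \<ge> 0" unfolding key using pos x z by (simp add: less_imp_le)
    then have ge: "Im (cnj z * x) \<ge> 0" using a by (simp add: zero_le_mult_iff)
    have "Im (cnj z * x) \<noteq> 0"
    proof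
      assume 0: "Im (cnj z * x) = 0"
      have n: "cmod z = 1" "cmod x = 1" using norm_mu[OF M_pos] assms(4) x z by auto
      have "cmod (cnj z * x) = 1" using n by (simp add: norm_mult)
      then have "Re (cnj z * x) = 1 \<or> Re (cnj z * x) = - 1"
        using 0 cmod_power2[of "cnj z * x"] by (simp add: power2_eq_1_iff)
      then have "cnj z * x = 1 \<or> cnj z * x = - 1" using 0 by (auto simp: complex_eq_iff)
      moreover have "z * (cnj z * x) = x" using n complex_norm_square[of z] by (simp flip: mult.assoc)
      ultimately have "x = - z" using x(2) by (metis mult.right_neutral mult_minus_right)
      then show False using pos[OF x(1)] pos[OF z(1)] by simp
    qed
    then show "Im (cnj z * x) > 0" using ge by simp
  qed
qed

lemma ccw_rotated:
  assumes "z \<in> mu M" "i < M" "j < M" "k < M"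
  shows "ccw (z * \<omega> ^ i) (z * \<omega> ^ j) (z * \<omega> ^ k) \<longleftrightarrow> cyc (int i) (int j) (int k)"
  using R.ccw_vertex[OF assms(2-4)] norm_mu[OF M_pos assms(1)] by (simp add: orient_mult)

lemma mu_index:
  assumes "z \<in> mu M" "x \<in> mu M"
  obtains k where "k < M" "x = z * \<omega> ^ k"
proof -
  have "x / z \<in> mu M" by (rule mu_divide[OF assms(2,1)])
  then obtain k where "k < M" "x / z = \<omega> ^ k" using mu_eq_powers[OF M_pos] by auto
  then show thesis using that mu_M_nonzero[OF assms(1)] by (simp add: field_simps)
qed

lemma omega_n_power: "\<omega> ^ (n * t) \<in> mu e"
proof -
  have "(\<omega> ^ (n * t)) ^ e = (\<omega> ^ M) ^ t" by (simp add: mult_ac flip: power_mult)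
  then show ?thesis by (simp add: mu_def omega_M)
qed

text \<open>Let \<open>z\<close> be the first nonzero point of the part of 0. This part spans fewer
  than \<open>n\<close> steps, as otherwise it would cross its rotated copy. The rotated copies of
  the radius to \<open>z\<close> cut the disc into sectors, and another part meeting two of them
  would cross such a radius, hence after rotation the part of 0.\<close>

lemma asymmetric_below_max:
  assumes v: "v \<in> NCP_ee e n" and asym: "asymmetric e n v"
  shows "\<exists>\<zeta>. \<zeta> \<in> mu M \<and> refines (mu0 M) v (max_asym e n \<zeta>)"
proof -
  note P = NCP_ee_D(1)[OF v] and F = NCP_ee_D(2)[OF v]
  note FN = NCP_e1_D(1,2)[OF F]
  define p where "p = part v 0 - {0}"
  have q: "part v 0 \<in> v" "0 \<in> part v 0" "part v 0 \<subseteq> mu0 M"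
    using part_in[OF P, of 0] part_self[OF P, of 0] part_subset[OF P, of 0] by blast+
  have "part v 0 \<noteq> {0}" using q(1) asym unfolding asymmetric_def by metis
  then have pne: "p \<noteq> {}" using q by (auto simp: p_def)
  have pmu: "p \<subseteq> mu M" using q by (auto simp: p_def)
  have "p = mu M \<inter> part v 0" using q(3) by (auto simp: p_def)
  then have pF: "p \<in> flat e n v" using q(1) pne unfolding flat_def restr_def by blast
  have short: "0 \<notin> convex hull a" if "a \<in> flat e n v" for a using asym that by (auto simp: asymmetric_def long_def)
  obtain z where z: "z \<in> p" "\<And>x. x \<in> p \<Longrightarrow> x \<noteq> z \<Longrightarrow> Im (cnj z * x) > 0"
    using least_direction[OF finite_subset[OF pmu finite_mu[OF M_pos]] pne short[OF pF] pmu] by metis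
  have zM: "z \<in> mu M" using z pmu by auto
  have z0: "z \<noteq> 0" by (rule mu_M_nonzero[OF zM])
  have half: "2 * k < M" if "k < M" "z * \<omega> ^ k \<in> p" for k
  proof (cases "k = 0")
    case False
    then have "\<omega> ^ k \<noteq> 1" using inj_on_eq_iff[OF inj_on_zeta[OF M_pos], of k 0] that e_pos n_pos by auto
    then have "Im (cnj z * (z * \<omega> ^ k)) > 0" using z(2)[OF that(2)] z0 by simp
    moreover have "cnj z * z = 1" using complex_norm_square[of z] norm_mu[OF M_pos zM] by (simp add: mult.commute)
    ultimately have s: "sin (2 * pi * real k / real M) > 0" by (simp add: zeta_power flip: mult.assoc)
    show ?thesis
    proof (rule ccontr)
      assume "\<not> 2 * k < M"
      then have "real M \<le> 2 * real k" by linarith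
      define r where "r = 2 * real k / real M"
      have "real k < real M" "0 < real M" using that(1) M_pos by (simp_all only: of_nat_less_iff of_nat_0_less_iff)
      with \<open>real M \<le> 2 * real k\<close> have r: "1 \<le> r" "r < 2"
        unfolding r_def by (simp_all only: le_divide_eq_1_pos pos_divide_less_eq)
      have "pi * 1 \<le> pi * r" "pi * r \<le> pi * 2" using r by (intro mult_left_mono; simp)+
      then have "sin (pi * r) \<le> 0" using sin_ge_zero[of "pi * r - pi"] by (simp add: sin_diff)
      moreover have "2 * pi * real k / real M = pi * r" by (simp add: r_def)
      ultimately show False using s by simp
    qed
  qed (use M_pos in simp)
  have lt_n: "k < n" if k: "k < M" "z * \<omega> ^ k \<in> p" for k
  proof (rule ccontr)
    assume nk: "\<not> k < n"
    have e2: "2 \<le> e"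
    proof (rule ccontr)
      assume "\<not> 2 \<le> e"
      then have "e = 1" using e_pos by linarith
      then show False using nk half[OF k] e1 n_pos by simp
    qed
    let ?\<xi> = "\<omega> ^ n"
    have \<xi>: "?\<xi> \<in> mu e" using omega_n_power[of 1] by simp
    have \<xi>p: "(*) ?\<xi> ` p \<in> flat e n v" using NCP_e1_D(3)[OF F \<xi>] pF by blast
    \<comment> \<open>Invariance would put \<open>n * (e - 1)\<close> steps between two points of
      \<open>p\<close>, at least half a turn.\<close>
    have neq: "(*) ?\<xi> ` p \<noteq> p"
    proof
      assume inv: "(*) ?\<xi> ` p = p"
      have "z * \<omega> ^ (n * t) \<in> p" for t
      proof (induction t)
        case (Suc t)
        have "?\<xi> * (z * \<omega> ^ (n * t)) \<in> (*) ?\<xi> ` p" using Suc by (rule imageI)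
        then show ?case using inv by (simp add: power_add mult_ac)
      qed (use z in simp)
      from this[of "e - 1"] have "2 * (n * (e - 1)) < M"
        using half[of "n * (e - 1)"] e2 n_pos by (simp add: mult.commute[of n])
      then have "n * (2 * (e - 1)) < n * e" by (simp add: mult_ac)
      then have "2 * (e - 1) < e" by simp
      then show False using e2 by arith
    qed
    have "k \<noteq> n"
    proof
      assume "k = n"
      then have "?\<xi> * z \<in> p" using k(2) by (simp add: mult.commute)
      moreover have "?\<xi> * z \<in> (*) ?\<xi> ` p" using z by blast
      ultimately have "p = (*) ?\<xi> ` p" by (rule partition_meet[OF FN(2) pF \<xi>p])
      then show False using neq by simp
    qed
    then have "n < k" using nk by simp
    then have bounds: "0 < n" "n < k" "k < n + k" "n + k < M" "n < M" using half[OF k] n_pos k(1) by linarith+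
    \<comment> \<open>The chord from step 0 to step \<open>k\<close> and its rotated copy from step
      \<open>n\<close> to step \<open>n + k\<close> cross.\<close>
    have "ccw (z * \<omega> ^ 0) (z * \<omega> ^ n) (z * \<omega> ^ k)" "ccw (z * \<omega> ^ k) (z * \<omega> ^ (n + k)) (z * \<omega> ^ 0)"
      using ccw_rotated[OF zM, of 0 n k] ccw_rotated[OF zM, of k "n + k" 0] bounds k(1) by (auto simp: cyc_def)
    moreover have "noncrossing p ((*) ?\<xi> ` p)" using R.NCP_D(2)[of "flat e n v"] FN(1) pF \<xi>p neq by auto
    moreover have "z * \<omega> ^ 0 \<in> p" "z * \<omega> ^ k \<in> p" using z k by auto
    moreover have "?\<xi> * z \<in> (*) ?\<xi> ` p" "?\<xi> * (z * \<omega> ^ k) \<in> (*) ?\<xi> ` p" using z k by blast+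
    then have "z * \<omega> ^ n \<in> (*) ?\<xi> ` p" "z * \<omega> ^ (n + k) \<in> (*) ?\<xi> ` p" by (simp_all add: power_add mult_ac)
    ultimately show False unfolding noncrossing_def by blast
  qed
  \<comment> \<open>The nonzero vertices of \<open>Q \<zeta>\<close> start at exponent 1, so \<zeta>
    is one step before \<open>z\<close>.\<close>
  define \<zeta> where "\<zeta> = z / \<omega>"
  have \<zeta>: "\<zeta> \<in> mu M" using mu_divide[OF zM omega_in_mu[of 1]] by (simp add: \<zeta>_def)
  have inQ: "z * \<omega> ^ k \<in> Q \<zeta>" if "k < n" for k
  proof -
    have "z * \<omega> ^ k = polygon_vertex e n \<zeta> (k + 1)"
      using omega_nonzero[of 1] by (simp add: polygon_vertex_def \<zeta>_def)
    then show ?thesis unfolding polygon_def using that by auto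
  qed
  have qQ: "part v 0 \<subseteq> Q \<zeta>"
  proof
    fix x assume x: "x \<in> part v 0"
    show "x \<in> Q \<zeta>"
    proof (cases "x = 0")
      case False
      then have xp: "x \<in> p" using x by (simp add: p_def)
      then obtain k where "k < M" "x = z * \<omega> ^ k" using mu_index[OF zM] pmu by blast
      then show ?thesis using lt_n inQ xp by simp
    qed simp
  qed
  have sector: "a div n = b div n"
    if r: "r \<in> v" "r \<noteq> part v 0" "a < b" "b < M" "z * \<omega> ^ a \<in> r" "z * \<omega> ^ b \<in> r" for r a b
  proof (rule ccontr)
    assume ne: "a div n \<noteq> b div n"
    have r0: "0 \<notin> r" using part_eq[OF P r(1)] r(2) by metis
    have rsub: "r \<subseteq> mu M" using partition_onD1[OF P] r(1) r0 by blast
    have "r = mu M \<inter> r" using rsub by auto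
    then have rF: "r \<in> flat e n v" using r(1,5) unfolding flat_def restr_def by blast
    \<comment> \<open>A part containing a rotation of \<open>z\<close> is the corresponding rotation
      of \<open>p\<close>, which lies in a single sector, contrary to \<open>ne\<close>.\<close>
    have norot: "\<omega> ^ (n * t) * z \<notin> r" for t
    proof
      assume "\<omega> ^ (n * t) * z \<in> r"
      moreover have "\<omega> ^ (n * t) * z \<in> (*) (\<omega> ^ (n * t)) ` p" using z by blast
      moreover have "(*) (\<omega> ^ (n * t)) ` p \<in> flat e n v"
        using NCP_e1_D(3)[OF F omega_n_power[of t]] pF by blast
      ultimately have eq: "r = (*) (\<omega> ^ (n * t)) ` p"
        using partition_meet[OF FN(2) rF] by blast
      have cst: "c div n = t mod e" if c: "c < M" "z * \<omega> ^ c \<in> r" for c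
      proof -
        obtain x where x: "x \<in> p" "z * \<omega> ^ c = \<omega> ^ (n * t) * x" using c eq by blast
        then obtain k where k: "k < M" "x = z * \<omega> ^ k" using mu_index[OF zM] pmu by blast
        then have kn: "k < n" using lt_n x by simp
        have "\<omega> ^ c = \<omega> ^ (n * t + k)" using x k z0 by (simp add: power_add)
        also have "\<dots> = \<omega> ^ (n * (t mod e) + k)"
        proof -
          have "n * t = M * (t div e) + n * (t mod e)"
            by (metis div_mult_mod_eq distrib_left mult.assoc mult.commute)
          then show ?thesis by (simp add: power_add power_mult omega_M[unfolded power_mult])
        qed
        finally have "\<omega> ^ c = \<omega> ^ (n * (t mod e) + k)" .
        moreover have "n * (t mod e) + k < M"
        proof -
          have "n * (t mod e) + k < n * (t mod e + 1)" using kn by simp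
          also have "\<dots> \<le> n * e" using e_pos by (intro mult_le_mono2) (simp add: Suc_leI)
          finally show ?thesis by (simp add: mult.commute)
        qed
        ultimately have "c = n * (t mod e) + k"
          using inj_on_eq_iff[OF inj_on_zeta[OF M_pos]] c(1) by auto
        then show ?thesis using kn n_pos by simp
      qed
      show False using ne cst[of a] cst[of b] r by simp
    qed
    define t where "t = b div n"
    have at: "a < n * t" "n * t < b"
    proof -
      have "a div n < t" using ne div_le_mono[of a b n] r(3) by (simp add: t_def)
      then show "a < n * t" using n_pos by (simp add: div_less_iff_less_mult mult.commute)
      have "n * t \<le> b" by (simp add: t_def)
      moreover have "n * t \<noteq> b" using norot[of t] r(6) by (auto simp: mult.commute)
      ultimately show "n * t < b" by simp
    qed
    have a0: "0 < a" using norot[of 0] r(5) by (cases "a = 0") auto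
    let ?A = "z * \<omega> ^ a" and ?B = "z * \<omega> ^ b"
    have "orient ?A ?B (z * \<omega> ^ m) < 0" if "a < m" "m < b" for m
      using ccw_rotated[OF zM, of a m b] that r(3,4) orient_swap[of ?A ?B "z * \<omega> ^ m"] by (auto simp: cyc_def)
    from this[OF at] have o1: "orient ?A ?B (z * \<omega> ^ (n * t)) < 0" .
    have o2: "orient ?A ?B (z * \<omega> ^ 0) > 0"
      using ccw_rotated[OF zM, of a b 0] a0 r(3,4) e_pos n_pos by (auto simp: cyc_def)
    have nrm: "cmod (z * \<omega> ^ k) = 1" for k using norm_mu[OF M_pos] mu_mult[OF zM omega_in_mu] by blast
    \<comment> \<open>The chord has \<open>z\<close> on its left and the boundary point
      \<open>z * \<omega> ^ (n * t)\<close> on its right. Whichever side contains 0, the radius to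
      the point of the other side meets the chord.\<close>
    have "\<exists>s. closed_segment ?A ?B \<inter> closed_segment 0 (z * \<omega> ^ (n * s)) \<noteq> {}"
    proof (cases "orient ?A ?B 0 \<ge> 0")
      case True
      show ?thesis by (rule exI[of _ t], rule chord_meets_radius[OF nrm nrm nrm])
        (use o1 True in \<open>auto simp: mult_nonneg_nonpos\<close>)
    next
      case False
      show ?thesis by (rule exI[of _ 0], rule chord_meets_radius[OF nrm nrm nrm])
        (use o2 False in \<open>auto simp: mult_nonpos_nonneg\<close>)
    qed
    then obtain s x where x: "x \<in> closed_segment ?A ?B" "x \<in> closed_segment 0 (z * \<omega> ^ (n * s))" by blast
    let ?\<xi> = "\<omega> ^ (n * s)"
    have \<xi>: "inverse ?\<xi> \<in> mu e" "?\<xi> \<noteq> 0" using mu_inverse[OF omega_n_power] omega_nonzero by auto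
    let ?r = "(*) (inverse ?\<xi>) ` r"
    have r'F: "?r \<in> flat e n v" using NCP_e1_D(3)[OF F \<xi>(1)] rF by blast
    have "?r \<noteq> p"
    proof
      assume "?r = p"
      then obtain y where "y \<in> r" "z = inverse ?\<xi> * y" using z by blast
      then have "?\<xi> * z \<in> r" using \<xi>(2) by (simp flip: mult.assoc)
      then show False using norot by blast
    qed
    then have r'v: "?r \<in> v" using flat_part_in[OF v r'F] by (simp add: p_def)
    have "convex hull {?A, ?B} \<subseteq> convex hull r" using r(5,6) by (intro hull_mono) auto
    then have "x \<in> convex hull r" using x(1) unfolding segment_convex_hull by blast
    then have "inverse ?\<xi> * x \<in> convex hull ?r" unfolding rotate_hull by blast
    moreover have "inverse ?\<xi> * x \<in> convex hull {0, z}"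
    proof -
      have "inverse ?\<xi> * (z * ?\<xi>) = z" using \<xi>(2) by (simp add: field_simps)
      then have zz: "(*) (inverse ?\<xi>) ` {0, z * ?\<xi>} = {0, z}"
        by (simp only: image_insert image_empty mult_zero_right)
      have "convex hull {0, z} = (*) (inverse ?\<xi>) ` closed_segment 0 (z * ?\<xi>)"
        unfolding segment_convex_hull rotate_hull[symmetric] zz ..
      then show ?thesis using x(2) by blast
    qed
    moreover have "convex hull {0, z} \<subseteq> convex hull (part v 0)"
      using z(1) q(2) by (intro hull_mono) (auto simp: p_def)
    ultimately have "?r = part v 0" using NCP_meet[OF NCP_ee_D(3)[OF v] r'v q(1)] by blast
    moreover have "0 \<notin> ?r" using r0 \<xi>(2) by auto
    ultimately show False using q(2) by simp
  qed
  have "refines (mu0 M) v (max_asym e n \<zeta>)" unfolding refines_def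
  proof (intro conjI ballI)
    show "partition_on (mu0 M) v" by (rule P)
    show "partition_on (mu0 M) (max_asym e n \<zeta>)" by (rule max_asym_partition[OF \<zeta>])
    fix r assume r: "r \<in> v"
    show "\<exists>q\<in>max_asym e n \<zeta>. r \<subseteq> q"
    proof (cases "r = part v 0")
      case True
      then show ?thesis using qQ by (intro bexI[of _ "Q \<zeta>"]) (auto simp: max_asym_def)
    next
      case False
      have r0: "0 \<notin> r" using part_eq[OF P r] False by metis
      have rsub: "r \<subseteq> mu M" using partition_onD1[OF P] r r0 by blast
      have "r \<noteq> {}" using partition_onD3[OF P] r by blast
      then obtain x where x: "x \<in> r" by blast
      then obtain a where a: "a < M" "x = z * \<omega> ^ a" using mu_index[OF zM] rsub by blast
      define c where "c = \<omega> ^ (n * (a div n))"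
      have c: "c \<in> mu e" unfolding c_def by (rule omega_n_power)
      have sub: "r \<subseteq> (*) c ` (Q \<zeta> - {0})"
      proof
        fix y assume y: "y \<in> r"
        then obtain b where b: "b < M" "y = z * \<omega> ^ b" using mu_index[OF zM] rsub by blast
        have "a div n = b div n"
        proof (cases a b rule: linorder_cases)
          case less then show ?thesis using sector[OF r False less b(1)] x y a b by simp
        next
          case greater then show ?thesis using sector[OF r False greater a(1)] x y a b by simp
        qed simp
        then have "y = c * (z * \<omega> ^ (b mod n))"
          unfolding b(2) c_def by (simp add: mult.left_commute flip: power_add)
        moreover have "z * \<omega> ^ (b mod n) \<in> Q \<zeta> - {0}"
          using inQ[of "b mod n"] n_pos z0 omega_nonzero by simp
        ultimately show "y \<in> (*) c ` (Q \<zeta> - {0})" by blast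
      qed
      show ?thesis
      proof (cases "c = 1")
        case True
        then show ?thesis using sub by (intro bexI[of _ "Q \<zeta>"]) (auto simp: max_asym_def)
      next
        case False
        have "(*) c ` (Q \<zeta> - {0}) = (*) c ` Q \<zeta> - {0}" using mu_nonzero[OF e_pos c] by auto
        then have "(*) c ` (Q \<zeta> - {0}) \<in> max_asym e n \<zeta>" using c False unfolding max_asym_def by blast
        then show ?thesis using sub by blast
      qed
    qed
  qed
  then show ?thesis using \<zeta> by blast
qed

end

section \<open>Complements\<close>

lemma refines_trans: "refines A u v \<Longrightarrow> refines A v w \<Longrightarrow> refines A u w"
  unfolding refines_def by (meson order_trans)

context ee
begin

lemma compl_via:
  assumes \<zeta>: "\<zeta> \<in> mu M" and u: "u \<in> NCP_ee e n" and v: "v \<in> NCP_ee e n" and uv: "refines (mu0 M) u v"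
  shows "compl_via e n \<zeta> u v \<in> NCP_ee e n" "refines (mu0 M) (compl_via e n \<zeta> u v) (max_asym e n \<zeta>)"
    and "z \<in> Q \<zeta> \<Longrightarrow> sigma (compl_via e n \<zeta> u v) (sigma (restr u (Q \<zeta>)) z) = sigma (restr v (Q \<zeta>)) z"
proof -
  note sub = Q_subset[OF \<zeta>]
  have NU: "restr u (Q \<zeta>) \<in> NCP (Q \<zeta>)" by (rule restr_NCP[OF NCP_ee_D(3)[OF u] sub])
  have NV: "restr v (Q \<zeta>) \<in> NCP (Q \<zeta>)" by (rule restr_NCP[OF NCP_ee_D(3)[OF v] sub])
  have R: "refines (Q \<zeta>) (restr u (Q \<zeta>)) (restr v (Q \<zeta>))"
    using restr_refines[OF uv sub] NU NV by (simp add: NCP_def)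
  note C = compl_polygon[OF \<zeta> NU NV R]
  note W = phi_inv[OF \<zeta> C(1)]
  show N: "compl_via e n \<zeta> u v \<in> NCP_ee e n"
    and max: "refines (mu0 M) (compl_via e n \<zeta> u v) (max_asym e n \<zeta>)"
    unfolding compl_via_def by (rule W(1), rule W(2))
  assume z: "z \<in> Q \<zeta>"
  have "sigma (restr u (Q \<zeta>)) z \<in> Q \<zeta>"
    using convex_polygon.sigma_S[OF convex_polygon_Q[OF \<zeta>]] NU z S_Q[OF \<zeta>] by metis
  from restr_Q_sigma[OF \<zeta> N max this] C(2)[OF z]
  show "sigma (compl_via e n \<zeta> u v) (sigma (restr u (Q \<zeta>)) z) = sigma (restr v (Q \<zeta>)) z"
    using W(3) unfolding compl_via_def by simp
qed

lemma braid_mult_compl_symmetric: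
  assumes u: "u \<in> NCP_ee e n" and v: "v \<in> NCP_ee e n" and uv: "refines (mu0 M) u v"
    and sym: "symmetric e n u" "symmetric e n v"
  shows "braid e n u \<otimes>\<^bsub>braid_group e n\<^esub> braid e n (compl_ee e n u v) = braid e n v"
proof -
  note FU = NCP_ee_D(2)[OF u] and FV = NCP_ee_D(2)[OF v]
  note R = flat_refines[OF u v uv]
  note S = star[OF compl_11_NCP_e1[OF FU FV R]]
  note C = compl_11[OF M_pos NCP_e1_D(1)[OF FU] NCP_e1_D(1)[OF FV] R]
  show ?thesis
    unfolding compl_ee_def using braid_mult_symmetric[OF u v S(1) sym S(3) R] C(2) S(2) sym by simp
qed

lemma braid_mult_compl_asymmetric:
  assumes u: "u \<in> NCP_ee e n" and v: "v \<in> NCP_ee e n" and uv: "refines (mu0 M) u v"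
    and asym: "asymmetric e n v"
  shows "braid e n u \<otimes>\<^bsub>braid_group e n\<^esub> braid e n (compl_ee e n u v) = braid e n v"
proof -
  define \<zeta> where "\<zeta> = (SOME \<zeta>. \<zeta> \<in> mu M \<and> refines (mu0 M) v (max_asym e n \<zeta>))"
  have \<zeta>: "\<zeta> \<in> mu M" and vM: "refines (mu0 M) v (max_asym e n \<zeta>)"
    using someI_ex[OF asymmetric_below_max[OF v asym]] unfolding \<zeta>_def by auto
  note uM = refines_trans[OF uv vM]
  have eq: "compl_ee e n u v = compl_via e n \<zeta> u v"
    using asym by (simp add: compl_ee_def asymmetric_iff \<zeta>_def)
  note W = compl_via[OF \<zeta> u v uv]
  show ?thesis unfolding eq
    by (rule braid_mult_polygon[OF \<zeta> u uM v vM W(1,2) uv])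
      (use W(3) restr_Q_sigma[OF \<zeta> u uM] restr_Q_sigma[OF \<zeta> v vM] in simp)
qed

end

section \<open>Factorization of asymmetric braids\<close>

context convex_polygon
begin

lemma ccw_succ_subset:
  assumes "p \<subseteq> S" "p' \<subseteq> p" "z \<in> p'" "ccw_succ p z \<in> p'"
  shows "ccw_succ p' z = ccw_succ p z"
proof (cases "p' = {z}")
  case True
  then show ?thesis using assms(4) by simp
next
  case False
  then have "p \<noteq> {z}" using assms by auto
  then show ?thesis using ccw_succ[of p z] assms
    by (intro ccw_succI) auto
qed

text \<open>The half-open arc after \<open>x\<close> up to and including \<open>y\<close>;
  \<open>right_side\<close> is the complementary arc, ending at \<open>x\<close>. Cutting a part
  along the chord from \<open>x\<close> to \<open>y\<close> divides its vertices this way.\<close>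

definition left_side :: "complex \<Rightarrow> complex \<Rightarrow> complex set" where
  "left_side x y = {z \<in> S. z = y \<or> ccw x z y}"

definition right_side :: "complex \<Rightarrow> complex \<Rightarrow> complex set" where
  "right_side x y = {z \<in> S. z = x \<or> ccw x y z}"

context
  fixes u x y
  assumes u: "u \<in> NCP S" and x: "x \<in> S" and y: "y \<in> part u x" and xy: "x \<noteq> y"
begin

lemma split_mem: "y \<in> S" "part u y = part u x" "x \<in> part u x" "z \<in> S \<Longrightarrow> part u z \<subseteq> S" "z \<in> S \<Longrightarrow> z \<in> part u z"
  using part_subset[OF P[OF u] x] y part_cong[OF P[OF u] x y] part_self[OF P[OF u]]
    part_subset[OF P[OF u]] x by auto

text \<open>Multiplying a cycle by the transposition of two of its points splits it in two: after
  the exchange of \<open>x\<close> and \<open>y\<close>, the point \<open>y\<close> takes over the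
  successor of \<open>x\<close>, and \<open>x\<close> that of \<open>y\<close> in
  \<open>split_right\<close>.\<close>

lemma split_left: "ccw_succ (part u x \<inter> left_side x y) y = sigma u x"
proof -
  let ?w = "sigma u x"
  have ne: "?w \<noteq> x" using sigma_moves[OF u x y] xy by simp
  have w: "?w \<in> part u x" "?w \<in> S" using sigma_part[OF u x] sigma_S[OF u x] by auto
  have nx: "ccw x ?w z" if "z \<in> part u x" "z \<noteq> x" "z \<noteq> ?w" for z
    using sigma_next[OF u x that(1,2)] that(3) by auto
  have wl: "?w \<in> left_side x y" using nx[OF y] w xy by (auto simp: left_side_def)
  show ?thesis
  proof (cases "?w = y")
    case True
    have "part u x \<inter> left_side x y = {y}"
    proof -
      have False if z: "z \<in> part u x" "z \<in> left_side x y" "z \<noteq> y" for z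
      proof -
        have "ccw x z y" "z \<in> S" using z by (auto simp: left_side_def)
        moreover then have "z \<noteq> x" by auto
        ultimately show False using nx[of z] z True split_mem(1) orient_swap[of x z y] by auto
      qed
      then show ?thesis using y split_mem(1) by (auto simp: left_side_def)
    qed
    then show ?thesis using True by simp
  next
    case False
    show ?thesis
    proof (rule ccw_succI)
      show "part u x \<inter> left_side x y \<subseteq> S" by (auto simp: left_side_def)
      fix z assume z: "z \<in> part u x \<inter> left_side x y" "z \<noteq> y" "z \<noteq> ?w"
      then have l: "ccw x z y" "z \<in> S" by (auto simp: left_side_def)
      then have "z \<noteq> x" by auto
      then have "ccw x ?w z" using nx z by simp
      then show "ccw y ?w z" using l x w(2) split_mem(1) by (simp add: to_idx) (smt (verit))
    qed (use w wl y split_mem(1) False in \<open>auto simp: left_side_def\<close>)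
  qed
qed

lemma split_right: "ccw_succ (part u x \<inter> right_side x y) x = sigma u y"
proof -
  let ?w = "sigma u y"
  have yS: "y \<in> S" by (rule split_mem(1))
  have xp: "x \<in> part u y" using split_mem by simp
  have w: "?w \<in> part u x" "?w \<in> S" using sigma_part[OF u yS] sigma_S[OF u yS] split_mem(2) by auto
  have ne: "?w \<noteq> y" using sigma_moves[OF u yS xp] xy by simp
  have nx: "ccw y ?w z" if "z \<in> part u x" "z \<noteq> y" "z \<noteq> ?w" for z
    using sigma_next[OF u yS, of z] that split_mem(2) by auto
  have wr: "?w = x \<or> ccw x y ?w" using nx[of x] split_mem(3) xy orient_rotate[of y ?w x] orient_rotate[of x y ?w] by auto
  show ?thesis
  proof (cases "?w = x")
    case True
    have "part u x \<inter> right_side x y = {x}"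
    proof -
      have False if z: "z \<in> part u x" "z \<in> right_side x y" "z \<noteq> x" for z
      proof -
        have l: "ccw x y z" "z \<in> S" using z by (auto simp: right_side_def)
        then have "z \<noteq> y" by auto
        then have "ccw y x z" using nx[of z] z True by simp
        then show False using l orient_swap'[of x y z] by simp
      qed
      then show ?thesis using split_mem(3) x by (auto simp: right_side_def)
    qed
    then show ?thesis using True by simp
  next
    case False
    show ?thesis
    proof (rule ccw_succI)
      show "part u x \<inter> right_side x y \<subseteq> S" by (auto simp: right_side_def)
      fix z assume z: "z \<in> part u x \<inter> right_side x y" "z \<noteq> x" "z \<noteq> ?w"
      then have l: "ccw x y z" "z \<in> S" by (auto simp: right_side_def)
      then have "z \<noteq> y" by auto
      then have "ccw y ?w z" using nx z by simp
      moreover have "ccw x y ?w" using wr False by simp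
      ultimately show "ccw x ?w z" using l x w(2) yS by (simp add: to_idx) (smt (verit))
    qed (use w wr x split_mem(3) False in \<open>auto simp: right_side_def\<close>)
  qed
qed

text \<open>From any other point a successor step cannot pass \<open>x\<close> or \<open>y\<close>:
  in their part it would stop there, and in another part it would cross the chord.\<close>

lemma split_sides:
  assumes z: "z \<in> S" "z \<noteq> x" "z \<noteq> y"
  shows "z \<in> left_side x y \<Longrightarrow> sigma u z \<in> left_side x y" "z \<in> right_side x y \<Longrightarrow> sigma u z \<in> right_side x y"
proof -
  let ?w = "sigma u z"
  have yS: "y \<in> S" by (rule split_mem(1))
  have w: "?w \<in> part u z" "?w \<in> S" using sigma_part[OF u z(1)] sigma_S[OF u z(1)] by auto
  have side: "(ccw x z y \<longrightarrow> ?w = y \<or> ccw x ?w y) \<and> (ccw x y z \<longrightarrow> ?w = x \<or> ccw x y ?w)"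
  proof (cases "part u z = part u x")
    case True
    then have "?w = y \<or> ccw z ?w y" "?w = x \<or> ccw z ?w x"
      using sigma_next[OF u z(1), of y] sigma_next[OF u z(1), of x] y split_mem(3) z by auto
    then show ?thesis using x yS z w(2) xy by (simp add: to_idx) (smt (verit))
  next
    case False
    have nx: "x \<notin> part u z" "y \<notin> part u z"
      using False part_cong[OF P[OF u] z(1)] split_mem(2) by metis+
    have "?w \<noteq> x" "?w \<noteq> y" using nx w by auto
    moreover have "\<not> (ccw z y ?w \<and> ccw ?w x z)"
      using NCP_crossing[OF u z(1) yS w(1) _ nx(2)] split_mem by auto
    moreover have "\<not> (ccw z x ?w \<and> ccw ?w y z)"
      using NCP_crossing[OF u z(1) x w(1) y nx(1)] by auto
    ultimately show ?thesis using x yS z w(2) xy by (simp add: to_idx) (smt (verit))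
  qed
  show "z \<in> left_side x y \<Longrightarrow> ?w \<in> left_side x y" "z \<in> right_side x y \<Longrightarrow> ?w \<in> right_side x y"
    using side z w(2) by (auto simp: left_side_def right_side_def)
qed

lemma split_others:
  assumes z: "z \<in> S" "z \<noteq> x" "z \<noteq> y"
  shows "z \<in> left_side x y \<Longrightarrow> ccw_succ (part u z \<inter> left_side x y) z = sigma u z"
    and "z \<in> right_side x y \<Longrightarrow> ccw_succ (part u z \<inter> right_side x y) z = sigma u z"
  unfolding sigma_def
  by (rule ccw_succ_subset; use split_sides[OF z] split_mem(4,5)[OF z(1)] sigma_part[OF u z(1)] in \<open>auto simp: sigma_def\<close>)+

end

end

lemma ccw_succ_pair: "a \<noteq> b \<Longrightarrow> ccw_succ {a, b} a = b"
  unfolding ccw_succ_def by (auto intro!: the_equality)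

context ee
begin

lemma omega_n_nontrivial: "e \<ge> 2 \<Longrightarrow> \<omega> ^ n \<noteq> 1"
  using inj_on_eq_iff[OF inj_on_zeta[OF M_pos], of n 0] n_pos by auto

context
  fixes \<zeta> assumes \<zeta>: "\<zeta> \<in> mu M"
begin

section \<open>Splitting off the part {0, \<zeta>}\<close>

abbreviation (input) "m \<equiv> min_asym e n \<zeta>"

lemma min_asym_NCP: "m \<in> NCP (mu0 M)"
proof (rule NCP_I)
  show "\<Union> m = mu0 M" "{} \<notin> m" using \<zeta> by (auto simp: min_asym_def)
  have seg: "z = \<zeta>" if z: "z \<in> mu M" "z \<in> convex hull {0, \<zeta>}" for z
  proof -
    obtain t where t: "0 \<le> t" "t \<le> 1" "z = of_real t * \<zeta>"
      using z(2) unfolding segment_convex_hull[symmetric] closed_segment_def by (auto simp: scaleR_conv_of_real)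
    then have "t = 1" using norm_mu[OF M_pos z(1)] norm_mu[OF M_pos \<zeta>] by (simp add: norm_mult)
    then show ?thesis using t by simp
  qed
  fix p q assume "p \<in> m" "q \<in> m" "convex hull p \<inter> convex hull q \<noteq> {}"
  then show "p = q" using seg by (auto simp: min_asym_def)
qed

lemma flat_min_asym: "flat e n m = (\<lambda>z. {z}) ` mu M"
proof -
  have "mu M \<inter> {0, \<zeta>} = {\<zeta>}" "\<And>z. z \<in> mu M - {\<zeta>} \<Longrightarrow> mu M \<inter> {z} = {z}" using \<zeta> by auto
  then have "(\<inter>) (mu M) ` m = insert {\<zeta>} ((\<lambda>z. {z}) ` (mu M - {\<zeta>}))"
    unfolding min_asym_def image_insert image_image by simp
  also have "\<dots> = (\<lambda>z. {z}) ` mu M" using \<zeta> by auto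
  finally show ?thesis by (auto simp: flat_def restr_def)
qed

lemma min_asym_NCP_ee: "m \<in> NCP_ee e n"
proof -
  have "flat e n m \<in> NCP (mu M)" unfolding flat_def by (rule restr_NCP[OF min_asym_NCP]) auto
  moreover have "(`) ((*) \<xi>) ` flat e n m = flat e n m" if "\<xi> \<in> mu e" for \<xi>
  proof -
    have "(`) ((*) \<xi>) ` flat e n m = (\<lambda>z. {z}) ` (*) \<xi> ` mu M" unfolding flat_min_asym by (simp add: image_image)
    then show ?thesis unfolding flat_min_asym rotate_mu[OF mu_e_M[OF that]] .
  qed
  ultimately show ?thesis using min_asym_NCP by (simp add: NCP_ee_def NCP_e1_def)
qed

lemma part_min_asym: "part m 0 = {0, \<zeta>}" "part m \<zeta> = {0, \<zeta>}" "z \<in> mu M \<Longrightarrow> z \<noteq> \<zeta> \<Longrightarrow> part m z = {z}"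
  by (rule part_eq[OF NCP_ee_D(1)[OF min_asym_NCP_ee]]; auto simp: min_asym_def)+

lemma sigma_min_asym: "sigma m 0 = \<zeta>" "sigma m \<zeta> = 0" "z \<in> mu M \<Longrightarrow> z \<noteq> \<zeta> \<Longrightarrow> sigma m z = z"
  using mu_M_nonzero[OF \<zeta>] ccw_succ_pair[of 0 \<zeta>] ccw_succ_pair[of \<zeta> 0]
  by (auto simp: sigma_def part_min_asym insert_commute ccw_succ_def)

lemma min_asym_refines:
  assumes u: "partition_on (mu0 M) u" and z: "\<zeta> \<in> part u 0"
  shows "refines (mu0 M) m u"
  unfolding refines_def
proof (intro conjI ballI)
  show "partition_on (mu0 M) m" "partition_on (mu0 M) u" using u NCP_ee_D(1)[OF min_asym_NCP_ee] by auto
  fix p assume p: "p \<in> m"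
  then have "p = {0, \<zeta>} \<or> (\<exists>x\<in>mu M. p = {x})" by (auto simp: min_asym_def)
  then have "p \<subseteq> part u 0 \<or> (\<exists>x\<in>mu M. p \<subseteq> part u x)"
    using z part_self[OF u] by blast
  then show "\<exists>q\<in>u. p \<subseteq> q" using part_in[OF u] by blast
qed

lemma min_asym_refines_D:
  assumes "refines (mu0 M) m u"
  shows "\<zeta> \<in> part u 0"
  using refines_part[OF assms, of 0] part_min_asym(1) by auto

lemma restr_below:
  assumes u: "u \<in> NCP_ee e n"
  shows "restr u (Q \<zeta>) \<in> NCP (Q \<zeta>)" "z \<in> Q \<zeta> \<Longrightarrow> part (restr u (Q \<zeta>)) z = part u z \<inter> Q \<zeta>"
    and "z \<in> Q \<zeta> \<Longrightarrow> part (spread (restr u (Q \<zeta>))) z = part u z \<inter> Q \<zeta>"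
proof -
  show N: "restr u (Q \<zeta>) \<in> NCP (Q \<zeta>)" by (rule restr_NCP[OF NCP_ee_D(3)[OF u] Q_subset[OF \<zeta>]])
  assume z: "z \<in> Q \<zeta>"
  show eq: "part (restr u (Q \<zeta>)) z = part u z \<inter> Q \<zeta>"
    using part_restr[OF NCP_ee_D(1)[OF u] Q_subset[OF \<zeta>] _ z] N by (auto simp: NCP_def)
  show "part (spread (restr u (Q \<zeta>))) z = part u z \<inter> Q \<zeta>"
    using restr_Q_part[OF \<zeta> spread_NCP_ee[OF \<zeta> N] spread_refines[OF \<zeta> N] z] restr_spread[OF \<zeta> N] eq by simp
qed

context
  fixes \<eta> assumes \<eta>: "\<eta> \<in> mu M" and \<zeta>\<eta>: "\<zeta> \<in> Q \<eta>" and e2: "e \<ge> 2"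
begin

interpretation A: convex_polygon "polygon_vertex e n \<eta>" "n + 1"
  by (rule convex_polygon_Q[OF \<eta>])

abbreviation (input) "L \<equiv> convex_polygon.left_side (polygon_vertex e n \<eta>) (n + 1) 0 \<zeta>"
abbreviation (input) "R \<equiv> convex_polygon.right_side (polygon_vertex e n \<eta>) (n + 1) 0 \<zeta>"

lemma sides_iff:
  "z \<in> L \<longleftrightarrow> z \<in> Q \<eta> \<and> (z = \<zeta> \<or> ccw 0 z \<zeta>)" "z \<in> R \<longleftrightarrow> z \<in> Q \<eta> \<and> (z = 0 \<or> ccw 0 \<zeta> z)"
  unfolding A.left_side_def A.right_side_def S_Q[OF \<eta>] by simp_all

lemma rotate_leaves_Q: "\<theta> \<in> mu M \<Longrightarrow> y \<in> Q \<theta> \<Longrightarrow> y \<noteq> 0 \<Longrightarrow> \<omega> ^ n * y \<notin> Q \<theta>"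
  using Q_inequivalent[of \<theta> "\<omega> ^ n * y" y "\<omega> ^ n"] omega_n_power[of 1] omega_n_nontrivial[OF e2] by auto

text \<open>Write \<zeta> as \<open>\<omega> ^ r * \<eta>\<close>. The vertices of
  \<open>Q \<eta>\<close> with exponent above \<open>r\<close> belong to \<open>Q \<zeta>\<close>,
  together with 0. Those up to \<open>r\<close> do so after rotation by \<open>\<omega> ^ n\<close>.
  Thus \<open>Q \<zeta>\<close> is \<open>Q \<eta>\<close> cut along the chord from 0 to \<zeta>,
  with one piece rotated.\<close>

lemma Q_sides:
  shows "y \<in> Q \<eta> \<Longrightarrow> y \<in> L \<or> y \<in> R"
    and right_side_Q: "y \<in> Q \<eta> \<Longrightarrow> y \<in> Q \<zeta> \<longleftrightarrow> y \<in> R"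
    and left_side_Q: "y \<in> Q \<eta> \<Longrightarrow> y \<noteq> 0 \<Longrightarrow> \<omega> ^ n * y \<in> Q \<zeta> \<longleftrightarrow> y \<in> L"
proof -
  have \<zeta>0: "\<zeta> \<noteq> 0" by (rule mu_M_nonzero[OF \<zeta>])
  obtain r where r: "0 < r" "r \<le> n" "\<zeta> = \<omega> ^ r * \<eta>" using Q_elem[OF \<zeta>\<eta> \<zeta>0] by blast
  have idx: "A.idx (\<omega> ^ j * \<eta>) = int j" if "0 < j" "j \<le> n" for j
    using A.idx_vertex[of j] that by (simp add: polygon_vertex_def)
  have idx0: "A.idx 0 = 0" using A.idx_vertex[of 0] by (simp add: polygon_vertex_def)
  have inQ: "\<omega> ^ k * \<zeta> \<in> Q \<zeta>" if "0 < k" "k \<le> n" for k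
    unfolding polygon_def by (rule image_eqI[of _ _ k]) (use that in \<open>auto simp: polygon_vertex_def\<close>)
  have S: "A.S = Q \<eta>" by (rule S_Q[OF \<eta>])
  have mem: "y \<in> L \<longleftrightarrow> 0 < A.idx y \<and> A.idx y \<le> int r" "y \<in> R \<longleftrightarrow> A.idx y = 0 \<or> int r < A.idx y"
    if y: "y \<in> Q \<eta>" for y
  proof -
    have rg: "0 \<le> A.idx y" using A.idx_range[of y] y S by simp
    have i: "A.idx \<zeta> = int r" using idx r by simp
    have eq: "y = \<zeta> \<longleftrightarrow> A.idx y = int r" "y = 0 \<longleftrightarrow> A.idx y = 0"
      using A.eq_iff[of y \<zeta>] A.eq_iff[of y 0] S y \<zeta>\<eta> i idx0 by simp_all
    show "y \<in> L \<longleftrightarrow> 0 < A.idx y \<and> A.idx y \<le> int r" "y \<in> R \<longleftrightarrow> A.idx y = 0 \<or> int r < A.idx y"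
      unfolding A.left_side_def A.right_side_def S mem_Collect_eq eq
      using A.ccw_iff[of 0 y \<zeta>] A.ccw_iff[of 0 \<zeta> y] S y \<zeta>\<eta> i idx0 rg r(1) by (auto simp: cyc_def)
  qed
  have l: "\<omega> ^ n * y \<in> Q \<zeta>" if y: "y \<in> Q \<eta>" "y \<in> L" for y
  proof -
    have "0 < A.idx y" "A.idx y \<le> int r" using mem(1) y by auto
    moreover then have "y \<noteq> 0" using idx0 by auto
    then obtain j where j: "0 < j" "j \<le> n" "y = \<omega> ^ j * \<eta>" using Q_elem[OF y(1)] by blast
    ultimately have "j \<le> r" using idx by simp
    then have "n + j = (n + j - r) + r" using r(2) by simp
    then have eq: "\<omega> ^ n * y = \<omega> ^ (n + j - r) * \<zeta>" unfolding j(3) r(3) by (metis mult.assoc power_add)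
    show ?thesis unfolding eq by (rule inQ) (use \<open>j \<le> r\<close> j(1) r(2) in simp_all)
  qed
  have rr: "y \<in> Q \<zeta>" if y: "y \<in> Q \<eta>" "y \<in> R" for y
  proof (cases "y = 0")
    case False
    then obtain j where j: "0 < j" "j \<le> n" "y = \<omega> ^ j * \<eta>" using Q_elem[OF y(1)] by blast
    then have "r < j" using mem(2)[OF y(1)] y(2) idx by simp
    then have "y = \<omega> ^ (j - r) * \<zeta>" using j r by (simp flip: power_add mult.assoc)
    then show ?thesis using inQ[of "j - r"] \<open>r < j\<close> j by simp
  qed simp
  show dich: "y \<in> L \<or> y \<in> R" if y: "y \<in> Q \<eta>" for y
    using mem[OF y] A.idx_range[of y] y S by auto
  have L0: "0 \<notin> L" using mem(1)[OF Q_0] idx0 by simp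
  show "y \<in> Q \<zeta> \<longleftrightarrow> y \<in> R" if y: "y \<in> Q \<eta>" for y
    using rr[OF y] dich[OF y] l[OF y] rotate_leaves_Q[OF \<zeta>, of y] L0 by metis
  show "\<omega> ^ n * y \<in> Q \<zeta> \<longleftrightarrow> y \<in> L" if y: "y \<in> Q \<eta>" "y \<noteq> 0" for y
    using rr[OF y(1)] dich[OF y(1)] l[OF y(1)] rotate_leaves_Q[OF \<zeta>, of y] y(2) by metis
qed

lemma left_side_nonzero: "0 \<notin> L"
  unfolding sides_iff using mu_M_nonzero[OF \<zeta>] by auto

context
  fixes u assumes u: "u \<in> NCP_ee e n" and uM: "refines (mu0 M) u (max_asym e n \<eta>)"
begin

abbreviation (input) "U \<equiv> spread (restr u (Q \<zeta>))"

lemma split_part_right: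
  assumes "z \<in> R"
  shows "part U z = part u z \<inter> R"
proof -
  have z: "z \<in> Q \<eta>" using assms unfolding sides_iff by simp
  have z': "z \<in> Q \<zeta>" using right_side_Q[OF z] assms by simp
  have "part U z = part u z \<inter> Q \<zeta>"
    by (rule restr_below(3)[OF u z'])
  then show ?thesis using part_in_Q[OF \<eta> u uM z] right_side_Q by blast
qed

text \<open>The point \<open>z\<close> is outside \<open>Q \<zeta>\<close> but its rotation by
  \<open>\<omega> ^ n\<close> is inside, so its part for \<open>U\<close> is computed there and
  rotated back.\<close>

lemma split_part_left:
  assumes "z \<in> L"
  shows "part U z = part u z \<inter> L"
proof -
  let ?\<xi> = "\<omega> ^ n"
  have z: "z \<in> Q \<eta>" "z \<noteq> 0" using assms mu_M_nonzero[OF \<zeta>] unfolding sides_iff by auto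
  have \<xi>: "?\<xi> \<in> mu e" "inverse ?\<xi> \<in> mu e" "?\<xi> \<noteq> 0"
    using omega_n_power[of 1] mu_inverse[OF omega_n_power[of 1]] omega_nonzero by auto
  have \<xi>z: "?\<xi> * z \<in> Q \<zeta>" "?\<xi> * z \<noteq> 0" "?\<xi> * z \<notin> Q \<eta>" "z \<notin> Q \<zeta>"
    using left_side_Q[OF z] assms rotate_leaves_Q[OF \<eta> z] rotate_leaves_Q[OF \<zeta>, of z] z(2) \<xi>(3) by auto
  have cancel: "inverse ?\<xi> * (?\<xi> * y) = y" for y using \<xi>(3) by (simp flip: mult.assoc)
  note z' = cancel[of z]
  have "part u (?\<xi> * z) = (*) ?\<xi> ` (part u z - {0})"
    using below_max_part[OF \<eta> u uM \<xi>(1) z \<xi>z(3)] restr_Q_part[OF \<eta> u uM z(1)] by simp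
  moreover have "part U (inverse ?\<xi> * (?\<xi> * z)) = (*) (inverse ?\<xi>) ` (part u (?\<xi> * z) \<inter> Q \<zeta> - {0})"
    using below_max_part[OF \<zeta> spread_NCP_ee[OF \<zeta> restr_below(1)[OF u]] spread_refines[OF \<zeta> restr_below(1)[OF u]] \<xi>(2) \<xi>z(1,2)]
      restr_spread[OF \<zeta> restr_below(1)[OF u]] restr_below(2)[OF u \<xi>z(1)] \<xi>z(4) unfolding z' by simp
  ultimately have eq: "part U z = (*) (inverse ?\<xi>) ` ((*) ?\<xi> ` (part u z - {0}) \<inter> Q \<zeta> - {0})"
    unfolding z' by simp
  also have "\<dots> = {y \<in> part u z. y \<noteq> 0 \<and> ?\<xi> * y \<in> Q \<zeta>}"
  proof (intro equalityI subsetI)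
    fix y assume "y \<in> {y \<in> part u z. y \<noteq> 0 \<and> ?\<xi> * y \<in> Q \<zeta>}"
    then show "y \<in> (*) (inverse ?\<xi>) ` ((*) ?\<xi> ` (part u z - {0}) \<inter> Q \<zeta> - {0})"
      using \<xi>(3) by (intro image_eqI[of _ _ "?\<xi> * y"]) (auto simp: cancel)
  qed (auto simp: cancel)
  also have "\<dots> = part u z \<inter> L"
    using part_in_Q[OF \<eta> u uM z(1)] left_side_Q left_side_nonzero by blast
  finally show ?thesis .
qed

lemma spread_restr_refines: "refines (mu0 M) U u"
  unfolding refines_def
proof (intro conjI ballI)
  note P = NCP_ee_D(1)[OF u]
  show "partition_on (mu0 M) u" by (rule P)
  show "partition_on (mu0 M) U" using spread_NCP[OF \<zeta> restr_below(1)[OF u]] by (simp add: NCP_def)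
  have sub: "\<exists>q\<in>u. a \<subseteq> q" if "a \<in> flat e n u" for a using that by (auto simp: flat_def restr_def)
  fix p assume p: "p \<in> U"
  show "\<exists>q\<in>u. p \<subseteq> q"
  proof (cases "p \<in> restr u (Q \<zeta>)")
    case True then show ?thesis by (auto simp: restr_def)
  next
    case False
    then obtain c q where cq: "c \<in> mu e" "q \<in> u" "p = (*) c ` (Q \<zeta> \<inter> q - {0})" "Q \<zeta> \<inter> q \<noteq> {}" "Q \<zeta> \<inter> q \<noteq> {0}"
      using p by (auto simp: spread_def restr_def)
    then obtain y where "y \<in> Q \<zeta>" "y \<in> q" "y \<noteq> 0" by blast
    then have "y \<in> mu M \<inter> q" using Q_nonzero_mu[OF \<zeta>] by blast
    then have "mu M \<inter> q \<in> flat e n u" using cq(2) unfolding flat_def restr_def by blast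
    then have "(*) c ` (mu M \<inter> q) \<in> flat e n u" using NCP_e1_D(3)[OF NCP_ee_D(2)[OF u] cq(1)] by blast
    moreover have "p \<subseteq> (*) c ` (mu M \<inter> q)" unfolding cq(3) using Q_nonzero_mu[OF \<zeta>] by blast
    ultimately show ?thesis using sub by (meson order_trans)
  qed
qed

text \<open>All three partitions lie below \<open>max_asym e n \<eta>\<close>. Within
  \<open>Q \<eta>\<close>, the parts of \<open>U\<close> are those of \<open>u\<close> cut along the
  chord from 0 to \<zeta>, so composing the transposition of 0 and \<zeta> with
  \<open>sigma U\<close> recovers \<open>sigma u\<close>.\<close>

lemma braid_factor:
  assumes mu: "refines (mu0 M) m u"
  shows "braid e n m \<otimes>\<^bsub>braid_group e n\<^esub> braid e n U = braid e n u"
proof (rule braid_mult_polygon[OF \<eta> min_asym_NCP_ee refines_trans[OF mu uM] u uM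
      spread_NCP_ee[OF \<zeta> restr_below(1)[OF u]] refines_trans[OF spread_restr_refines uM] mu])
  fix z assume z: "z \<in> Q \<eta>"
  have S: "A.S = Q \<eta>" by (rule S_Q[OF \<eta>])
  have N: "restr u (Q \<eta>) \<in> NCP A.S" unfolding S by (rule restr_Q_NCP[OF \<eta> u uM])
  note rp = restr_Q_part[OF \<eta> u uM] and rs = restr_Q_sigma[OF \<eta> u uM]
  have \<zeta>0: "0 \<noteq> \<zeta>" using mu_M_nonzero[OF \<zeta>] by simp
  have x: "0 \<in> A.S" and y: "\<zeta> \<in> part (restr u (Q \<eta>)) 0"
    using S min_asym_refines_D[OF mu] by (simp_all add: rp)
  have yL: "\<zeta> \<in> L" and xR: "0 \<in> R" unfolding sides_iff using \<zeta>\<eta> by simp_all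
  note split = A.split_left[OF N x y \<zeta>0] A.split_right[OF N x y \<zeta>0] A.split_others[OF N x y \<zeta>0, of z]
  consider "z = 0" | "z = \<zeta>" | "z \<noteq> 0" "z \<noteq> \<zeta>" by blast
  then show "sigma U (sigma m z) = sigma u z"
  proof cases
    case 1
    have "part u \<zeta> = part u 0" by (rule part_cong[OF NCP_ee_D(1)[OF u] _ min_asym_refines_D[OF mu]]) simp
    then show ?thesis using split(1) 1 split_part_left[OF yL] by (simp add: sigma_min_asym sigma_def[of U] rp rs)
  next
    case 2
    then show ?thesis using split(2) split_part_right[OF xR] by (simp add: sigma_min_asym sigma_def[of U] rp rs \<zeta>\<eta>)
  next
    case 3
    then have "sigma m z = z" using sigma_min_asym(3) Q_nonzero_mu[OF \<eta> z] by simp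
    then show ?thesis using Q_sides(1)[OF z] split(3,4) z 3 S split_part_left[of z] split_part_right[of z]
      by (auto simp: sigma_def[of U] rp rs)
  qed
qed

end

end

end

end

section \<open>Strands in the long part\<close>

context ee
begin

context
  assumes e2: "e \<ge> 2"
begin

text \<open>For \<open>e \<ge> 2\<close> the elements of \<open>mu e\<close> have sum 0, so 0 is the
  average of every orbit and inherits each half-plane that contains the orbit.\<close>

lemma
  assumes nn: "\<And>\<xi>. \<xi> \<in> mu e \<Longrightarrow> Im (c * (\<xi> * x - y)) \<ge> 0"
  shows orbit_average: "Im (c * (0 - y)) \<ge> 0"
    and orbit_average_strict: "\<theta> \<in> mu e \<Longrightarrow> Im (c * (\<theta> * x - y)) > 0 \<Longrightarrow> Im (c * (0 - y)) > 0"
proof -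
  let ?S = "\<Sum>\<xi>\<in>mu e. Im (c * (\<xi> * x - y))"
  have fin: "finite (mu e)" by (rule finite_mu[OF e_pos])
  have "mu e \<noteq> {}" using mu_1 by blast
  then have card: "real (card (mu e)) > 0" using fin by (simp add: card_gt_0_iff)
  have zero: "(\<Sum>\<xi>\<in>mu e. \<xi>) = 0" using sum_roots_unity[of e] e2 by (simp add: mu_def)
  have "(\<Sum>\<xi>\<in>mu e. c * (\<xi> * x - y)) = (\<Sum>\<xi>\<in>mu e. \<xi>) * (c * x) + of_nat (card (mu e)) * (c * (0 - y))"
    by (simp add: sum_distrib_left sum_subtractf algebra_simps)
  also have "\<dots> = of_nat (card (mu e)) * (c * (0 - y))" by (simp add: zero)
  finally have eq: "Im (\<Sum>\<xi>\<in>mu e. c * (\<xi> * x - y)) = Im (of_nat (card (mu e)) * (c * (0 - y)))" by (rule arg_cong)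
  have "Im (of_nat k * w) = real k * Im w" for k w by simp
  with eq have sum: "?S = real (card (mu e)) * Im (c * (0 - y))" by (simp only: Im_sum)
  have "0 \<le> ?S" using nn by (rule sum_nonneg)
  then show "Im (c * (0 - y)) \<ge> 0" unfolding sum using card zero_le_mult_iff by (metis not_le)
  assume "\<theta> \<in> mu e" "Im (c * (\<theta> * x - y)) > 0"
  then have "0 < ?S" using nn by (intro sum_pos2[OF fin])
  then show "Im (c * (0 - y)) > 0" unfolding sum using card by (simp only: zero_less_mult_pos)
qed

context
  fixes F a
  assumes F: "F \<in> NCP_e1 e n" and a: "a \<in> F" "0 \<in> convex hull a"
begin

abbreviation (input) "\<sigma> \<equiv> sigma F"

lemma F_NCP: "F \<in> NCP R.S" by (simp add: NCP_e1_D(1)[OF F])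

lemma long_subset: "y \<in> a \<Longrightarrow> y \<in> mu M"
  using partition_onD1[OF NCP_e1_D(2)[OF F]] a(1) by blast

lemma part_long: "y \<in> a \<Longrightarrow> part F y = a"
  by (rule part_eq[OF NCP_e1_D(2)[OF F] a(1)])

lemma long_mult: "\<xi> \<in> mu e \<Longrightarrow> y \<in> a \<Longrightarrow> \<xi> * y \<in> a"
  using long_part_invariant[OF F a] by blast

lemma long_sigma: "y \<in> a \<Longrightarrow> \<sigma> y \<in> a"
  using R.sigma_part[OF F_NCP, of y] part_long[of y] long_subset[of y] by simp

lemma long_sigma_moves: "y \<in> a \<Longrightarrow> \<sigma> y \<noteq> y"
proof -
  assume y: "y \<in> a"
  have "\<omega> ^ n * y \<in> a" using long_mult[OF _ y] omega_n_power[of 1] by simp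
  moreover have "\<omega> ^ n * y \<noteq> y" using omega_n_nontrivial[OF e2] mu_M_nonzero[OF long_subset[OF y]] by simp
  ultimately show ?thesis using R.sigma_moves[OF F_NCP, of y] part_long[OF y] long_subset[OF y] by simp
qed

lemma long_edge:
  assumes "y \<in> a" "x \<in> a"
  shows "orient y (\<sigma> y) x \<ge> 0" "x \<noteq> y \<Longrightarrow> x \<noteq> \<sigma> y \<Longrightarrow> orient y (\<sigma> y) x > 0"
proof -
  show "orient y (\<sigma> y) x > 0" if "x \<noteq> y" "x \<noteq> \<sigma> y"
    using R.sigma_next[OF F_NCP, of y x] that part_long[OF assms(1)] long_subset[OF assms(1)] assms by auto
  then show "orient y (\<sigma> y) x \<ge> 0" by (cases "x = y \<or> x = \<sigma> y") auto
qed

lemma long_edge_zero: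
  assumes y: "y \<in> a" and x: "x \<in> a"
  shows "orient y (\<sigma> y) 0 \<ge> 0" "x \<noteq> y \<Longrightarrow> x \<noteq> \<sigma> y \<Longrightarrow> orient y (\<sigma> y) 0 > 0"
proof -
  have nn: "Im (cnj (\<sigma> y - y) * (\<xi> * x - y)) \<ge> 0" if "\<xi> \<in> mu e" for \<xi>
    using long_edge(1)[OF y long_mult[OF that x]] by (simp only: orient_def)
  from orbit_average[OF this] show "orient y (\<sigma> y) 0 \<ge> 0" by (simp only: orient_def)
  assume ne: "x \<noteq> y" "x \<noteq> \<sigma> y"
  have "Im (cnj (\<sigma> y - y) * (1 * x - y)) > 0" using long_edge(2)[OF y x ne] by (simp only: orient_def mult_1)
  from orbit_average_strict[OF nn mu_1 this] show "orient y (\<sigma> y) 0 > 0" by (simp only: orient_def)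
qed

text \<open>The orbit of \<open>x\<close> has at least two points and avoids \<open>y\<close>, so
  some point of it differs from both ends of the edge and makes the average strict.\<close>

lemma long_edge_zero_strict:
  assumes y: "y \<in> a" and x: "x \<in> a" and yx: "\<And>\<xi>. \<xi> \<in> mu e \<Longrightarrow> y \<noteq> \<xi> * x"
  shows "orient y (\<sigma> y) 0 > 0"
proof (cases "x = \<sigma> y")
  case False
  then show ?thesis using long_edge_zero(2)[OF y x] yx[OF mu_1] by auto
next
  case True
  have \<xi>: "\<omega> ^ n \<in> mu e" using omega_n_power[of 1] by simp
  have "\<omega> ^ n * x \<noteq> x" using omega_n_nontrivial[OF e2] mu_M_nonzero[OF long_subset[OF x]] by simp
  then show ?thesis using long_edge_zero(2)[OF y long_mult[OF \<xi> x]] yx[OF \<xi>] True by auto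
qed

lemma outside_long:
  assumes y: "y \<in> mu M" "y \<notin> a" and x: "x \<in> a"
  obtains c where "\<And>p q. p \<in> a \<Longrightarrow> q \<in> part F y \<Longrightarrow> Im (c * (p - q)) > 0"
    and "\<And>q. q \<in> part F y \<Longrightarrow> Im (c * (0 - q)) > 0"
proof -
  have "y \<in> part F y" by (rule part_self[OF NCP_e1_D(2)[OF F] y(1)])
  then have "part F x \<noteq> part F y" using y(2) part_long[OF x] by auto
  then obtain c where c: "\<And>p q. p \<in> a \<Longrightarrow> q \<in> part F y \<Longrightarrow> Im (c * (p - q)) > 0"
    using R.parts_separated[OF F_NCP, of x y] long_subset[OF x] y(1) part_long[OF x] by auto
  have "Im (c * (0 - q)) > 0" if q: "q \<in> part F y" for q
  proof (rule orbit_average_strict[of _ x])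
    show "Im (c * (\<xi> * x - q)) \<ge> 0" if "\<xi> \<in> mu e" for \<xi> using c[OF long_mult[OF that x] q] by simp
    show "1 \<in> mu e" by (rule mu_1)
    show "Im (c * (1 * x - q)) > 0" using c[OF x q] by simp
  qed
  with c that show thesis by blast
qed

context
  fixes x y
  assumes x: "x \<in> a" and y: "y \<in> mu M" and yx: "\<And>\<xi>. \<xi> \<in> mu e \<Longrightarrow> y \<noteq> \<xi> * x"
begin

lemma y_mem: "y \<in> part F y" "\<sigma> y \<in> part F y"
  using part_self[OF NCP_e1_D(2)[OF F] y] R.sigma_part[OF F_NCP, of y] y by simp_all

text \<open>Coordinate 0 runs from 0 to \<open>x\<close> and back, while an ordinary one rests at
  \<open>y\<close> and then moves to its successor. The edge at \<open>y\<close> separates them, or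
  a line bounding the part of \<open>y\<close> if that is not the long part.\<close>

lemma long_zero_separated: "separated (0 - y) (x - y) (0 - \<sigma> y) bu bw bv"
proof (cases "y \<in> a")
  case True
  note c = orient_diff[of "\<sigma> y" y 0 y] orient_diff[of "\<sigma> y" y x y] orient_diff[of "\<sigma> y" y 0 "\<sigma> y"]
  show ?thesis unfolding separated_def
    by (rule exI[of _ "cnj (\<sigma> y - y)"])
      (use long_edge(1)[OF True x] long_edge_zero_strict[OF True x yx] in \<open>simp only: c, simp\<close>)
next
  case False
  obtain c where "\<And>p q. p \<in> a \<Longrightarrow> q \<in> part F y \<Longrightarrow> Im (c * (p - q)) > 0"
    "\<And>q. q \<in> part F y \<Longrightarrow> Im (c * (0 - q)) > 0" using outside_long[OF y False x] by blast
  then show ?thesis using x y_mem by (intro separatedI_strict[of c])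
qed

text \<open>The coordinate equivalent to \<zeta> runs from \<open>x\<close> through 0 to the
  successor of \<open>x\<close>. The edge at \<open>y\<close> has 0 strictly inside, so only the
  direct edge of \<open>v\<close> can lie on the line, namely when \<open>x\<close> and
  \<open>y\<close> are exchanged.\<close>

lemma long_spoke_separated:
  assumes k: "k \<ge> 0" "k' \<ge> 0"
  shows "separated (x - y) (0 - y) (\<sigma> x - \<sigma> y) bu bw (bulge k x (\<sigma> x) - bulge k' y (\<sigma> y))"
proof (cases "y \<in> a")
  case True
  note c = orient_diff[of "\<sigma> y" y x y] orient_diff[of "\<sigma> y" y 0 y] orient_diff[of "\<sigma> y" y "\<sigma> x" "\<sigma> y"]
  have pos: "orient y (\<sigma> y) 0 > 0" by (rule long_edge_zero_strict[OF True x yx])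
  have nn: "orient y (\<sigma> y) x \<ge> 0" "orient y (\<sigma> y) (\<sigma> x) \<ge> 0"
    using long_edge(1)[OF True] x long_sigma by auto
  have curv: "Im (cnj (\<sigma> y - y) * (bulge k x (\<sigma> x) - bulge k' y (\<sigma> y))) \<ge> 0"
    if h: "orient y (\<sigma> y) x = 0" "orient y (\<sigma> y) (\<sigma> x) = 0"
  proof -
    have xy: "x \<noteq> y" using yx[OF mu_1] by auto
    have "x = y \<or> x = \<sigma> y" "\<sigma> x = y \<or> \<sigma> x = \<sigma> y"
      using h long_edge(2)[OF True x] long_edge(2)[OF True long_sigma[OF x]] by auto
    moreover have "\<sigma> x \<noteq> \<sigma> y" using R.sigma_inj[OF F_NCP, of x y] xy long_subset[OF x] y by auto
    ultimately have s: "x = \<sigma> y" "\<sigma> x = y" using xy by auto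
    show ?thesis unfolding s(2) unfolding s(1) right_diff_distrib minus_complex.sel Im_bulge Im_bulge'
      using k by simp
  qed
  show ?thesis unfolding separated_def
    by (rule exI[of _ "cnj (\<sigma> y - y)"]) (use pos nn curv in \<open>simp only: c, simp\<close>)
next
  case False
  obtain c where "\<And>p q. p \<in> a \<Longrightarrow> q \<in> part F y \<Longrightarrow> Im (c * (p - q)) > 0"
    "\<And>q. q \<in> part F y \<Longrightarrow> Im (c * (0 - q)) > 0" using outside_long[OF y False x] by blast
  then show ?thesis using x y_mem long_sigma[OF x] by (intro separatedI_strict[of c])
qed

end

text \<open>Here both strands touch 0, one going out to \<open>z\<close> and back, the other coming
  from \<open>g\<close> and leaving for its successor. The separating line passes through 0 and one
  of these two points.\<close>

lemma long_corner_separated: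
  assumes g: "g \<in> a" and z: "z \<in> a"
    and k: "ku \<ge> 0" "kw \<ge> 0" "kv \<ge> 0" "card (part F g) = 2 \<Longrightarrow> kv > 0"
  shows "separated (0 - g) (z - 0) (0 - \<sigma> g) (bulge ku 0 z - bulge ku g 0)
     (bulge kw z 0 - bulge kw 0 (\<sigma> g)) (0 - bulge kv g (\<sigma> g))"
proof -
  let ?s = "\<sigma> g"
  define D where "D = Im (cnj g * ?s)"
  have nrm: "cnj g * g = 1" "cnj ?s * ?s = 1" "cmod g = 1" "cmod ?s = 1" "cmod z = 1"
    using norm_mu[OF M_pos long_subset] g z long_sigma[OF g] complex_norm_square[of g] complex_norm_square[of ?s]
    by (simp_all add: mult.commute)
  have sg: "?s \<noteq> g" by (rule long_sigma_moves[OF g])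
  have D': "Im (cnj ?s * g) = - D" by (simp add: D_def)
  have "orient g ?s 0 = D" using nrm(1) by (simp add: orient_def D_def algebra_simps)
  then have D0: "D \<ge> 0" and Dpos: "x \<in> a \<Longrightarrow> x \<noteq> g \<Longrightarrow> x \<noteq> ?s \<Longrightarrow> D > 0" for x
    using long_edge_zero[OF g] g by auto
  have deg: "?s = - g \<and> kv > 0" if D: "D = 0"
  proof
    define t where "t = cnj g * ?s"
    have "Im t = 0" using D by (simp add: t_def D_def)
    moreover have "cmod t = 1" using nrm by (simp add: t_def norm_mult)
    ultimately have "t = 1 \<or> t = - 1" by (auto simp: complex_eq_iff cmod_def abs_square_eq_1)
    moreover have "g * t = ?s" using nrm(1) by (simp add: t_def mult.assoc[symmetric] mult.commute)
    ultimately show "?s = - g" using sg by auto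
    have "a = {g, ?s}" using Dpos D g long_sigma[OF g] by blast
    then have "card a = 2" using card_2_iff[of a] sg by blast
    then show "kv > 0" using k(4) part_long[OF g] by simp
  qed
  consider "z = g" | "z = ?s" | "z \<noteq> g" "z \<noteq> ?s" by blast
  then show ?thesis
  proof cases
    case 1
    \<comment> \<open>Both strands traverse the same radius in opposite directions, so equal
      curvatures add up. \<open>D = 0\<close> means that the long part is a diameter, where
      \<open>kv\<close> is positive.\<close>
    have "- cnj g * (bulge ku 0 z - bulge ku g 0) = of_real (2 * ku) * \<i> * (cnj g * g)"
      by (simp add: 1 bulge_def algebra_simps)
    then have e: "Im (- cnj g * (0 - g)) = 0" "Im (- cnj g * (z - 0)) = 0" "Im (- cnj g * (0 - ?s)) = D"
      "Im (- cnj g * (bulge ku 0 z - bulge ku g 0)) = 2 * ku"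
      using nrm(1) by (simp_all only: 1) (simp_all add: D_def)
    have d: "Im (- cnj g * (bulge kw z 0 - bulge kw 0 ?s)) = 0"
      "Im (- cnj g * (0 - bulge kv g ?s)) = 2 * kv" if h: "D = 0"
    proof -
      note s = conjunct1[OF deg[OF h]]
      have "- cnj g * (0 - bulge kv g ?s) = of_real (2 * kv) * \<i> * (cnj g * g)"
        by (simp add: s bulge_def algebra_simps)
      then show "Im (- cnj g * (0 - bulge kv g ?s)) = 2 * kv" using nrm(1) by (simp only:) simp
      show "Im (- cnj g * (bulge kw z 0 - bulge kw 0 ?s)) = 0" by (simp add: 1 s bulge_def)
    qed
    show ?thesis unfolding separated_def
      by (rule exI[of _ "- cnj g"], unfold e) (use d deg D0 k in auto)
  next
    case 2
    have "cnj ?s * (bulge kw z 0 - bulge kw 0 ?s) = of_real (2 * kw) * \<i> * (cnj ?s * ?s)"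
      by (simp add: 2 bulge_def algebra_simps)
    then have e: "Im (cnj ?s * (0 - g)) = D" "Im (cnj ?s * (z - 0)) = 0" "Im (cnj ?s * (0 - ?s)) = 0"
      "Im (cnj ?s * (bulge kw z 0 - bulge kw 0 ?s)) = 2 * kw"
      using nrm(2) by (simp_all only: 2) (simp_all add: D_def)
    have d: "Im (cnj ?s * (bulge ku 0 z - bulge ku g 0)) = 0"
      "Im (cnj ?s * (0 - bulge kv g ?s)) = 2 * kv" if h: "D = 0"
    proof -
      note s = conjunct1[OF deg[OF h]]
      have "cnj ?s * (0 - bulge kv g ?s) = of_real (2 * kv) * \<i> * (cnj g * g)"
        by (simp add: s bulge_def algebra_simps)
      then show "Im (cnj ?s * (0 - bulge kv g ?s)) = 2 * kv" using nrm(1) by (simp only:) simp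
      show "Im (cnj ?s * (bulge ku 0 z - bulge ku g 0)) = 0" by (simp add: 2 s bulge_def)
    qed
    show ?thesis unfolding separated_def
      by (rule exI[of _ "cnj ?s"], unfold e) (use d deg D0 k in auto)
  next
    case 3
    \<comment> \<open>Up to the factor \<open>D\<close> these are the coordinates of
      \<open>z\<close> in the basis \<open>g\<close>, \<open>?s\<close>. Convexity gives
      \<open>\<alpha> + \<beta> < D\<close> and the triangle inequality the opposite bound for
      absolute values, so one coordinate is negative and \<open>z\<close> lies outside the cone of
      the two points.\<close>
    define \<alpha> \<beta> where "\<alpha> = Im (cnj g * z)" and "\<beta> = Im (cnj z * ?s)"
    have D: "D > 0" by (rule Dpos[OF z 3])
    have "orient g ?s z > 0" by (rule long_edge(2)[OF g z 3])
    moreover have "orient g ?s z = D - \<alpha> - \<beta>"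
      using nrm(1) by (simp add: orient_def D_def \<alpha>_def \<beta>_def algebra_simps)
    ultimately have lt: "\<alpha> + \<beta> < D" by simp
    have comb: "of_real D * z = of_real \<beta> * g + of_real \<alpha> * ?s"
      by (simp add: complex_eq_iff D_def \<alpha>_def \<beta>_def algebra_simps)
    have "D = cmod (of_real \<beta> * g + of_real \<alpha> * ?s)" unfolding comb[symmetric] using D nrm by (simp add: norm_mult)
    also have "\<dots> \<le> \<bar>\<beta>\<bar> + \<bar>\<alpha>\<bar>" using norm_triangle_ineq[of "of_real \<beta> * g" "of_real \<alpha> * ?s"] nrm by (simp add: norm_mult)
    finally consider "\<alpha> < 0" | "\<beta> < 0" using lt by linarith
    then show ?thesis
    proof cases
      case 1
      have e: "Im (- cnj g * (0 - g)) = 0" "Im (- cnj g * (z - 0)) = - \<alpha>" "Im (- cnj g * (0 - ?s)) = D"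
        using nrm(1) by (simp_all add: D_def \<alpha>_def algebra_simps complex_eq_iff)
      show ?thesis unfolding separated_def
        by (rule exI[of _ "- cnj g"], unfold e) (use 1 D in simp)
    next
      case 2
      have e: "Im (cnj ?s * (0 - g)) = D" "Im (cnj ?s * (z - 0)) = - \<beta>" "Im (cnj ?s * (0 - ?s)) = 0"
        using nrm(2) by (simp_all add: D_def \<beta>_def algebra_simps complex_eq_iff)
      show ?thesis unfolding separated_def
        by (rule exI[of _ "cnj ?s"], unfold e) (use 2 D in simp)
    qed
  qed
qed

end

end

end

section \<open>Asymmetric partitions below long symmetric ones\<close>

context ee
begin

context
  fixes \<zeta> v
  assumes e2: "e \<ge> 2" and \<zeta>: "\<zeta> \<in> mu M" and v: "v \<in> NCP_ee e n" and long: "long (flat e n v)"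
    and \<zeta>v: "\<zeta> \<in> part v 0"
begin

abbreviation (input) "F \<equiv> flat e n v"
abbreviation (input) "a \<equiv> mu M \<inter> part v 0"
text \<open>The last vertex of \<open>Q \<zeta>\<close>. It is the vertex equivalent to \<zeta>,
  which itself is outside \<open>Q \<zeta>\<close>, and it belongs to the long part with \<zeta> by
  invariance.\<close>

abbreviation (input) "y0 \<equiv> \<omega> ^ n * \<zeta>"
abbreviation (input) "W \<equiv> spread (restr v (Q \<zeta>))"

lemma F_NCP_e1: "F \<in> NCP_e1 e n"
  by (rule NCP_ee_D(2)[OF v])

lemma long_symmetric_v: "symmetric e n v"
  using long by (simp add: symmetric_def long_symmetric_def)

lemma long_part_v: "a \<in> F" "0 \<in> convex hull a"
proof -
  obtain b where b: "b \<in> F" "0 \<in> convex hull b" using long by (auto simp: long_def)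
  then obtain p where p: "p \<in> v" "b = mu M \<inter> p" by (auto simp: flat_def restr_def)
  have "0 \<in> convex hull p" using b(2) p(2) hull_mono[of b p convex] by auto
  moreover have "0 \<in> convex hull (part v 0)" using part_self[OF NCP_ee_D(1)[OF v], of 0] by (auto intro: hull_inc)
  ultimately have "p = part v 0"
    using NCP_meet[OF NCP_ee_D(3)[OF v] p(1)] part_in[OF NCP_ee_D(1)[OF v], of 0] by blast
  then show "a \<in> F" "0 \<in> convex hull a" using b p by auto
qed

lemma part_v_0: "part v 0 = insert 0 a"
  using part_subset[OF NCP_ee_D(1)[OF v], of 0] part_self[OF NCP_ee_D(1)[OF v], of 0] by auto

lemma \<zeta>_a: "\<zeta> \<in> a" and y0_a: "y0 \<in> a" and y0_\<zeta>: "y0 \<noteq> \<zeta>" and y0_0: "y0 \<noteq> 0"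
proof -
  show z: "\<zeta> \<in> a" using \<zeta> \<zeta>v by simp
  show "y0 \<in> a" using long_mult[OF e2 F_NCP_e1 long_part_v _ z] omega_n_power[of 1] by simp
  show "y0 \<noteq> \<zeta>" using omega_n_nontrivial[OF e2] mu_M_nonzero[OF \<zeta>] by simp
  show "y0 \<noteq> 0" using omega_nonzero mu_M_nonzero[OF \<zeta>] by simp
qed

lemma part_v_long: "z \<in> a \<Longrightarrow> part v z = part v 0"
  using part_cong[OF NCP_ee_D(1)[OF v], of 0 z] by simp

lemma part_F_long: "z \<in> a \<Longrightarrow> part F z = a"
  by (rule part_long[OF e2 F_NCP_e1 long_part_v])

lemma part_v_other: "z \<in> mu M \<Longrightarrow> z \<notin> a \<Longrightarrow> part v z = part F z"
proof -
  assume z: "z \<in> mu M" "z \<notin> a"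
  have "0 \<notin> part v z"
  proof
    assume "0 \<in> part v z"
    then have "part v 0 = part v z" using part_cong[OF NCP_ee_D(1)[OF v], of z 0] z(1) by simp
    then show False using part_self[OF NCP_ee_D(1)[OF v], of z] z by simp
  qed
  then show ?thesis using NCP_ee_D(4)[OF v z(1)] by simp
qed

interpretation A: convex_polygon "polygon_vertex e n \<zeta>" "n + 1"
  by (rule convex_polygon_Q[OF \<zeta>])

text \<open>Numbering the regular polygon from \<zeta> makes its indices agree with those of
  \<open>Q \<zeta>\<close> at nonzero vertices, while 0 receives the index of \<zeta>.\<close>

interpretation B: convex_polygon "\<lambda>k. \<zeta> * \<omega> ^ k" M
proof
  show "inj_on (\<lambda>k. \<zeta> * \<omega> ^ k) {..<M}"
    using inj_on_zeta[OF M_pos] mu_M_nonzero[OF \<zeta>] by (simp add: inj_on_def)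
qed (rule ccw_rotated[OF \<zeta>])

lemma B_S: "B.S = mu M"
proof
  show "B.S \<subseteq> mu M" using mu_mult[OF \<zeta> omega_in_mu] by (auto simp: B.S_def)
  show "mu M \<subseteq> B.S"
  proof
    fix x assume "x \<in> mu M"
    then obtain k where "k < M" "x = \<zeta> * \<omega> ^ k" by (rule mu_index[OF \<zeta>])
    then show "x \<in> B.S" using B.vertex_in_S by simp
  qed
qed

lemma A_S': "A.S = Q \<zeta>"
  by (rule S_Q[OF \<zeta>])

lemma B_idx:
  "B.idx \<zeta> = 0" "B.idx y0 = int n" "A.idx 0 = 0"
  "z \<in> Q \<zeta> \<Longrightarrow> z \<noteq> 0 \<Longrightarrow> A.idx z = B.idx z" "z \<in> mu M \<Longrightarrow> z \<in> Q \<zeta> \<longleftrightarrow> 0 < B.idx z \<and> B.idx z \<le> int n"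
proof -
  have nM: "n < M" using e2 n_pos by simp
  show "B.idx \<zeta> = 0" using B.idx_vertex[of 0] M_pos by simp
  show "B.idx y0 = int n" using B.idx_vertex[OF nM] by (simp add: mult.commute)
  show "A.idx 0 = 0" using A.idx_vertex[of 0] by (simp add: polygon_vertex_def)
  have Qk: "A.idx z = B.idx z \<and> 0 < B.idx z \<and> B.idx z \<le> int n" if z: "z \<in> Q \<zeta>" "z \<noteq> 0" for z
  proof -
    obtain k where k: "0 < k" "k \<le> n" "z = \<omega> ^ k * \<zeta>" using Q_elem[OF z] by blast
    then have "B.idx z = int k" using B.idx_vertex[of k] nM by (simp add: mult.commute)
    moreover have "A.idx z = int k" using A.idx_vertex[of k] k by (simp add: polygon_vertex_def)
    ultimately show ?thesis using k by simp
  qed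
  then show "z \<in> Q \<zeta> \<Longrightarrow> z \<noteq> 0 \<Longrightarrow> A.idx z = B.idx z" by blast
  assume z: "z \<in> mu M"
  then obtain k where k: "k < M" "z = \<zeta> * \<omega> ^ k" by (rule mu_index[OF \<zeta>])
  then have i: "B.idx z = int k" using B.idx_vertex by simp
  have "z \<in> Q \<zeta>" if "0 < k" "k \<le> n" unfolding polygon_def
    by (rule image_eqI[of _ _ k]) (use that k in \<open>auto simp: polygon_vertex_def mult.commute\<close>)
  then show "z \<in> Q \<zeta> \<longleftrightarrow> 0 < B.idx z \<and> B.idx z \<le> int n" using Qk[of z] mu_M_nonzero[OF z] i by auto
qed

lemma W_part: "z \<in> Q \<zeta> \<Longrightarrow> part W z = part v z \<inter> Q \<zeta>"
  by (rule restr_below(3)[OF \<zeta> v])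

lemma y0_Q: "y0 \<in> Q \<zeta>" and \<zeta>_Q: "\<zeta> \<notin> Q \<zeta>"
  using B_idx(1,2) B_idx(5)[of y0] B_idx(5)[of \<zeta>] n_pos y0_a \<zeta> by auto

lemma F_B: "F \<in> NCP B.S"
  using NCP_e1_D(1)[OF F_NCP_e1] B_S by simp

lemma sigma_F_long:
  assumes "z \<in> a" "y \<in> a" "y \<noteq> z"
  shows "y = sigma F z \<or> ccw z (sigma F z) y"
  using B.sigma_next[OF F_B, of z y] part_F_long[OF assms(1)] assms B_S by auto

lemma sigma_F_mem: "z \<in> a \<Longrightarrow> sigma F z \<in> a"
  by (rule long_sigma[OF e2 F_NCP_e1 long_part_v])

text \<open>In the restriction of the long part to \<open>Q \<zeta>\<close>, 0 takes the place of
  \<zeta> at index 0, and the arc is closed by sending its last vertex \<open>y0\<close> back to 0.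
  All other successors are those of \<open>F\<close>.\<close>

lemma W_sigma_0: "sigma W 0 = sigma F \<zeta>"
proof -
  let ?w = "sigma F \<zeta>"
  have w: "?w \<in> a" "?w \<noteq> \<zeta>"
    using sigma_F_mem[OF \<zeta>_a] long_sigma_moves[OF e2 F_NCP_e1 long_part_v \<zeta>_a] by auto
  have wQ: "?w \<in> Q \<zeta>"
  proof -
    have "y0 = ?w \<or> ccw \<zeta> ?w y0" by (rule sigma_F_long[OF \<zeta>_a y0_a y0_\<zeta>])
    then show ?thesis
    proof
      assume "ccw \<zeta> ?w y0"
      then have "cyc 0 (B.idx ?w) (int n)" using B.ccw_iff[of \<zeta> ?w y0] B_idx w \<zeta>_a y0_a B_S by simp
      then show ?thesis using B_idx(5)[of ?w] w(1) by (auto simp: cyc_def)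
    qed (use y0_Q in simp)
  qed
  have "ccw_succ (part v 0 \<inter> Q \<zeta>) 0 = ?w"
  proof (rule A.ccw_succI)
    show "part v 0 \<inter> Q \<zeta> \<subseteq> A.S" using A_S' by simp
    show "0 \<in> part v 0 \<inter> Q \<zeta>" "?w \<in> part v 0 \<inter> Q \<zeta>" "?w \<noteq> 0"
      using part_v_0 w wQ by auto
    fix y assume y: "y \<in> part v 0 \<inter> Q \<zeta>" "y \<noteq> 0" "y \<noteq> ?w"
    then have ya: "y \<in> a" "y \<in> Q \<zeta>" using part_v_0 by auto
    then have "y \<noteq> \<zeta>" using \<zeta>_Q by auto
    then have "ccw \<zeta> ?w y" using sigma_F_long[OF \<zeta>_a ya(1)] y(3) by auto
    then have "cyc 0 (B.idx ?w) (B.idx y)" using B.ccw_iff[of \<zeta> ?w y] B_idx(1) w \<zeta>_a ya B_S by simp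
    moreover have "?w \<noteq> 0" using mu_M_nonzero w by auto
    ultimately show "ccw 0 ?w y"
      using A.ccw_iff[of 0 ?w y] A_S' B_idx(3) B_idx(4)[OF wQ] B_idx(4)[OF ya(2) y(2)] wQ ya by simp
  qed
  then show ?thesis using W_part[OF Q_0] by (simp add: sigma_def[of W])
qed

lemma W_sigma_y0: "sigma W y0 = 0"
proof -
  have "ccw_succ (part v 0 \<inter> Q \<zeta>) y0 = 0"
  proof (rule A.ccw_succI)
    show "part v 0 \<inter> Q \<zeta> \<subseteq> A.S" using A_S' by simp
    show "0 \<in> part v 0 \<inter> Q \<zeta>" "y0 \<in> part v 0 \<inter> Q \<zeta>" "0 \<noteq> y0"
      using part_v_0 y0_a y0_Q y0_0 by auto
    fix y assume y: "y \<in> part v 0 \<inter> Q \<zeta>" "y \<noteq> y0" "y \<noteq> 0"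
    then have ya: "y \<in> mu M" "y \<in> Q \<zeta>" using part_v_0 by auto
    have "B.idx y \<noteq> int n" using B.eq_iff[of y y0] y(2) ya y0_a B_S B_idx(2) by simp
    then have "0 < B.idx y \<and> B.idx y < int n" using B_idx(5)[OF ya(1)] ya(2) by simp
    then show "ccw y0 0 y"
      using A.ccw_iff[of y0 0 y] A_S' B_idx(2,3) B_idx(4)[OF y0_Q y0_0] B_idx(4)[OF ya(2) y(3)] y0_Q ya
      by (simp add: cyc_def)
  qed
  then show ?thesis using W_part[OF y0_Q] part_v_long[OF y0_a] by (simp add: sigma_def[of W])
qed

lemma W_sigma_other:
  assumes z: "z \<in> Q \<zeta>" "z \<noteq> 0" "z \<noteq> y0"
  shows "sigma W z = sigma F z"
proof -
  let ?w = "sigma F z"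
  have zM: "z \<in> mu M" by (rule Q_nonzero_mu[OF \<zeta> z(1,2)])
  have "B.idx z \<noteq> int n" using B.eq_iff[of z y0] z(3) zM y0_a B_S B_idx(2) by simp
  then have iz: "0 < B.idx z" "B.idx z < int n" using B_idx(5)[OF zM] z(1) by simp_all
  have w: "?w \<in> part F z" "?w \<in> mu M" using B.sigma_part[OF F_B, of z] B.sigma_S[OF F_B, of z] zM B_S by simp_all
  show ?thesis
  proof (cases "z \<in> a")
    case True
    have wa: "?w \<in> a" by (rule sigma_F_mem[OF True])
    have "y0 = ?w \<or> ccw z ?w y0" using sigma_F_long[OF True y0_a] z(3) by blast
    then have iw: "B.idx z < B.idx ?w \<and> B.idx ?w \<le> int n"
    proof
      assume "ccw z ?w y0"
      then have "cyc (B.idx z) (B.idx ?w) (int n)" using B.ccw_iff[of z ?w y0] B_idx zM w y0_a B_S by simp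
      then show ?thesis using iz by (auto simp: cyc_def)
    qed (use iz B_idx(2) in auto)
    then have wQ: "?w \<in> Q \<zeta>" using B_idx(5)[OF w(2)] iz by simp
    have w0: "?w \<noteq> 0" by (rule mu_M_nonzero[OF w(2)])
    have "ccw_succ (part v 0 \<inter> Q \<zeta>) z = ?w"
    proof (rule A.ccw_succI)
      show "part v 0 \<inter> Q \<zeta> \<subseteq> A.S" using A_S' by simp
      show "z \<in> part v 0 \<inter> Q \<zeta>" "?w \<in> part v 0 \<inter> Q \<zeta>" "?w \<noteq> z"
        using True wa wQ z long_sigma_moves[OF e2 F_NCP_e1 long_part_v True] by auto
      fix y assume y: "y \<in> part v 0 \<inter> Q \<zeta>" "y \<noteq> z" "y \<noteq> ?w"
      show "ccw z ?w y"
      proof (cases "y = 0")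
        case y0: True
        show ?thesis unfolding y0
          using A.ccw_iff[of z ?w 0] A_S' B_idx(3) B_idx(4)[OF z(1,2)] B_idx(4)[OF wQ w0] iw iz z(1) wQ
          by (simp add: cyc_def)
      next
        case False
        then show ?thesis using sigma_F_long[OF True, of y] y part_v_0 by auto
      qed
    qed
    then show ?thesis using W_part[OF z(1)] part_v_long[OF True] by (simp add: sigma_def[of W])
  next
    case False
    have pF: "part F z \<inter> a = {}"
    proof (rule ccontr)
      assume "part F z \<inter> a \<noteq> {}"
      then obtain x where "x \<in> part F z" "x \<in> a" by blast
      then have "part F z = a" using part_cong[OF NCP_e1_D(2)[OF F_NCP_e1] zM] part_F_long by metis
      then show False using part_self[OF NCP_e1_D(2)[OF F_NCP_e1] zM] False by simp
    qed
    have disj: "x \<notin> a" if "x \<in> part F z" for x using pF that by (metis disjoint_iff)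
    have nw: "?w \<noteq> \<zeta>" "?w \<noteq> y0" using disj[OF w(1)] \<zeta>_a y0_a by metis+
    \<comment> \<open>The chord from \<open>y0\<close> to \<zeta> belongs to the long part and keeps
      the other parts on their side.\<close>
    have "y0 \<notin> part F z" using disj y0_a by metis
    moreover have "\<zeta> \<in> part F y0" using part_F_long[OF y0_a] \<zeta>_a by simp
    moreover have "z \<in> B.S" "y0 \<in> B.S" using zM y0_a B_S by simp_all
    ultimately have "\<not> (ccw z y0 ?w \<and> ccw ?w \<zeta> z)"
      using B.NCP_crossing[OF F_B, of z y0 ?w \<zeta>] w(1) by metis
    then have n: "\<not> (cyc (B.idx z) (int n) (B.idx ?w) \<and> cyc (B.idx ?w) 0 (B.idx z))"
      using B.ccw_iff[of z y0 ?w] B.ccw_iff[of ?w \<zeta> z] B_S zM w(2) y0_a \<zeta> B_idx(1,2) by simp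
    have "B.idx ?w \<noteq> 0" using B.eq_iff[of ?w \<zeta>] nw(1) w(2) \<zeta> B_S B_idx(1) by simp
    moreover have "B.idx ?w \<noteq> int n" using B.eq_iff[of ?w y0] nw(2) w(2) y0_a B_S B_idx(2) by simp
    moreover have "0 \<le> B.idx ?w" using B.idx_range[of ?w] w(2) B_S by simp
    ultimately have "0 < B.idx ?w" "B.idx ?w \<le> int n" using n iz by (auto simp: cyc_def)
    then have "?w \<in> Q \<zeta>" using B_idx(5)[OF w(2)] by simp
    then have "ccw_succ (part F z \<inter> Q \<zeta>) z = ccw_succ (part F z) z"
      using w(1) z(1) part_self[OF NCP_e1_D(2)[OF F_NCP_e1] zM] part_subset[OF NCP_e1_D(2)[OF F_NCP_e1] zM] B_S
      by (intro B.ccw_succ_subset) (auto simp: sigma_def)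
    then show ?thesis using W_part[OF z(1)] part_v_other[OF zM False] by (simp add: sigma_def)
  qed
qed

text \<open>The three paths are described in different polygons: \<open>Q \<eta>\<close> for the
  minimal partition, \<open>Q \<zeta>\<close> for \<open>W\<close> and the regular polygon for
  \<open>v\<close>. Only coordinate 0 and the coordinate \<open>j0\<close> equivalent to \<zeta>
  differ from strands that first rest and then follow \<open>v\<close>.\<close>

lemma braid_mult_min_asym: "braid e n (min_asym e n \<zeta>) \<otimes>\<^bsub>braid_group e n\<^esub> braid e n W = braid e n v"
proof -
  let ?m = "min_asym e n \<zeta>" and ?\<sigma> = "sigma F"
  note m = min_asym_NCP_ee[OF \<zeta>] and sm = sigma_min_asym[OF \<zeta>] and pm = part_min_asym[OF \<zeta>]
  note FF = F_NCP_e1 and LP = F_NCP_e1 long_part_v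
  have P: "partition_on (mu0 M) ?m" by (rule NCP_ee_D(1)[OF m])
  have \<zeta>0: "\<zeta> \<noteq> 0" by (rule mu_M_nonzero[OF \<zeta>])
  have fm: "flat e n ?m = (\<lambda>z. {z}) ` mu M" by (rule flat_min_asym[OF \<zeta>])
  have fm_part: "part (flat e n ?m) z = {z}" if "z \<in> mu M" for z
    by (rule part_eq[OF NCP_e1_D(2)[OF NCP_ee_D(2)[OF m]]]) (use that in \<open>auto simp: fm\<close>)
  have fm_sigma: "sigma (flat e n ?m) z = z" if "z \<in> mu M" for z
    using fm_part[OF that] by (simp add: sigma_def ccw_succ_def)
  have asym: "asymmetric e n ?m"
    using \<zeta>0 by (auto simp: asymmetric_def long_def fm) (auto simp: min_asym_def)
  obtain \<eta> where \<eta>: "\<eta> \<in> mu M" and mM: "refines (mu0 M) ?m (max_asym e n \<eta>)"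
    using asymmetric_below_max[OF m asym] by blast
  have \<zeta>\<eta>: "\<zeta> \<in> Q \<eta>" using part_in_Q[OF \<eta> m mM Q_0] pm(1) by blast
  note NW = spread_NCP_ee[OF \<zeta> restr_below(1)[OF \<zeta> v]] and WM = spread_refines[OF \<zeta> restr_below(1)[OF \<zeta> v]]
  obtain j0 c0 where j0: "0 < j0" "j0 \<le> n" "c0 \<in> mu e" "\<zeta> = c0 * \<omega> ^ j0" using mu_representative[OF \<zeta>] by blast
  have c0: "c0 \<noteq> 0" by (rule mu_nonzero[OF e_pos j0(3)])
  let ?h = "\<omega> ^ j0"
  have h: "?h = inverse c0 * \<zeta>" using c0 j0(4) by simp
  have ha: "?h \<in> a" unfolding h by (rule long_mult[OF e2 LP mu_inverse[OF j0(3)] \<zeta>_a])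
  have \<sigma>mult: "?\<sigma> (\<xi> * z) = \<xi> * ?\<sigma> z" if "\<xi> \<in> mu e" "z \<in> mu M" for \<xi> z by (rule NCP_e1_D(5)[OF FF that])
  have r\<eta>: "rep \<eta> j0 = \<zeta>" by (rule rep_unique[OF \<eta> \<zeta>\<eta> j0(3,4,1)])
  have \<xi>n: "\<omega> ^ n \<in> mu e" using omega_n_power[of 1] by simp
  have r\<zeta>: "rep \<zeta> j0 = y0"
    by (rule rep_unique[OF \<zeta> y0_Q mu_mult[OF \<xi>n j0(3)] _ j0(1)]) (simp only: j0(4) mult.assoc)
  \<comment> \<open>The minimal partition exchanges 0 with \<zeta>, that is, coordinates 0 and
    \<open>j0\<close> up to the factor \<open>c0\<close>; the two factors are inverse to each
    other.\<close>
  define s where "s = Transposition.transpose 0 j0"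
  define d where "d j = (if j = 0 then c0 else if j = j0 then inverse c0 else 1)" for j
  have s: "s 0 = j0" "s j0 = 0" "j \<noteq> 0 \<Longrightarrow> j \<noteq> j0 \<Longrightarrow> s j = j" for j by (simp_all add: s_def)
  have perm: "s permutes {..n}" unfolding s_def by (rule permutes_swap_id) (use j0 in auto)
  have d: "d j \<in> mu e" for j using j0(3) mu_inverse[OF j0(3)] mu_1 by (simp add: d_def)
  have "(\<Prod>j\<le>n. d j) = (\<Prod>j\<in>{0, j0}. d j)"
    by (rule prod.mono_neutral_right) (use j0 in \<open>auto simp: d_def\<close>)
  then have prod: "(\<Prod>j\<le>n. d j) = 1" using j0(1) c0 by (simp add: d_def)
  let ?Y = "poly_end \<eta> ?m" and ?Y' = "poly_end \<zeta> W" and ?Z = "sym_end v"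
  let ?ku = "poly_curv \<eta> ?m" and ?kw = "poly_curv \<zeta> W" and ?kv = "sym_curv v"
  let ?b = "base_point e n"
  note Yd = poly_end_def[OF \<eta> m mM] and Y'd = poly_end_def[OF \<zeta> NW WM]
  have Y: "?Y 0 = \<zeta>" "?Y j0 = 0" "0 < j \<Longrightarrow> j \<noteq> j0 \<Longrightarrow> j \<le> n \<Longrightarrow> ?Y j = \<omega> ^ j" for j
  proof -
    show "?Y 0 = \<zeta>" "?Y j0 = 0" unfolding Yd using sm by (simp_all add: r\<eta>)
    assume j: "0 < j" "j \<noteq> j0" "j \<le> n"
    have "rep \<eta> j \<noteq> \<zeta>" using rep_inj[OF \<eta> j(3) j0(2) j(2)] r\<eta> by simp
    then have "sigma ?m (rep \<eta> j) = rep \<eta> j"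
      using sm(3) Q_nonzero_mu[OF \<eta>] rep_coef(1,2)[OF \<eta> j(1)] by blast
    then show "?Y j = \<omega> ^ j" unfolding Yd using rep_coef(4)[OF \<eta> j(1)] by simp
  qed
  have Y': "?Y' 0 = ?\<sigma> \<zeta>" "?Y' j0 = 0" "0 < j \<Longrightarrow> j \<noteq> j0 \<Longrightarrow> j \<le> n \<Longrightarrow> ?Y' j = ?\<sigma> (\<omega> ^ j)" for j
  proof -
    show "?Y' 0 = ?\<sigma> \<zeta>" "?Y' j0 = 0" unfolding Y'd using W_sigma_0 W_sigma_y0 by (simp_all add: r\<zeta>)
    assume j: "0 < j" "j \<noteq> j0" "j \<le> n"
    have "rep \<zeta> j \<noteq> y0" using rep_inj[OF \<zeta> j(3) j0(2) j(2)] r\<zeta> by simp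
    then have "sigma W (rep \<zeta> j) = ?\<sigma> (rep \<zeta> j)" using W_sigma_other rep_coef(1,2)[OF \<zeta> j(1)] by blast
    then show "?Y' j = ?\<sigma> (\<omega> ^ j)" unfolding Y'd rep_coef(4)[OF \<zeta> j(1)]
      using \<sigma>mult[OF coef_mu[OF \<zeta>]] Q_nonzero_mu[OF \<zeta> rep_coef(1,2)[OF \<zeta> j(1)]] by simp
  qed
  have Z: "?Z 0 = 0" "0 < j \<Longrightarrow> ?Z j = ?\<sigma> (\<omega> ^ j)" for j by (simp_all add: sym_end_def)
  have Yb: "?Y j = d j * ?b (s j)" if "j \<le> n" for j
    using Y s j0 that by (cases "j = 0 \<or> j = j0") (auto simp: d_def base_point_pos base_point_0)
  have Zb: "?Z j = d j * ?Y' (s j)" if "j \<le> n" for j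
  proof -
    have "?\<sigma> ?h = inverse c0 * ?\<sigma> \<zeta>" unfolding h by (rule \<sigma>mult[OF mu_inverse[OF j0(3)] \<zeta>])
    then show ?thesis using Y' s j0 that Z by (cases "j = 0 \<or> j = j0") (auto simp: d_def)
  qed
  \<comment> \<open>\<open>long_corner_separated\<close> requires equal curvatures for the two
    strands along the part {0, \<zeta>}. Coordinate \<open>j0\<close> is special, so both are read
    off from the same part. The same holds for \<open>W\<close> with the part of
    \<open>y0\<close>.\<close>
  have ku: "?ku j \<ge> 0" "?ku j0 = ?ku 0" for j
  proof -
    show "?ku j \<ge> 0" by (rule poly_curv_nonneg[OF \<eta> m mM])
    have "\<exists>\<xi>. special e n ?m j0 \<xi>" using special_iff[OF \<eta> m mM j0(1)] sm(2) r\<eta> by simp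
    then show "?ku j0 = ?ku 0" unfolding poly_curv_def[OF \<eta> m mM] using pm r\<eta> by simp
  qed
  have kw: "?kw j \<ge> 0" "?kw j0 = ?kw 0" for j
  proof -
    show "?kw j \<ge> 0" by (rule poly_curv_nonneg[OF \<zeta> NW WM])
    have "\<exists>\<xi>. special e n W j0 \<xi>" using special_iff[OF \<zeta> NW WM j0(1)] W_sigma_y0 r\<zeta> by simp
    moreover have "part W y0 = part W 0" using W_part[OF y0_Q] W_part[OF Q_0] part_v_long[OF y0_a] by simp
    ultimately show "?kw j0 = ?kw 0" unfolding poly_curv_def[OF \<zeta> NW WM] by (simp add: r\<zeta>)
  qed
  have kv: "?kv j \<ge> 0" "0 < j \<Longrightarrow> \<xi> \<in> mu e \<Longrightarrow> card (part F (\<xi> * \<omega> ^ j)) = 2 \<Longrightarrow> ?kv j > 0" for j \<xi>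
    using part_rotate_card[OF FF omega_in_mu] by (simp_all add: sym_curv_def)
  have inequiv: "\<xi> * \<omega> ^ j \<noteq> \<theta> * \<omega> ^ k"
    if "0 < j" "j \<le> n" "0 < k" "k \<le> n" "j \<noteq> k" "\<xi> \<in> mu e" "\<theta> \<in> mu e" for j k \<xi> \<theta>
  proof
    assume "\<xi> * \<omega> ^ j = \<theta> * \<omega> ^ k"
    then have "\<omega> ^ j = (\<theta> / \<xi>) * \<omega> ^ k" using mu_nonzero[OF e_pos that(6)] by (simp add: field_simps)
    then show False using omega_equiv_unique[OF _ mu_divide[OF that(7,6)] that(1-4)] that(5) by simp
  qed
  define sep where "sep i j \<xi> \<longleftrightarrow> separated (?b i - \<xi> * ?b j) (?Y i - \<xi> * ?Y j) (?Z i - \<xi> * ?Z j)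
     (bulge (?ku i) (?b i) (?Y i) - \<xi> * bulge (?ku j) (?b j) (?Y j))
     (bulge (?kw (s i)) (?Y i) (?Z i) - \<xi> * bulge (?kw (s j)) (?Y j) (?Z j))
     (bulge (?kv i) (?b i) (?Z i) - \<xi> * bulge (?kv j) (?b j) (?Z j))" for i j \<xi>
  \<comment> \<open>Multiplication by \<open>- \<xi>\<close> exchanges the two strands, so only one
    order of each exceptional pair is needed.\<close>
  have flip: "sep i j \<xi>" if "sep j i (inverse \<xi>)" "\<xi> \<in> mu e" for i j \<xi>
  proof -
    have \<xi>: "\<xi> \<noteq> 0" by (rule mu_nonzero[OF e_pos that(2)])
    then have eq: "- \<xi> * (p - inverse \<xi> * q) = q - \<xi> * p" for p q by (simp add: field_simps)
    have "- \<xi> \<noteq> 0" using \<xi> by simp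
    from separated_mult[OF that(1)[unfolded sep_def] this] show ?thesis unfolding sep_def eq .
  qed
  have b: "?b 0 = 0" "0 < j \<Longrightarrow> j \<le> n \<Longrightarrow> ?b j = \<omega> ^ j" for j by (simp_all add: base_point_0 base_point_pos)
  have corner: "sep 0 j0 \<xi>" if \<xi>: "\<xi> \<in> mu e" for \<xi>
  proof -
    let ?g = "\<xi> * ?h"
    have "separated (0 - ?g) (\<zeta> - 0) (0 - ?\<sigma> ?g) (bulge (?ku 0) 0 \<zeta> - bulge (?ku 0) ?g 0)
       (bulge (?kw 0) \<zeta> 0 - bulge (?kw 0) 0 (?\<sigma> ?g)) (0 - bulge (?kv j0) ?g (?\<sigma> ?g))"
      by (rule long_corner_separated[OF e2 LP long_mult[OF e2 LP \<xi> ha] \<zeta>_a ku(1) kw(1) kv(1) kv(2)[OF j0(1) \<xi>]])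
    then show ?thesis unfolding sep_def using \<sigma>mult[OF \<xi> omega_in_mu] j0(1,2)
      by (simp add: b Y Z s ku(2) kw(2) bulge_mult)
  qed
  have zero: "sep 0 j \<xi>" if j: "0 < j" "j \<noteq> j0" "j \<le> n" and \<xi>: "\<xi> \<in> mu e" for j \<xi>
  proof -
    let ?y = "\<xi> * \<omega> ^ j"
    have y: "?y \<in> mu M" by (rule mu_mult[OF mu_e_M[OF \<xi>] omega_in_mu])
    have "?y \<noteq> \<theta> * \<zeta>" if "\<theta> \<in> mu e" for \<theta>
      using inequiv[OF j(1,3) j0(1,2) j(2) \<xi> mu_mult[OF that j0(3)]] by (simp add: j0(4) mult.assoc)
    from long_zero_separated[OF e2 LP \<zeta>_a y this]
    show ?thesis unfolding sep_def using \<sigma>mult[OF \<xi> omega_in_mu] j by (simp add: b Y Z)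
  qed
  have spoke: "sep j0 j \<xi>" if j: "0 < j" "j \<noteq> j0" "j \<le> n" and \<xi>: "\<xi> \<in> mu e" for j \<xi>
  proof -
    let ?y = "\<xi> * \<omega> ^ j"
    have y: "?y \<in> mu M" by (rule mu_mult[OF mu_e_M[OF \<xi>] omega_in_mu])
    have "?y \<noteq> \<theta> * ?h" if "\<theta> \<in> mu e" for \<theta> by (rule inequiv[OF j(1,3) j0(1,2) j(2) \<xi> that])
    from long_spoke_separated[OF e2 LP ha y this kv(1) kv(1)]
    show ?thesis unfolding sep_def using \<sigma>mult[OF \<xi> omega_in_mu] j j0(1,2) by (simp add: b Y Z bulge_mult)
  qed
  have ord: "sep i j \<xi>"
    if i: "0 < i" "i \<noteq> j0" "i \<le> n" and j: "0 < j" "j \<noteq> j0" "j \<le> n" and ij: "i \<noteq> j" and \<xi>: "\<xi> \<in> mu e" for i j \<xi>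
  proof -
    let ?y = "\<xi> * \<omega> ^ j" and ?x = "\<omega> ^ i"
    have y: "?y \<in> mu M" by (rule mu_mult[OF mu_e_M[OF \<xi>] omega_in_mu])
    have ref: "refines (mu M) (flat e n ?m) F"
      by (rule flat_refines[OF m v min_asym_refines[OF \<zeta> NCP_ee_D(1)[OF v] \<zeta>v]])
    have "separated (?x - ?y) (sigma (flat e n ?m) ?x - sigma (flat e n ?m) ?y) (?\<sigma> ?x - ?\<sigma> ?y)
      (bulge 0 ?x (sigma (flat e n ?m) ?x) - bulge 0 ?y (sigma (flat e n ?m) ?y))
      (bulge (?kw i) (sigma (flat e n ?m) ?x) (?\<sigma> ?x) - bulge (?kw j) (sigma (flat e n ?m) ?y) (?\<sigma> ?y))
      (bulge (?kv i) ?x (?\<sigma> ?x) - bulge (?kv j) ?y (?\<sigma> ?y))"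
    proof (rule R.sigma_separated)
      show "?x \<noteq> ?y" by (rule omega_distinct[OF i(3) j(3) ij i(1) j(1) \<xi>])
      show "card (part F ?y) = 2 \<Longrightarrow> 0 < ?kv j" by (rule kv(2)[OF j(1) \<xi>])
      show "card (part F ?x) = 2 \<Longrightarrow> 0 < ?kv i" using kv(2)[OF i(1) mu_1] by simp
      show "flat e n ?m \<in> NCP R.S" "F \<in> NCP R.S"
        using NCP_e1_D(1)[OF NCP_ee_D(2)[OF m]] NCP_e1_D(1)[OF FF] by simp_all
      show "refines R.S (flat e n ?m) F" using ref by simp
    qed (use y omega_in_mu kv(1) kw(1) in simp_all)
    then show ?thesis unfolding sep_def using \<sigma>mult[OF \<xi> omega_in_mu] i j
      by (simp add: b Y Z s bulge_mult fm_sigma y omega_in_mu)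
  qed
  have sep: "sep i j \<xi>" if h: "i \<le> n" "j \<le> n" "i \<noteq> j" "\<xi> \<in> mu e" for i j \<xi>
  proof -
    note \<xi>' = mu_inverse[OF h(4)]
    consider "i = 0" "j = j0" | "i = 0" "0 < j" "j \<noteq> j0" | "i = j0" "j = 0" | "i = j0" "0 < j" "j \<noteq> j0"
      | "0 < i" "i \<noteq> j0" "j = 0" | "0 < i" "i \<noteq> j0" "j = j0" | "0 < i" "i \<noteq> j0" "0 < j" "j \<noteq> j0"
      using h(3) by blast
    then show ?thesis
    proof cases
      case 1 then show ?thesis using corner[OF h(4)] by simp
    next
      case 2 then show ?thesis using zero[OF 2(2,3) h(2,4)] by simp
    next
      case 3 then show ?thesis using flip[OF corner[OF \<xi>'] h(4)] by simp
    next
      case 4 then show ?thesis using spoke[OF 4(2,3) h(2,4)] by simp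
    next
      case 5 then show ?thesis using flip[OF zero[OF 5(1,2) h(1) \<xi>'] h(4)] by simp
    next
      case 6 then show ?thesis using flip[OF spoke[OF 6(1,2) h(1) \<xi>'] h(4)] by simp
    next
      case 7 then show ?thesis by (intro ord h)
    qed
  qed
  show ?thesis
    by (rule braid_mult[OF e_pos poly_strands[OF \<eta> m mM] poly_strands[OF \<zeta> NW WM]
        symmetric_strands[OF v long_symmetric_v] perm d prod Yb Zb poly_twisted[OF \<eta> m mM]
        poly_twisted[OF \<zeta> NW WM] symmetric_twisted[OF v long_symmetric_v] poly_regular[OF \<eta> m mM]
        poly_regular[OF \<zeta> NW WM] symmetric_regular[OF v long_symmetric_v] sep[unfolded sep_def]])
qed

end

text \<open>The vertex \<zeta> is the one selected in \<open>compl_ee\<close>, so that the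
  complement is computed in \<open>Q \<zeta>\<close>, where it is also the complement of
  \<open>U\<close> in \<open>W\<close>.\<close>

lemma braid_mult_compl_long:
  assumes u: "u \<in> NCP_ee e n" and v: "v \<in> NCP_ee e n" and uv: "refines (mu0 M) u v"
    and asym: "asymmetric e n u" and sym: "symmetric e n v"
  shows "braid e n u \<otimes>\<^bsub>braid_group e n\<^esub> braid e n (compl_ee e n u v) = braid e n v"
proof -
  let ?b = "braid e n"
  note Pu = NCP_ee_D(1)[OF u] and Pv = NCP_ee_D(1)[OF v]
  have u0: "part u 0 \<in> u" "0 \<in> part u 0" using part_in[OF Pu, of 0] part_self[OF Pu, of 0] by simp_all
  moreover have "part u 0 \<noteq> {0}" using u0(1) asym unfolding asymmetric_def by metis
  ultimately obtain z where z: "z \<in> part u 0" "z \<noteq> 0" by blast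
  have zM: "z \<in> mu M" using part_subset[OF Pu, of 0] z by auto
  define \<zeta> where "\<zeta> = (SOME \<zeta>. \<zeta> \<in> mu M \<and> refines (mu0 M) (min_asym e n \<zeta>) u)"
  have "z \<in> mu M \<and> refines (mu0 M) (min_asym e n z) u" using zM min_asym_refines[OF zM Pu z(1)] by simp
  from someI[of "\<lambda>\<zeta>. \<zeta> \<in> mu M \<and> refines (mu0 M) (min_asym e n \<zeta>) u", OF this]
  have \<zeta>: "\<zeta> \<in> mu M" and mu: "refines (mu0 M) (min_asym e n \<zeta>) u" unfolding \<zeta>_def by auto
  have \<zeta>u: "\<zeta> \<in> part u 0" by (rule min_asym_refines_D[OF \<zeta> mu])
  have uv0: "part u 0 \<subseteq> part v 0" by (rule refines_part[OF uv]) simp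
  have \<zeta>v: "\<zeta> \<in> part v 0" using \<zeta>u uv0 by blast
  have "{0} \<notin> v"
  proof
    assume "{0} \<in> v"
    then have "part v 0 = {0}" by (intro part_eq[OF Pv]) auto
    then show False using \<zeta>v mu_M_nonzero[OF \<zeta>] by simp
  qed
  then have long: "long (flat e n v)"
    using sym by (auto simp: symmetric_def short_symmetric_def long_symmetric_def)
  \<comment> \<open>For \<open>e = 1\<close> the set \<open>mu M\<close> is the single point 1, so
    no part is long.\<close>
  have e2: "e \<ge> 2"
  proof (rule ccontr)
    assume "\<not> e \<ge> 2"
    then have "M = 1" using e_pos e1 by (cases "e = 1") auto
    then have M1: "mu M = {1}" by (auto simp: mu_def)
    obtain b where b: "b \<in> flat e n v" "0 \<in> convex hull b" using long by (auto simp: long_def)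
    then have "b \<subseteq> {1}" using M1 by (auto simp: flat_def restr_def)
    then have "b = {} \<or> b = {1}" by (rule subset_singletonD)
    then show False using b(2) by auto
  qed
  have eq: "compl_ee e n u v = compl_via e n \<zeta> u v"
    using asym sym by (auto simp: compl_ee_def asymmetric_iff \<zeta>_def)
  define m U W w where "m = min_asym e n \<zeta>" and "U = spread (restr u (Q \<zeta>))"
    and "W = spread (restr v (Q \<zeta>))" and "w = compl_via e n \<zeta> u v"
  note C = compl_via[OF \<zeta> u v uv, folded w_def]
  note RU = restr_below(1)[OF \<zeta> u] and RV = restr_below(1)[OF \<zeta> v]
  note U = spread_NCP_ee[OF \<zeta> RU, folded U_def] spread_refines[OF \<zeta> RU, folded U_def]
  note W = spread_NCP_ee[OF \<zeta> RV, folded W_def] spread_refines[OF \<zeta> RV, folded W_def]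
  have "refines (Q \<zeta>) (restr u (Q \<zeta>)) (restr v (Q \<zeta>))"
    using restr_refines[OF uv Q_subset[OF \<zeta>]] RU RV by (simp add: NCP_def)
  then have UW: "refines (mu0 M) U W" unfolding U_def W_def by (rule spread_mono[OF \<zeta> RU RV])
  have sigma_U: "sigma (restr u (Q \<zeta>)) y = sigma U y" if "y \<in> Q \<zeta>" for y
    using restr_Q_sigma[OF \<zeta> U that] restr_spread[OF \<zeta> RU] by (simp add: U_def)
  have sigma_W: "sigma (restr v (Q \<zeta>)) y = sigma W y" if "y \<in> Q \<zeta>" for y
    using restr_Q_sigma[OF \<zeta> W that] restr_spread[OF \<zeta> RV] by (simp add: W_def)
  have Uw: "?b U \<otimes>\<^bsub>braid_group e n\<^esub> ?b w = ?b W"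
    by (rule braid_mult_polygon[OF \<zeta> U W C(1,2) UW]) (use C(3) sigma_U sigma_W in simp)
  obtain \<eta> where \<eta>: "\<eta> \<in> mu M" and uM: "refines (mu0 M) u (max_asym e n \<eta>)"
    using asymmetric_below_max[OF u asym] by blast
  have "\<zeta> \<in> Q \<eta>" using part_in_Q[OF \<eta> u uM Q_0] \<zeta>u by blast
  from braid_factor[OF \<zeta> \<eta> this e2 u uM mu]
  have mU: "?b m \<otimes>\<^bsub>braid_group e n\<^esub> ?b U = ?b u" by (simp add: m_def U_def)
  have mW: "?b m \<otimes>\<^bsub>braid_group e n\<^esub> ?b W = ?b v"
    unfolding m_def W_def by (rule braid_mult_min_asym[OF e2 \<zeta> v long \<zeta>v])
  have in_group: "?b x \<in> carrier (braid_group e n)"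
    if "\<theta> \<in> mu M" "x \<in> NCP_ee e n" "refines (mu0 M) x (max_asym e n \<theta>)" for x \<theta>
    by (rule braid_class_eventually(2)[OF e_pos poly_strands[OF that] poly_twisted[OF that] poly_regular[OF that]])
  have "?b m \<in> carrier (braid_group e n)"
    unfolding m_def by (rule in_group[OF \<eta> min_asym_NCP_ee[OF \<zeta>] refines_trans[OF mu uM]])
  with in_group[OF \<zeta> U] in_group[OF \<zeta> C(1,2)]
  have "(?b m \<otimes>\<^bsub>braid_group e n\<^esub> ?b U) \<otimes>\<^bsub>braid_group e n\<^esub> ?b w =
      ?b m \<otimes>\<^bsub>braid_group e n\<^esub> (?b U \<otimes>\<^bsub>braid_group e n\<^esub> ?b w)"
    unfolding braid_group_def by (intro fundamental_group_assoc)
  then show ?thesis unfolding eq w_def[symmetric] mU Uw mW .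
qed

end

theorem proposition2p4:
  fixes e n :: nat and u v :: "complex set set"
  assumes "e > 0" and "n > 0"
    and "e = 1 \<longrightarrow> n = 1"
    and "u \<in> NCP_ee e n" and "v \<in> NCP_ee e n"
    and "refines (mu (e * n) \<union> {0}) u v"
  shows "braid e n u \<otimes>\<^bsub>braid_group e n\<^esub> braid e n (compl_ee e n u v) = braid e n v"
proof -
  interpret ee e n by unfold_locales (use assms in auto)
  consider "asymmetric e n v" | "symmetric e n u" "symmetric e n v" | "asymmetric e n u" "symmetric e n v"
    using asymmetric_iff by blast
  then show ?thesis
    using braid_mult_compl_asymmetric braid_mult_compl_symmetric braid_mult_compl_long assms(4-6) by cases
qed

end
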